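(* Put $$\mathrm{Sing}_{n,q}=\{\alpha\in\mathbb C : \text{the elements } D_q^{(\alpha)}(j_1,\dots,j_n)\ (1\le j_1,\dots,j_n\le n)\text{ are linearly dependent}\}.$$ If $\alpha\in\mathbb C\setminus\mathrm{Sing}_{n,q}$, then as $U_q(\mathfrak{gl}_n)$-modules $$V_{n,q}^{(\alpha)}\cong\bigoplus_{\lambda\vdash n}\bigl(E_{n,q}^\lambda\bigr)^{\oplus f^\lambda};$$ that is, the multiplicity $m_q^\lambda(\alpha)$ of the irreducible representation $E_{n,q}^\lambda$ in $V_{n,q}^{(\alpha)}$ equals $f^\lambda$ for every partition $\lambda$ of $n$.
   Context: $n\ge1$ is an integer; $q$ is a nonzero complex number that is not a root of unity, with a fixed square root $q^{1/2}$; $\alpha\in\mathbb C$, with $\alpha^0=1$. $S_n$ is the symmetric group; for $w\in S_n$, $\ell(w)$ is the number of inversions and $\nu_n(w)$ the number of cycles (fixed points included). $L_n=\bigoplus_{i=1}^n\mathbb Z\varepsilon_i$ with bilinear form $\langle\varepsilon_i,\varepsilon_j\rangle=\delta_{ij}$. $U_q(\mathfrak{gl}_n)$ is the standard quantum enveloping algebra generated by $e_k,f_k$ ($1\le k\le n-1$) and $q^\lambda$ ($\lambda\in\frac12L_n$), with $q^0=1$, $q^\lambda q^\mu=q^{\lambda+\mu}$, $q^\lambda e_kq^{-\lambda}=q^{\langle\lambda,\varepsilon_k-\varepsilon_{k+1}\rangle}e_k$, $q^\lambda f_kq^{-\lambda}=q^{-\langle\lambda,\varepsilon_k-\varepsilon_{k+1}\rangle}f_k$,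 $[e_i,f_j]=\delta_{ij}\frac{q^{\varepsilon_i-\varepsilon_{i+1}}-q^{-(\varepsilon_i-\varepsilon_{i+1})}}{q-q^{-1}}$ and the $q$-Serre relations. $A_q(\mathrm{Mat}_n)$ is the associative $\mathbb C$-algebra generated by $x_{ij}$ ($1\le i,j\le n$) with relations $x_{ik}x_{jk}=qx_{jk}x_{ik}$, $x_{ki}x_{kj}=qx_{kj}x_{ki}$ ($i<j$); $x_{il}x_{jk}=x_{jk}x_{il}$, $x_{ik}x_{jl}-x_{jl}x_{ik}=(q-q^{-1})x_{il}x_{jk}$ ($i<j$, $k<l$). $U_q(\mathfrak{gl}_n)$ acts (representation $\rho$) on degree-$n$ products by $\rho(q^\lambda)\cdot x_{i_1j_1}\cdots x_{i_nj_n}=q^{\langle\lambda,\varepsilon_{j_1}+\dots+\varepsilon_{j_n}\rangle}x_{i_1j_1}\cdots x_{i_nj_n}$, $\rho(e_k)\cdot x_{i_1j_1}\cdots x_{i_nj_n}=\sum_{l=1}^n\delta_{j_l,k+1}\,q_k^l(j_1,\dots,j_n)\,x_{i_1j_1}\cdots x_{i_lk}\cdots x_{i_nj_n}$, $\rho(f_k)\cdot x_{i_1j_1}\cdots x_{i_nj_n}=\sum_{l=1}^n\delta_{j_l,k}\,q_k^l(j_1,\dots,j_n)\,x_{i_1j_1}\cdots x_{i_l,k+1}\cdots x_{i_nj_n}$, where $q_k^l(j_1,\dots,j_n)=q^{\langle(\varepsilon_k-\varepsilon_{k+1})/2,\ \varepsilon_{j_1}+\dots+\varepsilon_{j_{l-1}}-\varepsilon_{j_{l+1}}-\dots-\varepsilon_{j_n}\rangle}$.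 For $1\le j_1,\dots,j_n\le n$ put $D_q^{(\alpha)}(j_1,\dots,j_n)=\sum_{w\in S_n}\alpha^{n-\nu_n(w)}q^{\ell(w)}x_{w(1)j_1}\cdots x_{w(n)j_n}$. The quantum $\alpha$-determinant is $\det_q^{(\alpha)}=D_q^{(\alpha)}(1,2,\dots,n)$, and $V_{n,q}^{(\alpha)}=\rho(U_q(\mathfrak{gl}_n))\cdot\det_q^{(\alpha)}$. A partition $\lambda=(\lambda_1\ge\dots\ge\lambda_n\ge0)\vdash n$ is identified with the dominant weight $\sum_i\lambda_i\varepsilon_i$; $E_{n,q}^\lambda$ is the irreducible highest weight $U_q(\mathfrak{gl}_n)$-module with highest weight $\lambda$; $f^\lambda$ is the number of standard tableaux of shape $\lambda$. *)

theory Defs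
  imports
    Complex_Main
    "HOL-Library.FuncSet"
    "HOL-Library.Poly_Mapping"
    "HOL-Algebra.QuotRing"
    "HOL-Algebra.Module"
    "HOL-Combinatorics.Permutations"
    "HOL-Combinatorics.Orbits"
begin

section \<open>Free associative algebras\<close>

text \<open>
  The free monoid on \<open>'g\<close>, written additively because the product of \<open>Poly_Mapping\<close> is the
  convolution product over an additive monoid. Thus \<open>'g free_monoid \<Rightarrow>\<^sub>0 complex\<close> is the free
  associative complex algebra on \<open>'g\<close>.
\<close>

datatype 'g free_monoid = FM (letters: "'g list")

instantiation free_monoid :: (type) monoid_add
begin

definition zero_free_monoid :: "'a free_monoid" where
  "0 = FM []"

definition plus_free_monoid :: "'a free_monoid \<Rightarrow> 'a free_monoid \<Rightarrow> 'a free_monoid" where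
  "v + w = FM (letters v @ letters w)"

instance
  by standard (auto simp: zero_free_monoid_def plus_free_monoid_def)

end

type_synonym 'g free_alg = "'g free_monoid \<Rightarrow>\<^sub>0 complex"

definition scal :: "complex \<Rightarrow> 'g free_alg" where
  "scal c = Poly_Mapping.single 0 c"

definition word :: "'g list \<Rightarrow> 'g free_alg" where
  "word ws = Poly_Mapping.single (FM ws) 1"

abbreviation gen :: "'g \<Rightarrow> 'g free_alg" where
  "gen g \<equiv> word [g]"

definition free_algebra :: "'g set \<Rightarrow> 'g free_alg ring" where
  "free_algebra X =
    \<lparr>carrier = {p. \<forall>w\<in>Poly_Mapping.keys p. set (letters w) \<subseteq> X},
     monoid.mult = (*), one = 1, zero = 0, add = (+)\<rparr>"

definition lin_ext :: "('g list \<Rightarrow> 'h free_alg) \<Rightarrow> 'g free_alg \<Rightarrow> 'h free_alg" where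
  "lin_ext f p = (\<Sum>w\<in>Poly_Mapping.keys p. scal (Poly_Mapping.lookup p w) * f (letters w))"


section \<open>Left modules\<close>

text \<open>
  The locale \<open>module\<close> of HOL-Algebra requires a commutative ring of scalars; the axioms below are
  the same for an arbitrary ring. For an algebra over the complex numbers, the vector space
  structure of a module is the action of the scalar multiples of the unit.
\<close>

locale left_module = R?: ring R + M?: abelian_group M
  for R (structure) and M (structure) +
  assumes smult_closed:
      "\<lbrakk>a \<in> carrier R; x \<in> carrier M\<rbrakk> \<Longrightarrow> a \<odot>\<^bsub>M\<^esub> x \<in> carrier M"
    and smult_l_distr:
      "\<lbrakk>a \<in> carrier R; b \<in> carrier R; x \<in> carrier M\<rbrakk> \<Longrightarrow>
        (a \<oplus> b) \<odot>\<^bsub>M\<^esub> x = a \<odot>\<^bsub>M\<^esub> x \<oplus>\<^bsub>M\<^esub> b \<odot>\<^bsub>M\<^esub> x"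
    and smult_r_distr:
      "\<lbrakk>a \<in> carrier R; x \<in> carrier M; y \<in> carrier M\<rbrakk> \<Longrightarrow>
        a \<odot>\<^bsub>M\<^esub> (x \<oplus>\<^bsub>M\<^esub> y) = a \<odot>\<^bsub>M\<^esub> x \<oplus>\<^bsub>M\<^esub> a \<odot>\<^bsub>M\<^esub> y"
    and smult_assoc1:
      "\<lbrakk>a \<in> carrier R; b \<in> carrier R; x \<in> carrier M\<rbrakk> \<Longrightarrow>
        (a \<otimes> b) \<odot>\<^bsub>M\<^esub> x = a \<odot>\<^bsub>M\<^esub> (b \<odot>\<^bsub>M\<^esub> x)"
    and smult_one:
      "x \<in> carrier M \<Longrightarrow> \<one> \<odot>\<^bsub>M\<^esub> x = x"

definition irreducible_module :: "'r ring \<Rightarrow> ('r, 'm) module \<Rightarrow> bool" where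
  "irreducible_module R M \<longleftrightarrow>
    left_module R M \<and> carrier M \<noteq> {\<zero>\<^bsub>M\<^esub>} \<and>
    (\<forall>H. submodule H R M \<longrightarrow> H = {\<zero>\<^bsub>M\<^esub>} \<or> H = carrier M)"

definition module_isomorphic :: "'r ring \<Rightarrow> ('r, 'm) module \<Rightarrow> ('r, 'k) module \<Rightarrow> bool" where
  "module_isomorphic R M N \<longleftrightarrow>
    (\<exists>h. bij_betw h (carrier M) (carrier N) \<and>
      (\<forall>x\<in>carrier M. \<forall>y\<in>carrier M. h (x \<oplus>\<^bsub>M\<^esub> y) = h x \<oplus>\<^bsub>N\<^esub> h y) \<and>
      (\<forall>a\<in>carrier R. \<forall>x\<in>carrier M. h (a \<odot>\<^bsub>M\<^esub> x) = a \<odot>\<^bsub>N\<^esub> h x))"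

text \<open>
  The direct sum of a finite family of modules (for an infinite index set this would be the direct
  product). The ring fields \<open>mult\<close> and \<open>one\<close> of a module record are irrelevant.
\<close>

definition direct_sum :: "'i set \<Rightarrow> ('i \<Rightarrow> ('r, 'm) module) \<Rightarrow> ('r, 'i \<Rightarrow> 'm) module" where
  "direct_sum I N =
    \<lparr>carrier = (\<Pi>\<^sub>E i\<in>I. carrier (N i)),
     monoid.mult = undefined, one = undefined,
     zero = (\<lambda>i\<in>I. \<zero>\<^bsub>N i\<^esub>),
     add = (\<lambda>x y. \<lambda>i\<in>I. x i \<oplus>\<^bsub>N i\<^esub> y i),
     smult = (\<lambda>a x. \<lambda>i\<in>I. a \<odot>\<^bsub>N i\<^esub> x i)\<rparr>"

text \<open>
  The number of summands isomorphic to \<open>E\<close> in a decomposition of \<open>M\<close> as a finite direct sum of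
  irreducible modules.
\<close>

definition multiplicity_in :: "'r ring \<Rightarrow> ('r, 'k) module \<Rightarrow> ('r, 'm) module \<Rightarrow> nat" where
  "multiplicity_in R E M = (THE m. \<exists>(r::nat) (N :: nat \<Rightarrow> ('r, 'm) module).
    (\<forall>i<r. irreducible_module R (N i)) \<and>
    module_isomorphic R M (direct_sum {..<r} N) \<and>
    m = card {i. i < r \<and> module_isomorphic R E (N i)})"


section \<open>The quantum enveloping algebra of gl(n)\<close>

text \<open>
  Throughout, \<open>s\<close> is the fixed square root of \<open>q\<close>. An element
  \<open>\<lambda> = (1/2) \<Sum>i m\<^sub>i \<epsilon>\<^sub>i\<close> of the half-integral lattice is represented by its doubled coordinates
  \<open>m :: nat \<Rightarrow> int\<close>, so that \<open>q\<close> to the power \<open>\<langle>\<lambda>,\<mu>\<rangle>\<close> is \<open>s\<close> to the power \<open>\<langle>m,\<mu>\<rangle>\<close> and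
  \<open>\<epsilon>\<^sub>i - \<epsilon>\<^sub>i\<^sub>+\<^sub>1\<close> has doubled coordinates \<open>2 * root i\<close>. The generator \<open>GenQ m\<close> is \<open>q\<^sup>\<lambda>\<close>.
\<close>

datatype uq_gen = GenE nat | GenF nat | GenQ "nat \<Rightarrow> int"

definition doubled_lattice :: "nat \<Rightarrow> (nat \<Rightarrow> int) set" where
  "doubled_lattice n = {m. \<forall>i. i \<notin> {1..n} \<longrightarrow> m i = 0}"

definition pairing :: "nat \<Rightarrow> (nat \<Rightarrow> int) \<Rightarrow> (nat \<Rightarrow> int) \<Rightarrow> int" where
  "pairing n a b = (\<Sum>i=1..n. a i * b i)"

definition eps :: "nat \<Rightarrow> nat \<Rightarrow> int" where
  "eps i = (\<lambda>j. if j = i then 1 else 0)"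

definition root :: "nat \<Rightarrow> nat \<Rightarrow> int" where
  "root k = (\<lambda>j. eps k j - eps (k + 1) j)"

definition uq_gens :: "nat \<Rightarrow> uq_gen set" where
  "uq_gens n = GenE ` {1..<n} \<union> GenF ` {1..<n} \<union> GenQ ` doubled_lattice n"

definition serre :: "complex \<Rightarrow> uq_gen \<Rightarrow> uq_gen \<Rightarrow> uq_gen free_alg" where
  "serre q x y = gen x * gen x * gen y - scal (q + 1 / q) * gen x * gen y * gen x
                 + gen y * gen x * gen x"

text \<open>The defining relations, each written as an element that is set to zero.\<close>

definition uq_relations :: "nat \<Rightarrow> complex \<Rightarrow> complex \<Rightarrow> uq_gen free_alg set" where
  "uq_relations n q s =
    {gen (GenQ (\<lambda>_. 0)) - 1}
    \<union> {gen (GenQ a) * gen (GenQ b) - gen (GenQ (\<lambda>i. a i + b i)) | a b.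
        a \<in> doubled_lattice n \<and> b \<in> doubled_lattice n}
    \<union> {gen (GenQ a) * gen (GenE k) * gen (GenQ (\<lambda>i. - a i))
        - scal (s powi pairing n a (root k)) * gen (GenE k) | a k.
        a \<in> doubled_lattice n \<and> k \<in> {1..<n}}
    \<union> {gen (GenQ a) * gen (GenF k) * gen (GenQ (\<lambda>i. - a i))
        - scal (s powi (- pairing n a (root k))) * gen (GenF k) | a k.
        a \<in> doubled_lattice n \<and> k \<in> {1..<n}}
    \<union> {gen (GenE i) * gen (GenF j) - gen (GenF j) * gen (GenE i)
        - scal (if i = j then 1 / (q - 1 / q) else 0)
          * (gen (GenQ (\<lambda>t. 2 * root i t)) - gen (GenQ (\<lambda>t. - 2 * root i t))) | i j.
        i \<in> {1..<n} \<and> j \<in> {1..<n}}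
    \<union> {gen (g i) * gen (g j) - gen (g j) * gen (g i) | g i j.
        g \<in> {GenE, GenF} \<and> i \<in> {1..<n} \<and> j \<in> {1..<n} \<and> i + 1 < j}
    \<union> {serre q (g i) (g j) | g i j.
        g \<in> {GenE, GenF} \<and> i \<in> {1..<n} \<and> j \<in> {1..<n} \<and> (j = i + 1 \<or> i = j + 1)}"

definition uq_ideal :: "nat \<Rightarrow> complex \<Rightarrow> complex \<Rightarrow> uq_gen free_alg set" where
  "uq_ideal n q s = Idl\<^bsub>free_algebra (uq_gens n)\<^esub> (uq_relations n q s)"

definition Uq :: "nat \<Rightarrow> complex \<Rightarrow> complex \<Rightarrow> uq_gen free_alg set ring" where
  "Uq n q s = free_algebra (uq_gens n) Quot uq_ideal n q s"

definition uq_proj :: "nat \<Rightarrow> complex \<Rightarrow> complex \<Rightarrow> uq_gen free_alg \<Rightarrow> uq_gen free_alg set" where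
  "uq_proj n q s u = uq_ideal n q s +>\<^bsub>free_algebra (uq_gens n)\<^esub> u"


section \<open>Partitions and irreducible highest weight modules\<close>

definition partitions :: "nat \<Rightarrow> (nat \<Rightarrow> nat) set" where
  "partitions n = {lam. (\<forall>i. i \<notin> {1..n} \<longrightarrow> lam i = 0) \<and>
    (\<forall>i\<in>{1..<n}. lam (i + 1) \<le> lam i) \<and> (\<Sum>i=1..n. lam i) = n}"

definition diagram :: "(nat \<Rightarrow> nat) \<Rightarrow> (nat \<times> nat) set" where
  "diagram lam = {(i, j). 1 \<le> i \<and> 1 \<le> j \<and> j \<le> lam i}"

definition standard_tableaux :: "nat \<Rightarrow> (nat \<Rightarrow> nat) \<Rightarrow> (nat \<times> nat \<Rightarrow> nat) set" where
  "standard_tableaux n lam = {T \<in> extensional (diagram lam).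
    bij_betw T (diagram lam) {1..n} \<and>
    (\<forall>i j. (i, j) \<in> diagram lam \<and> (i, j + 1) \<in> diagram lam \<longrightarrow> T (i, j) < T (i, j + 1)) \<and>
    (\<forall>i j. (i, j) \<in> diagram lam \<and> (i + 1, j) \<in> diagram lam \<longrightarrow> T (i, j) < T (i + 1, j))}"

definition num_standard_tableaux :: "nat \<Rightarrow> (nat \<Rightarrow> nat) \<Rightarrow> nat" where
  "num_standard_tableaux n lam = card (standard_tableaux n lam)"

text \<open>
  A module generated by a highest weight vector; for an irreducible module, every nonzero vector
  generates.
\<close>

definition irreducible_highest_weight ::
    "nat \<Rightarrow> complex \<Rightarrow> complex \<Rightarrow> (nat \<Rightarrow> nat) \<Rightarrow> (uq_gen free_alg set, 'm) module \<Rightarrow> bool" where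
  "irreducible_highest_weight n q s lam M \<longleftrightarrow>
    irreducible_module (Uq n q s) M \<and>
    (\<exists>v\<in>carrier M. v \<noteq> \<zero>\<^bsub>M\<^esub> \<and>
      (\<forall>k\<in>{1..<n}. uq_proj n q s (gen (GenE k)) \<odot>\<^bsub>M\<^esub> v = \<zero>\<^bsub>M\<^esub>) \<and>
      (\<forall>a\<in>doubled_lattice n. uq_proj n q s (gen (GenQ a)) \<odot>\<^bsub>M\<^esub> v =
         uq_proj n q s (scal (s powi pairing n a (\<lambda>i. int (lam i)))) \<odot>\<^bsub>M\<^esub> v))"

text \<open>
  The irreducible highest weight module is unique up to isomorphism. Being cyclic, it is
  isomorphic to a quotient of the left regular module, so it has a model whose elements are sets
  of elements of \<open>Uq\<close>; we pick one such model.
\<close>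

definition E_module ::
    "nat \<Rightarrow> complex \<Rightarrow> complex \<Rightarrow> (nat \<Rightarrow> nat)
      \<Rightarrow> (uq_gen free_alg set, uq_gen free_alg set set) module" where
  "E_module n q s lam = (SOME M. irreducible_highest_weight n q s lam M)"


section \<open>The quantum matrix algebra\<close>

text \<open>The letter \<open>(i, j)\<close> stands for the generator \<open>x\<^sub>i\<^sub>j\<close>.\<close>

definition aq_relations :: "nat \<Rightarrow> complex \<Rightarrow> (nat \<times> nat) free_alg set" where
  "aq_relations n q =
    {word [(i, k), (j, k)] - scal q * word [(j, k), (i, k)] | i j k.
        i \<in> {1..n} \<and> j \<in> {1..n} \<and> k \<in> {1..n} \<and> i < j}
    \<union> {word [(k, i), (k, j)] - scal q * word [(k, j), (k, i)] | i j k.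
        i \<in> {1..n} \<and> j \<in> {1..n} \<and> k \<in> {1..n} \<and> i < j}
    \<union> {word [(i, l), (j, k)] - word [(j, k), (i, l)] | i j k l.
        i \<in> {1..n} \<and> j \<in> {1..n} \<and> k \<in> {1..n} \<and> l \<in> {1..n} \<and> i < j \<and> k < l}
    \<union> {word [(i, k), (j, l)] - word [(j, l), (i, k)]
          - scal (q - 1 / q) * word [(i, l), (j, k)] | i j k l.
        i \<in> {1..n} \<and> j \<in> {1..n} \<and> k \<in> {1..n} \<and> l \<in> {1..n} \<and> i < j \<and> k < l}"

definition aq_free :: "nat \<Rightarrow> (nat \<times> nat) free_alg ring" where
  "aq_free n = free_algebra ({1..n} \<times> {1..n})"

definition aq_ideal :: "nat \<Rightarrow> complex \<Rightarrow> (nat \<times> nat) free_alg set" where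
  "aq_ideal n q = Idl\<^bsub>aq_free n\<^esub> (aq_relations n q)"

definition Aq :: "nat \<Rightarrow> complex \<Rightarrow> (nat \<times> nat) free_alg set ring" where
  "Aq n q = aq_free n Quot aq_ideal n q"

definition aq_proj :: "nat \<Rightarrow> complex \<Rightarrow> (nat \<times> nat) free_alg \<Rightarrow> (nat \<times> nat) free_alg set" where
  "aq_proj n q p = aq_ideal n q +>\<^bsub>aq_free n\<^esub> p"


section \<open>The representation on products of degree n\<close>

definition q_factor :: "nat \<Rightarrow> complex \<Rightarrow> nat \<Rightarrow> (nat \<times> nat) list \<Rightarrow> nat \<Rightarrow> complex" where
  "q_factor n s k xs l =
    s powi ((\<Sum>t<l. pairing n (root k) (eps (snd (xs ! t))))
          - (\<Sum>t=l+1..<length xs. pairing n (root k) (eps (snd (xs ! t)))))"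

text \<open>
  The operators are defined on words of every length by the formulas for degree \<open>n\<close>; only
  their restriction to degree \<open>n\<close> is used below. Positions are counted from \<open>0\<close>.
\<close>

fun rho_gen :: "nat \<Rightarrow> complex \<Rightarrow> uq_gen \<Rightarrow> (nat \<times> nat) list \<Rightarrow> (nat \<times> nat) free_alg" where
  "rho_gen n s (GenQ a) xs =
     scal (s powi (\<Sum>t<length xs. pairing n a (eps (snd (xs ! t))))) * word xs"
| "rho_gen n s (GenE k) xs =
     (\<Sum>l<length xs. if snd (xs ! l) = k + 1
        then scal (q_factor n s k xs l) * word (xs[l := (fst (xs ! l), k)]) else 0)"
| "rho_gen n s (GenF k) xs =
     (\<Sum>l<length xs. if snd (xs ! l) = k
        then scal (q_factor n s k xs l) * word (xs[l := (fst (xs ! l), k + 1)]) else 0)"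

definition rho_free ::
    "nat \<Rightarrow> complex \<Rightarrow> uq_gen free_alg \<Rightarrow> (nat \<times> nat) free_alg \<Rightarrow> (nat \<times> nat) free_alg" where
  "rho_free n s u p = lin_ext (\<lambda>gs. foldr (\<lambda>g. lin_ext (rho_gen n s g)) gs p) u"

text \<open>
  The action on cosets is defined through representatives, in the style of \<open>rcoset_mult\<close>: the
  union is a single coset because \<open>rho_free\<close> respects both ideals.
\<close>

definition rho ::
    "nat \<Rightarrow> complex \<Rightarrow> complex \<Rightarrow> uq_gen free_alg set
      \<Rightarrow> (nat \<times> nat) free_alg set \<Rightarrow> (nat \<times> nat) free_alg set" where
  "rho n q s X Y = (\<Union>u\<in>X. \<Union>p\<in>Y. aq_proj n q (rho_free n s u p))"

definition Aq_degree_n ::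
    "nat \<Rightarrow> complex \<Rightarrow> complex \<Rightarrow> (uq_gen free_alg set, (nat \<times> nat) free_alg set) module" where
  "Aq_degree_n n q s =
    \<lparr>carrier = aq_proj n q ` {p \<in> carrier (aq_free n).
        \<forall>w\<in>Poly_Mapping.keys p. length (letters w) = n},
     monoid.mult = undefined, one = undefined,
     zero = \<zero>\<^bsub>Aq n q\<^esub>, add = add (Aq n q), smult = rho n q s\<rparr>"


section \<open>Quantum alpha-determinants\<close>

definition inversions :: "nat \<Rightarrow> (nat \<Rightarrow> nat) \<Rightarrow> nat" where
  "inversions n w = card {(i, j). i \<in> {1..n} \<and> j \<in> {1..n} \<and> i < j \<and> w j < w i}"

definition num_cycles :: "nat \<Rightarrow> (nat \<Rightarrow> nat) \<Rightarrow> nat" where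
  "num_cycles n w = card (orbit w ` {1..n})"

definition D_elt ::
    "nat \<Rightarrow> complex \<Rightarrow> complex \<Rightarrow> (nat \<Rightarrow> nat) \<Rightarrow> (nat \<times> nat) free_alg set" where
  "D_elt n q \<alpha> j = aq_proj n q (\<Sum>w | w permutes {1..n}.
     scal (\<alpha> ^ (n - num_cycles n w) * q ^ inversions n w)
     * word (map (\<lambda>t. (w t, j t)) [1..<n+1]))"

definition q_alpha_det :: "nat \<Rightarrow> complex \<Rightarrow> complex \<Rightarrow> (nat \<times> nat) free_alg set" where
  "q_alpha_det n q \<alpha> = D_elt n q \<alpha> (\<lambda>t. t)"

definition V_module ::
    "nat \<Rightarrow> complex \<Rightarrow> complex \<Rightarrow> complex
      \<Rightarrow> (uq_gen free_alg set, (nat \<times> nat) free_alg set) module" where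
  "V_module n q s \<alpha> = (Aq_degree_n n q s)
    \<lparr>carrier := {rho n q s u (q_alpha_det n q \<alpha>) | u. u \<in> carrier (Uq n q s)}\<rparr>"

text \<open>Linear dependence is that of the family indexed by all the tuples \<open>(j\<^sub>1, \<dots>, j\<^sub>n)\<close>.\<close>

definition Sing :: "nat \<Rightarrow> complex \<Rightarrow> complex set" where
  "Sing n q = {\<alpha>. \<exists>c. (\<exists>j\<in>{1..n} \<rightarrow>\<^sub>E {1..n}. c j \<noteq> 0) \<and>
    (\<Oplus>\<^bsub>Aq n q\<^esub>j\<in>{1..n} \<rightarrow>\<^sub>E {1..n}. aq_proj n q (scal (c j)) \<otimes>\<^bsub>Aq n q\<^esub> D_elt n q \<alpha> j)
      = \<zero>\<^bsub>Aq n q\<^esub>}"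

end

theory Submission
  imports Defs
begin

text \<open>
  Words \<open>x\<^bsub>1 j_1\<^esub> \<dots> x\<^bsub>n j_n\<^esub>\<close> span a copy of the \<open>n\<close>-th tensor power of the vector representation.
  Replacing the row indices by permutations and summing with the weights \<open>\<alpha>\<^bsup>n - \<nu>(w)\<^esup> q\<^bsup>\<ell>(w)\<^esup>\<close> maps it
  equivariantly onto the span of the \<open>D(j_1, \<dots>, j_n)\<close>, and injectively when \<open>\<alpha>\<close> is not singular.
  The word with \<open>j_i = i\<close> is cyclic, so the module generated by the determinant is the whole
  tensor power.

  Adding one box at a time to a Young diagram lifts a singular vector of the \<open>m\<close>-th tensor power
  to one of the next. The singular vectors obtained from all paths are orthogonal for the form in which
  the words are orthonormal, and every singular vector orthogonal to all of them vanishes. As the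
  generators \<open>e_k\<close> and \<open>f_k\<close> are adjoint, the cyclic modules of these vectors are irreducible, mutually orthogonal, and their sum is everything. Paths of shape \<open>\<lambda>\<close> are
  counted by standard tableaux, and irreducible modules with equal highest weight are isomorphic.
\<close>

section \<open>Free algebras and linear maps\<close>

text \<open>Everything therefore rests on one explicit norm. Adding a box in row j multiplies
  \<open>form v v\<close> by q^(j-1) times the product over i < j of [d_i + 1]/[d_i], where [a] is
  the quantum integer and d_i the axial distance from the end of row i to the new box. Along a path
  of shapes every d_i is positive, so no factor vanishes when q is not a root of unity. Completeness
  of the family is the other half; it is read off from the highest nonzero coordinate of a singular
  vector in the last tensor factor. With nonzero norms at hand, orthogonal projection takes the
  place of complete reducibility. The multiplicity is a definite description over decompositions, so
  it also needs a uniqueness statement, obtained by counting independent highest weight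
  vectors.\<close>

abbreviation lk :: "'g free_alg \<Rightarrow> 'g list \<Rightarrow> complex" where
  "lk p ws \<equiv> Poly_Mapping.lookup p (FM ws)"

lemma scal_mult: "scal c * scal d = scal (c * d)"
  by (simp add: scal_def mult_single)

lemma scal_0 [simp]: "scal 0 = 0"
  by (simp add: scal_def)

lemma scal_1 [simp]: "scal 1 = 1"
  by (simp add: scal_def)

lemma scal_add: "scal (c + d) = scal c + scal d"
  by (simp add: scal_def single_add)

lemma scal_uminus: "scal (- c) = - scal c"
  by (simp add: scal_def single_uminus)

lemma scal_diff: "scal (c - d) = scal c - scal d"
  by (simp add: scal_def single_diff)

lemma scal_mult_left: "scal c * (scal d * p) = scal (c * d) * p"
  by (simp add: scal_mult mult.assoc [symmetric])

lemma word_mult: "word v * word w = word (v @ w)"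
  by (simp add: word_def mult_single plus_free_monoid_def)

lemma word_Nil: "word [] = 1"
  by (simp add: word_def zero_free_monoid_def[symmetric])

lemma lookup_scal [simp]: "Poly_Mapping.lookup (scal c * p) w = c * Poly_Mapping.lookup p w"
proof -
  have "scal c * p = Poly_Mapping.map ((*) c) p"
    by (simp add: scal_def mult_map_scale_conv_mult)
  then show ?thesis by (simp add: Poly_Mapping.map.rep_eq when_def)
qed

lemma lookup_word: "Poly_Mapping.lookup (word ws) w = (if w = FM ws then 1 else 0)"
  by (simp add: word_def lookup_single when_def)

lemma word_expand:
  "p = (\<Sum>w\<in>Poly_Mapping.keys p. scal (Poly_Mapping.lookup p w) * word (letters w))"
proof (rule poly_mapping_eqI)
  fix v :: "'a free_monoid"
  have eq: "FM (letters w) = w" for w :: "'a free_monoid" by simp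
  have "Poly_Mapping.lookup (\<Sum>w\<in>Poly_Mapping.keys p. scal (Poly_Mapping.lookup p w) * word (letters w)) v
      = (\<Sum>w\<in>Poly_Mapping.keys p. if v = w then Poly_Mapping.lookup p w else 0)"
    by (simp add: lookup_sum lookup_word if_distrib cong: if_cong)
  also have "\<dots> = Poly_Mapping.lookup p v"
    by (simp add: sum.delta' in_keys_iff)
  finally show "Poly_Mapping.lookup p v =
     Poly_Mapping.lookup (\<Sum>w\<in>Poly_Mapping.keys p. scal (Poly_Mapping.lookup p w) * word (letters w)) v"
    by simp
qed

text \<open>One notion covers several subspaces: \<open>lists X\<close> gives the free algebra on X,
  \<open>tw m\<close> a tensor power, words in the f_k the negative part, and bounds on length or
  height give filtrations.\<close>

definition supp_in :: "'g list set \<Rightarrow> 'g free_alg set" where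
  "supp_in S = {p. \<forall>w\<in>Poly_Mapping.keys p. letters w \<in> S}"

lemma supp_inD: "p \<in> supp_in S \<Longrightarrow> lk p ws \<noteq> 0 \<Longrightarrow> ws \<in> S"
  by (force simp: supp_in_def in_keys_iff)

lemma supp_inI: "(\<And>ws. lk p ws \<noteq> 0 \<Longrightarrow> ws \<in> S) \<Longrightarrow> p \<in> supp_in S"
  by (simp add: supp_in_def in_keys_iff)

lemma supp_in_mono: "S \<subseteq> S' \<Longrightarrow> supp_in S \<subseteq> supp_in S'"
  by (auto simp: supp_in_def)

lemma supp_in_0 [simp]: "0 \<in> supp_in S"
  by (simp add: supp_in_def)

lemma supp_in_add: "p \<in> supp_in S \<Longrightarrow> r \<in> supp_in S \<Longrightarrow> p + r \<in> supp_in S"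
  using keys_add[of p r] by (auto simp: supp_in_def)

lemma supp_in_scal: "p \<in> supp_in S \<Longrightarrow> scal c * p \<in> supp_in S"
  by (auto simp: supp_in_def in_keys_iff)

lemma supp_in_uminus: "p \<in> supp_in S \<Longrightarrow> - p \<in> supp_in S"
  by (auto simp: supp_in_def in_keys_iff)

lemma supp_in_diff: "p \<in> supp_in S \<Longrightarrow> r \<in> supp_in S \<Longrightarrow> p - r \<in> supp_in S"
  using supp_in_add[OF _ supp_in_uminus, of p S r] by simp

lemma supp_in_word [simp]: "word ws \<in> supp_in S \<longleftrightarrow> ws \<in> S"
  by (simp add: supp_in_def word_def)

lemma supp_in_sum: "(\<And>i. i \<in> I \<Longrightarrow> f i \<in> supp_in S) \<Longrightarrow> sum f I \<in> supp_in S"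
  by (induction I rule: infinite_finite_induct) (auto intro: supp_in_add)

lemma supp_in_induct [consumes 1, case_names zero add word]:
  assumes "p \<in> supp_in S" "P 0"
    and add: "\<And>x y. x \<in> supp_in S \<Longrightarrow> y \<in> supp_in S \<Longrightarrow> P x \<Longrightarrow> P y \<Longrightarrow> P (x + y)"
    and word: "\<And>c ws. ws \<in> S \<Longrightarrow> P (scal c * word ws)"
  shows "P p"
proof -
  have "(\<Sum>w\<in>K. scal (Poly_Mapping.lookup p w) * word (letters w)) \<in> supp_in S
      \<and> P (\<Sum>w\<in>K. scal (Poly_Mapping.lookup p w) * word (letters w))"
    if "finite K" "K \<subseteq> Poly_Mapping.keys p" for K
    using that
  proof (induction K rule: finite_induct)
    case empty
    then show ?case using assms(2) by simp
  next
    case (insert w K)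
    then have "letters w \<in> S" using assms(1) by (auto simp: supp_in_def)
    with insert show ?case
      by (auto intro!: supp_in_add supp_in_scal add word)
  qed
  from this[of "Poly_Mapping.keys p"] show ?thesis
    using word_expand[of p] by simp
qed

lemma free_alg_induct [case_names zero add word]:
  assumes "P 0" "\<And>x y. P x \<Longrightarrow> P y \<Longrightarrow> P (x + y)" "\<And>c ws. P (scal c * word ws)"
  shows "P p"
  by (rule supp_in_induct[of p UNIV]) (use assms in \<open>auto simp: supp_in_def\<close>)

lemma scal_commute: "p * scal c = scal c * (p :: 'g free_alg)"
proof (induction p rule: free_alg_induct)
  case (word d ws)
  have "word ws * scal c = scal c * word ws"
    by (simp add: scal_def word_def mult_single)
  then show ?case
    by (simp add: mult.assoc scal_mult_left mult.commute)
qed (auto simp: algebra_simps)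

lemma scal_mult_right: "p * (scal c * r) = scal c * (p * r)"
  by (metis mult.assoc scal_commute)

text \<open>Scalars act through multiplication by the central elements \<open>scal c\<close>, and
  linearity is expressed with these.\<close>

definition lin :: "('g free_alg \<Rightarrow> 'h free_alg) \<Rightarrow> bool" where
  "lin f \<longleftrightarrow> (\<forall>p r. f (p + r) = f p + f r) \<and> (\<forall>c p. f (scal c * p) = scal c * f p)"

lemma linI: "(\<And>p r. f (p + r) = f p + f r) \<Longrightarrow> (\<And>c p. f (scal c * p) = scal c * f p) \<Longrightarrow> lin f"
  by (simp add: lin_def)

lemma lin_add: "lin f \<Longrightarrow> f (p + r) = f p + f r"
  and lin_scal: "lin f \<Longrightarrow> f (scal c * p) = scal c * f p"
  by (auto simp: lin_def)

lemma lin_0: "lin f \<Longrightarrow> f 0 = 0"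
  using lin_scal[of f 0 0] by simp

lemma lin_uminus: "lin f \<Longrightarrow> f (- p) = - f p"
  using lin_scal[of f "-1" p] by (simp add: scal_uminus)

lemma lin_diff: "lin f \<Longrightarrow> f (p - r) = f p - f r"
  using lin_add[of f p "- r"] by (simp add: lin_uminus)

lemma lin_sum: "lin f \<Longrightarrow> f (sum g I) = (\<Sum>i\<in>I. f (g i))"
  by (induction I rule: infinite_finite_induct) (auto simp: lin_add lin_0)

lemmas lin_simps = lin_add lin_scal lin_0 lin_uminus lin_diff lin_sum

lemma lin_compose: "lin f \<Longrightarrow> lin g \<Longrightarrow> lin (\<lambda>p. f (g p))"
  by (simp add: lin_def)

lemma lin_ident: "lin (\<lambda>p. p)"
  by (simp add: lin_def)

lemma lin_plus: "lin f \<Longrightarrow> lin g \<Longrightarrow> lin (\<lambda>p. f p + g p)"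
  by (simp add: lin_def algebra_simps)

lemma lin_minus: "lin f \<Longrightarrow> lin g \<Longrightarrow> lin (\<lambda>p. f p - g p)"
  by (simp add: lin_def algebra_simps)

lemma lin_zero: "lin (\<lambda>p. 0)"
  by (simp add: lin_def)

lemma lin_scaled: "lin f \<Longrightarrow> lin (\<lambda>p. scal c * f p)"
  by (simp add: lin_def algebra_simps scal_mult_left mult.commute)

lemma lin_mult_left: "lin f \<Longrightarrow> lin (\<lambda>p. a * f p)"
  by (simp add: lin_def algebra_simps scal_mult_right)

lemma lin_mult_right: "lin f \<Longrightarrow> lin (\<lambda>p. f p * a)"
  by (simp add: lin_def algebra_simps)

lemma lin_sum_fun: "(\<And>i. i \<in> I \<Longrightarrow> lin (f i)) \<Longrightarrow> lin (\<lambda>p. \<Sum>i\<in>I. f i p)"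
  by (induction I rule: infinite_finite_induct) (auto simp: lin_zero lin_plus)

lemmas lin_intros = lin_ident lin_plus lin_minus lin_zero lin_scaled lin_mult_left
  lin_mult_right lin_sum_fun

lemma lin_eq_on:
  assumes "lin f" "lin g" "p \<in> supp_in S" "\<And>ws. ws \<in> S \<Longrightarrow> f (word ws) = g (word ws)"
  shows "f p = g p"
  using assms(3) by (induction rule: supp_in_induct) (use assms in \<open>auto simp: lin_simps\<close>)

lemma lin_eq:
  assumes "lin f" "lin g" "\<And>ws. f (word ws) = g (word ws)"
  shows "f p = g p"
  by (rule lin_eq_on[OF assms(1,2), of p UNIV]) (use assms in \<open>auto simp: supp_in_def\<close>)

lemma lin_supp_in:
  assumes "lin f" "p \<in> supp_in S" "\<And>ws. ws \<in> S \<Longrightarrow> f (word ws) \<in> supp_in S'"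
  shows "f p \<in> supp_in S'"
  using assms(2) by (induction rule: supp_in_induct)
    (use assms in \<open>auto simp: lin_simps intro: supp_in_add supp_in_scal\<close>)

text \<open>\<open>lin_ext\<close> sums over the support of its argument; two arguments can be
  compared only over a common finite set of words.\<close>

lemma lin_ext_superset:
  assumes "finite K" "Poly_Mapping.keys p \<subseteq> K"
  shows "lin_ext f p = (\<Sum>w\<in>K. scal (Poly_Mapping.lookup p w) * f (letters w))"
  unfolding lin_ext_def
  by (rule sum.mono_neutral_left) (use assms in \<open>auto simp: in_keys_iff\<close>)

lemma lin_lin_ext [simp]: "lin (lin_ext f)"
proof (rule linI)
  fix p r :: "'a free_alg" and c
  let ?K = "Poly_Mapping.keys p \<union> Poly_Mapping.keys r"
  have "lin_ext f x = (\<Sum>w\<in>?K. scal (Poly_Mapping.lookup x w) * f (letters w))"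
    if "Poly_Mapping.keys x \<subseteq> ?K" for x
    using that by (intro lin_ext_superset) auto
  then show "lin_ext f (p + r) = lin_ext f p + lin_ext f r"
    using keys_add[of p r]
    by (simp add: lookup_add scal_add algebra_simps sum.distrib)
  have "Poly_Mapping.keys (scal c * p) \<subseteq> Poly_Mapping.keys p"
    by (auto simp: in_keys_iff)
  then show "lin_ext f (scal c * p) = scal c * lin_ext f p"
    by (subst lin_ext_superset[of "Poly_Mapping.keys p"])
      (auto simp: lin_ext_def sum_distrib_left scal_mult_left)
qed

lemma lin_ext_word [simp]: "lin_ext f (word ws) = f ws"
  by (simp add: lin_ext_def word_def)

lemma free_algebra_carrier: "carrier (free_algebra X) = supp_in (lists X)"
  by (auto simp: free_algebra_def supp_in_def lists_eq_set)

lemma supp_in_mult: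
  assumes "p \<in> supp_in (lists X)" "r \<in> supp_in (lists X)"
  shows "p * r \<in> supp_in (lists X)"
proof -
  have "word v * r \<in> supp_in (lists X)" if "v \<in> lists X" for v
    by (rule lin_supp_in[OF _ assms(2)]) (use that in \<open>auto intro!: lin_intros simp: word_mult\<close>)
  then show ?thesis
    by (intro lin_supp_in[OF _ assms(1), of "\<lambda>p. p * r"]) (auto intro!: lin_intros)
qed

lemma supp_in_1: "1 \<in> supp_in (lists X)"
  by (simp flip: word_Nil)

lemma supp_in_scal_1: "scal c \<in> supp_in (lists X)"
  using supp_in_scal[OF supp_in_1, of c] by simp

lemma free_algebra_simps [simp]:
  "x \<otimes>\<^bsub>free_algebra X\<^esub> y = x * y" "\<one>\<^bsub>free_algebra X\<^esub> = 1"
  "\<zero>\<^bsub>free_algebra X\<^esub> = 0" "x \<oplus>\<^bsub>free_algebra X\<^esub> y = x + y"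
  by (auto simp: free_algebra_def)

lemma ring_free_algebra: "ring (free_algebra X)"
proof (rule ringI)
  show "abelian_group (free_algebra X)"
  proof (rule abelian_groupI)
    fix x assume "x \<in> carrier (free_algebra X)"
    then show "\<exists>y\<in>carrier (free_algebra X). y \<oplus>\<^bsub>free_algebra X\<^esub> x = \<zero>\<^bsub>free_algebra X\<^esub>"
      by (intro bexI[of _ "- x"]) (auto simp: free_algebra_carrier supp_in_uminus)
  qed (auto simp: free_algebra_carrier supp_in_add add.assoc add.commute)
  show "Group.monoid (free_algebra X)"
    by (rule monoidI) (auto simp: free_algebra_carrier supp_in_mult supp_in_1 mult.assoc)
qed (auto simp: distrib_left distrib_right)

lemma free_algebra_a_inv:
  assumes "x \<in> carrier (free_algebra X)"
  shows "\<ominus>\<^bsub>free_algebra X\<^esub> x = - x"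
proof -
  interpret ring "free_algebra X" by (rule ring_free_algebra)
  have "- x \<oplus>\<^bsub>free_algebra X\<^esub> x = \<zero>\<^bsub>free_algebra X\<^esub>" by simp
  then show ?thesis
    using assms by (intro minus_equality) (auto simp: free_algebra_carrier supp_in_uminus)
qed

section \<open>The bilinear form in which the words are orthonormal\<close>

definition form :: "'g free_alg \<Rightarrow> 'g free_alg \<Rightarrow> complex" where
  "form p r = (\<Sum>w\<in>Poly_Mapping.keys p. Poly_Mapping.lookup p w * Poly_Mapping.lookup r w)"

lemma form_superset:
  assumes "finite K" "Poly_Mapping.keys p \<subseteq> K"
  shows "form p r = (\<Sum>w\<in>K. Poly_Mapping.lookup p w * Poly_Mapping.lookup r w)"
  unfolding form_def
  by (rule sum.mono_neutral_left) (use assms in \<open>auto simp: in_keys_iff\<close>)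

lemma form_add_left: "form (p + p') r = form p r + form p' r"
proof -
  let ?K = "Poly_Mapping.keys p \<union> Poly_Mapping.keys p'"
  have "form x r = (\<Sum>w\<in>?K. Poly_Mapping.lookup x w * Poly_Mapping.lookup r w)"
    if "Poly_Mapping.keys x \<subseteq> ?K" for x
    using that by (intro form_superset) auto
  then show ?thesis
    using keys_add[of p p'] by (simp add: lookup_add algebra_simps sum.distrib)
qed

lemma form_sym: "form p r = form r p"
proof -
  let ?K = "Poly_Mapping.keys p \<union> Poly_Mapping.keys r"
  show ?thesis
    by (simp add: form_superset[of ?K] mult.commute)
qed

lemma form_scal_left: "form (scal c * p) r = c * form p r"
proof -
  have "Poly_Mapping.keys (scal c * p) \<subseteq> Poly_Mapping.keys p"
    by (auto simp: in_keys_iff)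
  then show ?thesis
    by (subst form_superset[of "Poly_Mapping.keys p"]) (auto simp: form_def sum_distrib_left mult.assoc)
qed

lemma form_0_left [simp]: "form 0 r = 0"
  by (simp add: form_def)

lemma form_0_right [simp]: "form r 0 = 0"
  by (simp add: form_def)

lemma form_add_right: "form r (p + p') = form r p + form r p'"
  using form_add_left[of p p' r] by (simp add: form_sym)

lemma form_scal_right: "form r (scal c * p) = c * form r p"
  using form_scal_left[of c p r] by (simp add: form_sym)

lemma form_uminus_left: "form (- p) r = - form p r"
  using form_scal_left[of "-1" p r] by (simp add: scal_uminus)

lemma form_uminus_right: "form r (- p) = - form r p"
  using form_uminus_left[of p r] by (simp add: form_sym)

lemma form_diff_left: "form (p - p') r = form p r - form p' r"
  using form_add_left[of p "- p'" r] by (simp add: form_uminus_left)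

lemma form_diff_right: "form r (p - p') = form r p - form r p'"
  using form_diff_left[of p p' r] by (simp add: form_sym)

lemma form_sum_left: "form (sum f I) r = (\<Sum>i\<in>I. form (f i) r)"
  by (induction I rule: infinite_finite_induct) (auto simp: form_add_left)

lemma form_sum_right: "form r (sum f I) = (\<Sum>i\<in>I. form r (f i))"
  by (induction I rule: infinite_finite_induct) (auto simp: form_add_right)

lemmas form_simps = form_add_left form_add_right form_scal_left form_scal_right form_0_left
  form_0_right form_diff_left form_diff_right form_uminus_left form_uminus_right
  form_sum_left form_sum_right

lemma form_word_left: "form (word ws) p = lk p ws"
  by (simp add: form_def word_def)

lemma form_word_right: "form p (word ws) = lk p ws"
  by (simp add: form_sym[of p] form_word_left)

lemma form_word_word: "form (word v) (word w) = (if v = w then 1 else 0)"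
  by (simp add: form_word_left lookup_word)

lemma free_alg_eqI: "(\<And>ws. lk p ws = lk r ws) \<Longrightarrow> p = r"
  by (metis free_monoid.collapse poly_mapping_eqI)

text \<open>The words in S serve as test vectors: pairing with a word reads off its
  coefficient.\<close>

lemma form_nondegenerate:
  assumes "p \<in> supp_in S" "\<And>r. r \<in> supp_in S \<Longrightarrow> form p r = 0"
  shows "p = 0"
proof (rule free_alg_eqI)
  fix ws
  show "lk p ws = lk 0 ws"
    using assms(2)[of "word ws"] supp_inD[OF assms(1), of ws] by (auto simp: form_word_right)
qed

section \<open>The generators as operators on words\<close>

definition wt_pair :: "nat \<Rightarrow> (nat \<Rightarrow> int) \<Rightarrow> (nat \<times> nat) list \<Rightarrow> int" where
  "wt_pair n a xs = (\<Sum>x\<leftarrow>xs. pairing n a (eps (snd x)))"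

lemma wt_pair_simps [simp]:
  "wt_pair n a [] = 0" "wt_pair n a (x # xs) = pairing n a (eps (snd x)) + wt_pair n a xs"
  "wt_pair n a (xs @ ys) = wt_pair n a xs + wt_pair n a ys"
  by (auto simp: wt_pair_def)

lemma wt_pair_conv_sum: "wt_pair n a xs = (\<Sum>t<length xs. pairing n a (eps (snd (xs ! t))))"
  by (simp add: wt_pair_def sum_list_sum_nth atLeast0LessThan)

lemma pairing_eps: "pairing n a (eps b) = (if b \<in> {1..n} then a b else 0)"
  by (simp add: pairing_def eps_def if_distrib sum.delta cong: if_cong)

lemma wt_pair_uminus: "wt_pair n (\<lambda>i. - a i) xs = - wt_pair n a xs"
  by (induction xs) (auto simp: pairing_eps)

lemma wt_pair_add: "wt_pair n (\<lambda>i. a i + b i) xs = wt_pair n a xs + wt_pair n b xs"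
  by (induction xs) (auto simp: pairing_eps)

lemma wt_pair_0: "wt_pair n (\<lambda>i. 0) xs = 0"
  by (induction xs) (auto simp: pairing_eps)

lemma wt_pair_update:
  assumes "l < length xs"
  shows "wt_pair n a (xs[l := y])
    = wt_pair n a xs - pairing n a (eps (snd (xs ! l))) + pairing n a (eps (snd y))"
  using assms by (induction xs arbitrary: l) (auto split: nat.split)

text \<open>Weights of prefix and suffix are additive under concatenation, which is the form that
  the coproduct rule below requires.\<close>

lemma q_factor_eq:
  assumes "l < length xs"
  shows "q_factor n s k xs l
    = s powi (wt_pair n (root k) (take l xs) - wt_pair n (root k) (drop (Suc l) xs))"
proof -
  have "(\<Sum>t=l+1..<length xs. pairing n (root k) (eps (snd (xs ! t))))
      = wt_pair n (root k) (drop (Suc l) xs)"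
    unfolding wt_pair_conv_sum
    by (rule sum.reindex_bij_witness[of _ "\<lambda>t. t + Suc l" "\<lambda>t. t - Suc l"]) (use assms in auto)
  moreover have "(\<Sum>t<l. pairing n (root k) (eps (snd (xs ! t))))
      = wt_pair n (root k) (take l xs)"
    unfolding wt_pair_conv_sum using assms by (intro sum.cong) auto
  ultimately show ?thesis
    by (simp add: q_factor_def)
qed

text \<open>The operators of e_k and f_k both have this shape with the same factor; they differ only
  in which of the letters k, k + 1 is replaced by the other.\<close>

definition replace_letter :: "nat \<Rightarrow> complex \<Rightarrow> nat \<Rightarrow> nat \<Rightarrow> nat \<Rightarrow> (nat \<times> nat) list \<Rightarrow> (nat \<times> nat) free_alg"
  where "replace_letter n s k a b xs = (\<Sum>l<length xs. if snd (xs ! l) = a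
        then scal (q_factor n s k xs l) * word (xs[l := (fst (xs ! l), b)]) else 0)"

lemma rho_gen_replace_letter:
  "rho_gen n s (GenE k) = replace_letter n s k (k + 1) k"
  "rho_gen n s (GenF k) = replace_letter n s k k (k + 1)"
  by (rule ext, simp only: replace_letter_def rho_gen.simps)+

lemma rho_gen_GenQ: "rho_gen n s (GenQ a) xs = scal (s powi wt_pair n a xs) * word xs"
  by (simp add: wt_pair_conv_sum)

declare rho_gen.simps [simp del]

lemma sum_lessThan_add:
  "(\<Sum>l<a + (b::nat). f l) = (\<Sum>l<a. f l) + (\<Sum>l<b. f (a + l) :: 'a :: comm_monoid_add)"
  by (induction b) (auto simp: add.assoc)

lemma scal_word_mult: "(scal c * word v) * (scal d * word w) = scal (c * d) * word (v @ w)"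
proof -
  have "(scal c * word v) * (scal d * word w) = scal c * ((word v * scal d) * word w)"
    by (simp only: mult.assoc)
  also have "\<dots> = scal c * (scal d * (word v * word w))"
    by (simp only: scal_commute[of "word v"] mult.assoc)
  finally show ?thesis
    by (simp add: scal_mult_left word_mult)
qed

text \<open>The coproduct e -> e (x) K^-1 + K (x) e read on words, where K is q to half of the root
  (\<open>root k\<close> in doubled coordinates): letters left of the changed one contribute K,
  letters right of it K^-1.\<close>

lemma replace_letter_append:
  assumes "s \<noteq> 0"
  shows "replace_letter n s k a b (xs @ ys) =
    replace_letter n s k a b xs * rho_gen n s (GenQ (\<lambda>i. - root k i)) ys
    + rho_gen n s (GenQ (root k)) xs * replace_letter n s k a b ys"
proof -
  let ?f = "\<lambda>l. if snd ((xs @ ys) ! l) = a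
      then scal (q_factor n s k (xs @ ys) l) * word ((xs @ ys)[l := (fst ((xs @ ys) ! l), b)]) else 0"
  have 1: "?f l = (if snd (xs ! l) = a
        then scal (q_factor n s k xs l) * word (xs[l := (fst (xs ! l), b)]) else 0)
      * rho_gen n s (GenQ (\<lambda>i. - root k i)) ys" if "l < length xs" for l
  proof -
    have "q_factor n s k (xs @ ys) l = q_factor n s k xs l * s powi (- wt_pair n (root k) ys)"
      using that assms by (simp add: q_factor_eq flip: power_int_add) (simp add: algebra_simps)
    then show ?thesis
      using that by (simp add: nth_append list_update_append rho_gen_GenQ scal_word_mult wt_pair_uminus)
  qed
  have 2: "?f (length xs + l) = rho_gen n s (GenQ (root k)) xs * (if snd (ys ! l) = a
        then scal (q_factor n s k ys l) * word (ys[l := (fst (ys ! l), b)]) else 0)"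
    if "l < length ys" for l
  proof -
    have "q_factor n s k (xs @ ys) (length xs + l) = s powi wt_pair n (root k) xs * q_factor n s k ys l"
      using that assms by (simp add: q_factor_eq flip: power_int_add) (simp add: algebra_simps)
    then show ?thesis
      using that by (simp add: nth_append list_update_append rho_gen_GenQ scal_word_mult)
  qed
  show ?thesis
    unfolding replace_letter_def length_append sum_lessThan_add sum_distrib_left sum_distrib_right
    using 1 2 by (intro arg_cong2[of _ _ _ _ "(+)"] sum.cong) auto
qed

lemma replace_letter_single:
  "replace_letter n s k a b [x] = (if snd x = a then word [(fst x, b)] else 0)"
  by (simp add: replace_letter_def q_factor_eq)

lemma replace_letter_Nil: "replace_letter n s k a b [] = 0"
  by (simp add: replace_letter_def)

lemma lin_mult_eqI:
  assumes "\<And>r. lin (\<lambda>p. f p r)" "\<And>p. lin (f p)" "\<And>r. lin (\<lambda>p. g p r)" "\<And>p. lin (g p)"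
    and "\<And>v w. f (word v) (word w) = g (word v) (word w)"
  shows "f p r = g p r"
proof -
  have *: "f (word v) r = g (word v) r" for v
    by (rule lin_eq[of "f (word v)" "g (word v)"]) (use assms in auto)
  show ?thesis
    by (rule lin_eq[of "\<lambda>p. f p r" "\<lambda>p. g p r"]) (use assms * in auto)
qed

lemma pairing_uminus: "pairing n (\<lambda>i. - a i) b = - pairing n a b"
  by (simp add: pairing_def sum_negf)

lemma pairing_diff_right: "pairing n a (\<lambda>i. b i - c i) = pairing n a b - pairing n a c"
  by (simp add: pairing_def sum_subtractf algebra_simps)

lemma pairing_root: "pairing n a (root k) = pairing n a (eps k) - pairing n a (eps (k + 1))"
  unfolding root_def by (rule pairing_diff_right)

lemma pairing_root_eps:
  assumes "k \<in> {1..<n}"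
  shows "pairing n (root k) (eps b) = (if b = k then 1 else if b = k + 1 then - 1 else 0)"
  unfolding pairing_eps using assms by (auto simp: root_def eps_def)

section \<open>The operators of the generators on words and the relations between them\<close>

locale quantum_gl =
  fixes n :: nat and q s :: complex
  assumes n_pos: "n \<ge> 1" and q_nz: "q \<noteq> 0"
    and q_not_root: "\<And>k::nat. k > 0 \<Longrightarrow> q ^ k \<noteq> 1"
    and s_sq: "s ^ 2 = q"
begin

lemma s_nz [simp]: "s \<noteq> 0"
  using q_nz s_sq by auto

lemma q_eq: "q = s * s"
  using s_sq by (simp add: power2_eq_square)

definition opr :: "uq_gen \<Rightarrow> (nat \<times> nat) free_alg \<Rightarrow> (nat \<times> nat) free_alg" where
  "opr g = lin_ext (rho_gen n s g)"

abbreviation "E k \<equiv> opr (GenE k)"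
abbreviation "F k \<equiv> opr (GenF k)"
abbreviation "K a \<equiv> opr (GenQ a)"
abbreviation "Kp k \<equiv> opr (GenQ (root k))"
abbreviation "Km k \<equiv> opr (GenQ (\<lambda>i. - root k i))"

lemma lin_opr [simp]: "lin (opr g)"
  by (simp add: opr_def)

lemmas opr_lin = lin_simps[OF lin_opr]

lemma lin_opr_compose: "lin f \<Longrightarrow> lin (\<lambda>p. opr g (f p))"
  by (rule lin_compose[of "opr g"]) simp_all

lemma K_word: "K a (word xs) = scal (s powi wt_pair n a xs) * word xs"
  by (simp add: opr_def rho_gen_GenQ)

lemma K_mult: "K a (p * r) = K a p * K a r"
  by (rule lin_mult_eqI[of "\<lambda>p r. K a (p * r)" "\<lambda>p r. K a p * K a r"])
    (auto simp: word_mult K_word scal_word_mult power_int_add intro!: lin_intros lin_opr_compose)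

lemma E_mult: "E k (p * r) = E k p * Km k r + Kp k p * E k r"
proof -
  have *: "E k (word v * word w) = E k (word v) * Km k (word w) + Kp k (word v) * E k (word w)" for v w
    unfolding word_mult by (simp add: opr_def rho_gen_replace_letter replace_letter_append)
  show ?thesis
    by (rule lin_mult_eqI[of "\<lambda>p r. E k (p * r)" "\<lambda>p r. E k p * Km k r + Kp k p * E k r"])
      (intro lin_intros lin_opr_compose lin_opr *)+
qed

lemma F_mult: "F k (p * r) = F k p * Km k r + Kp k p * F k r"
proof -
  have *: "F k (word v * word w) = F k (word v) * Km k (word w) + Kp k (word v) * F k (word w)" for v w
    unfolding word_mult by (simp add: opr_def rho_gen_replace_letter replace_letter_append)
  show ?thesis
    by (rule lin_mult_eqI[of "\<lambda>p r. F k (p * r)" "\<lambda>p r. F k p * Km k r + Kp k p * F k r"])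
      (intro lin_intros lin_opr_compose lin_opr *)+
qed

lemma E_gen: "E k (word [x]) = (if snd x = k + 1 then word [(fst x, k)] else 0)"
  and F_gen: "F k (word [x]) = (if snd x = k then word [(fst x, k + 1)] else 0)"
  by (auto simp: opr_def rho_gen_replace_letter replace_letter_single)

lemma E_one [simp]: "E k 1 = 0" and F_one [simp]: "F k 1 = 0" and K_one [simp]: "K a 1 = 1"
  by (auto simp: opr_def rho_gen_replace_letter replace_letter_Nil rho_gen_GenQ word_mult simp flip: word_Nil)
lemma K_gen: "K a (word [x]) = scal (s powi pairing n a (eps (snd x))) * word [x]"
  by (simp add: K_word)

lemma Kp_gen: "k \<in> {1..<n} \<Longrightarrow> Kp k (word [x]) =
    scal (if snd x = k then s else if snd x = k + 1 then 1 / s else 1) * word [x]"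
  and Km_gen: "k \<in> {1..<n} \<Longrightarrow> Km k (word [x]) =
    scal (if snd x = k then 1 / s else if snd x = k + 1 then s else 1) * word [x]"
  by (auto simp: K_gen pairing_uminus pairing_root_eps power_int_minus divide_inverse)

lemma K_comp: "K a (K b p) = K (\<lambda>i. a i + b i) p"
  by (rule lin_eq[of "\<lambda>p. K a (K b p)" "K (\<lambda>i. a i + b i)"])
    (auto simp: K_word opr_lin scal_mult_left wt_pair_add power_int_add mult.commute
      intro!: lin_intros lin_opr_compose)

lemma K_zero: "K (\<lambda>i. 0) p = p"
  by (rule lin_eq[of "K (\<lambda>i. 0)" "\<lambda>p. p"]) (auto simp: K_word wt_pair_0 intro!: lin_intros)

lemma K_commute: "K a (K b p) = K b (K a p)"
  by (simp add: K_comp add.commute)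

text \<open>All summands have the same weight, since one letter b became c wherever it
  stood.\<close>

lemma K_replace_letter:
  "K a (replace_letter n s k b c xs) = scal (s powi (pairing n a (eps c) - pairing n a (eps b)))
    * (scal (s powi wt_pair n a xs) * replace_letter n s k b c xs)"
  unfolding replace_letter_def
  by (auto simp: opr_lin sum_distrib_left K_word wt_pair_update scal_mult_left
      intro!: sum.cong simp flip: power_int_add) (simp add: algebra_simps)

lemma K_E: "K a (E k p) = scal (s powi pairing n a (root k)) * E k (K a p)"
proof -
  have *: "K a (E k (word xs)) = scal (s powi pairing n a (root k)) * E k (K a (word xs))" for xs
    by (simp add: K_word opr_lin)
      (simp add: opr_def rho_gen_replace_letter K_replace_letter[unfolded opr_def] pairing_root)
  show ?thesis
    by (rule lin_eq[of "\<lambda>p. K a (E k p)" "\<lambda>p. scal (s powi pairing n a (root k)) * E k (K a p)"])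
      (intro lin_intros lin_opr_compose lin_opr *)+
qed

lemma K_F: "K a (F k p) = scal (s powi - pairing n a (root k)) * F k (K a p)"
proof -
  have *: "K a (F k (word xs)) = scal (s powi - pairing n a (root k)) * F k (K a (word xs))" for xs
    by (simp add: K_word opr_lin)
      (simp add: opr_def rho_gen_replace_letter K_replace_letter[unfolded opr_def] pairing_root)
  show ?thesis
    by (rule lin_eq[of "\<lambda>p. K a (F k p)" "\<lambda>p. scal (s powi - pairing n a (root k)) * F k (K a p)"])
      (intro lin_intros lin_opr_compose lin_opr *)+
qed

lemma E_K: "E k (K a p) = scal (s powi - pairing n a (root k)) * K a (E k p)"
  by (simp add: K_E scal_mult_left flip: power_int_add)

lemma F_K: "F k (K a p) = scal (s powi pairing n a (root k)) * K a (F k p)"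
  by (simp add: K_F scal_mult_left flip: power_int_add)

text \<open>A relation that holds on p and on r passes to the product by the coproduct. It is used
  with d = 1/(q - 1/q) for equal indices and with d = 0 for distinct ones.\<close>

lemma comm_EF_mult:
  fixes d :: complex
  assumes p: "E i (F j p) - F j (E i p) = scal d * (Kp j (Kp i p) - Km j (Km i p))"
    and r: "E i (F j r) - F j (E i r) = scal d * (Kp j (Kp i r) - Km j (Km i r))"
  shows "E i (F j (p * r)) - F j (E i (p * r))
    = scal d * (Kp j (Kp i (p * r)) - Km j (Km i (p * r)))"
proof -
  let ?a = "pairing n (root j) (root i)"
  have sym: "pairing n (root i) (root j) = ?a"
    by (simp add: pairing_def mult.commute)
  have "E i (F j (p * r)) = E i (F j p) * Km i (Km j r) + Kp i (F j p) * E i (Km j r)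
      + E i (Kp j p) * Km i (F j r) + Kp i (Kp j p) * E i (F j r)"
    by (simp add: F_mult E_mult opr_lin algebra_simps)
  moreover have "F j (E i (p * r)) = F j (E i p) * Km j (Km i r) + Kp j (E i p) * F j (Km i r)
      + F j (Kp i p) * Km j (E i r) + Kp j (Kp i p) * F j (E i r)"
    by (simp add: F_mult E_mult opr_lin algebra_simps)
  \<comment> \<open>The cross terms match: moving \<open>F j\<close> past \<open>Kp i\<close> and
    \<open>E i\<close> past \<open>Km j\<close> costs the same power of s, because the pairing of
    the two roots is symmetric.\<close>
  moreover have "Kp i (F j p) * E i (Km j r) = F j (Kp i p) * Km j (E i r)"
    by (simp add: F_K E_K pairing_uminus sym scal_mult_right scal_mult_left mult.assoc)
  moreover have "E i (Kp j p) * Km i (F j r) = Kp j (E i p) * F j (Km i r)"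
    by (simp add: F_K E_K pairing_uminus sym scal_mult_right scal_mult_left mult.assoc)
  ultimately have "E i (F j (p * r)) - F j (E i (p * r))
      = (E i (F j p) - F j (E i p)) * Km j (Km i r) + Kp j (Kp i p) * (E i (F j r) - F j (E i r))"
    by (simp add: algebra_simps K_commute)
  also have "\<dots> = scal d * (Kp j (Kp i p) * Kp j (Kp i r) - Km j (Km i p) * Km j (Km i r))"
    by (simp add: p r algebra_simps scal_mult_right)
  finally show ?thesis by (simp add: K_mult)
qed

lemma q_diff_nz: "q - 1 / q \<noteq> 0"
  using q_not_root[of 2] q_nz by (auto simp: field_simps power2_eq_square)

text \<open>The scheme by which relations are verified: on the empty word, by inspection on a
  letter, and through the coproduct on products.\<close>

lemma opr_word_induct:
  assumes "P 1" "\<And>x. P (word [x])" "\<And>p r. P p \<Longrightarrow> P r \<Longrightarrow> P (p * r)"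
  shows "P (word xs)"
proof (induction xs)
  case (Cons x xs)
  have "word (x # xs) = gen x * word xs" by (simp add: word_mult)
  then show ?case using assms(3)[OF assms(2) Cons] by (simp only:)
qed (simp add: word_Nil assms)

lemma comm_EF:
  assumes "i \<in> {1..<n}" "j \<in> {1..<n}"
  shows "E i (F j p) - F j (E i p)
    = scal (if i = j then 1 / (q - 1 / q) else 0) * (Kp j (Kp i p) - Km j (Km i p))"
proof -
  have gen: "E i (F j (gen x)) - F j (E i (gen x))
    = scal (if i = j then 1 / (q - 1 / q) else 0) * (Kp j (Kp i (gen x)) - Km j (Km i (gen x)))" for x
  proof -
    \<comment> \<open>On the letters k and k + 1 the right side of the relation is the quantum
      integer [1] or [-1]; these identities evaluate it.\<close>
    have 1: "scal (1 / (q - 1 / q)) * (scal (s * s) * y - scal (1 / s * (1 / s)) * y) = y"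
      and 2: "scal (1 / (q - 1 / q)) * (scal (1 / s * (1 / s)) * y - scal (s * s) * y) = - y"
      for y :: "(nat \<times> nat) free_alg"
    proof -
      have c: "1 / d * d = 1" "1 / d * - d = - 1" if "d \<noteq> 0" for d :: complex
        using that by simp_all
      have sq: "scal (s * s) * y - scal (1 / s * (1 / s)) * y = scal (q - 1 / q) * y"
        unfolding q_eq by (simp add: scal_diff left_diff_distrib)
      then have sq': "scal (1 / s * (1 / s)) * y - scal (s * s) * y = scal (- (q - 1 / q)) * y"
        by (simp only: scal_uminus) (metis minus_diff_eq mult_minus_left)
      show "scal (1 / (q - 1 / q)) * (scal (s * s) * y - scal (1 / s * (1 / s)) * y) = y"
        unfolding sq scal_mult_left c[OF q_diff_nz] by simp
      show "scal (1 / (q - 1 / q)) * (scal (1 / s * (1 / s)) * y - scal (s * s) * y) = - y"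
        unfolding sq' scal_mult_left c[OF q_diff_nz] by (simp add: scal_uminus)
    qed
    show ?thesis
    proof (cases "i = j")
      case True
      then show ?thesis
        using assms by (cases x) (auto simp: E_gen F_gen Kp_gen Km_gen opr_lin scal_mult_left 1[simplified] 2[simplified])
    next
      case False
      then show ?thesis
        using assms by (cases x) (auto simp: E_gen F_gen opr_lin)
    qed
  qed
  show ?thesis
    by (rule lin_eq[of "\<lambda>p. E i (F j p) - F j (E i p)"
        "\<lambda>p. scal (if i = j then 1 / (q - 1 / q) else 0) * (Kp j (Kp i p) - Km j (Km i p))"],
      (intro lin_intros lin_opr_compose lin_opr)+, rule opr_word_induct)
      (auto simp: gen opr_lin comm_EF_mult)
qed

text \<open>The product is kept opaque as \<open>m\<close>, so that only scalars are moved by the simplifier.\<close>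

lemma serre_bilinear:
  fixes X Y :: "'a free_alg \<Rightarrow> 'a free_alg" and u :: complex
  assumes lin: "lin X" "lin Y" "lin Pa" "lin Ma" "lin Pb" "lin Mb"
    and m: "\<And>p. lin (m p)" "\<And>r. lin (\<lambda>p. m p r)"
    and X: "\<And>p r. X (m p r) = m (X p) (Ma r) + m (Pa p) (X r)"
    and Y: "\<And>p r. Y (m p r) = m (Y p) (Mb r) + m (Pb p) (Y r)"
    and XPa: "\<And>p. X (Pa p) = scal (inverse u * inverse u) * Pa (X p)"
    and XPb: "\<And>p. X (Pb p) = scal u * Pb (X p)"
    and YPa: "\<And>p. Y (Pa p) = scal u * Pa (Y p)"
    and XMa: "\<And>p. X (Ma p) = scal (u * u) * Ma (X p)"
    and XMb: "\<And>p. X (Mb p) = scal (inverse u) * Mb (X p)"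
    and YMa: "\<And>p. Y (Ma p) = scal (inverse u) * Ma (Y p)"
    and P: "\<And>p. Pb (Pa p) = Pa (Pb p)" and M: "\<And>p. Mb (Ma p) = Ma (Mb p)"
    and u: "u \<noteq> 0" and c: "c = u * u + inverse u * inverse u"
    and p: "X (X (Y p)) - scal c * X (Y (X p)) + Y (X (X p)) = 0"
    and r: "X (X (Y r)) - scal c * X (Y (X r)) + Y (X (X r)) = 0"
  shows "X (X (Y (m p r))) - scal c * X (Y (X (m p r))) + Y (X (X (m p r))) = 0"
proof -
  note lins = lin[THEN lin_add] lin[THEN lin_scal] m[THEN lin_add] m[THEN lin_scal]
    lin[THEN lin_diff] m[THEN lin_diff]
  have p': "X (X (Y p)) = scal c * X (Y (X p)) - Y (X (X p))"
    and r': "X (X (Y r)) = scal c * X (Y (X r)) - Y (X (X r))"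
    using p r by (auto simp: algebra_simps eq_diff_eq)
  show ?thesis
  proof (rule poly_mapping_eqI)
    fix w
    \<comment> \<open>Terms in which all three operators act on one factor vanish by
      \<open>p'\<close> and \<open>r'\<close>. The coefficients of the mixed terms are Laurent
      polynomials in u that vanish because c = u^2 + u^-2.\<close>
    show "Poly_Mapping.lookup (X (X (Y (m p r))) - scal c * X (Y (X (m p r))) + Y (X (X (m p r)))) w
      = Poly_Mapping.lookup 0 w"
      using u
      by (simp add: X Y XPa XPb YPa XMa XMb YMa P M lins p' r' lookup_add lookup_minus
          scal_mult_left)
         (simp add: c field_simps)
  qed
qed

lemma commute_bilinear:
  fixes X Y :: "'a free_alg \<Rightarrow> 'a free_alg"
  assumes lin: "lin X" "lin Y"
    and X: "\<And>p r. X (p * r) = X p * Ma r + Pa p * X r"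
    and Y: "\<And>p r. Y (p * r) = Y p * Mb r + Pb p * Y r"
    and K: "\<And>p. X (Pb p) = Pb (X p)" "\<And>p. X (Mb p) = Mb (X p)"
       "\<And>p. Y (Pa p) = Pa (Y p)" "\<And>p. Y (Ma p) = Ma (Y p)"
    and P: "\<And>p. Pb (Pa p) = Pa (Pb p)" and M: "\<And>p. Mb (Ma p) = Ma (Mb p)"
    and p: "X (Y p) = Y (X p)" and r: "X (Y r) = Y (X r)"
  shows "X (Y (p * r)) = Y (X (p * r))"
  by (simp add: X Y K P M p r lin[THEN lin_add])

end

context quantum_gl
begin

lemma pairing_root_root:
  assumes "i \<in> {1..<n}"
  shows "pairing n (root i) (root j) =
    (if j = i then 2 else if j = i + 1 \<or> i = j + 1 then - 1 else 0)"
  unfolding pairing_root[of n _ j] pairing_root_eps[OF assms] by auto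

text \<open>On a single letter all three products are zero, since no letter can be lowered by two
  neighbouring indices with one of them repeated; products of words are covered by the
  coproduct.\<close>

lemma serre_E:
  assumes "i \<in> {1..<n}" "j \<in> {1..<n}" "j = i + 1 \<or> i = j + 1"
  shows "E i (E i (E j p)) - scal (q + 1 / q) * E i (E j (E i p)) + E j (E i (E i p)) = 0"
proof -
  have "E i (E i (E j (p * r))) - scal (q + 1 / q) * E i (E j (E i (p * r))) + E j (E i (E i (p * r))) = 0"
    if p: "E i (E i (E j p)) - scal (q + 1 / q) * E i (E j (E i p)) + E j (E i (E i p)) = 0"
     and r: "E i (E i (E j r)) - scal (q + 1 / q) * E i (E j (E i r)) + E j (E i (E i r)) = 0" for p r
    \<comment> \<open>The scalar u is s: this is the cost of moving \<open>E i\<close> past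
      \<open>Kp j\<close> for neighbouring indices, and u^2 + u^-2 = q + 1/q.\<close>
    by (rule serre_bilinear[of "E i" "E j" "Kp i" "Km i" "Kp j" "Km j" "(*)" s])
      (use p r assms in \<open>auto intro: lin_mult_left[OF lin_ident] lin_mult_right[OF lin_ident] K_commute simp: q_eq divide_inverse
        E_mult E_K pairing_uminus pairing_root_root power_int_minus numeral_2_eq_2\<close>)
  then show ?thesis
    by - (rule lin_eq[of "\<lambda>p. E i (E i (E j p)) - scal (q + 1 / q) * E i (E j (E i p)) + E j (E i (E i p))"
        "\<lambda>p. 0"],
      (intro lin_intros lin_opr_compose lin_opr)+, rule opr_word_induct,
      use assms in \<open>auto simp: E_gen opr_lin\<close>)
qed

lemma serre_F:
  assumes "i \<in> {1..<n}" "j \<in> {1..<n}" "j = i + 1 \<or> i = j + 1"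
  shows "F i (F i (F j p)) - scal (q + 1 / q) * F i (F j (F i p)) + F j (F i (F i p)) = 0"
proof -
  have "F i (F i (F j (p * r))) - scal (q + 1 / q) * F i (F j (F i (p * r))) + F j (F i (F i (p * r))) = 0"
    if p: "F i (F i (F j p)) - scal (q + 1 / q) * F i (F j (F i p)) + F j (F i (F i p)) = 0"
     and r: "F i (F i (F j r)) - scal (q + 1 / q) * F i (F j (F i r)) + F j (F i (F i r)) = 0" for p r
    \<comment> \<open>\<open>F i\<close> has the opposite weight, hence the inverse scalar; u^2 +
      u^-2 is unchanged.\<close>
    by (rule serre_bilinear[of "F i" "F j" "Kp i" "Km i" "Kp j" "Km j" "(*)" "inverse s"])
      (use p r assms in \<open>auto intro: lin_mult_left[OF lin_ident] lin_mult_right[OF lin_ident] K_commute simp: q_eq divide_inverse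
        F_mult F_K pairing_uminus pairing_root_root power_int_minus numeral_2_eq_2\<close>)
  then show ?thesis
    by - (rule lin_eq[of "\<lambda>p. F i (F i (F j p)) - scal (q + 1 / q) * F i (F j (F i p)) + F j (F i (F i p))"
        "\<lambda>p. 0"],
      (intro lin_intros lin_opr_compose lin_opr)+, rule opr_word_induct,
      use assms in \<open>auto simp: F_gen opr_lin\<close>)
qed

lemma E_E_commute:
  assumes "i \<in> {1..<n}" "j \<in> {1..<n}" "i + 1 < j"
  shows "E i (E j p) = E j (E i p)"
proof -
  have "E i (E j (p * r)) = E j (E i (p * r))"
    if "E i (E j p) = E j (E i p)" "E i (E j r) = E j (E i r)" for p r
    by (rule commute_bilinear[of "E i" "E j" "Km i" "Kp i" "Km j" "Kp j"])
      (use that assms in \<open>auto simp: E_mult E_K pairing_uminus pairing_root_root intro: K_commute\<close>)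
  then show ?thesis
    by - (rule lin_eq[of "\<lambda>p. E i (E j p)" "\<lambda>p. E j (E i p)"],
      (intro lin_intros lin_opr_compose lin_opr)+, rule opr_word_induct,
      use assms in \<open>auto simp: E_gen opr_lin\<close>)
qed

lemma F_F_commute:
  assumes "i \<in> {1..<n}" "j \<in> {1..<n}" "i + 1 < j"
  shows "F i (F j p) = F j (F i p)"
proof -
  have "F i (F j (p * r)) = F j (F i (p * r))"
    if "F i (F j p) = F j (F i p)" "F i (F j r) = F j (F i r)" for p r
    by (rule commute_bilinear[of "F i" "F j" "Km i" "Kp i" "Km j" "Kp j"])
      (use that assms in \<open>auto simp: F_mult F_K pairing_uminus pairing_root_root intro: K_commute\<close>)
  then show ?thesis
    by - (rule lin_eq[of "\<lambda>p. F i (F j p)" "\<lambda>p. F j (F i p)"],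
      (intro lin_intros lin_opr_compose lin_opr)+, rule opr_word_induct,
      use assms in \<open>auto simp: F_gen opr_lin\<close>)
qed

section \<open>The action on the quantum matrix algebra\<close>

abbreviation "act \<equiv> rho_free n s"

lemma act_word: "act (word gs) p = foldr opr gs p"
  by (simp add: rho_free_def opr_def[abs_def])

lemma lin_act_left: "lin (\<lambda>u. act u p)"
  by (simp add: rho_free_def)

lemmas act_left_lin = lin_simps[OF lin_act_left]

lemma lin_foldr_opr: "lin (foldr opr gs)"
  by (induction gs) (auto simp: comp_def id_def intro!: lin_ident lin_opr_compose)

lemma lin_act: "lin (act u)"
proof (induction u rule: free_alg_induct)
  case (word c gs)
  then show ?case
    unfolding act_left_lin act_word using lin_scaled[OF lin_foldr_opr] by blast
qed (auto simp: act_left_lin intro!: lin_intros)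

lemmas act_lin = lin_simps[OF lin_act]

lemma act_mult: "act (u * v) p = act u (act v p)"
proof (rule lin_mult_eqI[of "\<lambda>u v. act (u * v) p" "\<lambda>u v. act u (act v p)"])
  show "lin (\<lambda>u. act (u * v) p)" for v
    by (rule lin_compose[OF lin_act_left], intro lin_intros)
  show "lin (\<lambda>v. act (u * v) p)" for u
    by (rule lin_compose[OF lin_act_left], intro lin_intros)
  show "lin (\<lambda>u. act u (act v p))" for v
    by (rule lin_act_left)
  show "lin (\<lambda>v. act u (act v p))" for u
    by (rule lin_compose[OF lin_act lin_act_left])
qed (simp add: word_mult act_word)

lemma act_gen: "act (gen g) p = opr g p"
  by (simp add: act_word)

lemma act_1: "act 1 p = p"
  by (simp add: act_word flip: word_Nil)

lemma act_scal: "act (scal c) p = scal c * p"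
  using lin_scal[OF lin_act_left, of c 1 p] by (simp add: act_1)

lemmas act_simps = act_left_lin act_mult act_gen act_1 act_scal

section \<open>The defining relations of the quantum group act by zero\<close>

abbreviation "Ufree \<equiv> free_algebra (uq_gens n)"

lemma uq_gens_simps [simp]:
  "GenE k \<in> uq_gens n \<longleftrightarrow> k \<in> {1..<n}" "GenF k \<in> uq_gens n \<longleftrightarrow> k \<in> {1..<n}"
  "GenQ a \<in> uq_gens n \<longleftrightarrow> a \<in> doubled_lattice n"
  by (auto simp: uq_gens_def)

lemma doubled_lattice_intros:
  "(\<lambda>_. 0) \<in> doubled_lattice n"
  "a \<in> doubled_lattice n \<Longrightarrow> b \<in> doubled_lattice n \<Longrightarrow> (\<lambda>i. a i + b i) \<in> doubled_lattice n"
  "a \<in> doubled_lattice n \<Longrightarrow> (\<lambda>i. - a i) \<in> doubled_lattice n"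
  "k \<in> {1..<n} \<Longrightarrow> root k \<in> doubled_lattice n"
  "k \<in> {1..<n} \<Longrightarrow> (\<lambda>t. 2 * root k t) \<in> doubled_lattice n"
  "k \<in> {1..<n} \<Longrightarrow> (\<lambda>t. - (2 * root k t)) \<in> doubled_lattice n"
  by (auto simp: doubled_lattice_def root_def eps_def)

lemmas supp_in_lists_intros = supp_in_add supp_in_diff supp_in_mult supp_in_1 supp_in_scal_1
  supp_in_uminus supp_in_0

lemma uq_relations_subset: "uq_relations n q s \<subseteq> carrier Ufree"
  unfolding uq_relations_def free_algebra_carrier serre_def
  by (auto intro!: supp_in_lists_intros doubled_lattice_intros)

lemma act_uq_relations:
  assumes "u \<in> uq_relations n q s"
  shows "act u p = 0"
proof -
  have K2: "Kp k (Kp k p) = K (\<lambda>t. 2 * root k t) p" "Km k (Km k p) = K (\<lambda>t. - 2 * root k t) p" for k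
    by (simp_all add: K_comp)
  have comm: "E i (F j p) - F j (E i p) - scal (if i = j then 1 / (q - 1 / q) else 0)
      * (K (\<lambda>t. 2 * root i t) p - K (\<lambda>t. - 2 * root i t) p) = 0"
    if "i \<in> {1..<n}" "j \<in> {1..<n}" for i j
    using comm_EF[OF that, of p] K2 by (cases "i = j") auto
  show ?thesis
    using assms unfolding uq_relations_def
  proof (elim UnE)
    assume "u \<in> {gen (GenQ (\<lambda>_. 0)) - 1}"
    then show ?thesis by (simp add: act_simps K_zero)
  next
    assume "u \<in> {gen (GenQ a) * gen (GenQ b) - gen (GenQ (\<lambda>i. a i + b i)) | a b.
        a \<in> doubled_lattice n \<and> b \<in> doubled_lattice n}"
    then show ?thesis by (auto simp: act_simps K_comp)
  next
    assume "u \<in> {gen (GenQ a) * gen (GenE k) * gen (GenQ (\<lambda>i. - a i))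
        - scal (s powi pairing n a (root k)) * gen (GenE k) | a k.
        a \<in> doubled_lattice n \<and> k \<in> {1..<n}}"
    then show ?thesis by (auto simp: act_simps K_E K_comp K_zero)
  next
    assume "u \<in> {gen (GenQ a) * gen (GenF k) * gen (GenQ (\<lambda>i. - a i))
        - scal (s powi (- pairing n a (root k))) * gen (GenF k) | a k.
        a \<in> doubled_lattice n \<and> k \<in> {1..<n}}"
    then show ?thesis by (auto simp: act_simps K_F K_comp K_zero)
  next
    assume "u \<in> {gen (GenE i) * gen (GenF j) - gen (GenF j) * gen (GenE i)
        - scal (if i = j then 1 / (q - 1 / q) else 0)
          * (gen (GenQ (\<lambda>t. 2 * root i t)) - gen (GenQ (\<lambda>t. - 2 * root i t))) | i j.
        i \<in> {1..<n} \<and> j \<in> {1..<n}}"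
    then obtain i j where ij: "i \<in> {1..<n}" "j \<in> {1..<n}"
      and u: "u = gen (GenE i) * gen (GenF j) - gen (GenF j) * gen (GenE i)
        - scal (if i = j then 1 / (q - 1 / q) else 0)
          * (gen (GenQ (\<lambda>t. 2 * root i t)) - gen (GenQ (\<lambda>t. - 2 * root i t)))"
      by blast
    show ?thesis
      unfolding u act_simps by (rule comm[OF ij])
  next
    assume "u \<in> {gen (g i) * gen (g j) - gen (g j) * gen (g i) | g i j.
        g \<in> {GenE, GenF} \<and> i \<in> {1..<n} \<and> j \<in> {1..<n} \<and> i + 1 < j}"
    then obtain g i j where "u = gen (g i) * gen (g j) - gen (g j) * gen (g i)"
      "g = GenE \<or> g = GenF" "i \<in> {1..<n}" "j \<in> {1..<n}" "i + 1 < j"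
      by blast
    then show ?thesis
      using E_E_commute[of i j p] F_F_commute[of i j p] by (auto simp only: act_simps diff_self)
  next
    assume "u \<in> {serre q (g i) (g j) | g i j.
        g \<in> {GenE, GenF} \<and> i \<in> {1..<n} \<and> j \<in> {1..<n} \<and> (j = i + 1 \<or> i = j + 1)}"
    then obtain g i j where "u = serre q (g i) (g j)"
      "g = GenE \<or> g = GenF" "i \<in> {1..<n}" "j \<in> {1..<n}" "j = i + 1 \<or> i = j + 1"
      by blast
    then show ?thesis
      using serre_E[of i j p] serre_F[of i j p] by (auto simp only: act_simps serre_def mult.assoc)
  qed
qed

lemma uq_ideal_ideal: "ideal (uq_ideal n q s) Ufree"
  unfolding uq_ideal_def by (rule ring.genideal_ideal[OF ring_free_algebra uq_relations_subset])

lemma uq_relations_ideal: "uq_relations n q s \<subseteq> uq_ideal n q s"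
  unfolding uq_ideal_def by (rule ring.genideal_self[OF ring_free_algebra uq_relations_subset])

lemma free_algebra_idealI:
  assumes "I \<subseteq> carrier (free_algebra X)" "0 \<in> I" "\<And>x y. x \<in> I \<Longrightarrow> y \<in> I \<Longrightarrow> x + y \<in> I"
    "\<And>x y. x \<in> I \<Longrightarrow> y \<in> carrier (free_algebra X) \<Longrightarrow> x * y \<in> I"
    "\<And>x y. x \<in> I \<Longrightarrow> y \<in> carrier (free_algebra X) \<Longrightarrow> y * x \<in> I"
  shows "ideal I (free_algebra X)"
proof (rule idealI[OF ring_free_algebra])
  have "- x \<in> I" if "x \<in> I" for x
    using assms(5)[OF that, of "- 1"] supp_in_uminus[OF supp_in_1, of X] by (simp add: free_algebra_carrier)
  then have neg: "\<ominus>\<^bsub>free_algebra X\<^esub> x \<in> I" if "x \<in> I" for x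
    using that assms(1) by (subst free_algebra_a_inv) auto
  show "subgroup I (add_monoid (free_algebra X))"
    by (rule subgroup.intro) (use assms neg[unfolded a_inv_def] in auto)
qed (use assms in auto)

text \<open>The elements that annihilate every p form a two-sided ideal, because \<open>act\<close>
  is multiplicative, and this ideal contains the relations.\<close>

lemma act_uq_ideal:
  assumes "u \<in> uq_ideal n q s"
  shows "act u p = 0"
proof -
  have "uq_ideal n q s \<subseteq> {u \<in> carrier Ufree. \<forall>p. act u p = 0}"
    unfolding uq_ideal_def
  proof (rule ring.genideal_minimal[OF ring_free_algebra])
    show "ideal {u \<in> carrier Ufree. \<forall>p. act u p = 0} Ufree"
      by (rule free_algebra_idealI)
        (auto simp: free_algebra_carrier act_simps act_lin intro: supp_in_lists_intros)
    show "uq_relations n q s \<subseteq> {u \<in> carrier Ufree. \<forall>p. act u p = 0}"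
      using uq_relations_subset act_uq_relations by auto
  qed
  then show ?thesis using assms by auto
qed

section \<open>The operators preserve the ideal of the quantum matrix algebra\<close>

abbreviation "letters_n \<equiv> {1..n} \<times> {1..n}"

lemma aq_carrier: "carrier (aq_free n) = supp_in (lists letters_n)"
  by (simp add: aq_free_def free_algebra_carrier)

lemma replace_letter_supp_in:
  assumes "xs \<in> S" "\<And>l. l < length xs \<Longrightarrow> snd (xs ! l) = a \<Longrightarrow> xs[l := (fst (xs ! l), b)] \<in> S"
  shows "replace_letter n s k a b xs \<in> supp_in S"
  unfolding replace_letter_def
  by (rule supp_in_sum) (use assms in \<open>auto intro: supp_in_scal\<close>)

lemma opr_supp_in:
  assumes "p \<in> supp_in S" "g \<in> uq_gens n"
    "\<And>xs l b. xs \<in> S \<Longrightarrow> l < length xs \<Longrightarrow> b \<in> {1..n} \<Longrightarrow> xs[l := (fst (xs ! l), b)] \<in> S"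
  shows "opr g p \<in> supp_in S"
proof (rule lin_supp_in[OF lin_opr assms(1)])
  fix xs assume "xs \<in> S"
  then show "opr g (word xs) \<in> supp_in S"
    using assms(2,3) by (cases g)
      (auto simp: opr_def rho_gen_replace_letter rho_gen_GenQ intro!: replace_letter_supp_in supp_in_scal)
qed

lemma opr_aq_carrier:
  assumes "p \<in> carrier (aq_free n)" "g \<in> uq_gens n"
  shows "opr g p \<in> carrier (aq_free n)"
  unfolding aq_carrier
proof (rule opr_supp_in)
  fix xs :: "(nat \<times> nat) list" and l b
  assume "xs \<in> lists letters_n" "l < length xs" "b \<in> {1..n}"
  moreover from this have "xs ! l \<in> letters_n" by (auto simp: lists_eq_set)
  ultimately show "xs[l := (fst (xs ! l), b)] \<in> lists letters_n"
    using set_update_subset_insert[of xs l "(fst (xs ! l), b)"] by (fastforce simp: lists_eq_set)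
qed (use assms in \<open>auto simp: aq_carrier\<close>)

lemma aq_relations_subset: "aq_relations n q \<subseteq> carrier (aq_free n)"
  unfolding aq_relations_def aq_carrier
  by (auto intro!: supp_in_diff supp_in_scal)

lemma aq_ideal_ideal: "ideal (aq_ideal n q) (aq_free n)"
  unfolding aq_ideal_def
  by (rule ring.genideal_ideal[OF _ aq_relations_subset]) (simp add: aq_free_def ring_free_algebra)

lemma aq_relations_ideal: "aq_relations n q \<subseteq> aq_ideal n q"
  unfolding aq_ideal_def
  by (rule ring.genideal_self[OF _ aq_relations_subset]) (simp add: aq_free_def ring_free_algebra)

lemma aq_ideal_carrier: "p \<in> aq_ideal n q \<Longrightarrow> p \<in> carrier (aq_free n)"
  using ideal.Icarr[OF aq_ideal_ideal] by blast

lemma aq_ideal_add: "p \<in> aq_ideal n q \<Longrightarrow> r \<in> aq_ideal n q \<Longrightarrow> p + r \<in> aq_ideal n q"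
  using additive_subgroup.a_closed[OF ideal.axioms(1)[OF aq_ideal_ideal]] by (simp add: aq_free_def)

lemma aq_ideal_0: "0 \<in> aq_ideal n q"
  using additive_subgroup.zero_closed[OF ideal.axioms(1)[OF aq_ideal_ideal]] by (simp add: aq_free_def)

lemma aq_ideal_mult_right:
  "p \<in> aq_ideal n q \<Longrightarrow> r \<in> carrier (aq_free n) \<Longrightarrow> p * r \<in> aq_ideal n q"
  and aq_ideal_mult_left:
  "p \<in> aq_ideal n q \<Longrightarrow> r \<in> carrier (aq_free n) \<Longrightarrow> r * p \<in> aq_ideal n q"
  using ideal.I_r_closed[OF aq_ideal_ideal] ideal.I_l_closed[OF aq_ideal_ideal]
  by (auto simp: aq_free_def)

lemma aq_ideal_scal: "p \<in> aq_ideal n q \<Longrightarrow> scal c * p \<in> aq_ideal n q"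
  by (rule aq_ideal_mult_left) (auto simp: aq_carrier supp_in_scal_1)

lemma E_pair:
  assumes "k \<in> {1..<n}"
  shows "E k (word [x, y]) =
    (if snd x = k + 1 then scal (if snd y = k then 1 / s else if snd y = k + 1 then s else 1)
      * word [(fst x, k), y] else 0)
    + (if snd y = k + 1 then scal (if snd x = k then s else if snd x = k + 1 then 1 / s else 1)
      * word [x, (fst y, k)] else 0)"
proof -
  have eq: "word [x, y] = gen x * gen y" by (simp add: word_mult)
  show ?thesis
    unfolding eq E_mult using assms
    by (auto simp: E_gen Kp_gen Km_gen word_mult scal_mult_right mult.assoc)
qed

lemma F_pair:
  assumes "k \<in> {1..<n}"
  shows "F k (word [x, y]) =
    (if snd x = k then scal (if snd y = k then 1 / s else if snd y = k + 1 then s else 1)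
      * word [(fst x, k + 1), y] else 0)
    + (if snd y = k then scal (if snd x = k then s else if snd x = k + 1 then 1 / s else 1)
      * word [x, (fst y, k + 1)] else 0)"
proof -
  have eq: "word [x, y] = gen x * gen y" by (simp add: word_mult)
  show ?thesis
    unfolding eq F_mult using assms
    by (auto simp: F_gen Kp_gen Km_gen word_mult scal_mult_right mult.assoc)
qed

text \<open>The four families of relations are named as functions of their indices, so that the
  effect of an operator on one of them can be written as a combination of others.\<close>

definition rel1 :: "nat \<Rightarrow> nat \<Rightarrow> nat \<Rightarrow> (nat \<times> nat) free_alg" where
  "rel1 i j k = word [(i, k), (j, k)] - scal q * word [(j, k), (i, k)]"
definition rel2 :: "nat \<Rightarrow> nat \<Rightarrow> nat \<Rightarrow> (nat \<times> nat) free_alg" where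
  "rel2 k i j = word [(k, i), (k, j)] - scal q * word [(k, j), (k, i)]"
definition rel3 :: "nat \<Rightarrow> nat \<Rightarrow> nat \<Rightarrow> nat \<Rightarrow> (nat \<times> nat) free_alg" where
  "rel3 i j k l = word [(i, l), (j, k)] - word [(j, k), (i, l)]"
definition rel4 :: "nat \<Rightarrow> nat \<Rightarrow> nat \<Rightarrow> nat \<Rightarrow> (nat \<times> nat) free_alg" where
  "rel4 i j k l = word [(i, k), (j, l)] - word [(j, l), (i, k)]
     - scal (q - 1 / q) * word [(i, l), (j, k)]"

lemma rel_mem:
  "i \<in> {1..n} \<Longrightarrow> j \<in> {1..n} \<Longrightarrow> k \<in> {1..n} \<Longrightarrow> i < j \<Longrightarrow> rel1 i j k \<in> aq_ideal n q"
  "i \<in> {1..n} \<Longrightarrow> j \<in> {1..n} \<Longrightarrow> k \<in> {1..n} \<Longrightarrow> i < j \<Longrightarrow> rel2 k i j \<in> aq_ideal n q"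
  "i \<in> {1..n} \<Longrightarrow> j \<in> {1..n} \<Longrightarrow> k \<in> {1..n} \<Longrightarrow> l \<in> {1..n} \<Longrightarrow> i < j \<Longrightarrow> k < l \<Longrightarrow>
     rel3 i j k l \<in> aq_ideal n q"
  "i \<in> {1..n} \<Longrightarrow> j \<in> {1..n} \<Longrightarrow> k \<in> {1..n} \<Longrightarrow> l \<in> {1..n} \<Longrightarrow> i < j \<Longrightarrow> k < l \<Longrightarrow>
     rel4 i j k l \<in> aq_ideal n q"
  by (rule subsetD[OF aq_relations_ideal], unfold aq_relations_def rel1_def rel2_def rel3_def rel4_def, blast)+

lemma aq_relations_cases:
  assumes "r \<in> aq_relations n q"
  obtains (1) i j k where "r = rel1 i j k" "i \<in> {1..n}" "j \<in> {1..n}" "k \<in> {1..n}" "i < j"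
  | (2) i j k where "r = rel2 k i j" "i \<in> {1..n}" "j \<in> {1..n}" "k \<in> {1..n}" "i < j"
  | (3) i j k l where "r = rel3 i j k l" "i \<in> {1..n}" "j \<in> {1..n}" "k \<in> {1..n}" "l \<in> {1..n}" "i < j" "k < l"
  | (4) i j k l where "r = rel4 i j k l" "i \<in> {1..n}" "j \<in> {1..n}" "k \<in> {1..n}" "l \<in> {1..n}" "i < j" "k < l"
  using assms unfolding aq_relations_def rel1_def rel2_def rel3_def rel4_def by blast

text \<open>Two letters of one column are spread over columns m and m + 1, so the mixed relations
  appear. The word \<open>[(i, m + 1), (j, m)]\<close> receives s q - s (q - 1/q) = 1/s, as the left
  side demands.\<close>

lemma E_rel1:
  assumes "m \<in> {1..<n}"
  shows "E m (rel1 i j k) = (if k = m + 1 then scal s * rel4 i j m k + scal (s * q) * rel3 i j m k else 0)"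
  unfolding rel1_def rel2_def rel3_def rel4_def
  by (rule poly_mapping_eqI)
    (use assms in \<open>auto simp: opr_lin E_pair lookup_add lookup_minus q_eq field_simps\<close>)

lemma F_rel1:
  assumes "m \<in> {1..<n}"
  shows "F m (rel1 i j k) = (if k = m then scal s * rel4 i j k (m + 1) + scal (s * q) * rel3 i j k (m + 1) else 0)"
  unfolding rel1_def rel2_def rel3_def rel4_def
  by (rule poly_mapping_eqI)
    (use assms in \<open>auto simp: opr_lin F_pair lookup_add lookup_minus q_eq field_simps\<close>)

text \<open>For i = m and j = m + 1 both words become the same square, with the equal coefficients s
  and q/s.\<close>

lemma E_rel2:
  assumes "m \<in> {1..<n}" "i < j"
  shows "E m (rel2 k i j) = (if j = m + 1 then if i = m then 0 else rel2 k i m else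
    if i = m + 1 then rel2 k m j else 0)"
  unfolding rel1_def rel2_def rel3_def rel4_def
  by (rule poly_mapping_eqI)
    (use assms in \<open>auto simp: opr_lin E_pair lookup_add lookup_minus q_eq field_simps\<close>)

lemma F_rel2:
  assumes "m \<in> {1..<n}" "i < j"
  shows "F m (rel2 k i j) = (if i = m then if j = m + 1 then 0 else rel2 k (m + 1) j else
    if j = m then rel2 k i (m + 1) else 0)"
  unfolding rel1_def rel2_def rel3_def rel4_def
  by (rule poly_mapping_eqI)
    (use assms in \<open>auto simp: opr_lin F_pair lookup_add lookup_minus q_eq field_simps\<close>)

lemma E_rel3:
  assumes "m \<in> {1..<n}" "k < l"
  shows "E m (rel3 i j k l) = (if l = m + 1 then if k = m then scal (1 / s) * rel1 i j m
    else rel3 i j k m else if k = m + 1 then rel3 i j m l else 0)"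
  unfolding rel1_def rel2_def rel3_def rel4_def
  by (rule poly_mapping_eqI)
    (use assms in \<open>auto simp: opr_lin E_pair lookup_add lookup_minus q_eq field_simps\<close>)

lemma F_rel3:
  assumes "m \<in> {1..<n}" "k < l"
  shows "F m (rel3 i j k l) = (if k = m then if l = m + 1 then scal (1 / s) * rel1 i j l
    else rel3 i j (m + 1) l else if l = m then rel3 i j k (m + 1) else 0)"
  unfolding rel1_def rel2_def rel3_def rel4_def
  by (rule poly_mapping_eqI)
    (use assms in \<open>auto simp: opr_lin F_pair lookup_add lookup_minus q_eq field_simps\<close>)

text \<open>When columns m and m + 1 merge, the word \<open>[(i, m), (j, m)]\<close> has coefficient
  s - (q - 1/q)/s = 1/(s q), and the reversed word has -1/s, which is -q times this.\<close>

lemma E_rel4: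
  assumes "m \<in> {1..<n}" "k < l"
  shows "E m (rel4 i j k l) = (if l = m + 1 then if k = m then scal (1 / (s * q)) * rel1 i j m
    else rel4 i j k m else if k = m + 1 then rel4 i j m l else 0)"
  unfolding rel1_def rel2_def rel3_def rel4_def
  by (rule poly_mapping_eqI)
    (use assms in \<open>auto simp: opr_lin E_pair lookup_add lookup_minus q_eq field_simps\<close>)

lemma F_rel4:
  assumes "m \<in> {1..<n}" "k < l"
  shows "F m (rel4 i j k l) = (if k = m then if l = m + 1 then scal (1 / (s * q)) * rel1 i j l
    else rel4 i j (m + 1) l else if l = m then rel4 i j k (m + 1) else 0)"
  unfolding rel1_def rel2_def rel3_def rel4_def
  by (rule poly_mapping_eqI)
    (use assms in \<open>auto simp: opr_lin F_pair lookup_add lookup_minus q_eq field_simps\<close>)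

text \<open>Each relation is homogeneous for the weight given by the column indices.\<close>

lemma K_rel: "\<exists>c. K a (rel1 i j k) = scal c * rel1 i j k"
  "\<exists>c. K a (rel2 k i j) = scal c * rel2 k i j"
  "\<exists>c. K a (rel3 i j k l) = scal c * rel3 i j k l"
  "\<exists>c. K a (rel4 i j k l) = scal c * rel4 i j k l"
proof -
  let ?w = "\<lambda>k l. s powi (pairing n a (eps k) + pairing n a (eps l))"
  have "scal c * (x - scal d * y) = scal c * x - scal d * (scal c * y)"
    and "scal c * (x - y - scal d * z) = scal c * x - scal c * y - scal d * (scal c * z)"
    for c d and x y z :: "(nat \<times> nat) free_alg"
    by (simp_all add: algebra_simps scal_mult_left)
  note * = this
  have "K a (rel1 i j k) = scal (?w k k) * rel1 i j k"
    by (simp add: rel1_def opr_lin K_word *)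
  moreover have "K a (rel2 k i j) = scal (?w i j) * rel2 k i j"
    by (simp add: rel2_def opr_lin K_word * add.commute)
  moreover have "K a (rel3 i j k l) = scal (?w k l) * rel3 i j k l"
  proof -
    have "K a (rel3 i j k l) = scal (?w k l) * word [(i, l), (j, k)] - scal (?w k l) * word [(j, k), (i, l)]"
      by (simp add: rel3_def opr_lin K_word add.commute)
    then show ?thesis
      unfolding rel3_def by (simp only: right_diff_distrib)
  qed
  moreover have "K a (rel4 i j k l) = scal (?w k l) * rel4 i j k l"
  proof -
    have "K a (rel4 i j k l) = scal (?w k l) * word [(i, k), (j, l)] - scal (?w k l) * word [(j, l), (i, k)]
      - scal (q - 1 / q) * (scal (?w k l) * word [(i, l), (j, k)])"
      by (simp add: rel4_def opr_lin K_word add.commute)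
    then show ?thesis
      unfolding rel4_def by (simp only: *(2))
  qed
  ultimately show "\<exists>c. K a (rel1 i j k) = scal c * rel1 i j k"
    "\<exists>c. K a (rel2 k i j) = scal c * rel2 k i j"
    "\<exists>c. K a (rel3 i j k l) = scal c * rel3 i j k l"
    "\<exists>c. K a (rel4 i j k l) = scal c * rel4 i j k l" by blast+
qed

lemma opr_aq_relations:
  assumes "r \<in> aq_relations n q" "g \<in> uq_gens n"
  shows "opr g r \<in> aq_ideal n q"
proof (cases g)
  case (GenQ a)
  have "\<exists>c. K a r = scal c * r"
    using assms(1) by (cases rule: aq_relations_cases) (use K_rel in auto)
  then show ?thesis
    using GenQ subsetD[OF aq_relations_ideal assms(1)] by (auto intro: aq_ideal_scal)
next
  case (GenE m)
  then have m: "m \<in> {1..<n}" using assms(2) by simp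
  have "E m r \<in> aq_ideal n q"
    using assms(1) by (cases rule: aq_relations_cases)
      (use m in \<open>auto simp: E_rel1 E_rel2 E_rel3 E_rel4 intro!: aq_ideal_0 aq_ideal_add aq_ideal_scal rel_mem\<close>)
  then show ?thesis using GenE by simp
next
  case (GenF m)
  then have m: "m \<in> {1..<n}" using assms(2) by simp
  have "F m r \<in> aq_ideal n q"
    using assms(1) by (cases rule: aq_relations_cases)
      (use m in \<open>auto simp: F_rel1 F_rel2 F_rel3 F_rel4 intro!: aq_ideal_0 aq_ideal_add aq_ideal_scal rel_mem\<close>)
  then show ?thesis using GenF by simp
qed

text \<open>The elements of the ideal that every generator keeps in the ideal form an ideal
  themselves, by the coproduct rules. All generators are treated together because the rules for e_k
  and f_k involve q^lambda.\<close>

lemma opr_aq_ideal: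
  assumes "p \<in> aq_ideal n q" "g \<in> uq_gens n"
  shows "opr g p \<in> aq_ideal n q"
proof -
  let ?I = "aq_ideal n q"
  let ?J = "{p \<in> ?I. \<forall>g\<in>uq_gens n. opr g p \<in> ?I}"
  have closed: "opr g (x * y) \<in> ?I"
    if "x \<in> ?J \<and> y \<in> carrier (aq_free n) \<or> y \<in> ?J \<and> x \<in> carrier (aq_free n)" "g \<in> uq_gens n" for g x y
  proof (cases g)
    case (GenQ a)
    then show ?thesis using that opr_aq_carrier[of _ g]
      by (auto simp: K_mult intro: aq_ideal_mult_left aq_ideal_mult_right)
  next
    case (GenE k)
    then have "k \<in> {1..<n}" using that by simp
    then have "GenQ (root k) \<in> uq_gens n" "GenQ (\<lambda>i. - root k i) \<in> uq_gens n"
      using doubled_lattice_intros by auto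
    then show ?thesis using GenE that opr_aq_carrier
      by (auto simp: E_mult intro!: aq_ideal_add intro: aq_ideal_mult_left aq_ideal_mult_right)
  next
    case (GenF k)
    then have "k \<in> {1..<n}" using that by simp
    then have "GenQ (root k) \<in> uq_gens n" "GenQ (\<lambda>i. - root k i) \<in> uq_gens n"
      using doubled_lattice_intros by auto
    then show ?thesis using GenF that opr_aq_carrier
      by (auto simp: F_mult intro!: aq_ideal_add intro: aq_ideal_mult_left aq_ideal_mult_right)
  qed
  have "ideal ?J (aq_free n)"
    unfolding aq_free_def
  proof (rule free_algebra_idealI)
    show "?J \<subseteq> carrier (free_algebra letters_n)"
      using aq_ideal_carrier by (auto simp: aq_free_def)
    fix x y assume "x \<in> ?J" "y \<in> carrier (free_algebra letters_n)"
    then show "x * y \<in> ?J" "y * x \<in> ?J"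
      using closed[of x y] closed[of y x]
      by (auto simp: aq_free_def intro: aq_ideal_mult_left aq_ideal_mult_right)
  qed (auto simp: opr_lin aq_ideal_0 aq_ideal_add)
  then have "?I \<subseteq> ?J"
    unfolding aq_ideal_def aq_free_def
    by (rule ring.genideal_minimal[OF ring_free_algebra])
      (use aq_relations_ideal opr_aq_relations in \<open>auto simp: aq_ideal_def aq_free_def\<close>)
  then show ?thesis using assms by blast
qed

end

section \<open>Singular vectors\<close>

context quantum_gl
begin

lemma scal_mult_scal: "(scal c * p) * (scal d * r) = scal (c * d) * (p * r :: 'g free_alg)"
proof -
  have "(scal c * p) * (scal d * r) = scal c * ((p * scal d) * r)"
    by (simp only: mult.assoc)
  also have "\<dots> = scal c * (scal d * (p * r))"
    by (simp only: scal_commute[of p] mult.assoc)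
  finally show ?thesis
    by (simp add: scal_mult_left)
qed

lemma form_gen_mult: "form (gen x * p) (gen y * r) = (if x = y then form p r else 0)"
proof (induction p rule: free_alg_induct)
  case (word c v)
  show ?case
  proof (induction r rule: free_alg_induct)
    case (word d w)
    have "gen x * (scal c * word v) = scal c * word (x # v)" "gen y * (scal d * word w) = scal d * word (y # w)"
      by (simp_all add: scal_mult_right word_mult)
    then show ?case by (simp add: form_simps form_word_word)
  qed (auto simp: distrib_left form_simps)
qed (auto simp: distrib_left form_simps)

lemma form_mult_gen: "form (p * gen x) (r * gen y) = (if x = y then form p r else 0)"
proof (induction p rule: free_alg_induct)
  case (word c v)
  show ?case
  proof (induction r rule: free_alg_induct)
    case (word d w)
    then show ?case by (simp add: mult.assoc form_simps form_word_word word_mult)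
  qed (auto simp: distrib_right form_simps)
qed (auto simp: distrib_right form_simps)

lemma form_gen_mult_1: "form (gen x * p) 1 = 0"
  by (induction p rule: free_alg_induct)
    (auto simp: distrib_left form_simps scal_mult_right word_mult form_word_word simp flip: word_Nil)

lemma bilinear_eq_words:
  fixes f g :: "'a free_alg \<Rightarrow> 'b free_alg \<Rightarrow> complex"
  assumes "\<And>p p' r. f (p + p') r = f p r + f p' r" "\<And>c p r. f (scal c * p) r = c * f p r"
    "\<And>p r r'. f p (r + r') = f p r + f p r'" "\<And>c p r. f p (scal c * r) = c * f p r"
    "\<And>p p' r. g (p + p') r = g p r + g p' r" "\<And>c p r. g (scal c * p) r = c * g p r"
    "\<And>p r r'. g p (r + r') = g p r + g p r'" "\<And>c p r. g p (scal c * r) = c * g p r"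
    and "\<And>v w. f (word v) (word w) = g (word v) (word w)"
  shows "f p r = g p r"
proof (induction p rule: free_alg_induct)
  case zero
  show ?case using assms(2)[of 0 0 r] assms(6)[of 0 0 r] by simp
next
  case (word c v)
  have "f (word v) r = g (word v) r"
  proof (induction r rule: free_alg_induct)
    case zero
    show ?case using assms(4)[of "word v" 0 0] assms(8)[of "word v" 0 0] by simp
  qed (use assms in auto)
  then show ?case using assms by simp
qed (use assms in auto)

lemma form_K: "form (K a p) r = form p (K a r)"
  by (rule bilinear_eq_words[of "\<lambda>p r. form (K a p) r" "\<lambda>p r. form p (K a r)"])
    (auto simp: form_simps opr_lin K_word form_word_word)

text \<open>The operators E_k and F_k have the same coproduct and the q^lambda are self-adjoint, so
  the claim descends along the first letters; on one letter the two operators are transposed matrix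
  units.\<close>

lemma form_E:
  assumes "k \<in> {1..<n}"
  shows "form (E k p) r = form p (F k r)"
proof (rule bilinear_eq_words[of "\<lambda>p r. form (E k p) r" "\<lambda>p r. form p (F k r)"])
  fix xs ys :: "(nat \<times> nat) list"
  show "form (E k (word xs)) (word ys) = form (word xs) (F k (word ys))"
  proof (induction xs arbitrary: ys)
    case Nil
    show ?case
    proof (cases ys)
      case (Cons y ys')
      have "word ys = gen y * word ys'" using Cons by (simp add: word_mult)
      then show ?thesis
        using assms by (auto simp: word_Nil F_mult F_gen Kp_gen form_simps mult.assoc
            form_sym[of 1] form_gen_mult_1)
    qed (simp add: word_Nil)
  next
    case (Cons x xs)
    have x: "word (x # xs) = gen x * word xs" by (simp add: word_mult)
    show ?case
    proof (cases ys)
      case Nil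
      then show ?thesis
        unfolding x using assms by (auto simp: word_Nil E_mult E_gen Kp_gen form_simps mult.assoc form_gen_mult_1)
    next
      case (Cons y ys')
      then have y: "word ys = gen y * word ys'" by (simp add: word_mult)
      show ?thesis
        unfolding x y
        by (cases x; cases y) (use assms Cons.IH in \<open>auto simp: E_mult F_mult E_gen F_gen Kp_gen form_simps
            mult.assoc form_gen_mult form_K\<close>)
    qed
  qed
qed (auto simp: form_simps opr_lin)

lemma form_F: "k \<in> {1..<n} \<Longrightarrow> form (F k p) r = form p (E k r)"
  using form_E[of k r p] by (simp add: form_sym)

subsection \<open>Quantum integers\<close>

text \<open>The hypothesis on q in the form used later: s^k = 1 with k > 0 would give q^k = 1. Hence
  distinct integral weights have distinct eigenvalues and quantum integers of nonzero argument do
  not vanish.\<close>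

lemma s_powi_inj: "s powi a = s powi b \<longleftrightarrow> a = b"
proof
  assume eq: "s powi a = s powi b"
  have pos: "s powi int k \<noteq> 1" if "k > 0" for k
  proof
    assume "s powi int k = 1"
    then have "q ^ k = 1" by (simp add: s_sq[symmetric] flip: power_mult) (simp add: mult.commute power_mult)
    then show False using q_not_root that by blast
  qed
  have *: "s powi (a - b) = 1" "s powi (b - a) = 1"
    using eq by (simp_all add: power_int_diff)
  show "a = b"
  proof (rule ccontr)
    assume "a \<noteq> b"
    then consider "a - b = int (nat (a - b))" "nat (a - b) > 0" | "b - a = int (nat (b - a))" "nat (b - a) > 0"
      by linarith
    then show False using * pos by (metis)
  qed
qed simp

lemma q_powi: "q powi a = s powi (2 * a)"
  by (simp add: s_sq[symmetric] power_int_mult)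

definition qn :: "int \<Rightarrow> complex" where
  "qn a = (q powi a - q powi (- a)) / (q - 1 / q)"

lemma qn_0 [simp]: "qn 0 = 0"
  by (simp add: qn_def)

lemma qn_1 [simp]: "qn 1 = 1"
  using q_diff_nz by (simp add: qn_def power_int_minus divide_inverse)

lemma qn_minus: "qn (- a) = - qn a"
  by (simp add: qn_def divide_inverse algebra_simps)

lemma qn_nz: "a \<noteq> 0 \<Longrightarrow> qn a \<noteq> 0"
  using q_diff_nz by (simp add: qn_def q_powi s_powi_inj)

text \<open>Divided by [a], this is the identity that makes the sum in the norm computation
  telescope.\<close>

lemma qn_add_1: "qn (a + 1) = inverse q * qn a + q powi a"
proof -
  have "q powi (a + 1) = q * q powi a" "q powi (- (a + 1)) = inverse q * q powi - a"
    using q_nz by (simp_all add: power_int_add power_int_diff divide_inverse mult.commute)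
  moreover have "q * q powi a - inverse q * q powi - a
      = inverse q * (q powi a - q powi - a) + q powi a * (q - 1 / q)"
    using q_nz by (simp add: field_simps)
  ultimately show ?thesis
    using q_diff_nz unfolding qn_def by (simp add: add_divide_distrib)
qed

text \<open>Merges the two terms in the recursion of the lowering operators into a single quantum
  integer.\<close>

lemma qn_mult: "qn (a + 1) * qn (b + 1) - qn a * qn b = qn (a + b + 1)"
proof -
  define A B where "A = q powi a" and "B = q powi b"
  have nz: "A \<noteq> 0" "B \<noteq> 0" using q_nz by (simp_all add: A_def B_def)
  have "q powi (a + 1) = q * A" "q powi - (a + 1) = 1 / (q * A)" "q powi (b + 1) = q * B"
    "q powi - (b + 1) = 1 / (q * B)" "q powi - a = 1 / A" "q powi - b = 1 / B"
    "q powi (a + b + 1) = q * A * B" "q powi - (a + b + 1) = 1 / (q * A * B)"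
    using q_nz by (simp_all add: A_def B_def power_int_add power_int_diff power_int_minus divide_inverse mult.commute)
  note pw = this
  have "(q * A - 1 / (q * A)) * (q * B - 1 / (q * B)) - (A - 1 / A) * (B - 1 / B)
      = (q * A * B - 1 / (q * A * B)) * (q - 1 / q)"
    using nz q_nz by (simp add: field_simps)
  then show ?thesis
    using q_diff_nz unfolding qn_def pw A_def[symmetric] B_def[symmetric]
    by (simp add: divide_simps)
qed

subsection \<open>Weights\<close>

text \<open>Weights are functions on all naturals, but \<open>pairing\<close> sees only {1..n}, so a
  weight is determined up to its values elsewhere. The zero vector has every weight.\<close>

definition isw :: "(nat \<Rightarrow> int) \<Rightarrow> (nat \<times> nat) free_alg \<Rightarrow> bool" where
  "isw mu p \<longleftrightarrow> (\<forall>a. K a p = scal (s powi pairing n a mu) * p)"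

lemma pairing_add_right: "pairing n a (\<lambda>i. b i + c i) = pairing n a b + pairing n a c"
  by (simp add: pairing_def sum.distrib algebra_simps)

lemma pairing_root_left:
  assumes "k \<in> {1..<n}"
  shows "pairing n (root k) mu = mu k - mu (k + 1)"
proof -
  have "pairing n (root k) mu = (\<Sum>i=1..n. if i = k then mu k else 0) - (\<Sum>i=1..n. if i = k + 1 then mu (k + 1) else 0)"
    unfolding pairing_def sum_subtractf[symmetric] by (rule sum.cong) (auto simp: root_def eps_def)
  then show ?thesis using assms by simp
qed

lemma pairing_cong: "(\<And>i. i \<in> {1..n} \<Longrightarrow> b i = c i) \<Longrightarrow> pairing n a b = pairing n a c"
  by (auto simp: pairing_def intro!: sum.cong)

lemma isw_cong: "isw mu p \<Longrightarrow> (\<And>i. i \<in> {1..n} \<Longrightarrow> mu i = nu i) \<Longrightarrow> isw nu p"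
  using pairing_cong[of mu nu] by (simp add: isw_def)

lemma isw_0: "isw mu 0"
  by (simp add: isw_def opr_lin)

lemma isw_add: "isw mu p \<Longrightarrow> isw mu r \<Longrightarrow> isw mu (p + r)"
  by (simp add: isw_def opr_lin distrib_left)

lemma isw_scal: "isw mu p \<Longrightarrow> isw mu (scal c * p)"
  by (simp add: isw_def opr_lin scal_mult_left mult.commute)

lemma isw_diff: "isw mu p \<Longrightarrow> isw mu r \<Longrightarrow> isw mu (p - r)"
  by (simp add: isw_def opr_lin right_diff_distrib)

lemma isw_sum: "(\<And>i. i \<in> I \<Longrightarrow> isw mu (f i)) \<Longrightarrow> isw mu (sum f I)"
  by (induction I rule: infinite_finite_induct) (auto intro: isw_0 isw_add)

lemma isw_E: "isw mu p \<Longrightarrow> isw (\<lambda>i. mu i + root k i) (E k p)"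
  by (simp add: isw_def K_E opr_lin scal_mult_left pairing_add_right power_int_add mult.commute)

lemma isw_F: "isw mu p \<Longrightarrow> isw (\<lambda>i. mu i - root k i) (F k p)"
  by (simp add: isw_def K_F opr_lin scal_mult_left pairing_diff_right power_int_diff power_int_minus
      divide_inverse mult.commute)

lemma isw_mult_gen:
  assumes "isw mu p"
  shows "isw (\<lambda>i. mu i + eps (snd x) i) (p * gen x)"
  using assms
  by (simp add: isw_def K_mult K_gen pairing_add_right power_int_add scal_mult_scal)

text \<open>The operator K of \<open>eps i\<close> is self-adjoint and has the distinct eigenvalues
  s^(mu i) and s^(nu i) on the two vectors.\<close>

lemma isw_orth:
  assumes "isw mu p" "isw nu r" "i \<in> {1..n}" "mu i \<noteq> nu i"
  shows "form p r = 0"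
proof -
  have pe: "pairing n (eps i) b = b i" for b
  proof -
    have "pairing n (eps i) b = (\<Sum>j=1..n. if j = i then b i else 0)"
      unfolding pairing_def by (rule sum.cong) (auto simp: eps_def)
    then show ?thesis using assms(3) by simp
  qed
  have "form (K (eps i) p) r = form p (K (eps i) r)" by (rule form_K)
  then have "s powi mu i * form p r = s powi nu i * form p r"
    using assms(1,2) by (simp add: isw_def pe form_simps)
  then show ?thesis using assms(4) by (simp add: s_powi_inj)
qed

text \<open>The sl_2 relation behind all later computations: on a weight vector the torus part of
  the commutator is a quantum integer.\<close>

lemma comm_EF_weight:
  assumes "isw mu p" "k \<in> {1..<n}"
  shows "E k (F k p) = F k (E k p) + scal (qn (mu k - mu (k + 1))) * p"
proof -
  let ?h = "mu k - mu (k + 1)"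
  have Kp: "Kp k p = scal (s powi ?h) * p" and Km: "Km k p = scal (s powi - ?h) * p"
    using assms by (auto simp: isw_def pairing_uminus pairing_root_left)
  have "E k (F k p) - F k (E k p) = scal (1 / (q - 1 / q)) * (Kp k (Kp k p) - Km k (Km k p))"
    using comm_EF[OF assms(2,2), of p] by simp
  also have "\<dots> = scal (1 / (q - 1 / q)) * ((scal (s powi (2 * ?h)) - scal (s powi (2 * - ?h))) * p)"
    by (simp add: Kp Km opr_lin scal_mult_left left_diff_distrib flip: power_int_add)
  also have "\<dots> = scal (qn ?h) * p"
    unfolding scal_diff[symmetric] scal_mult_left qn_def q_powi by simp
  finally show ?thesis by (simp add: algebra_simps)
qed

lemma comm_EF_neq:
  assumes "i \<noteq> k" "i \<in> {1..<n}" "k \<in> {1..<n}"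
  shows "E i (F k p) = F k (E i p)"
  using comm_EF[OF assms(2,3), of p] assms(1) by simp

lemma F_F_commute':
  assumes "i \<in> {1..<n}" "j \<in> {1..<n}" "i + 1 < j \<or> j + 1 < i"
  shows "F i (F j p) = F j (F i p)"
  using F_F_commute[OF assms(1,2)] F_F_commute[OF assms(2,1)] assms(3) by metis

subsection \<open>Lowering operators\<close>

text \<open>A noncommutative polynomial in F_(j-d), ..., F_(j-1) that lowers the weight by eps (j-d)
  - eps j, with coefficients chosen so that the intermediate E's kill the result on a singular
  vector. The numbers L are a parameter and not computed from the weight, because the recursion
  applies the same operator to a vector of different weight.\<close>

primrec low :: "nat \<Rightarrow> (nat \<Rightarrow> int) \<Rightarrow> nat \<Rightarrow> (nat \<times> nat) free_alg \<Rightarrow> (nat \<times> nat) free_alg" where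
  "low j L 0 p = p"
| "low j L (Suc d) p = scal (qn (L (j - d) + 1)) * F (j - Suc d) (low j L d p)
     - scal (qn (L (j - d))) * low j L d (F (j - Suc d) p)"

lemma lin_low: "lin (low j L d)"
proof (induction d)
  case (Suc d)
  show ?case
    unfolding low.simps[abs_def]
    by (intro lin_intros lin_opr_compose Suc lin_compose[OF Suc lin_opr])
qed (auto simp: low.simps[abs_def] intro: lin_ident)

lemmas low_lin = lin_simps[OF lin_low]

text \<open>Only F_(j-d), ..., F_(j-1) occur in the operator, and the index i is none of
  these.\<close>

lemma E_low:
  assumes "j \<le> n" "d < j" "i \<in> {1..<n}" "i < j - d \<or> j \<le> i"
  shows "E i (low j L d p) = low j L d (E i p)"
  using assms
proof (induction d arbitrary: p)
  case (Suc d)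
  then have "i \<noteq> j - Suc d" "j - Suc d \<in> {1..<n}" by auto
  then have "E i (F (j - Suc d) p) = F (j - Suc d) (E i p)" for p
    using comm_EF_neq Suc.prems by blast
  moreover have "i < j - d \<or> j \<le> i"
    using Suc.prems by linarith
  then have "E i (low j L d p) = low j L d (E i p)" for p
    using Suc.prems by (intro Suc.IH) auto
  ultimately show ?case by (simp add: opr_lin low_lin)
qed simp

lemma F_low:
  assumes "j \<le> n" "d < j" "i \<in> {1..<n}" "i + 1 < j - d"
  shows "F i (low j L d p) = low j L d (F i p)"
  using assms
proof (induction d arbitrary: p)
  case (Suc d)
  then have "i + 1 < j - Suc d" "j - Suc d \<in> {1..<n}" by auto
  then have "F i (F (j - Suc d) p) = F (j - Suc d) (F i p)" for p
    using F_F_commute' Suc.prems by blast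
  moreover have "i + 1 < j - d"
    using Suc.prems by linarith
  then have "F i (low j L d p) = low j L d (F i p)" for p
    using Suc.prems by (intro Suc.IH) auto
  ultimately show ?case by (simp add: opr_lin low_lin)
qed simp

lemma isw_low:
  assumes "isw mu p" "j \<le> n" "d < j"
  shows "isw (\<lambda>i. mu i - eps (j - d) i + eps j i) (low j L d p)"
  using assms
proof (induction d arbitrary: p mu)
  case (Suc d)
  let ?k = "j - Suc d"
  have k: "Suc ?k = j - d" using Suc.prems by simp
  have "isw (\<lambda>i. mu i - eps (j - d) i + eps j i) (low j L d p)"
    using Suc by simp
  then have 1: "isw (\<lambda>i. mu i - eps ?k i + eps j i) (F ?k (low j L d p))"
    by (rule isw_cong[OF isw_F]) (simp add: root_def k)
  have "isw (\<lambda>i. mu i - root ?k i) (F ?k p)"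
    using Suc.prems isw_F by blast
  then have "isw (\<lambda>i. mu i - root ?k i - eps (j - d) i + eps j i) (low j L d (F ?k p))"
    using Suc.IH[of "\<lambda>i. mu i - root ?k i" "F ?k p"] Suc.prems by simp
  then have 2: "isw (\<lambda>i. mu i - eps ?k i + eps j i) (low j L d (F ?k p))"
    by (rule isw_cong) (auto simp: root_def k)
  show ?case using 1 2 by (auto intro: isw_diff isw_scal)
qed simp

text \<open>For a partition mu this is the axial distance between the last box of row i and the box
  to be added in row j: the content mu i - i minus the content mu j + 1 - j. At i = j it equals
  -1.\<close>

definition shifted_diff :: "nat \<Rightarrow> (nat \<Rightarrow> int) \<Rightarrow> nat \<Rightarrow> int" where
  "shifted_diff j mu i = mu i - mu j + int j - int i - 1"

text \<open>The two claims feed each other in the induction. Only E_(j-d), ..., E_(j-1) are assumed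
  to kill v because the induction hypothesis is also applied to F_k v, which E_k need not
  kill.\<close>

lemma E_low_singular:
  assumes "isw mu v" "j \<le> n" "d < j" "\<And>i. i \<in> {j - d..<j} \<Longrightarrow> E i v = 0"
    and "\<And>i. i \<in> {j - d<..j} \<Longrightarrow> L i = shifted_diff j mu i"
  shows "(\<forall>i\<in>{j - d<..<j}. E i (low j L d v) = 0) \<and>
    (\<forall>d'. d = Suc d' \<longrightarrow> E (j - d) (low j L d v) = scal (qn (shifted_diff j mu (j - d))) * low j L d' v)"
  using assms
proof (induction d arbitrary: v mu)
  case (Suc d)
  define k where "k = j - Suc d"
  have k: "k + 1 = j - d" "k \<in> {1..<n}" "k < j" using Suc.prems by (auto simp: k_def)
  have Ev: "E i v = 0" if "i \<in> {k..<j}" for i using Suc.prems that by (simp add: k_def)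
  have L: "L i = shifted_diff j mu i" if "i \<in> {k<..j}" for i using Suc.prems that by (simp add: k_def)
  have low: "low j L (Suc d) v = scal (qn (L (k + 1) + 1)) * F k (low j L d v)
     - scal (qn (L (k + 1))) * low j L d (F k v)"
    by (simp add: k_def k(1)[unfolded k_def, simplified])
  have comm: "E i (F k p) = F k (E i p)" if "i \<in> {k<..<j}" for i p
    using comm_EF_neq[of i k] that k Suc.prems by auto
  show ?case
  proof (cases d)
    case 0
    then have "k + 1 = j" using k by simp
    \<comment> \<open>The value at the end of the range: the coefficients [L j + 1] and -[L j]
      become 0 and 1, so that the first lowering operator is just F_(j-1).\<close>
    moreover have "L j = - 1" using L[of j] k by (simp add: shifted_diff_def)
    ultimately have "low j L (Suc d) v = F k v"
      using low 0 by (simp add: qn_minus scal_uminus)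
    moreover have "E k (F k v) = scal (qn (shifted_diff j mu k)) * v"
      using comm_EF_weight[OF Suc.prems(1) k(2)] Ev[of k] k \<open>k + 1 = j\<close>
      by (auto simp: opr_lin shifted_diff_def)
    moreover have "{j - Suc d<..<j} = {}" using 0 by auto
    ultimately show ?thesis using 0 by (simp add: k_def)
  next
    case (Suc d')
    have kj: "k + 1 < j" "k + 1 + 1 = j - d'" using k Suc \<open>Suc d < j\<close> by auto
    have "(\<forall>i\<in>{k + 1<..<j}. E i (low j L d v) = 0) \<and>
        (\<forall>d'. d = Suc d' \<longrightarrow> E (k + 1) (low j L d v) = scal (qn (shifted_diff j mu (k + 1))) * low j L d' v)"
      unfolding k(1) by (rule Suc.IH) (use Suc.prems(1-3) Ev L k in auto)
    then have E1: "\<And>i. i \<in> {k + 1<..<j} \<Longrightarrow> E i (low j L d v) = 0"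
      and E2: "E (k + 1) (low j L d v) = scal (qn (L (k + 1))) * low j L d' v"
      using L[of "k + 1"] kj Suc by auto
    let ?mu' = "\<lambda>i. mu i - root k i"
    have Fv: "isw ?mu' (F k v)" "\<And>i. i \<in> {k<..<j} \<Longrightarrow> E i (F k v) = 0"
      using isw_F[OF Suc.prems(1)] comm Ev by (auto simp: opr_lin)
    have L': "L i = shifted_diff j ?mu' i" if "i \<in> {k + 1<..j}" for i
      using L that kj by (auto simp: shifted_diff_def root_def eps_def)
    \<comment> \<open>Subtracting the root raises coordinate k + 1 by one. The entries of L beyond k
      + 1 remain valid, and at k + 1 the axial distance exceeds L by one.\<close>
    have sd: "shifted_diff j ?mu' (k + 1) = L (k + 1) + 1"
      using L[of "k + 1"] kj by (auto simp: shifted_diff_def root_def eps_def)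
    have "(\<forall>i\<in>{k + 1<..<j}. E i (low j L d (F k v)) = 0) \<and>
        (\<forall>d'. d = Suc d' \<longrightarrow> E (k + 1) (low j L d (F k v))
          = scal (qn (shifted_diff j ?mu' (k + 1))) * low j L d' (F k v))"
      unfolding k(1) by (rule Suc.IH) (use Suc.prems(2,3) Fv L' k in auto)
    then have E3: "\<And>i. i \<in> {k + 1<..<j} \<Longrightarrow> E i (low j L d (F k v)) = 0"
      and E4: "E (k + 1) (low j L d (F k v)) = scal (qn (L (k + 1) + 1)) * low j L d' (F k v)"
      using sd Suc by auto
    have "E i (low j L (Suc d) v) = 0" if "i \<in> {k<..<j}" for i
    proof (cases "i = k + 1")
      case True
      \<comment> \<open>F_k commutes with the shorter operator, whose smallest index is k + 2; the
        two terms then carry [L + 1][L] and [L][L + 1] and cancel.\<close>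
      have "F k (low j L d' v) = low j L d' (F k v)"
        by (rule F_low) (use Suc.prems Suc kj k in auto)
      then show ?thesis
        using True that kj by (simp add: low opr_lin comm E2[simplified] E4[simplified] scal_mult_left mult.commute del: low.simps)
    next
      case False
      then show ?thesis
        using that by (simp add: low opr_lin comm E1 E3 del: low.simps)
    qed
    moreover have "E k (low j L (Suc d) v) = scal (qn (shifted_diff j mu k)) * low j L d v"
    proof -
      have E0: "E k (low j L d v) = 0"
        using E_low[of j d k L v] Suc.prems k Ev[of k] by (simp add: low_lin flip: k(1))
      have iw: "isw (\<lambda>i. mu i - eps (k + 1) i + eps j i) (low j L d v)"
        using isw_low[OF Suc.prems(1,2), of d L] Suc.prems by (simp flip: k(1))
      have h: "mu k - eps (k + 1) k + eps j k - (mu (k + 1) - eps (k + 1) (k + 1) + eps j (k + 1))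
          = mu k - mu (k + 1) + 1"
        using kj by (simp add: eps_def)
      \<comment> \<open>The shorter lowering operator has removed one unit from coordinate k + 1, so
        the eigenvalue here is one step above the one for F_k v. This sets up the identity for
        [a + 1][b + 1] - [a][b].\<close>
      have "E k (F k (low j L d v)) = scal (qn (mu k - mu (k + 1) + 1)) * low j L d v"
        using comm_EF_weight[OF iw k(2)] unfolding h E0 by (simp add: opr_lin)
      moreover have "E k (low j L d (F k v)) = low j L d (E k (F k v))"
        using E_low[of j d k L] Suc.prems k by (simp flip: k(1))
      moreover have "E k (F k v) = scal (qn (mu k - mu (k + 1))) * v"
        using comm_EF_weight[OF Suc.prems(1) k(2)] Ev[of k] k by (simp add: opr_lin)
      ultimately have "E k (low j L (Suc d) v) =
        (scal (qn (L (k + 1) + 1) * qn (mu k - mu (k + 1) + 1)) - scal (qn (L (k + 1)) * qn (mu k - mu (k + 1))))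
         * low j L d v"
        by (simp add: low opr_lin low_lin scal_mult_left left_diff_distrib del: low.simps)
      also have "\<dots> = scal (qn (L (k + 1) + (mu k - mu (k + 1)) + 1)) * low j L d v"
        by (simp only: qn_mult flip: scal_diff)
      also have "L (k + 1) + (mu k - mu (k + 1)) + 1 = shifted_diff j mu k"
        using L[of "k + 1"] kj by (simp add: shifted_diff_def)
      finally show ?thesis .
    qed
    ultimately show ?thesis by (simp add: k_def del: low.simps)
  qed
qed simp

text \<open>Every monomial in the operator has some F_i with i in {j - d..<j} as its leftmost
  factor, and the adjoint E_i kills y.\<close>

lemma form_low:
  assumes "j \<le> n" "d < j" "0 < d" "\<And>i. i \<in> {j - d..<j} \<Longrightarrow> E i y = 0"
  shows "form y (low j L d u) = 0"
  using assms
proof (induction d arbitrary: u)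
  case (Suc d)
  have k: "j - Suc d \<in> {1..<n}" "j - Suc d < j" using Suc.prems by auto
  have F: "form y (F (j - Suc d) p) = 0" for p
    using form_E[OF k(1), of y p] Suc.prems(4)[of "j - Suc d"] k by simp
  have "form y (low j L d (F (j - Suc d) u)) = 0"
  proof (cases d)
    case 0
    then show ?thesis using F by simp
  next
    case (Suc d')
    then show ?thesis using Suc.prems by (intro Suc.IH) auto
  qed
  then show ?case by (simp add: form_simps F)
qed simp

end

section \<open>The tensor powers of the vector representation\<close>

context quantum_gl
begin

text \<open>The row index of each letter only marks its position; the column indices run through the
  basis of the m-fold tensor power.\<close>

definition tw :: "nat \<Rightarrow> (nat \<times> nat) list set" where
  "tw m = {xs. map fst xs = [1..<Suc m] \<and> set (map snd xs) \<subseteq> {1..n}}"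

abbreviation "T m \<equiv> supp_in (tw m)"

lemma tw_0: "tw 0 = {[]}"
  by (auto simp: tw_def)

lemma tw_Suc: "ws \<in> tw (Suc m) \<longleftrightarrow> (\<exists>vs k. ws = vs @ [(Suc m, k)] \<and> vs \<in> tw m \<and> k \<in> {1..n})"
proof (cases ws rule: rev_cases)
  case Nil
  then show ?thesis by (auto simp: tw_def)
next
  case (snoc vs x)
  then show ?thesis by (cases x) (auto simp: tw_def)
qed

lemma tw_update: "xs \<in> tw m \<Longrightarrow> l < length xs \<Longrightarrow> b \<in> {1..n} \<Longrightarrow> xs[l := (fst (xs ! l), b)] \<in> tw m"
proof -
  assume a: "xs \<in> tw m" "l < length xs" "b \<in> {1..n}"
  have "map fst (xs[l := (fst (xs ! l), b)]) = map fst xs"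
    by (simp add: map_update) (metis a(2) list_update_id map_update nth_map)
  moreover have "set (map snd (xs[l := (fst (xs ! l), b)])) \<subseteq> {1..n}"
    using a by (auto simp: map_update tw_def dest!: set_update_subset_insert[THEN subsetD])
  ultimately show ?thesis using a by (simp add: tw_def)
qed

lemma opr_T: "g \<in> uq_gens n \<Longrightarrow> p \<in> T m \<Longrightarrow> opr g p \<in> T m"
  by (rule opr_supp_in) (auto intro: tw_update)

lemma E_T: "k \<in> {1..<n} \<Longrightarrow> p \<in> T m \<Longrightarrow> E k p \<in> T m"
  and F_T: "k \<in> {1..<n} \<Longrightarrow> p \<in> T m \<Longrightarrow> F k p \<in> T m"
  by (auto intro: opr_T)

lemma mult_gen_T: "p \<in> T m \<Longrightarrow> k \<in> {1..n} \<Longrightarrow> p * gen (Suc m, k) \<in> T (Suc m)"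
  by (rule lin_supp_in[of "\<lambda>p. p * gen (Suc m, k)"])
    (auto intro!: lin_intros simp: word_mult tw_Suc)

lemma T_Suc_induct [consumes 1, case_names zero add mult]:
  assumes "p \<in> T (Suc m)" "P 0" "\<And>x y. x \<in> T (Suc m) \<Longrightarrow> y \<in> T (Suc m) \<Longrightarrow> P x \<Longrightarrow> P y \<Longrightarrow> P (x + y)"
    and "\<And>y k. y \<in> T m \<Longrightarrow> k \<in> {1..n} \<Longrightarrow> P (y * gen (Suc m, k))"
  shows "P p"
  using assms(1)
proof (induction rule: supp_in_induct)
  case (word c ws)
  then obtain vs k where "ws = vs @ [(Suc m, k)]" "vs \<in> tw m" "k \<in> {1..n}"
    by (auto simp: tw_Suc)
  then show ?case
    using assms(4)[of "scal c * word vs" k] by (auto simp: supp_in_scal mult.assoc word_mult)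
qed (use assms in auto)

section \<open>Coordinates with respect to the last tensor factor\<close>

definition coef :: "nat \<Rightarrow> nat \<Rightarrow> (nat \<times> nat) free_alg \<Rightarrow> (nat \<times> nat) free_alg" where
  "coef m k = lin_ext (\<lambda>ws. if ws \<noteq> [] \<and> last ws = (Suc m, k) then word (butlast ws) else 0)"

lemma lin_coef [simp]: "lin (coef m k)"
  by (simp add: coef_def)

lemmas coef_lin = lin_simps[OF lin_coef]

lemma coef_mult_gen: "coef m k (p * gen x) = (if x = (Suc m, k) then p else 0)"
proof (rule lin_eq[of "\<lambda>p. coef m k (p * gen x)" "\<lambda>p. if x = (Suc m, k) then p else 0"])
  show "lin (\<lambda>p. coef m k (p * gen x))"
    by (rule lin_compose[OF lin_coef]) (intro lin_intros)
  show "lin (\<lambda>p. if x = (Suc m, k) then p else 0)"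
    by (cases "x = (Suc m, k)") (auto intro: lin_intros)
qed (simp add: word_mult coef_def)

lemma coef_T: "x \<in> T (Suc m) \<Longrightarrow> coef m k x \<in> T m"
  by (induction rule: T_Suc_induct) (auto simp: coef_lin coef_mult_gen intro: supp_in_add)

lemma T_Suc_expand: "x \<in> T (Suc m) \<Longrightarrow> x = (\<Sum>k=1..n. coef m k x * gen (Suc m, k))"
proof (induction rule: T_Suc_induct)
  case (mult y k)
  then have "(\<Sum>i=1..n. coef m i (y * gen (Suc m, k)) * gen (Suc m, i))
      = (\<Sum>i=1..n. if i = k then y * gen (Suc m, k) else 0)"
    by (intro sum.cong) (auto simp: coef_mult_gen)
  then show ?case using mult by simp
qed (simp_all add: coef_lin distrib_right sum.distrib)

lemma T_Suc_eq_0: "x \<in> T (Suc m) \<Longrightarrow> (\<And>k. k \<in> {1..n} \<Longrightarrow> coef m k x = 0) \<Longrightarrow> x = 0"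
  by (subst T_Suc_expand) auto

lemma form_coef:
  assumes "x \<in> T (Suc m)" "y \<in> T (Suc m)"
  shows "form x y = (\<Sum>k=1..n. form (coef m k x) (coef m k y))"
proof -
  have "form x y = (\<Sum>k=1..n. \<Sum>l=1..n. form (coef m k x * gen (Suc m, k)) (coef m l y * gen (Suc m, l)))"
    by (subst T_Suc_expand[OF assms(1)], subst T_Suc_expand[OF assms(2)])
      (simp add: form_simps, rule sum.swap)
  also have "\<dots> = (\<Sum>k=1..n. \<Sum>l=1..n. if k = l then form (coef m k x) (coef m k y) else 0)"
    by (intro sum.cong) (auto simp: form_mult_gen)
  also have "\<dots> = (\<Sum>k=1..n. form (coef m k x) (coef m k y))"
    by simp
  finally show ?thesis .
qed

text \<open>The coproduct in coordinates: either E_i acts on the first m factors, with K^-1 on the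
  last letter, or it turns the last letter i + 1 into i, with K on the first m factors.\<close>

lemma coef_E:
  assumes "x \<in> T (Suc m)" "i \<in> {1..<n}" "k \<in> {1..n}"
  shows "coef m k (E i x) = scal (if k = i then 1 / s else if k = i + 1 then s else 1) * E i (coef m k x)
    + (if k = i then Kp i (coef m (i + 1) x) else 0)"
  using assms(1)
proof (induction rule: T_Suc_induct)
  case (mult y l)
  show ?case using assms(2,3)
    by (auto simp: E_mult Km_gen E_gen coef_lin coef_mult_gen opr_lin scal_mult_right)
qed (auto simp: coef_lin opr_lin distrib_left)

lemma coef_K:
  assumes "x \<in> T (Suc m)"
  shows "coef m k (K a x) = scal (s powi pairing n a (eps k)) * K a (coef m k x)"
  using assms(1)
proof (induction rule: T_Suc_induct)
  case (mult y l)
  then show ?case by (auto simp: K_mult K_gen coef_lin coef_mult_gen opr_lin scal_mult_right)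
qed (auto simp: coef_lin opr_lin distrib_left)

lemma isw_coef:
  assumes "isw mu x" "x \<in> T (Suc m)"
  shows "isw (\<lambda>i. mu i - eps k i) (coef m k x)"
  unfolding isw_def
proof
  fix a
  have "scal (s powi pairing n a mu) * coef m k x = scal (s powi pairing n a (eps k)) * K a (coef m k x)"
    using coef_K[OF assms(2), of k a] assms(1) by (simp add: isw_def coef_lin)
  then have "scal (s powi - pairing n a (eps k)) * (scal (s powi pairing n a mu) * coef m k x) = K a (coef m k x)"
    by (simp add: scal_mult_left flip: power_int_add)
  then show "K a (coef m k x) = scal (s powi pairing n a (\<lambda>i. mu i - eps k i)) * coef m k x"
    by (simp add: scal_mult_left pairing_diff_right add.commute flip: power_int_add)
qed

lemma scal_eq_0_iff: "scal c * p = 0 \<longleftrightarrow> c = 0 \<or> p = 0"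
proof
  assume *: "scal c * p = 0"
  have "p = 0" if "c \<noteq> 0"
    using arg_cong[OF *, of "\<lambda>x. scal (1 / c) * x"] that by (simp add: scal_mult_left)
  then show "c = 0 \<or> p = 0" by blast
qed auto

definition sing :: "nat \<Rightarrow> (nat \<times> nat) free_alg \<Rightarrow> bool" where
  "sing m p \<longleftrightarrow> p \<in> T m \<and> (\<forall>k\<in>{1..<n}. E k p = 0)"

text \<open>The factor that links consecutive coordinates of a singular vector of weight nu; it
  results from solving E_i x = 0 in coordinate i.\<close>

definition lead :: "(nat \<Rightarrow> int) \<Rightarrow> nat \<Rightarrow> complex" where
  "lead nu i = - (s powi (nu i - nu (i + 1) + 2))"

lemma lead_sq: "lead nu i * lead nu i = q powi (nu i - nu (i + 1) + 2)"
  by (simp add: lead_def q_powi algebra_simps flip: power_int_add)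

lemma sing_coef:
  assumes "sing (Suc m) x" "isw nu x" "i \<in> {1..<n}" "k \<in> {1..n}"
  shows "E i (coef m k x) = (if k = i then scal (lead nu i) * coef m (i + 1) x else 0)"
proof -
  have x: "x \<in> T (Suc m)" "E i x = 0" using assms by (auto simp: sing_def)
  have 0: "scal (if k = i then 1 / s else if k = i + 1 then s else 1) * E i (coef m k x)
    + (if k = i then Kp i (coef m (i + 1) x) else 0) = 0"
    using coef_E[OF x(1) assms(3,4)] x(2) by (simp add: coef_lin)
  show ?thesis
  proof (cases "k = i")
    case False
    then show ?thesis
      using 0 by (auto simp: scal_eq_0_iff split: if_splits)
  next
    case True
    \<comment> \<open>Coordinate i + 1 has weight nu - eps (i + 1), which pairs with the root to nu
      i - nu (i + 1) + 1; the other unit in \<open>lead\<close> comes from clearing the factor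
      1/s.\<close>
    have "Kp i (coef m (i + 1) x) = scal (s powi (nu i - nu (i + 1) + 1)) * coef m (i + 1) x"
      using isw_coef[OF assms(2) x(1), of "i + 1"] assms(3)
      by (simp add: isw_def pairing_root_left eps_def algebra_simps)
    then have "scal (1 / s) * E i (coef m k x) + scal (s powi (nu i - nu (i + 1) + 1)) * coef m (i + 1) x = 0"
      using 0 True by simp
    then have "scal s * (scal (1 / s) * E i (coef m k x) + scal (s powi (nu i - nu (i + 1) + 1)) * coef m (i + 1) x) = 0"
      by simp
    moreover have "s * s powi (nu i - nu (i + 1) + 1) = s powi (nu i - nu (i + 1) + 2)"
      by (simp add: power_int_add power2_eq_square)
    ultimately have "E i (coef m k x) + scal (s powi (nu i - nu (i + 1) + 2)) * coef m (i + 1) x = 0"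
      by (simp add: distrib_left scal_mult_left)
    then show ?thesis using True by (simp add: lead_def scal_uminus eq_neg_iff_add_eq_0)
  qed
qed

lemma low_T:
  assumes "j \<le> n" "d < j" "p \<in> T m"
  shows "low j L d p \<in> T m"
  using assms
proof (induction d arbitrary: p)
  case (Suc d)
  then have k: "j - Suc d \<in> {1..<n}" by auto
  have "low j L d p \<in> T m" "low j L d (F (j - Suc d) p) \<in> T m"
    using Suc.IH[of p] Suc.IH[OF _ _ F_T[OF k Suc.prems(3)]] Suc.prems by simp_all
  then show ?case
    unfolding low.simps by (intro supp_in_diff supp_in_scal F_T[OF k])
qed simp

text \<open>
  The new singular vector has leading term \<open>v \<otimes> e\<^sub>j\<close>, corrected by lowering operators. Pairing a
  singular vector of the same weight with it only sees the \<open>j\<close>-th coordinate, up to a product of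
  ratios of quantum integers; this is where \<open>q\<close> must not be a root of unity.
\<close>

lemma singular_step:
  assumes v: "sing m v" "isw mu v" and j: "j \<in> {1..n}"
    and pos: "\<And>i. i \<in> {1..<j} \<Longrightarrow> shifted_diff j mu i > 0"
  obtains z \<kappa> where "sing (Suc m) z" "isw (\<lambda>i. mu i + eps j i) z" "coef m j z = v"
    "\<And>k. k \<in> {j<..n} \<Longrightarrow> coef m k z = 0" "\<kappa> \<noteq> 0"
    "\<And>x. sing (Suc m) x \<Longrightarrow> isw (\<lambda>i. mu i + eps j i) x \<Longrightarrow> form x z = \<kappa> * form (coef m j x) v"
proof -
  define L where "L = shifted_diff j mu"
  define nu where "nu = (\<lambda>i. mu i + eps j i)"
  \<comment> \<open>Singularity of z forces c k [L k] = lead nu k c (k + 1), because E_k maps w k to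
    [L k] times w (k + 1). With c j = 1 this is the solution.\<close>
  define c where "c k = (\<Prod>i\<in>{k..<j}. lead nu i / qn (L i))" for k
  define w where "w k = low j L (j - k) v" for k
  define z where "z = (\<Sum>k=1..j. scal (c k) * w k * gen (Suc m, k))"
  have vT: "v \<in> T m" and Ev: "\<And>i. i \<in> {1..<n} \<Longrightarrow> E i v = 0"
    using v by (auto simp: sing_def)
  have Lnz: "qn (L i) \<noteq> 0" "qn (L i + 1) \<noteq> 0" if "i \<in> {1..<j}" for i
    using pos[OF that] by (auto simp: L_def intro!: qn_nz)
  have wT: "w k \<in> T m" if "k \<in> {1..j}" for k
    unfolding w_def by (rule low_T) (use that j vT in auto)
  have zT: "z \<in> T (Suc m)"
    unfolding z_def using wT j by (intro supp_in_sum) (auto intro!: mult_gen_T supp_in_scal)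
  have cz: "coef m k z = (if k \<le> j then scal (c k) * w k else 0)" if "k \<in> {1..n}" for k
  proof -
    have "coef m k z = (\<Sum>i=1..j. if i = k then scal (c i) * w i else 0)"
      unfolding z_def coef_lin by (intro sum.cong) (auto simp: coef_mult_gen)
    then show ?thesis using that by auto
  qed
  have wj: "w j = v" and cj: "c j = 1" by (simp_all add: w_def c_def)
  have c_step: "c k = lead nu k / qn (L k) * c (k + 1)" if "k < j" for k
    using that by (simp add: c_def prod.atLeast_Suc_lessThan)
  have Ew: "E i (w k) = (if i = k then scal (qn (L k)) * w (k + 1) else 0)"
    if "k \<in> {1..j}" "i \<in> {1..<n}" "i = k \<longrightarrow> k < j" for i k
  proof -
    have main: "(\<forall>i\<in>{j - (j - k)<..<j}. E i (low j L (j - k) v) = 0) \<and>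
      (\<forall>d'. j - k = Suc d' \<longrightarrow> E (j - (j - k)) (low j L (j - k) v)
        = scal (qn (shifted_diff j mu (j - (j - k)))) * low j L d' v)"
      by (rule E_low_singular[OF v(2)]) (use that j Ev in \<open>auto simp: L_def\<close>)
    have k: "j - (j - k) = k" using that by simp
    consider "i < k \<or> j \<le> i" | "i \<in> {k<..<j}" | "i = k" "k < j" using that by fastforce
    then show ?thesis
    proof cases
      case 1
      then have "E i (w k) = low j L (j - k) (E i v)"
        unfolding w_def by (intro E_low) (use that j in auto)
      then show ?thesis using 1 that Ev by (auto simp: low_lin)
    next
      case 2
      then show ?thesis using main by (simp add: k w_def)
    next
      case 3
      then have "j - k = Suc (j - (k + 1))" by simp
      then show ?thesis using main 3 by (simp add: k w_def L_def)
    qed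
  qed
  have isw_w: "isw (\<lambda>i. mu i - eps k i + eps j i) (w k)" if "k \<in> {1..j}" for k
    using isw_low[OF v(2), of j "j - k" L] that j by (simp add: w_def)
  have "isw nu z"
    unfolding z_def
  proof (intro isw_sum)
    fix k assume "k \<in> {1..j}"
    then have "isw (\<lambda>i. mu i - eps k i + eps j i + eps (snd (Suc m, k)) i) (scal (c k) * w k * gen (Suc m, k))"
      using isw_w by (intro isw_mult_gen isw_scal) auto
    then show "isw nu (scal (c k) * w k * gen (Suc m, k))"
      by (rule isw_cong) (simp add: nu_def)
  qed
  have sz: "sing (Suc m) z"
    unfolding sing_def
  proof (intro conjI ballI zT)
    fix i assume i: "i \<in> {1..<n}"
    show "E i z = 0"
    proof (rule T_Suc_eq_0[OF E_T[OF i zT]])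
      fix k assume k: "k \<in> {1..n}"
      show "coef m k (E i z) = 0"
      proof (cases "k = i")
        case False
        then show ?thesis
          using coef_E[OF zT i k] cz[OF k] Ew[of k i] k i by (auto simp: opr_lin)
      next
        case True
        show ?thesis
        proof (cases "i < j")
          case True
          have Kp: "Kp i (w (i + 1)) = scal (s powi (nu i - nu (i + 1) + 1)) * w (i + 1)"
            using isw_w[of "i + 1"] True i
            by (auto simp: isw_def pairing_root_left nu_def eps_def algebra_simps)
          have "coef m k (E i z) = scal (1 / s) * E i (scal (c i) * w i) + Kp i (scal (c (i + 1)) * w (i + 1))"
            using coef_E[OF zT i k] \<open>k = i\<close> cz[OF k] cz[of "i + 1"] True i by auto
          also have "\<dots> = scal (1 / s * c i * qn (L i) + c (i + 1) * s powi (nu i - nu (i + 1) + 1)) * w (i + 1)"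
            using Ew[of i i] True i
            by (simp add: opr_lin Kp[simplified] scal_mult_left scal_add distrib_right mult.assoc)
          also have "1 / s * c i * qn (L i) + c (i + 1) * s powi (nu i - nu (i + 1) + 1) = 0"
            using c_step[OF True] Lnz[of i] True i
            by (simp add: lead_def power_int_add power2_eq_square)
          finally show ?thesis by simp
        next
          case False
          have "coef m i z = (if i = j then v else 0)" "coef m (i + 1) z = 0"
            using cz[of i] cz[of "i + 1"] False i wj cj by auto
          then show ?thesis
            using coef_E[OF zT i k] \<open>k = i\<close> Ev i by (auto simp: opr_lin)
        qed
      qed
    qed
  qed
  \<comment> \<open>The contribution of row i to the norm. The power of q and the product in
    \<kappa> come out of the telescoping sum computed below.\<close>
  define r where "r i = qn (L i + 1) / qn (L i)" for i
  define \<kappa> where "\<kappa> = q powi int (j - 1) * (\<Prod>i\<in>{1..<j}. r i)"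
  have "\<kappa> \<noteq> 0"
    unfolding \<kappa>_def r_def using Lnz q_nz by auto
  moreover have "form x z = \<kappa> * form (coef m j x) v" if x: "sing (Suc m) x" "isw nu x" for x
  proof -
    define G where "G k = form (coef m k x) (w k)" for k
    define P where "P k = (\<Prod>i\<in>{k..<j}. r i)" for k
    have xT: "x \<in> T (Suc m)" using x by (simp add: sing_def)
    have P_step: "P k = r k * P (k + 1)" if "k < j" for k
      using that by (simp add: P_def prod.atLeast_Suc_lessThan)
    have G1: "G (j - 1) = lead nu (j - 1) * G j" if "j > 1"
    proof -
      have w1: "w (j - 1) = F (j - 1) v"
        using that by (simp add: w_def L_def shifted_diff_def qn_minus scal_uminus)
      have k: "j - 1 \<in> {1..<n}" "j - 1 \<in> {1..n}" "j - 1 + 1 = j" using that j by auto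
      have "G (j - 1) = form (E (j - 1) (coef m (j - 1) x)) v"
        unfolding G_def w1 by (rule form_E[OF k(1), symmetric])
      then show ?thesis
        unfolding sing_coef[OF x k(1,2)] k(3) by (simp add: G_def wj form_simps)
    qed
    \<comment> \<open>The second term of the lowering operator is orthogonal to coordinate k of x,
      which E_(k+1), ..., E_(j-1) kill. In the first term F_k passes to x as E_k and produces the
      next coordinate.\<close>
    have G_step: "G k = qn (L (k + 1) + 1) * lead nu k * G (k + 1)" if "1 \<le> k" "k + 1 < j" for k
    proof -
      have k: "k \<in> {1..<n}" "k \<in> {1..n}" using that j by auto
      define d where "d = j - (k + 1)"
      have d: "j - k = Suc d" "j - Suc d = k" "j - d = k + 1" "d < j" "d > 0" "j - Suc k = d" using that by (auto simp: d_def)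
      have "form (coef m k x) (low j L d (F k v)) = 0"
        by (rule form_low) (use d j that sing_coef[OF x] in auto)
      then have "G k = qn (L (k + 1) + 1) * form (coef m k x) (F k (w (k + 1)))"
        by (simp add: G_def w_def d form_simps)
      also have "form (coef m k x) (F k (w (k + 1))) = lead nu k * G (k + 1)"
        using sing_coef[OF x k] by (simp add: G_def form_simps flip: form_E[OF k(1)])
      finally show ?thesis by simp
    qed
    \<comment> \<open>The k-th summand cleared of its denominator. Each step contributes the square
      of \<open>lead\<close>, and the exponents collapse because nu k - nu (k + 1) + 2 = L k - L (k
      + 1) + 1 as long as k + 1 < j.\<close>
    have R: "c k * G k * qn (L k) = q powi (L k + int (j - k)) * P (k + 1) * G j"
      if "1 \<le> k" "k < j" for k
      using that(2,1)
    proof (induction "j - k" arbitrary: k rule: less_induct)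
      case less
      have kk: "k \<in> {1..<j}" using less.prems by auto
      show ?case
      proof (cases "k + 1 = j")
        case True
        have "c k * G k * qn (L k) = (lead nu k * lead nu k) * G j"
          using c_step[OF less.prems(1)] G1 True Lnz[OF kk] cj kk by (auto simp: field_simps)
        also have "lead nu k * lead nu k = q powi (L k + int (j - k))"
          unfolding lead_sq using True kk
          by (auto simp: nu_def L_def shifted_diff_def eps_def intro!: arg_cong[of _ _ "\<lambda>x. q powi x"])
        finally show ?thesis using True by (simp add: P_def)
      next
        case False
        then have lt: "k + 1 < j" using less.prems by simp
        have IH: "c (k + 1) * G (k + 1) * qn (L (k + 1))
            = q powi (L (k + 1) + int (j - (k + 1))) * P (k + 1 + 1) * G j"
          using less.hyps[of "k + 1"] lt less.prems by simp
        have "c k * G k * qn (L k) = (lead nu k * lead nu k) * (qn (L (k + 1) + 1) * (c (k + 1) * G (k + 1)))"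
          using c_step[OF less.prems(1)] G_step[OF less.prems(2) lt] Lnz[OF kk] by simp
        also have "lead nu k * lead nu k = q powi (L k - L (k + 1) + 1)"
          unfolding lead_sq using lt
          by (auto simp: nu_def L_def shifted_diff_def eps_def intro!: arg_cong[of _ _ "\<lambda>x. q powi x"])
        also have "qn (L (k + 1) + 1) * (c (k + 1) * G (k + 1))
            = r (k + 1) * (c (k + 1) * G (k + 1) * qn (L (k + 1)))"
          using Lnz[of "k + 1"] lt by (simp add: r_def)
        finally have "c k * G k * qn (L k) = (q powi (L k - L (k + 1) + 1) * q powi (L (k + 1) + int (j - (k + 1))))
            * (r (k + 1) * P (k + 1 + 1)) * G j"
          unfolding IH by (simp add: mult_ac)
        also have "q powi (L k - L (k + 1) + 1) * q powi (L (k + 1) + int (j - (k + 1)))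
            = q powi (L k + int (j - k))"
          using q_nz lt by (simp add: of_nat_diff algebra_simps flip: power_int_add)
        also have "r (k + 1) * P (k + 1 + 1) = P (k + 1)" using P_step[OF lt] by simp
        finally show ?thesis .
      qed
    qed
    \<comment> \<open>Summing downwards from j, each new summand multiplies the partial sum by q
      [L k + 1]/[L k].\<close>
    have S: "(\<Sum>i\<in>{k..j}. c i * G i) = q powi int (j - k) * P k * G j" if "1 \<le> k" "k \<le> j" for k
      using that(2,1)
    proof (induction "j - k" arbitrary: k rule: less_induct)
      case less
      show ?case
      proof (cases "k = j")
        case True
        then show ?thesis using cj by (simp add: P_def)
      next
        case False
        then have lt: "k < j" using less.prems by simp
        have nz: "qn (L k) \<noteq> 0" using Lnz[of k] lt less.prems by auto
        have "(\<Sum>i\<in>{k..j}. c i * G i) = c k * G k + (\<Sum>i\<in>{k+1..j}. c i * G i)"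
          using lt by (simp add: sum.atLeast_Suc_atMost)
        also have "(\<Sum>i\<in>{k+1..j}. c i * G i) = q powi int (j - (k + 1)) * P (k + 1) * G j"
          using less.hyps[of "k + 1"] lt by simp
        also have "c k * G k = q powi (L k + int (j - k)) * P (k + 1) * G j / qn (L k)"
          using R[OF less.prems(2) lt] nz by (simp add: field_simps)
        also have "q powi (L k + int (j - k)) = q * q powi int (j - (k + 1)) * q powi L k"
          using q_nz lt by (simp add: of_nat_diff algebra_simps power_int_add power_int_diff)
        also have "q * q powi int (j - (k + 1)) * q powi L k * P (k + 1) * G j / qn (L k)
            + q powi int (j - (k + 1)) * P (k + 1) * G j
          = q * q powi int (j - (k + 1)) * ((q powi L k + inverse q * qn (L k)) / qn (L k)) * P (k + 1) * G j"
          using nz q_nz by (simp add: field_simps)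
        also have "(q powi L k + inverse q * qn (L k)) / qn (L k) = r k"
          unfolding r_def qn_add_1 by (simp only: add.commute)
        also have "q * q powi int (j - (k + 1)) = q powi int (j - k)"
        proof -
          have "int (j - k) = 1 + int (j - (k + 1))" using lt by simp
          then show ?thesis by (simp only: power_int_add q_nz power_int_1_right simp_thms)
        qed
        finally show ?thesis using P_step[OF lt] by simp
      qed
    qed
    have "form x z = (\<Sum>k=1..n. if k \<le> j then c k * G k else 0)"
      unfolding form_coef[OF xT zT] by (intro sum.cong) (auto simp: cz G_def form_simps)
    also have "\<dots> = (\<Sum>k\<in>{1..j}. c k * G k)"
      using j by (intro sum.mono_neutral_cong_right) auto
    also have "\<dots> = \<kappa> * G j"
      using S[of 1] j by (simp add: \<kappa>_def P_def)
    finally show ?thesis by (simp add: G_def wj)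
  qed
  moreover have "coef m j z = v" "\<And>k. k \<in> {j<..n} \<Longrightarrow> coef m k z = 0"
    using cz j wj cj by auto
  ultimately show ?thesis
    using that[OF sz \<open>isw nu z\<close>[unfolded nu_def]] unfolding nu_def by blast
qed

end

context quantum_gl
begin

section \<open>A basis of singular vectors\<close>

definition addable :: "(nat \<Rightarrow> nat) \<Rightarrow> nat \<Rightarrow> bool" where
  "addable lam j \<longleftrightarrow> j = 1 \<or> lam j < lam (j - 1)"

text \<open>A path in the Young graph is recorded as the list of rows to which boxes are added.\<close>

primrec paths :: "nat \<Rightarrow> nat list set" where
  "paths 0 = {[]}"
| "paths (Suc m) = {js @ [j] | js j. js \<in> paths m \<and> j \<in> {1..n} \<and> addable (count_list js) j}"

definition content :: "nat list \<Rightarrow> nat \<Rightarrow> int" where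
  "content js i = int (count_list js i)"

lemma content_snoc: "content (js @ [j]) = (\<lambda>i. content js i + eps j i)"
  by (auto simp: content_def eps_def fun_eq_iff)

lemma paths_props:
  assumes "js \<in> paths m"
  shows "set js \<subseteq> {1..n}" "length js = m" "\<And>i. 1 \<le> i \<Longrightarrow> count_list js (i + 1) \<le> count_list js i"
proof -
  have "set js \<subseteq> {1..n} \<and> length js = m \<and> (\<forall>i\<ge>1. count_list js (i + 1) \<le> count_list js i)"
    using assms
  proof (induction m arbitrary: js)
    case (Suc m)
    then obtain js' j where js: "js = js' @ [j]" "js' \<in> paths m" "j \<in> {1..n}" "addable (count_list js') j"
      by auto
    have IH: "set js' \<subseteq> {1..n}" "length js' = m" "\<forall>i\<ge>1. count_list js' (i + 1) \<le> count_list js' i"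
      using Suc.IH[OF js(2)] by auto
    have "count_list js (i + 1) \<le> count_list js i" if "i \<ge> 1" for i
      using IH(3) that js(3,4) by (auto simp: js(1) addable_def Suc_leI le_SucI)
    then show ?case using IH js by auto
  qed simp
  then show "set js \<subseteq> {1..n}" "length js = m" "\<And>i. 1 \<le> i \<Longrightarrow> count_list js (i + 1) \<le> count_list js i"
    by auto
qed

lemma finite_paths: "finite (paths m)"
proof (rule finite_subset)
  show "paths m \<subseteq> {js. set js \<subseteq> {1..n} \<and> length js = m}"
    using paths_props by auto
qed (rule finite_lists_length_eq, simp)

lemma paths_antimono:
  assumes "js \<in> paths m" "1 \<le> i" "i \<le> k"
  shows "count_list js k \<le> count_list js i"
  using assms(3)
proof (induction k rule: dec_induct)
  case (step k)
  then show ?case using paths_props(3)[OF assms(1), of k] assms(2) by simp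
qed simp

text \<open>For the row just above, addability gives the strict inequality; for the others the term
  j - i - 1 is positive and rows decrease. This keeps the denominators of the new singular vector
  away from zero.\<close>

lemma shifted_diff_pos:
  assumes "js \<in> paths m" "addable (count_list js) j" "i \<in> {1..<j}"
  shows "shifted_diff j (content js) i > 0"
proof (cases "i = j - 1")
  case True
  then show ?thesis using assms(2,3) by (auto simp: shifted_diff_def content_def addable_def)
next
  case False
  then have "i + 1 < j" using assms(3) by auto
  then show ?thesis
    using paths_antimono[OF assms(1), of i j] assms(3) by (auto simp: shifted_diff_def content_def)
qed

lemma T_0: "x \<in> T 0 \<Longrightarrow> \<exists>c. x = scal c"
  by (induction rule: supp_in_induct) (auto simp: tw_0 word_Nil intro: exI[of _ 0] simp flip: scal_add)

text \<open>By \<open>sing_coef\<close>, E_j maps coordinate j to a multiple of coordinate j + 1,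
  which is zero here, and all other E_k kill it anyway.\<close>

lemma sing_leading:
  assumes x: "sing (Suc m) x" "isw nu x" and j: "j \<in> {1..n}" "\<And>k. k \<in> {j<..n} \<Longrightarrow> coef m k x = 0"
  shows "sing m (coef m j x)"
  unfolding sing_def
proof (intro conjI ballI)
  show "coef m j x \<in> T m" using x by (auto simp: sing_def intro: coef_T)
  fix k assume "k \<in> {1..<n}"
  then show "E k (coef m j x) = 0"
    using sing_coef[OF x _ j(1), of k] j(2)[of "k + 1"] by auto
qed

text \<open>The induction hypothesis on the tensor power. Completeness is asked of weight vectors;
  arbitrary singular vectors are later split into weight components.\<close>

definition sing_family :: "nat \<Rightarrow> (nat list \<Rightarrow> (nat \<times> nat) free_alg) \<Rightarrow> bool" where
  "sing_family m v \<longleftrightarrow>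
    (\<forall>js\<in>paths m. sing m (v js) \<and> isw (content js) (v js) \<and> form (v js) (v js) \<noteq> 0) \<and>
    (\<forall>js\<in>paths m. \<forall>js'\<in>paths m. js \<noteq> js' \<longrightarrow> form (v js) (v js') = 0) \<and>
    (\<forall>x mu. sing m x \<longrightarrow> isw mu x \<longrightarrow> (\<forall>js\<in>paths m. form x (v js) = 0) \<longrightarrow> x = 0)"

text \<open>Norms and orthogonality follow from the pairing formula, as the lift for row j has no
  coordinate above j. For completeness, the top nonzero coordinate j of x is singular and hence
  pairs nontrivially with some old v. Either a box can be added in row j, and x pairs with the lift,
  or F_(j-1) v = 0, which contradicts the singularity of x.\<close>

lemma sing_family_step:
  assumes v: "sing_family m v"
  shows "\<exists>v'. sing_family (Suc m) v'"
proof -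
  define R where "R = (\<lambda>js j z \<kappa>. sing (Suc m) z \<and> isw (\<lambda>i. content js i + eps j i) z \<and> coef m j z = v js \<and>
    (\<forall>k\<in>{j<..n}. coef m k z = 0) \<and> \<kappa> \<noteq> 0 \<and>
    (\<forall>x. sing (Suc m) x \<longrightarrow> isw (\<lambda>i. content js i + eps j i) x \<longrightarrow> form x z = \<kappa> * form (coef m j x) (v js)))"
  have vp: "sing m (v js)" "isw (content js) (v js)" "form (v js) (v js) \<noteq> 0" if "js \<in> paths m" for js
    using v that by (auto simp: sing_family_def)
  have vorth: "form (v js) (v js') = 0" if "js \<in> paths m" "js' \<in> paths m" "js \<noteq> js'" for js js'
    using v that by (auto simp: sing_family_def)
  have vspan: "x = 0" if "sing m x" "isw mu x" "\<And>js. js \<in> paths m \<Longrightarrow> form x (v js) = 0" for x mu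
    using v that by (auto simp: sing_family_def)
  have ex: "\<exists>z \<kappa>. R js j z \<kappa>" if "js \<in> paths m" "j \<in> {1..n}" "addable (count_list js) j" for js j
  proof (rule singular_step[OF vp(1,2)[OF that(1)] that(2)])
    show "shifted_diff j (content js) i > 0" if "i \<in> {1..<j}" for i
      using shifted_diff_pos[OF \<open>js \<in> paths m\<close> \<open>addable (count_list js) j\<close> that] .
  next
    fix z \<kappa>
    assume a: "sing (Suc m) z" "isw (\<lambda>i. content js i + eps j i) z" "coef m j z = v js"
      "\<And>k. k \<in> {j<..n} \<Longrightarrow> coef m k z = 0" "\<kappa> \<noteq> 0"
      "\<And>x. sing (Suc m) x \<Longrightarrow> isw (\<lambda>i. content js i + eps j i) x \<Longrightarrow> form x z = \<kappa> * form (coef m j x) (v js)"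
    show ?thesis
      unfolding R_def by (intro exI[of _ z] exI[of _ \<kappa>] conjI allI ballI impI a)
  qed
  define z where "z js j = (SOME z. \<exists>\<kappa>. R js j z \<kappa>)" for js j
  define \<kappa> where "\<kappa> js j = (SOME \<kappa>. R js j (z js j) \<kappa>)" for js j
  have "R js j (z js j) (\<kappa> js j)" if "js \<in> paths m" "j \<in> {1..n}" "addable (count_list js) j" for js j
    unfolding \<kappa>_def by (rule someI_ex, unfold z_def, rule someI_ex, rule ex[OF that])
  note R = this[unfolded R_def]
  define v' where "v' l = z (butlast l) (last l)" for l
  have v'_snoc: "v' (js @ [j]) = z js j" for js j by (simp add: v'_def)
  have pathE: "\<exists>js j. l = js @ [j] \<and> js \<in> paths m \<and> j \<in> {1..n} \<and> addable (count_list js) j"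
    if "l \<in> paths (Suc m)" for l
    using that by auto
  have p1: "sing (Suc m) (v' l) \<and> isw (content l) (v' l) \<and> form (v' l) (v' l) \<noteq> 0" if lp: "l \<in> paths (Suc m)" for l
  proof -
    obtain js j where l: "l = js @ [j]" "js \<in> paths m" "j \<in> {1..n}" "addable (count_list js) j"
      using pathE[OF lp] by blast
    note r = R[OF l(2-4)]
    then have "form (z js j) (z js j) = \<kappa> js j * form (v js) (v js)" by metis
    then show ?thesis using r vp(3)[OF l(2)] by (simp add: l(1) v'_snoc content_snoc)
  qed
  have p2: "form (v' l) (v' l') = 0" if ll: "l \<in> paths (Suc m)" "l' \<in> paths (Suc m)" "l \<noteq> l'" for l l'
  proof (cases "\<forall>i\<in>{1..n}. content l i = content l' i")
    case False
    then show ?thesis using isw_orth p1 ll by blast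
  next
    case True
    obtain js j where l: "l = js @ [j]" "js \<in> paths m" "j \<in> {1..n}" "addable (count_list js) j"
      using pathE[OF ll(1)] by blast
    obtain js' j' where l': "l' = js' @ [j']" "js' \<in> paths m" "j' \<in> {1..n}" "addable (count_list js') j'"
      using pathE[OF ll(2)] by blast
    note r = R[OF l(2-4)] and r' = R[OF l'(2-4)]
    have w: "isw (\<lambda>i. content js' i + eps j' i) (z js j)" "isw (\<lambda>i. content js i + eps j i) (z js' j')"
      using r r' True isw_cong[of _ "z js j" "\<lambda>i. content js' i + eps j' i"]
        isw_cong[of _ "z js' j'" "\<lambda>i. content js i + eps j i"]
      by (auto simp: l(1) l'(1) content_snoc)
    have f: "form (z js j) (z js' j') = \<kappa> js' j' * form (coef m j' (z js j)) (v js')"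
      "form (z js' j') (z js j) = \<kappa> js j * form (coef m j (z js' j')) (v js)"
      using r r' w by blast+
    \<comment> \<open>For distinct rows the formula is applied to the vector with the larger row;
      the other vector has no coordinate there.\<close>
    consider "j = j'" | "j < j'" | "j' < j" by linarith
    then show ?thesis
    proof cases
      case 1
      then have "js \<noteq> js'" using ll(3) l l' by auto
      then show ?thesis using f(1) r 1 vorth l l' by (simp add: v'_snoc)
    next
      case 2
      then have "coef m j' (z js j) = 0" using r l'(3) by auto
      then show ?thesis using f(1) by (simp add: l l' v'_snoc)
    next
      case 3
      then have "coef m j (z js' j') = 0" using r' l(3) by auto
      then show ?thesis using f(2) by (simp add: l l' v'_snoc form_sym[of "z js j"])
    qed
  qed
  have p3: "x = 0" if x: "sing (Suc m) x" "isw mu x" "\<And>l. l \<in> paths (Suc m) \<Longrightarrow> form x (v' l) = 0" for x mu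
  proof (rule ccontr)
    assume "x \<noteq> 0"
    have xT: "x \<in> T (Suc m)" using x by (simp add: sing_def)
    define J where "J = {k \<in> {1..n}. coef m k x \<noteq> 0}"
    have "J \<noteq> {}" "finite J" using T_Suc_eq_0[OF xT] \<open>x \<noteq> 0\<close> by (auto simp: J_def)
    define j where "j = Max J"
    have "j \<in> J" using \<open>J \<noteq> {}\<close> \<open>finite J\<close> by (simp add: j_def)
    then have j: "j \<in> {1..n}" "coef m j x \<noteq> 0" by (auto simp: J_def)
    have above: "coef m k x = 0" if "k \<in> {j<..n}" for k
      using that Max_ge[OF \<open>finite J\<close>, of k] by (fastforce simp: j_def J_def)
    let ?y = "coef m j x" and ?lam = "\<lambda>i. mu i - eps j i"
    have sy: "sing m ?y" by (rule sing_leading[OF x(1,2) j(1) above])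
    have wy: "isw ?lam ?y" by (rule isw_coef[OF x(2) xT])
    obtain js where js: "js \<in> paths m" "form ?y (v js) \<noteq> 0"
      using vspan[OF sy wy] j(2) by blast
    have lam: "content js i = mu i - eps j i" if "i \<in> {1..n}" for i
      using isw_orth[OF wy vp(2)[OF js(1)] that] js(2) by force
    show False
    proof (cases "addable (count_list js) j")
      case True
      have "js @ [j] \<in> paths (Suc m)" using js(1) j(1) True by auto
      then have "form x (z js j) = 0" using x(3) by (metis v'_snoc)
      moreover have "isw (\<lambda>i. content js i + eps j i) x"
        by (rule isw_cong[OF x(2)]) (simp add: lam)
      ultimately show False using R[OF js(1) j(1) True] x(1) js(2) by auto
    next
      case False
      define k where "k = j - 1"
      have k: "k \<in> {1..<n}" "k \<in> {1..n}" "k + 1 = j" and le: "count_list js k = count_list js j"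
        using False j(1) paths_antimono[OF js(1), of "j - 1" j] by (auto simp: addable_def k_def)
      \<comment> \<open>Rows k and k + 1 = j have equal length, so E_k F_k v = [0] v = 0 and F_k v
        is singular. Its weight is not dominant, hence not the content of a path, and completeness
        in degree m makes it zero.\<close>
      have Fv0: "F k (v js) = 0"
      proof -
        have wF: "isw (\<lambda>i. content js i - root k i) (F k (v js))"
          using vp(2)[OF js(1)] by (rule isw_F)
        have sv: "v js \<in> T m" "\<And>i. i \<in> {1..<n} \<Longrightarrow> E i (v js) = 0"
          using vp(1)[OF js(1)] by (auto simp: sing_def)
        have "content js k - content js (k + 1) = 0"
          using le k(3) by (simp add: content_def)
        then have "E k (F k (v js)) = 0"
          using comm_EF_weight[OF vp(2)[OF js(1)] k(1)] sv(2)[OF k(1)] by (simp add: opr_lin)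
        then have "E i (F k (v js)) = 0" if "i \<in> {1..<n}" for i
          using comm_EF_neq[of i k "v js"] that k(1) sv(2) by (cases "i = k") (auto simp: opr_lin)
        then have sF: "sing m (F k (v js))"
          using sv F_T[OF k(1)] by (auto simp: sing_def)
        show ?thesis
        proof (rule vspan[OF sF wF])
          fix js' assume js': "js' \<in> paths m"
          have "\<exists>i\<in>{1..n}. content js i - root k i \<noteq> content js' i"
          proof (rule ccontr)
            assume "\<not> ?thesis"
            then have "content js k - root k k = content js' k" "content js j - root k j = content js' j"
              using k j(1) by auto
            then have "content js' k < content js' j"
              using k(3) le by (auto simp: root_def eps_def content_def)
            then show False
              using paths_props(3)[OF js', of k] k by (simp add: content_def)
          qed
          then show "form (F k (v js)) (v js') = 0"
            using isw_orth[OF wF vp(2)[OF js']] by blast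
        qed
      qed
      \<comment> \<open>E_k sends coordinate k of x to a nonzero multiple of the top coordinate,
        while adjointness moves it to F_k v = 0; so the top coordinate would be orthogonal to v
        after all.\<close>
      have "form (E k (coef m k x)) (v js) = 0"
        by (simp add: form_E[OF k(1)] Fv0)
      then have "lead mu k * form ?y (v js) = 0"
        using sing_coef[OF x(1,2) k(1,2)] k(3) by (simp add: form_simps)
      then show False using js(2) by (simp add: lead_def)
    qed
  qed
  show ?thesis
    unfolding sing_family_def by (intro exI[of _ v']) (use p1 p2 p3 in blast)
qed

lemma sing_family_exists: "\<exists>v. sing_family m v"
proof (induction m)
  case 0
  have "sing_family 0 (\<lambda>_. 1)"
    unfolding sing_family_def
  proof (intro conjI allI impI ballI)
    fix js assume "js \<in> paths 0"
    then show "isw (content js) 1"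
      by (simp add: isw_def content_def pairing_def)
  next
    show "sing 0 1" by (simp add: sing_def tw_0 flip: word_Nil) (simp add: word_Nil)
    show "form 1 1 \<noteq> 0" by (simp add: form_word_word flip: word_Nil)
  next
    fix x :: "(nat \<times> nat) free_alg" assume x: "sing 0 x" "\<forall>js\<in>paths 0. form x 1 = 0"
    then obtain c where "x = scal c * 1" using T_0 by (auto simp: sing_def)
    moreover from this have "c = 0" using x(2) by (simp only: form_simps) (simp add: form_word_word flip: word_Nil)
    ultimately show "x = 0" by simp
  qed auto
  then show ?case by blast
qed (use sing_family_step in blast)

subsection \<open>Weight components\<close>

text \<open>The value 0 outside {1..n} normalises weights, so that they can be compared as
  functions.\<close>

definition word_wt :: "(nat \<times> nat) list \<Rightarrow> nat \<Rightarrow> int" where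
  "word_wt ws i = (if i \<in> {1..n} then wt_pair n (eps i) ws else 0)"

definition wt_comp :: "(nat \<Rightarrow> int) \<Rightarrow> (nat \<times> nat) free_alg \<Rightarrow> (nat \<times> nat) free_alg" where
  "wt_comp mu = lin_ext (\<lambda>ws. if word_wt ws = mu then word ws else 0)"

lemma lin_wt_comp [simp]: "lin (wt_comp mu)"
  by (simp add: wt_comp_def)

lemma wt_comp_word: "wt_comp mu (word ws) = (if word_wt ws = mu then word ws else 0)"
  by (simp add: wt_comp_def)

lemma lk_wt_comp: "lk (wt_comp mu p) ws = (if word_wt ws = mu then lk p ws else 0)"
  by (induction p rule: free_alg_induct)
    (auto simp: lin_simps[OF lin_wt_comp] wt_comp_word lookup_add lookup_word)

lemma wt_pair_word_wt: "wt_pair n a ws = pairing n a (word_wt ws)"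
proof (induction ws)
  case Nil
  then show ?case by (auto simp: word_wt_def pairing_def intro!: sum.neutral)
next
  case (Cons x ws)
  have "pairing n a (word_wt (x # ws)) = pairing n a (\<lambda>i. eps (snd x) i + word_wt ws i)"
    by (rule pairing_cong, simp add: word_wt_def pairing_eps) (auto simp: eps_def)
  then show ?case using Cons by (simp add: pairing_add_right)
qed

lemma isw_word: "isw (word_wt ws) (word ws)"
  by (simp add: isw_def K_word wt_pair_word_wt)

lemma isw_lk:
  assumes "isw mu p" "lk p ws \<noteq> 0" "i \<in> {1..n}"
  shows "word_wt ws i = mu i"
proof (rule ccontr)
  assume "word_wt ws i \<noteq> mu i"
  then have "form (word ws) p = 0" by (rule isw_orth[OF isw_word assms(1,3)])
  then show False using assms(2) by (simp add: form_word_left)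
qed

lemma isw_wt_comp: "isw mu (wt_comp mu p)"
proof (induction p rule: free_alg_induct)
  case (word c ws)
  then show ?case using isw_word[of ws]
    by (auto simp: lin_simps[OF lin_wt_comp] wt_comp_word intro: isw_scal isw_0)
qed (auto simp: lin_simps[OF lin_wt_comp] intro: isw_0 isw_add)

lemma wt_comp_isw:
  assumes "isw mu p" "\<And>i. i \<notin> {1..n} \<Longrightarrow> mu i = 0"
  shows "wt_comp nu p = (if mu = nu then p else 0)"
proof (rule free_alg_eqI)
  fix ws
  have "word_wt ws = mu" if "lk p ws \<noteq> 0"
  proof
    fix i show "word_wt ws i = mu i"
      using isw_lk[OF assms(1) that, of i] assms(2)[of i] by (auto simp: word_wt_def)
  qed
  then show "lk (wt_comp nu p) ws = lk (if mu = nu then p else 0) ws"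
    by (auto simp: lk_wt_comp)
qed

lemma wt_comp_E:
  assumes "k \<in> {1..<n}"
  shows "wt_comp (\<lambda>i. mu i + root k i) (E k p) = E k (wt_comp mu p)"
proof (rule lin_eq[of "\<lambda>p. wt_comp (\<lambda>i. mu i + root k i) (E k p)" "\<lambda>p. E k (wt_comp mu p)"])
  show "lin (\<lambda>p. wt_comp (\<lambda>i. mu i + root k i) (E k p))"
    by (rule lin_compose[OF lin_wt_comp lin_opr])
  show "lin (\<lambda>p. E k (wt_comp mu p))"
    by (rule lin_compose[OF lin_opr lin_wt_comp])
  fix ws
  have 1: "isw (\<lambda>i. word_wt ws i + root k i) (E k (word ws))"
    by (rule isw_E[OF isw_word])
  have 2: "word_wt ws i + root k i = 0" if "i \<notin> {1..n}" for i
    using that assms by (auto simp: word_wt_def root_def eps_def)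
  have "(\<lambda>i. word_wt ws i + root k i) = (\<lambda>i. mu i + root k i) \<longleftrightarrow> word_wt ws = mu"
    by (auto simp: fun_eq_iff)
  then show "wt_comp (\<lambda>i. mu i + root k i) (E k (word ws)) = E k (wt_comp mu (word ws))"
    using wt_comp_isw[OF 1, of "\<lambda>i. mu i + root k i"] 2 by (simp add: wt_comp_word opr_lin)
qed

lemma wt_comp_T: "p \<in> T m \<Longrightarrow> wt_comp mu p \<in> T m"
  by (rule lin_supp_in[OF lin_wt_comp]) (auto simp: wt_comp_word)

lemma form_wt_comp_left: "form (wt_comp mu p) r = form p (wt_comp mu r)"
  by (rule bilinear_eq_words[of "\<lambda>p r. form (wt_comp mu p) r" "\<lambda>p r. form p (wt_comp mu r)"])
    (auto simp: form_simps lin_simps[OF lin_wt_comp] wt_comp_word form_word_word)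

text \<open>Weight components of a singular vector are singular, and they stay orthogonal to the
  family because its members are weight vectors and the projection to a weight is
  self-adjoint.\<close>

lemma sing_orth_eq_0:
  assumes v: "sing_family m v" and x: "sing m x" "\<And>js. js \<in> paths m \<Longrightarrow> form x (v js) = 0"
  shows "x = 0"
proof (rule free_alg_eqI)
  fix ws
  let ?y = "wt_comp (word_wt ws) x"
  have "sing m ?y"
    using x(1) by (auto simp: sing_def wt_comp_T lin_simps[OF lin_wt_comp] simp flip: wt_comp_E)
  moreover have "form ?y (v js) = 0" if "js \<in> paths m" for js
  proof -
    have 1: "isw (content js) (v js)" using v that by (simp add: sing_family_def)
    have 2: "content js i = 0" if "i \<notin> {1..n}" for i
      using paths_props(1)[OF \<open>js \<in> paths m\<close>] that by (auto simp: content_def count_list_0_iff)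
    have "wt_comp (word_wt ws) (v js) = v js \<or> wt_comp (word_wt ws) (v js) = 0"
      using wt_comp_isw[OF 1, of "word_wt ws"] 2 by auto
    then show ?thesis using x(2)[OF that] by (auto simp: form_wt_comp_left)
  qed
  ultimately have "?y = 0"
    using v isw_wt_comp unfolding sing_family_def by blast
  then show "lk x ws = lk 0 ws"
    using lk_wt_comp[of "word_wt ws" x ws] by simp
qed

end

context quantum_gl
begin

section \<open>Decomposition of the tensor power\<close>

definition stable :: "nat \<Rightarrow> (nat \<times> nat) free_alg set \<Rightarrow> bool" where
  "stable m N \<longleftrightarrow> N \<subseteq> T m \<and> 0 \<in> N \<and> (\<forall>x\<in>N. \<forall>y\<in>N. x + y \<in> N) \<and>
    (\<forall>c. \<forall>x\<in>N. scal c * x \<in> N) \<and> (\<forall>g\<in>uq_gens n. \<forall>x\<in>N. opr g x \<in> N)"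

lemma stableD:
  assumes "stable m N"
  shows "x \<in> N \<Longrightarrow> x \<in> T m" "0 \<in> N" "x \<in> N \<Longrightarrow> y \<in> N \<Longrightarrow> x + y \<in> N" "x \<in> N \<Longrightarrow> scal c * x \<in> N"
    "g \<in> uq_gens n \<Longrightarrow> x \<in> N \<Longrightarrow> opr g x \<in> N"
  using assms by (auto simp: stable_def)

lemma stable_diff: "stable m N \<Longrightarrow> x \<in> N \<Longrightarrow> y \<in> N \<Longrightarrow> x - y \<in> N"
  using stableD(3)[of m N x "scal (-1) * y"] stableD(4)[of m N y "-1"] by (simp add: scal_uminus)

lemma stable_T: "stable m (T m)"
  by (auto simp: stable_def intro: supp_in_add supp_in_scal opr_T)

lemma act_Cons: "act (word (g # gs)) p = opr g (act (word gs) p)"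
  by (simp add: act_word)

lemma stable_act:
  assumes "stable m N" "u \<in> carrier Ufree" "x \<in> N"
  shows "act u x \<in> N"
  using assms(2) unfolding free_algebra_carrier
proof (induction rule: supp_in_induct)
  case (word c gs)
  have "act (word gs) x \<in> N"
    using word by (induction gs) (auto simp: act_word assms intro: stableD[OF assms(1)])
  then show ?case by (simp add: act_left_lin stableD[OF assms(1)])
qed (auto simp: act_left_lin intro: stableD[OF assms(1)])

definition cyc :: "(nat \<times> nat) free_alg \<Rightarrow> (nat \<times> nat) free_alg set" where
  "cyc v = (\<lambda>u. act u v) ` carrier Ufree"

lemma cycI: "v \<in> cyc v"
  unfolding cyc_def by (rule image_eqI[of _ _ 1]) (auto simp: act_1 free_algebra_carrier supp_in_1)

lemma stable_cyc:
  assumes "v \<in> T m"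
  shows "stable m (cyc v)"
  unfolding stable_def
proof (intro conjI ballI allI)
  show "cyc v \<subseteq> T m" using stable_act[OF stable_T _ assms] by (auto simp: cyc_def)
  show "0 \<in> cyc v"
    unfolding cyc_def by (rule image_eqI[of _ _ 0]) (auto simp: act_left_lin free_algebra_carrier)
  fix x assume "x \<in> cyc v"
  then obtain u where u: "u \<in> carrier Ufree" "x = act u v" by (auto simp: cyc_def)
  show "scal c * x \<in> cyc v" for c
    unfolding cyc_def using u
    by (intro image_eqI[of _ _ "scal c * u"]) (auto simp: act_left_lin free_algebra_carrier supp_in_scal)
  show "opr g x \<in> cyc v" if "g \<in> uq_gens n" for g
    unfolding cyc_def using u that
    by (intro image_eqI[of _ _ "gen g * u"]) (auto simp: act_mult act_gen free_algebra_carrier intro!: supp_in_mult)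
  fix y assume "y \<in> cyc v"
  then obtain w where w: "w \<in> carrier Ufree" "y = act w v" by (auto simp: cyc_def)
  show "x + y \<in> cyc v"
    unfolding cyc_def using u w
    by (intro image_eqI[of _ _ "u + w"]) (auto simp: act_left_lin free_algebra_carrier supp_in_add)
qed

lemma cyc_least: "stable m N \<Longrightarrow> v \<in> N \<Longrightarrow> cyc v \<subseteq> N"
  using stable_act by (auto simp: cyc_def)

definition orth :: "nat \<Rightarrow> (nat \<times> nat) free_alg set \<Rightarrow> (nat \<times> nat) free_alg set" where
  "orth m N = {x \<in> T m. \<forall>y\<in>N. form x y = 0}"

lemma form_opr_stable:
  assumes "stable m N" "g \<in> uq_gens n" "\<forall>y\<in>N. form x y = 0" "y \<in> N"
  shows "form (opr g x) y = 0"
proof (cases g)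
  case (GenE k)
  then show ?thesis
    using assms stableD(5)[OF assms(1), of "GenF k" y] by (simp add: form_E)
next
  case (GenF k)
  then show ?thesis
    using assms stableD(5)[OF assms(1), of "GenE k" y] by (simp add: form_F)
next
  case (GenQ a)
  then show ?thesis
    using assms stableD(5)[OF assms(1), of g y] by (simp add: form_K)
qed

text \<open>The adjoint of a generator is again a generator.\<close>

lemma stable_orth: "stable m N \<Longrightarrow> stable m (orth m N)"
  unfolding stable_def[of m "orth m N"] using form_opr_stable
  by (auto simp: orth_def form_simps intro: supp_in_add supp_in_scal opr_T)

abbreviation "FF \<equiv> supp_in (lists (GenF ` {1..<n}))"

text \<open>The span of the F-words applied to v is already stable. Moving an E_i to the right
  leaves behind only multiples of F-words, as every vector on the way is a weight vector, and at the
  end E_i meets v.\<close>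

lemma cyc_FF:
  assumes "v \<in> T m" "isw mu v" "\<And>k. k \<in> {1..<n} \<Longrightarrow> E k v = 0"
  shows "cyc v = (\<lambda>u. act u v) ` FF"
proof
  show "(\<lambda>u. act u v) ` FF \<subseteq> cyc v"
    unfolding cyc_def free_algebra_carrier by (rule image_mono, rule supp_in_mono) (auto simp: uq_gens_def)
  let ?S = "(\<lambda>u. act u v) ` FF"
  have add: "x + y \<in> ?S" if "x \<in> ?S" "y \<in> ?S" for x y
    using that by (auto simp: act_left_lin supp_in_add simp flip: act_left_lin(1))
  have sc: "scal c * x \<in> ?S" if "x \<in> ?S" for x c
    using that by (auto simp: supp_in_scal simp flip: act_left_lin(2))
  have wt: "\<exists>nu. isw nu (act (word gs) v)" if "gs \<in> lists (GenF ` {1..<n})" for gs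
    using that
  proof (induction gs)
    case Nil
    then show ?case using assms(2) by (auto simp: act_word)
  next
    case (Cons g gs)
    then show ?case using isw_F by (auto simp: act_Cons)
  qed
  have w: "act (word gs) v \<in> ?S" if "gs \<in> lists (GenF ` {1..<n})" for gs
    using that by auto
  have Fw: "F k x \<in> ?S" if "k \<in> {1..<n}" "x \<in> ?S" for k x
  proof -
    from that(2) obtain u where "u \<in> FF" "x = act u v" by blast
    then have "F k x = act (gen (GenF k) * u) v" "gen (GenF k) * u \<in> FF"
      using that(1) by (auto simp: act_mult act_gen intro!: supp_in_mult)
    then show ?thesis by blast
  qed
  have Ew: "E i (act (word gs) v) \<in> ?S" if "i \<in> {1..<n}" "gs \<in> lists (GenF ` {1..<n})" for i gs
    using that(2)
  proof (induction gs)
    case Nil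
    have "0 \<in> ?S" by (rule image_eqI[of _ _ 0]) (auto simp: act_left_lin)
    then show ?case using assms(3)[OF that(1)] by (simp add: act_word)
  next
    case (Cons g gs)
    then obtain k where k: "g = GenF k" "k \<in> {1..<n}" by auto
    obtain nu where nu: "isw nu (act (word gs) v)" using wt Cons by blast
    have "\<exists>c. E i (F k (act (word gs) v)) = F k (E i (act (word gs) v)) + scal c * act (word gs) v"
      (is "\<exists>c. ?l = ?r c")
    proof (cases "i = k")
      case True
      then show ?thesis using comm_EF_weight[OF nu k(2)] by blast
    next
      case False
      then show ?thesis using comm_EF_neq[OF False that(1) k(2)] by (auto intro!: exI[of _ 0])
    qed
    then obtain c where "?l = ?r c" by blast
    moreover have "?r c \<in> ?S"
      using Cons by (intro add Fw[OF k(2)] sc w)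
    ultimately show ?case by (simp only: act_Cons k(1))
  qed
  have closed: "opr g (act u v) \<in> ?S" if "g \<in> uq_gens n" "u \<in> FF" for g u
    using that(2)
  proof (induction rule: supp_in_induct)
    case zero
    show ?case by (rule image_eqI[of _ _ 0]) (auto simp: act_left_lin opr_lin)
  next
    case (word c gs)
    have "opr g (act (word gs) v) \<in> ?S"
    proof (cases g)
      case (GenQ a)
      then show ?thesis using wt[OF word] w[OF word] sc by (auto simp: isw_def)
    next
      case (GenE i)
      then show ?thesis using Ew[of i gs] that(1) word by simp
    next
      case (GenF i)
      then show ?thesis using Fw[of i] that(1) w[OF word] by simp
    qed
    then show ?case using sc by (simp add: act_left_lin opr_lin)
  qed (use add in \<open>auto simp: act_left_lin opr_lin\<close>)
  have "stable m ?S"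
    unfolding stable_def
  proof (intro conjI ballI allI)
    show "?S \<subseteq> T m"
      using \<open>?S \<subseteq> cyc v\<close> stableD(1)[OF stable_cyc[OF assms(1)]] by blast
    show "0 \<in> ?S" by (rule image_eqI[of _ _ 0]) (auto simp: act_left_lin)
  qed (use add sc closed in blast)+
  then show "cyc v \<subseteq> ?S"
    by (rule cyc_least) (rule image_eqI[of _ _ 1], auto simp: act_1 supp_in_1)
qed

text \<open>In a nonempty F-word applied to v, the leftmost F passes to x as an E and gives zero;
  only v itself remains.\<close>

lemma form_sing_cyc:
  assumes v: "v \<in> T m" "isw mu v" "\<And>k. k \<in> {1..<n} \<Longrightarrow> E k v = 0"
    and x: "\<And>k. k \<in> {1..<n} \<Longrightarrow> E k x = 0" and 0: "form x v = 0" and y: "y \<in> cyc v"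
  shows "form x y = 0"
proof -
  obtain u where "u \<in> FF" "y = act u v" using y cyc_FF[OF v] by blast
  moreover have "form x (act u v) = 0" if "u \<in> FF" for u
    using that
  proof (induction rule: supp_in_induct)
    case (word c gs)
    have "form x (act (word gs) v) = 0"
    proof (cases gs)
      case (Cons g gs')
      then obtain k where "g = GenF k" "k \<in> {1..<n}" using word by auto
      then show ?thesis using Cons x by (simp add: act_Cons flip: form_E)
    qed (simp add: act_word 0)
    then show ?case by (simp add: act_left_lin form_simps)
  qed (simp_all add: act_left_lin form_simps)
  ultimately show ?thesis by blast
qed

text \<open>E_k lowers one column index by one, so this sum bounds how often the E's can be applied
  to a vector without killing it.\<close>

definition height :: "(nat \<times> nat) list \<Rightarrow> nat" where
  "height ws = sum_list (map snd ws)"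

lemma height_update: "l < length xs \<Longrightarrow> snd (xs ! l) = Suc k \<Longrightarrow> height (xs[l := (a, k)]) < height xs"
  by (induction xs arbitrary: l) (auto simp: height_def split: nat.split)

lemma E_height:
  assumes "p \<in> supp_in {ws. height ws < Suc h}"
  shows "E k p \<in> supp_in {ws. height ws < h}"
proof (rule lin_supp_in[OF lin_opr assms])
  fix ws :: "(nat \<times> nat) list" assume ws: "ws \<in> {ws. height ws < Suc h}"
  have "ws[l := (fst (ws ! l), k)] \<in> {ws. height ws < h}" if "l < length ws" "snd (ws ! l) = k + 1" for l
    using height_update[OF that(1), of k "fst (ws ! l)"] that(2) ws by simp
  then have "replace_letter n s k (k + 1) k ws \<in> supp_in {ws. height ws < h}"
    unfolding replace_letter_def by (auto intro!: supp_in_sum supp_in_scal simp del: mem_Collect_eq)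
  then show "E k (word ws) \<in> supp_in {ws. height ws < h}"
    unfolding opr_def lin_ext_word rho_gen_replace_letter .
qed

text \<open>Some E is applied as long as this gives a nonzero vector; the bound on the height stops
  the process at a singular one.\<close>

lemma stable_sing:
  assumes N: "stable m N" "x \<in> N" "x \<noteq> 0"
  obtains y where "y \<in> N" "y \<noteq> 0" "sing m y"
proof -
  have "\<exists>y\<in>N. y \<noteq> 0 \<and> sing m y" if "x \<in> supp_in {ws. height ws < h}" for h
    using that N(2,3)
  proof (induction h arbitrary: x)
    case 0
    then have "x = 0" by (intro free_alg_eqI) (use supp_inD in force)
    then show ?case using 0 by simp
  next
    case (Suc h)
    show ?case
    proof (cases "\<forall>k\<in>{1..<n}. E k x = 0")
      case True
      then show ?thesis using Suc.prems stableD(1)[OF N(1)] by (auto simp: sing_def)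
    next
      case False
      then obtain k where k: "k \<in> {1..<n}" "E k x \<noteq> 0" by blast
      show ?thesis
        by (rule Suc.IH[OF E_height[OF Suc.prems(1)] stableD(5)[OF N(1) _ Suc.prems(2)] k(2)])
          (use k in simp)
    qed
  qed
  moreover have "x \<in> supp_in {ws. height ws < Suc (Max (height ` letters ` Poly_Mapping.keys x))}"
    by (auto simp: supp_in_def less_Suc_eq_le)
  ultimately show thesis using that by blast
qed

lemma vector_space_free_alg: "vector_space (\<lambda>c p. scal c * (p :: 'g free_alg))"
  by unfold_locales (simp_all add: distrib_left scal_add distrib_right scal_mult_left)

lemma finite_tw: "finite (tw m)"
proof (rule finite_subset)
  show "tw m \<subseteq> {xs. set xs \<subseteq> {1..m} \<times> {1..n} \<and> length xs = m}"
  proof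
    fix xs assume xs: "xs \<in> tw m"
    then have f: "map fst xs = [1..<Suc m]" and "snd ` set xs \<subseteq> {1..n}" by (auto simp: tw_def)
    moreover have "fst ` set xs \<subseteq> {1..m}" using arg_cong[OF f, of set] by auto
    moreover have "length xs = m" using arg_cong[OF f, of length] by simp
    ultimately show "xs \<in> {xs. set xs \<subseteq> {1..m} \<times> {1..n} \<and> length xs = m}" by force
  qed
qed (rule finite_lists_length_eq, simp)

text \<open>If x lies outside N, a linear functional vanishes on N but not at x. Finitely many words
  span \<open>T m\<close>, so the functional is the pairing with some vector y, which is then a
  nonzero element of the complement.\<close>

lemma stable_eq_T:
  assumes "stable m N" "orth m N = {0}"
  shows "N = T m"
proof (rule ccontr)
  assume "N \<noteq> T m"
  then obtain x where x: "x \<in> T m" "x \<notin> N" using stableD(1)[OF assms(1)] by blast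
  interpret vector_space "\<lambda>c p. scal c * (p :: (nat \<times> nat) free_alg)"
    by (rule vector_space_free_alg)
  interpret P: vector_space_pair "\<lambda>c p. scal c * (p :: (nat \<times> nat) free_alg)" "(*) :: complex \<Rightarrow> complex \<Rightarrow> complex"
    by unfold_locales (simp_all add: algebra_simps)
  have sub: "subspace N"
    using stableD[OF assms(1)] by (auto simp: subspace_def)
  obtain B where B: "B \<subseteq> N" "independent B" "N \<subseteq> span B" "card B = dim N"
    by (rule basis_exists)
  have spanB: "span B = N" using B sub by (metis span_subspace)
  have "independent (insert x B)"
    using B x(2) spanB by (intro independent_insertI) auto
  then obtain g where g: "Vector_Spaces.linear (\<lambda>c p. scal c * p) (*) g"
    "\<forall>y\<in>insert x B. g y = (if y = x then 1 else 0)"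
    using P.linear_independent_extend[of "insert x B" "\<lambda>y. if y = x then 1 else 0"] by blast
  have gadd: "g (a + b) = g a + g b" and gsc: "g (scal c * a) = c * g a" for a b c
    using g(1) by (simp_all add: Vector_Spaces.linear_iff)
  have gN: "g y = 0" if "y \<in> N" for y
  proof -
    have "y \<in> span B" using that spanB by simp
    then show ?thesis
    proof (induction rule: span_induct_alt)
      case base
      show ?case using gsc[of 0 0] by simp
    next
      case (step c z y)
      then have "g z = 0" using g(2) B(1) x(2) by auto
      then show ?case using step by (simp add: gadd gsc)
    qed
  qed
  \<comment> \<open>The vector that represents the functional g: its coefficients are the values of
    g on words.\<close>
  define y where "y = (\<Sum>ws\<in>tw m. scal (g (word ws)) * word ws)"
  have yT: "y \<in> T m" unfolding y_def by (intro supp_in_sum supp_in_scal) simp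
  have gy: "form y p = g p" if "p \<in> T m" for p
    using that
  proof (induction rule: supp_in_induct)
    case zero
    show ?case using gsc[of 0 0] by simp
  next
    case (word c ws)
    have "form y (word ws) = (\<Sum>vs\<in>tw m. if vs = ws then g (word ws) else 0)"
      unfolding y_def form_simps by (intro sum.cong) (auto simp: form_word_word)
    also have "\<dots> = g (word ws)" using word finite_tw by simp
    finally show ?case by (simp add: form_simps gsc)
  qed (simp add: form_simps gadd)
  have "y \<in> orth m N"
    using yT gy gN stableD(1)[OF assms(1)] by (auto simp: orth_def)
  then have "y = 0" using assms(2) by simp
  then show False using gy[OF x(1)] g(2) by simp
qed

section \<open>The cyclic modules of a complete orthogonal family of singular vectors\<close>

context
  fixes m v
  assumes fam: "sing_family m v"
begin

lemma fam_props:
  assumes "t \<in> paths m"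
  shows "v t \<in> T m" "isw (content t) (v t)" "\<And>k. k \<in> {1..<n} \<Longrightarrow> E k (v t) = 0" "form (v t) (v t) \<noteq> 0"
    "v t \<noteq> 0"
proof -
  show "v t \<in> T m" "isw (content t) (v t)" "\<And>k. k \<in> {1..<n} \<Longrightarrow> E k (v t) = 0" "form (v t) (v t) \<noteq> 0"
    using fam assms by (auto simp: sing_family_def sing_def)
  then show "v t \<noteq> 0" by auto
qed

text \<open>The complement of \<open>cyc (v t')\<close> contains v t by singularity; it is stable,
  so it contains all of \<open>cyc (v t)\<close>.\<close>

lemma fam_orth:
  assumes "t \<in> paths m" "t' \<in> paths m" "t \<noteq> t'" "x \<in> cyc (v t)" "y \<in> cyc (v t')"
  shows "form x y = 0"
proof -
  have "form (v t) (v t') = 0" using fam assms by (auto simp: sing_family_def)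
  then have "v t \<in> orth m (cyc (v t'))"
    unfolding orth_def using form_sing_cyc[OF fam_props(1-3)[OF assms(2)] fam_props(3)[OF assms(1)]]
      fam_props(1)[OF assms(1)] by blast
  then have "cyc (v t) \<subseteq> orth m (cyc (v t'))"
    by (intro cyc_least[of m] stable_orth stable_cyc fam_props(1) assms(2))
  then show ?thesis using assms by (auto simp: orth_def)
qed

text \<open>N contains a nonzero singular vector x. Subtracting its projection to v t, possible
  because v t has nonzero norm, leaves a singular vector orthogonal to the whole family, hence zero;
  so N contains v t.\<close>

lemma fam_irreducible:
  assumes t: "t \<in> paths m" and N: "stable m N" "N \<subseteq> cyc (v t)" "N \<noteq> {0}"
  shows "N = cyc (v t)"
proof -
  obtain x0 where "x0 \<in> N" "x0 \<noteq> 0" using N stableD(2)[OF N(1)] by blast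
  then obtain x where x: "x \<in> N" "x \<noteq> 0" "sing m x" by (rule stable_sing[OF N(1)])
  define c where "c = form x (v t) / form (v t) (v t)"
  let ?y = "x - scal c * v t"
  have "?y = 0"
  proof (rule sing_orth_eq_0[OF fam])
    show "sing m ?y"
      using x(3) fam_props[OF t] by (auto simp: sing_def opr_lin intro!: supp_in_diff supp_in_scal)
    fix t' assume t': "t' \<in> paths m"
    show "form ?y (v t') = 0"
    proof (cases "t' = t")
      case True
      then show ?thesis using fam_props(4)[OF t] by (simp add: form_simps c_def)
    next
      case False
      have "?y \<in> cyc (v t)"
        using x N(2) stable_cyc[OF fam_props(1)[OF t]] cycI by (blast intro: stable_diff stableD)
      then show ?thesis using fam_orth[OF t t'] False cycI by metis
    qed
  qed
  then have "x = scal c * v t" by simp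
  moreover from this have "c \<noteq> 0" using x(2) by auto
  ultimately have "v t = scal (1 / c) * x" by (simp add: scal_mult_left)
  then have "v t \<in> N" using stableD(4)[OF N(1) x(1)] by simp
  then show ?thesis using cyc_least[OF N(1)] N(2) by blast
qed

text \<open>The complement of the sum is stable, so if it were nonzero it would contain a nonzero
  singular vector orthogonal to every v t.\<close>

lemma fam_sum: "x \<in> T m \<Longrightarrow> \<exists>w. (\<forall>t\<in>paths m. w t \<in> cyc (v t)) \<and> x = (\<Sum>t\<in>paths m. w t)"
proof -
  let ?S = "{\<Sum>t\<in>paths m. w t | w. \<forall>t\<in>paths m. w t \<in> cyc (v t)}"
  have st: "stable m (cyc (v t))" if "t \<in> paths m" for t
    using stable_cyc fam_props(1)[OF that] by blast
  have stS: "stable m ?S"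
    unfolding stable_def
  proof (intro conjI ballI allI)
    show "?S \<subseteq> T m" using stableD(1)[OF st] by (auto intro!: supp_in_sum)
    show "0 \<in> ?S"
      by (rule CollectI, rule exI[of _ "\<lambda>_. 0"]) (use stableD(2)[OF st] in auto)
    fix x assume "x \<in> ?S"
    then obtain w where w: "x = (\<Sum>t\<in>paths m. w t)" "\<forall>t\<in>paths m. w t \<in> cyc (v t)" by blast
    show "scal c * x \<in> ?S" for c
      by (rule CollectI, rule exI[of _ "\<lambda>t. scal c * w t"])
        (use w stableD(4)[OF st] in \<open>auto simp: sum_distrib_left\<close>)
    show "opr g x \<in> ?S" if "g \<in> uq_gens n" for g
      by (rule CollectI, rule exI[of _ "\<lambda>t. opr g (w t)"])
        (use w stableD(5)[OF st that] in \<open>auto simp: opr_lin\<close>)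
    fix y assume "y \<in> ?S"
    then obtain w' where w': "y = (\<Sum>t\<in>paths m. w' t)" "\<forall>t\<in>paths m. w' t \<in> cyc (v t)" by blast
    show "x + y \<in> ?S"
      by (rule CollectI, rule exI[of _ "\<lambda>t. w t + w' t"])
        (use w w' stableD(3)[OF st] in \<open>auto simp: sum.distrib\<close>)
  qed
  have sub: "cyc (v t) \<subseteq> ?S" if t: "t \<in> paths m" for t
  proof
    fix x assume x: "x \<in> cyc (v t)"
    have "x = (\<Sum>t'\<in>paths m. if t' = t then x else 0)" using t finite_paths by simp
    then show "x \<in> ?S"
      by (intro CollectI exI[of _ "\<lambda>t'. if t' = t then x else 0"]) (use x stableD(2)[OF st] in auto)
  qed
  have "orth m ?S = {0}"
  proof (rule ccontr)
    assume ne: "orth m ?S \<noteq> {0}"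
    have so: "stable m (orth m ?S)" by (rule stable_orth[OF stS])
    then obtain x0 where "x0 \<in> orth m ?S" "x0 \<noteq> 0" using ne stableD(2)[OF so] by blast
    then obtain x where x: "x \<in> orth m ?S" "x \<noteq> 0" "sing m x" by (rule stable_sing[OF so])
    have "x = 0"
      using sing_orth_eq_0[OF fam x(3)] x(1) sub cycI unfolding orth_def by blast
    then show False using x(2) by simp
  qed
  then have "?S = T m" by (rule stable_eq_T[OF stS])
  then show "x \<in> T m \<Longrightarrow> ?thesis" by blast
qed

text \<open>For a bilinear form mutual orthogonality alone does not give independence. Since the
  modules together span everything, w t can be tested against an arbitrary r.\<close>

lemma fam_direct:
  assumes w: "\<forall>t\<in>paths m. w t \<in> cyc (v t)" and 0: "(\<Sum>t\<in>paths m. w t) = 0" and t: "t \<in> paths m"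
  shows "w t = 0"
proof (rule form_nondegenerate)
  show "w t \<in> T m" using w t stableD(1)[OF stable_cyc[OF fam_props(1)[OF t]]] by blast
  have other: "form (w t') y = 0" if "t' \<in> paths m" "t' \<noteq> t''" "t'' \<in> paths m" "y \<in> cyc (v t'')" for t' t'' y
    using fam_orth[OF that(1,3,2)] w that by blast
  fix r assume "r \<in> T m"
  then obtain w' where w': "\<forall>t\<in>paths m. w' t \<in> cyc (v t)" "r = (\<Sum>t\<in>paths m. w' t)"
    using fam_sum by blast
  have o1: "form (w t) (w' t') = 0" "form (w t') (w' t) = 0" if "t' \<in> paths m" "t' \<noteq> t" for t'
    using other[OF t _ that(1), of "w' t'"] other[OF that t, of "w' t"] that w'(1) t by auto
  have "form (w t) r = (\<Sum>t'\<in>paths m. if t' = t then form (w t) (w' t) else 0)"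
    unfolding w'(2) form_simps by (intro sum.cong) (use o1 in auto)
  also have "\<dots> = form (w t) (w' t)" using t finite_paths by simp
  \<comment> \<open>Against w' t only the component w t counts, so it may be replaced by the whole
    sum, which is zero.\<close>
  also have "\<dots> = form (\<Sum>t'\<in>paths m. w t') (w' t)"
  proof -
    have "form (\<Sum>t'\<in>paths m. w t') (w' t) = (\<Sum>t'\<in>paths m. if t' = t then form (w t) (w' t) else 0)"
      unfolding form_simps by (intro sum.cong) (use o1 in auto)
    then show ?thesis using t finite_paths by simp
  qed
  finally show "form (w t) r = 0" by (simp add: 0)
qed

end

section \<open>Cyclicity\<close>

definition wd :: "(nat \<Rightarrow> nat) \<Rightarrow> (nat \<times> nat) list" where
  "wd f = map (\<lambda>i. (i, f i)) [1..<Suc n]"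

lemma wd_cong: "(\<And>i. i \<in> {1..n} \<Longrightarrow> f i = g i) \<Longrightarrow> wd f = wd g"
  by (auto simp: wd_def)

lemma tw_n_wd: "tw n = wd ` ({1..n} \<rightarrow>\<^sub>E {1..n})"
proof (intro equalityI subsetI)
  fix xs assume xs: "xs \<in> tw n"
  then have f: "map fst xs = [1..<Suc n]" and s: "snd ` set xs \<subseteq> {1..n}" by (auto simp: tw_def)
  have len: "length xs = n" using arg_cong[OF f, of length] by simp
  have nth: "fst (xs ! i) = Suc i" if "i < n" for i
    using arg_cong[OF f, of "\<lambda>l. l ! i"] that len by (simp del: upt_Suc)
  let ?f = "\<lambda>i\<in>{1..n}. snd (xs ! (i - 1))"
  have "xs = wd ?f"
    unfolding wd_def
    by (rule nth_equalityI) (use len nth in \<open>auto simp del: upt_Suc intro!: prod_eqI\<close>)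
  moreover have "?f \<in> {1..n} \<rightarrow>\<^sub>E {1..n}"
    using s len nth_mem by (fastforce simp: image_subset_iff)
  ultimately show "xs \<in> wd ` ({1..n} \<rightarrow>\<^sub>E {1..n})" by blast
next
  fix xs assume "xs \<in> wd ` ({1..n} \<rightarrow>\<^sub>E {1..n})"
  then obtain f where f: "xs = wd f" "f \<in> {1..n} \<rightarrow>\<^sub>E {1..n}" by blast
  have "f i \<in> {1..n}" if "i \<in> {1..n}" for i using f(2) that by blast
  then show "xs \<in> tw n" by (auto simp: f(1) tw_def wd_def comp_def simp del: upt_Suc)
qed

lemma wd_update:
  assumes "l < n"
  shows "(wd f)[l := (fst (wd f ! l), b)] = wd (f(Suc l := b))"
  by (rule nth_equalityI) (use assms in \<open>auto simp: wd_def nth_list_update simp del: upt_Suc\<close>)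

text \<open>Cyclicity uses of the coefficients only that they are nonzero, so the powers of s are
  hidden behind an existential quantifier.\<close>

lemma replace_letter_wd:
  "\<exists>c. (\<forall>i. c i \<noteq> 0) \<and> replace_letter n s k a b (wd f)
    = (\<Sum>i=1..n. if f i = a then scal (c i) * word (wd (f(i := b))) else 0)"
proof (intro exI conjI allI)
  let ?c = "\<lambda>i. q_factor n s k (wd f) (i - 1)"
  show "?c i \<noteq> 0" for i by (simp add: q_factor_def)
  have len: "length (wd f) = n" by (simp add: wd_def)
  have "replace_letter n s k a b (wd f) = (\<Sum>l<n. if f (Suc l) = a then scal (?c (Suc l)) * word (wd (f(Suc l := b))) else 0)"
    unfolding replace_letter_def len
    by (intro sum.cong) (auto simp: wd_update, auto simp: wd_def simp del: upt_Suc)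
  also have "\<dots> = (\<Sum>i=1..n. if f i = a then scal (?c i) * word (wd (f(i := b))) else 0)"
    by (rule sum.reindex_bij_witness[of _ "\<lambda>i. i - 1" Suc]) auto
  finally show "replace_letter n s k a b (wd f)
    = (\<Sum>i=1..n. if f i = a then scal (?c i) * word (wd (f(i := b))) else 0)" .
qed

section \<open>A submodule that contains the word of the identity contains all words\<close>

context
  fixes X
  assumes X: "stable n X"
begin

lemma stable_cancel: "scal c * x \<in> X \<Longrightarrow> c \<noteq> 0 \<Longrightarrow> x \<in> X"
  using stableD(4)[OF X, of "scal c * x" "1 / c"] by (simp add: scal_mult_left)

lemma replace_letter_X:
  assumes "k \<in> {1..<n}" "(a = k \<and> b = k + 1) \<or> (a = k + 1 \<and> b = k)" "word (wd f) \<in> X"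
  shows "replace_letter n s k a b (wd f) \<in> X"
  using assms stableD(5)[OF X _ assms(3), of "GenE k"] stableD(5)[OF X _ assms(3), of "GenF k"]
  by (auto simp: opr_def rho_gen_replace_letter)

text \<open>A single occurrence of the letter a leaves a single summand, with nonzero
  coefficient.\<close>

lemma move_unique:
  assumes k: "k \<in> {1..<n}" "(a = k \<and> b = k + 1) \<or> (a = k + 1 \<and> b = k)"
    and f: "word (wd f) \<in> X" "p \<in> {1..n}" "\<And>i. i \<in> {1..n} \<Longrightarrow> f i = a \<longleftrightarrow> i = p"
  shows "word (wd (f(p := b))) \<in> X"
proof -
  obtain c where c: "\<forall>i. c i \<noteq> (0::complex)" "replace_letter n s k a b (wd f)
    = (\<Sum>i=1..n. if f i = a then scal (c i) * word (wd (f(i := b))) else 0)"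
    using replace_letter_wd by blast
  have "\<dots> = (\<Sum>i=1..n. if i = p then scal (c p) * word (wd (f(p := b))) else 0)"
    by (intro sum.cong) (use f(3) in auto)
  then have "scal (c p) * word (wd (f(p := b))) \<in> X"
    using replace_letter_X[OF k f(1)] c(2) f(2) by simp
  then show ?thesis using stable_cancel c(1) by blast
qed

text \<open>One generator turns k + 1 into a second k. The opposite generator then changes either of
  the two k's; one result is f itself and can be subtracted, the other is the word with the two
  letters exchanged.\<close>

lemma swap_adjacent:
  assumes k: "k \<in> {1..<n}" and f: "word (wd f) \<in> X" "f permutes {1..n}"
  shows "word (wd (Transposition.transpose k (k + 1) \<circ> f)) \<in> X"
proof -
  obtain p p' where p: "p \<in> {1..n}" "f p = k" "p' \<in> {1..n}" "f p' = k + 1"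
    using permutes_image[OF f(2)] k by (metis (no_types, lifting) Suc_eq_plus1 Suc_leI atLeastAtMost_iff
        atLeastLessThan_iff imageE le_SucI less_imp_le_nat)
  have inj: "f i = f j \<longleftrightarrow> i = j" for i j using permutes_inj[OF f(2)] by (auto dest: injD)
  have pp: "p \<noteq> p'" using p by auto
  let ?g = "f(p' := k)"
  have g: "word (wd ?g) \<in> X"
    by (rule move_unique[OF k _ f(1) p(3), of "k + 1" k]) (use inj[of _ p'] p in auto)
  obtain c where c: "\<forall>i. c i \<noteq> (0::complex)" "replace_letter n s k k (k + 1) (wd ?g)
    = (\<Sum>i=1..n. if ?g i = k then scal (c i) * word (wd (?g(i := k + 1))) else 0)"
    using replace_letter_wd by blast
  have gk: "?g i = k \<longleftrightarrow> i = p \<or> i = p'" for i using inj[of i p] p by auto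
  have "(\<Sum>i=1..n. if ?g i = k then scal (c i) * word (wd (?g(i := k + 1))) else 0)
    = (\<Sum>i\<in>{p, p'}. scal (c i) * word (wd (?g(i := k + 1))))"
    unfolding gk by (rule sum.mono_neutral_cong_right) (use p in auto)
  also have "\<dots> = scal (c p) * word (wd (?g(p := k + 1))) + scal (c p') * word (wd f)"
    using pp p(4) by (simp add: fun_upd_idem)
  finally have "scal (c p) * word (wd (?g(p := k + 1))) + scal (c p') * word (wd f) \<in> X"
    using replace_letter_X[OF k _ g, of k "k + 1"] c(2) by simp
  then have "scal (c p) * word (wd (?g(p := k + 1))) \<in> X"
    using stable_diff[OF X _ stableD(4)[OF X f(1), of "c p'"]] by (metis add_diff_cancel_right')
  then have "word (wd (?g(p := k + 1))) \<in> X" using stable_cancel c(1) by blast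
  moreover have "?g(p := k + 1) = Transposition.transpose k (k + 1) \<circ> f"
  proof
    fix i
    have "f i = k \<longleftrightarrow> i = p" "f i = k + 1 \<longleftrightarrow> i = p'"
      using inj[of i p] inj[of i p'] p(2,4) by auto
    then show "(?g(p := k + 1)) i = (Transposition.transpose k (k + 1) \<circ> f) i"
      using pp by (simp add: Transposition.transpose_def)
  qed
  ultimately show ?thesis by simp
qed

lemma swap_any:
  assumes "a < b" "a \<in> {1..n}" "b \<in> {1..n}" "word (wd f) \<in> X" "f permutes {1..n}"
  shows "word (wd (Transposition.transpose a b \<circ> f)) \<in> X"
  using assms
proof (induction "b - a" arbitrary: b f rule: less_induct)
  case less
  show ?case
  proof (cases "b = a + 1")
    case True
    then show ?thesis using swap_adjacent[of a f] less.prems by simp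
  next
    case False
    define c where "c = b - 1"
    have c: "a < c" "c + 1 = b" "c \<in> {1..<n}" "c \<in> {1..n}" using False less.prems by (auto simp: c_def)
    let ?t = "Transposition.transpose c (c + 1)" and ?u = "Transposition.transpose a c"
    have t: "?t permutes {1..n}" "?u permutes {1..n}"
      using c less.prems by (auto intro!: permutes_swap_id)
    have 1: "word (wd (?t \<circ> f)) \<in> X" by (rule swap_adjacent[OF c(3) less.prems(4,5)])
    have p1: "(?t \<circ> f) permutes {1..n}" by (rule permutes_compose[OF less.prems(5) t(1)])
    have 2: "word (wd (?u \<circ> (?t \<circ> f))) \<in> X"
      by (rule less.hyps) (use c less.prems 1 p1 in auto)
    have p2: "(?u \<circ> (?t \<circ> f)) permutes {1..n}" by (rule permutes_compose[OF p1 t(2)])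
    have 3: "word (wd (?t \<circ> (?u \<circ> (?t \<circ> f)))) \<in> X" by (rule swap_adjacent[OF c(3) 2 p2])
    \<comment> \<open>The transposition of a and b is the conjugate of that of a and b - 1 by an
      adjacent one.\<close>
    have "?t \<circ> (?u \<circ> (?t \<circ> f)) = Transposition.transpose a b \<circ> f"
      using c(1) by (auto simp: fun_eq_iff Transposition.transpose_def simp flip: c(2))
    then show ?thesis using 3 by simp
  qed
qed

lemma permutation_X:
  assumes id: "word (wd id) \<in> X" and f: "f permutes {1..n}"
  shows "word (wd f) \<in> X"
proof -
  have "f permutes {1..n} \<and> word (wd f) \<in> X"
  proof (rule permutes_induct[of f "{1..n}" "\<lambda>f. f permutes {1..n} \<and> word (wd f) \<in> X"])
    fix a b p
    assume ab: "a \<in> {1..n}" "b \<in> {1..n}" "p permutes {1..n} \<and> word (wd p) \<in> X" 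
    have perm: "(Transposition.transpose a b \<circ> p) permutes {1..n}"
      using ab by (intro permutes_compose permutes_swap_id) auto
    consider "a = b" | "a < b" | "b < a" by linarith
    then show "(Transposition.transpose a b \<circ> p) permutes {1..n} \<and> word (wd (Transposition.transpose a b \<circ> p)) \<in> X"
      using ab perm swap_any[of a b p] swap_any[of b a p]
      by cases (auto simp: transpose_commute)
  qed (use f id in \<open>auto simp: permutes_id\<close>)
  then show ?thesis by blast
qed

text \<open>The induction measure for cyclicity: for f mapping {1..n} to itself it vanishes exactly
  when f is bijective there.\<close>

definition missing :: "(nat \<Rightarrow> nat) \<Rightarrow> nat" where
  "missing f = card ({1..n} - f ` {1..n})"

lemma missing_less:
  assumes "b \<in> {1..n}" "b \<notin> f ` {1..n}" "p \<in> {1..n}" "p' \<in> {1..n}" "p \<noteq> p'" "f p = f p'"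
  shows "missing (f(p := b)) < missing f"
  unfolding missing_def
proof (rule psubset_card_mono)
  have "f ` {1..n} \<subseteq> (f(p := b)) ` {1..n}"
  proof
    fix y assume "y \<in> f ` {1..n}"
    then obtain i where i: "i \<in> {1..n}" "y = f i" by blast
    then show "y \<in> (f(p := b)) ` {1..n}"
      using assms by (cases "i = p") (auto intro: image_eqI[of _ _ p'] image_eqI[of _ _ i])
  qed
  moreover have "b \<in> (f(p := b)) ` {1..n}" using assms(3) by (auto intro: image_eqI[of _ _ p])
  ultimately show "{1..n} - (f(p := b)) ` {1..n} \<subset> {1..n} - f ` {1..n}"
    using assms(1,2) by blast
qed simp

lemma missing_eq:
  assumes "b \<in> {1..n}" "b \<notin> f ` {1..n}" "p \<in> {1..n}" "f p \<in> {1..n}" "\<And>i. i \<in> {1..n} \<Longrightarrow> f i = f p \<Longrightarrow> i = p"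
  shows "missing (f(p := b)) = missing f"
proof -
  have "(f(p := b)) ` {1..n} = insert b (f ` {1..n} - {f p})"
    using assms(3,5) by (auto simp: image_iff)
  then have "{1..n} - (f(p := b)) ` {1..n} = insert (f p) ({1..n} - f ` {1..n} - {b})"
    using assms by auto
  moreover have "f p \<notin> {1..n} - f ` {1..n} - {b}" using assms(3) by auto
  moreover have "card ({1..n} - f ` {1..n} - {b}) = card ({1..n} - f ` {1..n}) - 1" "card ({1..n} - f ` {1..n}) > 0"
    using assms(1,2) by (auto simp: card_gt_0_iff)
  ultimately show ?thesis by (simp add: missing_def)
qed

text \<open>
  A repeated letter \<open>a\<close> and a missing letter \<open>b\<close> are brought next to each other; then one copy of
  \<open>a\<close> is produced from \<open>b\<close> by a single generator.
\<close>

lemma word_X_repeated: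
  assumes IH: "\<And>g. g ` {1..n} \<subseteq> {1..n} \<Longrightarrow> missing g < D \<Longrightarrow> word (wd g) \<in> X"
    and f: "f ` {1..n} \<subseteq> {1..n}" "missing f = D"
    and a: "p \<in> {1..n}" "p' \<in> {1..n}" "p \<noteq> p'" "f p = a" "f p' = a"
    and b: "b \<in> {1..n}" "b \<notin> f ` {1..n}"
  shows "word (wd f) \<in> X"
  using f a b
proof (induction "nat \<bar>int a - int b\<bar>" arbitrary: f a b p p' rule: less_induct)
  case less
  note f = less.prems(1,2) and a = less.prems(3-7) and b = less.prems(8,9)
  have ain: "a \<in> {1..n}" using f(1) a(1,4) by blast
  have ab: "a \<noteq> b" using a b by auto
  \<comment> \<open>The neighbour of b on the side of a: a single generator turns b into c, and c is
    closer to a.\<close>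
  define c where "c = (if a < b then b - 1 else b + 1)"
  define k where "k = min b c"
  have c: "c \<in> {1..n}" "c \<noteq> b" "k \<in> {1..<n}" "(b = k \<and> c = k + 1) \<or> (b = k + 1 \<and> c = k)"
    and dist: "c \<noteq> a \<Longrightarrow> nat \<bar>int a - int c\<bar> < nat \<bar>int a - int b\<bar>"
    using ab ain b(1) by (auto simp: c_def k_def)
  have fb: "f i \<noteq> b" if "i \<in> {1..n}" for i using b(2) that by auto
  \<comment> \<open>As f omits b, the letter b occurs in \<open>f(r := b)\<close> only at r, and
    turning it back into c recovers f.\<close>
  have finish: "word (wd f) \<in> X" if r: "r \<in> {1..n}" "f r = c" "word (wd (f(r := b))) \<in> X" for r
  proof -
    have "word (wd ((f(r := b))(r := c))) \<in> X"
      by (rule move_unique[OF c(3,4) r(3,1)]) (use fb in auto)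
    then show ?thesis using r(2) by (simp add: fun_upd_idem)
  qed
  have upd: "(f(r := b)) ` {1..n} \<subseteq> {1..n}" for r using f(1) b(1) by auto
  show ?case
  proof (cases "\<exists>r\<in>{1..n}. \<exists>r'\<in>{1..n}. r \<noteq> r' \<and> f r = c \<and> f r' = c")
    case True
    then obtain r r' where r: "r \<in> {1..n}" "r' \<in> {1..n}" "r \<noteq> r'" "f r = c" "f r' = c" by blast
    \<comment> \<open>When c is repeated, putting b in place of one copy enlarges the image, and the
      outer induction applies.\<close>
    have "missing (f(r := b)) < D"
      using missing_less[OF b r(1-3)] r f(2) by simp
    then show ?thesis using finish[OF r(1,4)] IH[OF upd] by blast
  next
    case False
    then have ca: "c \<noteq> a" using a by blast
    show ?thesis
    proof (cases "c \<in> f ` {1..n}")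
      case True
      then obtain r where r: "r \<in> {1..n}" "f r = c" by auto
      have uniq: "i = r" if "i \<in> {1..n}" "f i = c" for i using False r that by blast
      \<comment> \<open>With a single c, the gap moves from b to c: the measure is unchanged and the
        gap is closer to the repeated letter a.\<close>
      have "missing (f(r := b)) = D"
        using missing_eq[OF b r(1)] r(2) c(1) uniq f(2) by simp
      moreover have "p \<noteq> r" "p' \<noteq> r" using a r ca by auto
      moreover have "c \<notin> (f(r := b)) ` {1..n}" using uniq c(2) by auto
      ultimately have "word (wd (f(r := b))) \<in> X"
        using less.hyps[OF dist[OF ca], of "f(r := b)" p p'] upd a c(1) by simp
      then show ?thesis using finish[OF r] by blast
    next
      case False
      then show ?thesis
        using less.hyps[OF dist[OF ca], of f p p'] f a c(1) by blast
    qed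
  qed
qed

lemma word_X:
  assumes id: "word (wd id) \<in> X" and f: "f ` {1..n} \<subseteq> {1..n}"
  shows "word (wd f) \<in> X"
  using f
proof (induction "missing f" arbitrary: f rule: less_induct)
  case less
  show ?case
  proof (cases "inj_on f {1..n}")
    case True
    let ?g = "\<lambda>i. if i \<in> {1..n} then f i else i"
    have "bij_betw f {1..n} {1..n}"
      using True less.prems by (simp add: bij_betw_def endo_inj_surj)
    then have "bij_betw ?g {1..n} {1..n}"
      by (rule bij_betw_cong[THEN iffD1, rotated]) auto
    then have "?g permutes {1..n}"
      by (rule bij_imp_permutes) auto
    then have "word (wd ?g) \<in> X" by (rule permutation_X[OF id])
    moreover have "wd ?g = wd f" by (rule wd_cong) auto
    ultimately show ?thesis by simp
  next
    case False
    then obtain p p' where p: "p \<in> {1..n}" "p' \<in> {1..n}" "p \<noteq> p'" "f p = f p'"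
      by (auto simp: inj_on_def)
    have "f ` {1..n} \<noteq> {1..n}"
      using False finite_surj_inj[of "{1..n}" f] by auto
    then obtain b where b: "b \<in> {1..n}" "b \<notin> f ` {1..n}" using less.prems by blast
    show ?thesis
      by (rule word_X_repeated[of "missing f" f p p' "f p" b]) (use less p b in auto)
  qed
qed

lemma X_eq_T: "word (wd id) \<in> X \<Longrightarrow> X = T n"
proof
  assume id: "word (wd id) \<in> X"
  show "X \<subseteq> T n" using stableD(1)[OF X] by blast
  show "T n \<subseteq> X"
  proof
    fix x assume "x \<in> T n"
    then show "x \<in> X"
    proof (induction rule: supp_in_induct)
      case (word c ws)
      then obtain f where "ws = wd f" "f \<in> {1..n} \<rightarrow>\<^sub>E {1..n}" by (auto simp: tw_n_wd)
      then show ?case using word_X[OF id, of f] by (auto intro!: stableD(4)[OF X])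
    qed (auto intro: stableD[OF X])
  qed
qed

end

lemma cyc_generator: "cyc (word (wd id)) = T n"
proof (rule X_eq_T)
  have "wd id \<in> tw n" by (auto simp: tw_def wd_def comp_def simp del: upt_Suc)
  then show "stable n (cyc (word (wd id)))" by (intro stable_cyc) simp
qed (rule cycI)

end

section \<open>Left modules\<close>

context left_module
begin

lemma smult_l_null: "x \<in> carrier M \<Longrightarrow> \<zero> \<odot>\<^bsub>M\<^esub> x = \<zero>\<^bsub>M\<^esub>"
  using smult_l_distr[of \<zero> \<zero> x] smult_closed[of \<zero> x] M.add.l_cancel_one[of "\<zero> \<odot>\<^bsub>M\<^esub> x" "\<zero> \<odot>\<^bsub>M\<^esub> x"]
  by simp

lemma smult_r_null: "a \<in> carrier R \<Longrightarrow> a \<odot>\<^bsub>M\<^esub> \<zero>\<^bsub>M\<^esub> = \<zero>\<^bsub>M\<^esub>"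
  using smult_r_distr[of a "\<zero>\<^bsub>M\<^esub>" "\<zero>\<^bsub>M\<^esub>"] smult_closed[of a "\<zero>\<^bsub>M\<^esub>"]
    M.add.l_cancel_one[of "a \<odot>\<^bsub>M\<^esub> \<zero>\<^bsub>M\<^esub>" "a \<odot>\<^bsub>M\<^esub> \<zero>\<^bsub>M\<^esub>"]
  by simp

lemma smult_l_minus:
  assumes "a \<in> carrier R" "x \<in> carrier M"
  shows "(\<ominus> a) \<odot>\<^bsub>M\<^esub> x = \<ominus>\<^bsub>M\<^esub> (a \<odot>\<^bsub>M\<^esub> x)"
proof -
  have "(\<ominus> a) \<odot>\<^bsub>M\<^esub> x \<oplus>\<^bsub>M\<^esub> a \<odot>\<^bsub>M\<^esub> x = \<zero>\<^bsub>M\<^esub>"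
    using smult_l_distr[of "\<ominus> a" a x] assms smult_l_null by (simp add: R.l_neg)
  then show ?thesis
    using assms by (intro M.minus_equality[symmetric]) (auto intro: smult_closed)
qed

lemma cyclic_submodule:
  assumes "y \<in> carrier M"
  shows "submodule ((\<lambda>a. a \<odot>\<^bsub>M\<^esub> y) ` carrier R) R M"
proof (intro submodule.intro subgroup.intro submodule_axioms.intro)
  show "(\<lambda>a. a \<odot>\<^bsub>M\<^esub> y) ` carrier R \<subseteq> carrier (add_monoid M)"
    using assms smult_closed by auto
  show "\<one>\<^bsub>add_monoid M\<^esub> \<in> (\<lambda>a. a \<odot>\<^bsub>M\<^esub> y) ` carrier R"
    using assms smult_l_null by (auto intro!: image_eqI[of _ _ \<zero>])
  fix x z assume "x \<in> (\<lambda>a. a \<odot>\<^bsub>M\<^esub> y) ` carrier R"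
  then obtain a where a: "a \<in> carrier R" "x = a \<odot>\<^bsub>M\<^esub> y" by blast
  show "inv\<^bsub>add_monoid M\<^esub> x \<in> (\<lambda>a. a \<odot>\<^bsub>M\<^esub> y) ` carrier R"
    using a assms smult_l_minus by (auto intro!: image_eqI[of _ _ "\<ominus> a"] simp flip: a_inv_def)
  assume "z \<in> (\<lambda>a. a \<odot>\<^bsub>M\<^esub> y) ` carrier R"
  then obtain b where b: "b \<in> carrier R" "z = b \<odot>\<^bsub>M\<^esub> y" by blast
  show "x \<otimes>\<^bsub>add_monoid M\<^esub> z \<in> (\<lambda>a. a \<odot>\<^bsub>M\<^esub> y) ` carrier R"
    using a b assms smult_l_distr by (auto intro!: image_eqI[of _ _ "a \<oplus> b"])
next
  fix a x assume "a \<in> carrier R" "x \<in> (\<lambda>a. a \<odot>\<^bsub>M\<^esub> y) ` carrier R"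
  then obtain b where b: "a \<in> carrier R" "b \<in> carrier R" "x = b \<odot>\<^bsub>M\<^esub> y" by blast
  then show "a \<odot>\<^bsub>M\<^esub> x \<in> (\<lambda>a. a \<odot>\<^bsub>M\<^esub> y) ` carrier R"
    using assms smult_assoc1 by (auto intro!: image_eqI[of _ _ "a \<otimes> b"])
qed

end

lemma irreducible_generates:
  assumes irr: "irreducible_module R M" and y: "y \<in> carrier M" "y \<noteq> \<zero>\<^bsub>M\<^esub>" "z \<in> carrier M"
  obtains a where "a \<in> carrier R" "a \<odot>\<^bsub>M\<^esub> y = z"
proof -
  interpret left_module R M using irr by (simp add: irreducible_module_def)
  have "y \<in> (\<lambda>a. a \<odot>\<^bsub>M\<^esub> y) ` carrier R"
    using y(1) smult_one by (auto intro!: image_eqI[of _ _ "\<one>\<^bsub>R\<^esub>"])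
  then have "(\<lambda>a. a \<odot>\<^bsub>M\<^esub> y) ` carrier R = carrier M"
    using y(2) irr cyclic_submodule[OF y(1)] unfolding irreducible_module_def by blast
  then have "z \<in> (\<lambda>a. a \<odot>\<^bsub>M\<^esub> y) ` carrier R" using y(3) by simp
  then show thesis by (auto intro: that)
qed

lemma irreducibleI:
  assumes M: "left_module R M" and "carrier M \<noteq> {\<zero>\<^bsub>M\<^esub>}"
    and gen: "\<And>y z. y \<in> carrier M \<Longrightarrow> y \<noteq> \<zero>\<^bsub>M\<^esub> \<Longrightarrow> z \<in> carrier M \<Longrightarrow> \<exists>a\<in>carrier R. a \<odot>\<^bsub>M\<^esub> y = z"
  shows "irreducible_module R M"
  unfolding irreducible_module_def
proof (intro conjI allI impI M assms(2))
  fix H assume H: "submodule H R M"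
  have sub: "H \<subseteq> carrier M" "\<zero>\<^bsub>M\<^esub> \<in> H"
    using subgroup.subset[OF submodule.axioms(1)[OF H]] subgroup.one_closed[OF submodule.axioms(1)[OF H]] by auto
  show "H = {\<zero>\<^bsub>M\<^esub>} \<or> H = carrier M"
  proof (cases "H = {\<zero>\<^bsub>M\<^esub>}")
    case False
    then obtain y where "y \<in> H" "y \<noteq> \<zero>\<^bsub>M\<^esub>" using sub by blast
    then have "carrier M \<subseteq> H"
      using gen[of y] sub submodule.smult_closed[OF H] by blast
    then show ?thesis using sub by blast
  qed simp
qed

section \<open>Isomorphisms of modules and transport of structure\<close>

definition iso_via :: "'r ring \<Rightarrow> ('r, 'm) module \<Rightarrow> ('r, 'k) module \<Rightarrow> ('m \<Rightarrow> 'k) \<Rightarrow> bool" where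
  "iso_via R M N h \<longleftrightarrow> bij_betw h (carrier M) (carrier N) \<and>
      (\<forall>x\<in>carrier M. \<forall>y\<in>carrier M. h (x \<oplus>\<^bsub>M\<^esub> y) = h x \<oplus>\<^bsub>N\<^esub> h y) \<and>
      (\<forall>a\<in>carrier R. \<forall>x\<in>carrier M. h (a \<odot>\<^bsub>M\<^esub> x) = a \<odot>\<^bsub>N\<^esub> h x)"

lemma module_isomorphic_iso_via: "module_isomorphic R M N \<longleftrightarrow> (\<exists>h. iso_via R M N h)"
  by (simp add: module_isomorphic_def iso_via_def)

lemma iso_viaD:
  assumes "iso_via R M N h"
  shows "bij_betw h (carrier M) (carrier N)" "x \<in> carrier M \<Longrightarrow> h x \<in> carrier N"
    "x \<in> carrier M \<Longrightarrow> y \<in> carrier M \<Longrightarrow> h (x \<oplus>\<^bsub>M\<^esub> y) = h x \<oplus>\<^bsub>N\<^esub> h y"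
    "a \<in> carrier R \<Longrightarrow> x \<in> carrier M \<Longrightarrow> h (a \<odot>\<^bsub>M\<^esub> x) = a \<odot>\<^bsub>N\<^esub> h x"
    "x \<in> carrier M \<Longrightarrow> y \<in> carrier M \<Longrightarrow> h x = h y \<longleftrightarrow> x = y"
    "z \<in> carrier N \<Longrightarrow> \<exists>x\<in>carrier M. h x = z"
proof -
  show "bij_betw h (carrier M) (carrier N)" "x \<in> carrier M \<Longrightarrow> h x \<in> carrier N"
    "x \<in> carrier M \<Longrightarrow> y \<in> carrier M \<Longrightarrow> h (x \<oplus>\<^bsub>M\<^esub> y) = h x \<oplus>\<^bsub>N\<^esub> h y"
    "a \<in> carrier R \<Longrightarrow> x \<in> carrier M \<Longrightarrow> h (a \<odot>\<^bsub>M\<^esub> x) = a \<odot>\<^bsub>N\<^esub> h x"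
    "x \<in> carrier M \<Longrightarrow> y \<in> carrier M \<Longrightarrow> h x = h y \<longleftrightarrow> x = y"
    using assms by (auto simp: iso_via_def bij_betw_def inj_on_def)
  show "z \<in> carrier N \<Longrightarrow> \<exists>x\<in>carrier M. h x = z"
  proof -
    assume "z \<in> carrier N"
    then have "z \<in> h ` carrier M" using assms by (simp add: iso_via_def bij_betw_def)
    then show ?thesis by auto
  qed
qed

lemma iso_via_zero:
  assumes "iso_via R M N h" "left_module R M" "left_module R N"
  shows "h \<zero>\<^bsub>M\<^esub> = \<zero>\<^bsub>N\<^esub>"
proof -
  interpret M: left_module R M by fact
  interpret N: left_module R N by fact
  have z: "\<zero>\<^bsub>M\<^esub> \<in> carrier M" by simp
  show ?thesis
    using iso_viaD(4)[OF assms(1) M.R.zero_closed z] iso_viaD(2)[OF assms(1) z]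
      M.smult_l_null[OF z] N.smult_l_null by simp
qed

text \<open>Formulated with closure of the operations, so that an isomorphism out of a direct sum
  can be inverted before the direct sum is known to be a module.\<close>

lemma iso_via_inv_closed:
  assumes iso: "iso_via R M N h"
    and add: "\<And>x y. x \<in> carrier M \<Longrightarrow> y \<in> carrier M \<Longrightarrow> x \<oplus>\<^bsub>M\<^esub> y \<in> carrier M"
    and smult: "\<And>a x. a \<in> carrier R \<Longrightarrow> x \<in> carrier M \<Longrightarrow> a \<odot>\<^bsub>M\<^esub> x \<in> carrier M"
  shows "iso_via R N M (inv_into (carrier M) h)"
proof -
  let ?g = "inv_into (carrier M) h"
  have bij: "bij_betw h (carrier M) (carrier N)" using iso by (simp add: iso_via_def)
  have g: "?g y \<in> carrier M" "h (?g y) = y" if "y \<in> carrier N" for y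
    using that bij by (auto simp: bij_betw_def inv_into_into f_inv_into_f)
  have gI: "?g y = x" if "x \<in> carrier M" "h x = y" for x y
    using that bij by (auto simp: bij_betw_def)
  show ?thesis
    unfolding iso_via_def
  proof (intro conjI ballI)
    show "bij_betw ?g (carrier N) (carrier M)" by (rule bij_betw_inv_into[OF bij])
    show "?g (x \<oplus>\<^bsub>N\<^esub> y) = ?g x \<oplus>\<^bsub>M\<^esub> ?g y" if "x \<in> carrier N" "y \<in> carrier N" for x y
      by (rule gI) (use g that add in \<open>auto simp: iso_viaD(3)[OF iso]\<close>)
    show "?g (a \<odot>\<^bsub>N\<^esub> x) = a \<odot>\<^bsub>M\<^esub> ?g x" if "a \<in> carrier R" "x \<in> carrier N" for a x
      by (rule gI) (use g that smult in \<open>auto simp: iso_viaD(4)[OF iso]\<close>)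
  qed
qed

lemma iso_via_inv:
  assumes iso: "iso_via R M N h" and M: "left_module R M"
  shows "iso_via R N M (inv_into (carrier M) h)"
proof -
  interpret M: left_module R M by fact
  show ?thesis by (rule iso_via_inv_closed[OF iso]) (blast intro: M.a_closed M.smult_closed)+
qed

lemma iso_via_trans:
  assumes "iso_via R M N h" "iso_via R N P g"
  shows "iso_via R M P (g \<circ> h)"
  unfolding iso_via_def
proof (intro conjI)
  show "bij_betw (g \<circ> h) (carrier M) (carrier P)"
    using assms by (auto simp: iso_via_def intro: bij_betw_trans)
qed (auto simp: iso_viaD[OF assms(1)] iso_viaD[OF assms(2)])

lemma module_isomorphic_sym: "left_module R M \<Longrightarrow> module_isomorphic R M N \<Longrightarrow> module_isomorphic R N M"
  unfolding module_isomorphic_iso_via using iso_via_inv by blast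

lemma module_isomorphic_trans:
  "module_isomorphic R M N \<Longrightarrow> module_isomorphic R N P \<Longrightarrow> module_isomorphic R M P"
  unfolding module_isomorphic_iso_via using iso_via_trans by blast

text \<open>\<open>iso_via\<close> fixes addition and scalar multiplication on the carrier of N but
  does not speak of its zero, whence the third assumption.\<close>

lemma left_module_transport:
  assumes M: "left_module R M" and iso: "iso_via R M N h" and z: "\<zero>\<^bsub>N\<^esub> = h \<zero>\<^bsub>M\<^esub>"
  shows "left_module R N"
proof -
  interpret M: left_module R M by fact
  note iso = iso_viaD[OF iso]
  have ex: "\<exists>x. x \<in> carrier M \<and> y = h x" if "y \<in> carrier N" for y using iso(6) that by blast
  have "abelian_group N"
  proof (rule abelian_groupI)
    show "\<zero>\<^bsub>N\<^esub> \<in> carrier N" using z iso(2) by simp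
    fix x y w assume xyw: "x \<in> carrier N" "y \<in> carrier N"
    obtain x' where x': "x' \<in> carrier M" "x = h x'" using ex xyw by blast
    obtain y' where y': "y' \<in> carrier M" "y = h y'" using ex xyw by blast
    show "x \<oplus>\<^bsub>N\<^esub> y \<in> carrier N" using x' y' iso(2)[of "x' \<oplus>\<^bsub>M\<^esub> y'"] by (simp add: iso(3))
    show "x \<oplus>\<^bsub>N\<^esub> y = y \<oplus>\<^bsub>N\<^esub> x" using x' y' by (simp add: M.M.a_comm flip: iso(3))
    show "\<zero>\<^bsub>N\<^esub> \<oplus>\<^bsub>N\<^esub> x = x" using x' by (simp add: z flip: iso(3))
    show "\<exists>y\<in>carrier N. y \<oplus>\<^bsub>N\<^esub> x = \<zero>\<^bsub>N\<^esub>"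
      using x' by (intro bexI[of _ "h (\<ominus>\<^bsub>M\<^esub> x')"]) (auto simp: z M.M.l_neg iso(2) simp flip: iso(3))
    assume "w \<in> carrier N"
    then obtain w' where w': "w' \<in> carrier M" "w = h w'" using ex by blast
    show "x \<oplus>\<^bsub>N\<^esub> y \<oplus>\<^bsub>N\<^esub> w = x \<oplus>\<^bsub>N\<^esub> (y \<oplus>\<^bsub>N\<^esub> w)"
      using x' y' w' by (simp add: M.M.a_assoc flip: iso(3))
  qed
  moreover have "left_module_axioms R N"
  proof
    show "\<one>\<^bsub>R\<^esub> \<odot>\<^bsub>N\<^esub> x = x" if "x \<in> carrier N" for x
      using ex[OF that] M.smult_one by (auto simp flip: iso(4))
    fix a b x y assume a: "a \<in> carrier R" and x: "x \<in> carrier N"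
    obtain x' where x': "x' \<in> carrier M" "x = h x'" using ex x by blast
    note cl = M.smult_closed
    show "a \<odot>\<^bsub>N\<^esub> x \<in> carrier N" using a x' cl by (auto simp: iso(2) simp flip: iso(4))
    show "a \<odot>\<^bsub>N\<^esub> (x \<oplus>\<^bsub>N\<^esub> y) = a \<odot>\<^bsub>N\<^esub> x \<oplus>\<^bsub>N\<^esub> a \<odot>\<^bsub>N\<^esub> y" if y: "y \<in> carrier N"
    proof -
      obtain y' where y': "y' \<in> carrier M" "y = h y'" using ex[OF y] by blast
      have "a \<odot>\<^bsub>N\<^esub> (x \<oplus>\<^bsub>N\<^esub> y) = h (a \<odot>\<^bsub>M\<^esub> (x' \<oplus>\<^bsub>M\<^esub> y'))"
        using a x' y' by (simp add: iso(3,4))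
      also have "\<dots> = h (a \<odot>\<^bsub>M\<^esub> x' \<oplus>\<^bsub>M\<^esub> a \<odot>\<^bsub>M\<^esub> y')"
        using a x' y' by (simp only: M.smult_r_distr)
      also have "\<dots> = a \<odot>\<^bsub>N\<^esub> x \<oplus>\<^bsub>N\<^esub> a \<odot>\<^bsub>N\<^esub> y"
        using a x' y' cl by (simp add: iso(3,4))
      finally show ?thesis .
    qed
    assume b: "b \<in> carrier R"
    have "(a \<oplus>\<^bsub>R\<^esub> b) \<odot>\<^bsub>N\<^esub> x = h ((a \<oplus>\<^bsub>R\<^esub> b) \<odot>\<^bsub>M\<^esub> x')"
      using a b x' by (simp add: iso(4))
    also have "\<dots> = h (a \<odot>\<^bsub>M\<^esub> x' \<oplus>\<^bsub>M\<^esub> b \<odot>\<^bsub>M\<^esub> x')"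
      using a b x' by (simp only: M.smult_l_distr)
    also have "\<dots> = a \<odot>\<^bsub>N\<^esub> x \<oplus>\<^bsub>N\<^esub> b \<odot>\<^bsub>N\<^esub> x"
      using a b x' cl by (simp add: iso(3,4))
    finally show "(a \<oplus>\<^bsub>R\<^esub> b) \<odot>\<^bsub>N\<^esub> x = a \<odot>\<^bsub>N\<^esub> x \<oplus>\<^bsub>N\<^esub> b \<odot>\<^bsub>N\<^esub> x" .
    have "(a \<otimes>\<^bsub>R\<^esub> b) \<odot>\<^bsub>N\<^esub> x = h ((a \<otimes>\<^bsub>R\<^esub> b) \<odot>\<^bsub>M\<^esub> x')"
      using a b x' by (simp add: iso(4))
    also have "\<dots> = h (a \<odot>\<^bsub>M\<^esub> (b \<odot>\<^bsub>M\<^esub> x'))"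
      using a b x' by (simp only: M.smult_assoc1)
    also have "\<dots> = a \<odot>\<^bsub>N\<^esub> (b \<odot>\<^bsub>N\<^esub> x)"
      using a b x' cl by (simp add: iso(4))
    finally show "(a \<otimes>\<^bsub>R\<^esub> b) \<odot>\<^bsub>N\<^esub> x = a \<odot>\<^bsub>N\<^esub> (b \<odot>\<^bsub>N\<^esub> x)" .
  qed
  ultimately show ?thesis
    using M.R.ring_axioms by (simp add: left_module_def)
qed

lemma irreducible_transport:
  assumes M: "irreducible_module R M" and iso: "iso_via R M N h" and N: "left_module R N"
  shows "irreducible_module R N"
proof -
  have M': "left_module R M" using M by (simp add: irreducible_module_def)
  interpret M: left_module R M by fact
  interpret N: left_module R N by fact
  have z: "h \<zero>\<^bsub>M\<^esub> = \<zero>\<^bsub>N\<^esub>" by (rule iso_via_zero[OF iso M' N])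
  note iso = iso_viaD[OF iso]
  show ?thesis
  proof (rule irreducibleI[OF N])
    obtain x where "x \<in> carrier M" "x \<noteq> \<zero>\<^bsub>M\<^esub>"
      using M M.M.zero_closed unfolding irreducible_module_def by blast
    then have "h x \<noteq> \<zero>\<^bsub>N\<^esub>" "h x \<in> carrier N" using iso(2) iso(5)[of x "\<zero>\<^bsub>M\<^esub>"] z by auto
    then show "carrier N \<noteq> {\<zero>\<^bsub>N\<^esub>}" by blast
    fix y w assume yw: "y \<in> carrier N" "y \<noteq> \<zero>\<^bsub>N\<^esub>" "w \<in> carrier N"
    obtain y' where y': "y' \<in> carrier M" "h y' = y" using iso(6) yw by blast
    obtain w' where w': "w' \<in> carrier M" "h w' = w" using iso(6) yw by blast
    have ny: "y' \<noteq> \<zero>\<^bsub>M\<^esub>" using yw y' z by auto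
    obtain a where a: "a \<in> carrier R" "a \<odot>\<^bsub>M\<^esub> y' = w'"
      by (rule irreducible_generates[OF M y'(1) ny w'(1)])
    then have "a \<odot>\<^bsub>N\<^esub> y = w"
      using iso(4)[OF a(1) y'(1)] y' w' by simp
    then show "\<exists>a\<in>carrier R. a \<odot>\<^bsub>N\<^esub> y = w"
      using a(1) by blast
  qed
qed

subsection \<open>Direct sums\<close>

lemma direct_sum_simps [simp]:
  "carrier (direct_sum I N) = (\<Pi>\<^sub>E i\<in>I. carrier (N i))"
  "\<zero>\<^bsub>direct_sum I N\<^esub> = (\<lambda>i\<in>I. \<zero>\<^bsub>N i\<^esub>)"
  "x \<oplus>\<^bsub>direct_sum I N\<^esub> y = (\<lambda>i\<in>I. x i \<oplus>\<^bsub>N i\<^esub> y i)"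
  "a \<odot>\<^bsub>direct_sum I N\<^esub> x = (\<lambda>i\<in>I. a \<odot>\<^bsub>N i\<^esub> x i)"
  by (simp_all add: direct_sum_def)

lemma direct_sum_cong_iso:
  assumes "bij_betw \<pi> J I" "\<And>j. j \<in> J \<Longrightarrow> module_isomorphic R (N (\<pi> j)) (P j)"
  shows "module_isomorphic R (direct_sum I N) (direct_sum J P)"
proof -
  have "\<forall>j\<in>J. \<exists>h. iso_via R (N (\<pi> j)) (P j) h"
    using assms(2) by (simp add: module_isomorphic_iso_via)
  then obtain h where h: "\<And>j. j \<in> J \<Longrightarrow> iso_via R (N (\<pi> j)) (P j) (h j)"
    by (metis (no_types, lifting))
  have \<pi>: "\<pi> j \<in> I" if "j \<in> J" for j using assms(1) that by (auto simp: bij_betw_def)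
  have inv: "inv_into J \<pi> i \<in> J" "\<pi> (inv_into J \<pi> i) = i" if "i \<in> I" for i
    using assms(1) that by (auto simp: bij_betw_def inv_into_into f_inv_into_f)
  have inv': "inv_into J \<pi> (\<pi> j) = j" if "j \<in> J" for j
    using assms(1) that by (auto simp: bij_betw_def)
  let ?H = "\<lambda>x. \<lambda>j\<in>J. h j (x (\<pi> j))"
  have "iso_via R (direct_sum I N) (direct_sum J P) ?H"
    unfolding iso_via_def
  proof (intro conjI ballI)
    show "bij_betw ?H (carrier (direct_sum I N)) (carrier (direct_sum J P))"
      unfolding bij_betw_def
    proof (intro conjI equalityI subsetI)
      show "inj_on ?H (carrier (direct_sum I N))"
      proof (rule inj_onI)
        fix x y assume xy: "x \<in> carrier (direct_sum I N)" "y \<in> carrier (direct_sum I N)" "?H x = ?H y"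
        show "x = y"
        proof (rule PiE_ext[of _ I "\<lambda>i. carrier (N i)"])
          fix i assume i: "i \<in> I"
          let ?j = "inv_into J \<pi> i"
          have "h ?j (x i) = h ?j (y i)" using fun_cong[OF xy(3), of ?j] inv[OF i] by simp
          moreover have "x i \<in> carrier (N i)" "y i \<in> carrier (N i)" using xy i by auto
          ultimately show "x i = y i" using iso_viaD(5)[OF h[OF inv(1)[OF i]], of "x i" "y i"] inv[OF i] by simp
        qed (use xy in auto)
      qed
      fix y assume "y \<in> ?H ` carrier (direct_sum I N)"
      then obtain x where "x \<in> carrier (direct_sum I N)" "y = ?H x" by blast
      then show "y \<in> carrier (direct_sum J P)"
        using iso_viaD(2)[OF h] \<pi> by (auto simp: PiE_def Pi_def)
    next
      fix y assume y: "y \<in> carrier (direct_sum J P)"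
      let ?g = "\<lambda>j. inv_into (carrier (N (\<pi> j))) (h j)"
      have g: "?g j (y j) \<in> carrier (N (\<pi> j))" "h j (?g j (y j)) = y j" if "j \<in> J" for j
        using iso_viaD(1)[OF h[OF that]] y that
        by (auto simp: bij_betw_def inv_into_into f_inv_into_f PiE_def Pi_def)
      let ?x = "\<lambda>i\<in>I. ?g (inv_into J \<pi> i) (y (inv_into J \<pi> i))"
      have "?x i \<in> carrier (N i)" if "i \<in> I" for i
        using g(1)[OF inv(1)[OF that]] inv(2)[OF that] that by simp
      then have x: "?x \<in> carrier (direct_sum I N)" by auto
      have H: "?H ?x = y"
      proof (rule PiE_ext[of _ J "\<lambda>j. carrier (P j)"])
        show "?H ?x j = y j" if "j \<in> J" for j using that g \<pi> inv' by simp
        show "?H ?x \<in> (\<Pi>\<^sub>E j\<in>J. carrier (P j))"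
          using g \<pi> inv' y by (auto simp: PiE_def Pi_def)
      qed (use y in simp)
      show "y \<in> ?H ` carrier (direct_sum I N)"
        by (rule image_eqI[of _ ?H ?x]) (rule H[symmetric], rule x)
    qed
    show "?H (x \<oplus>\<^bsub>direct_sum I N\<^esub> y) = ?H x \<oplus>\<^bsub>direct_sum J P\<^esub> ?H y"
      if "x \<in> carrier (direct_sum I N)" "y \<in> carrier (direct_sum I N)" for x y
      using that iso_viaD(3)[OF h] \<pi> by (auto simp: fun_eq_iff PiE_def Pi_def)
    show "?H (a \<odot>\<^bsub>direct_sum I N\<^esub> x) = a \<odot>\<^bsub>direct_sum J P\<^esub> ?H x"
      if "a \<in> carrier R" "x \<in> carrier (direct_sum I N)" for a x
      using that iso_viaD(4)[OF h] \<pi> by (auto simp: fun_eq_iff PiE_def Pi_def)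
  qed
  then show ?thesis by (auto simp: module_isomorphic_iso_via)
qed

text \<open>
  \<open>E_module\<close> is an epsilon choice among modules whose elements are sets of scalars. Sending \<open>x\<close> to
  \<open>{a. a v = x}\<close> moves a cyclic module to this type, so that the choice has a witness.
\<close>

lemma transport_to_sets:
  fixes M :: "('r, 'm) module"
  assumes M: "left_module R M" and v: "\<And>x. x \<in> carrier M \<Longrightarrow> \<exists>a\<in>carrier R. a \<odot>\<^bsub>M\<^esub> v = x"
  obtains N :: "('r, 'r set) module" and h where "iso_via R M N h" "left_module R N"
proof -
  interpret M: left_module R M by fact
  define h where "h x = {a \<in> carrier R. a \<odot>\<^bsub>M\<^esub> v = x}" for x
  let ?g = "inv_into (carrier M) h"
  define N :: "('r, 'r set) module" where
    "N = \<lparr>carrier = h ` carrier M, monoid.mult = undefined, one = undefined, zero = h \<zero>\<^bsub>M\<^esub>,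
      add = (\<lambda>X Y. h (?g X \<oplus>\<^bsub>M\<^esub> ?g Y)), smult = (\<lambda>a X. h (a \<odot>\<^bsub>M\<^esub> ?g X))\<rparr>"
  have inj: "inj_on h (carrier M)"
    using v by (force intro!: inj_onI simp: h_def set_eq_iff)
  then have g: "?g (h x) = x" if "x \<in> carrier M" for x using that by simp
  have "iso_via R M N h"
    unfolding iso_via_def bij_betw_def using inj g by (auto simp: N_def)
  moreover have "left_module R N"
    by (rule left_module_transport[OF M calculation]) (simp add: N_def)
  ultimately show thesis using that by blast
qed

section \<open>Irreducible highest weight modules\<close>

lemma lk_scal: "lk (scal c) ws = (if ws = [] then c else 0)"
  by (auto simp: scal_def lookup_single zero_free_monoid_def when_def)

lemma lk_1: "lk 1 ws = (if ws = [] then 1 else 0)"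
  using lk_scal[of 1 ws] by simp

text \<open>Combinations of the one-letter words with letter in I model the coordinate space with
  basis I. The images of its basis are independent and lie in the span of the letters in J.\<close>

lemma card_le_of_linear_inj:
  fixes G :: "nat free_alg \<Rightarrow> nat free_alg"
  assumes fin: "finite I" "finite J" and G: "lin G"
    and supp: "\<And>p. G p \<in> supp_in ((\<lambda>i. [i]) ` J)"
    and inj: "\<And>p. p \<in> supp_in ((\<lambda>i. [i]) ` I) \<Longrightarrow> G p = 0 \<Longrightarrow> p = 0"
  shows "card I \<le> card J"
proof -
  interpret vector_space "\<lambda>c p. scal c * (p :: nat free_alg)"
    by unfold_locales (simp_all add: distrib_left scal_add distrib_right scal_mult_left)
  have key: "u i = 0" if "(\<Sum>i\<in>I. scal (u i) * G (gen i)) = 0" "i \<in> I" for u i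
  proof -
    have "(\<Sum>i\<in>I. scal (u i) * gen i) = 0"
    proof (rule inj)
      show "(\<Sum>i\<in>I. scal (u i) * gen i) \<in> supp_in ((\<lambda>i. [i]) ` I)"
        by (intro supp_in_sum supp_in_scal) simp
      show "G (\<Sum>i\<in>I. scal (u i) * gen i) = 0"
        using that(1) by (simp add: lin_simps[OF G])
    qed
    then have "lk (\<Sum>i\<in>I. scal (u i) * gen i) [i] = 0" by simp
    then have "(\<Sum>j\<in>I. if j = i then u i else 0) = 0"
      unfolding lookup_sum by (simp add: lookup_word if_distrib eq_commute[of i] cong: if_cong)
    then show ?thesis using that(2) fin by simp
  qed
  have inj_G: "inj_on (\<lambda>i. G (gen i)) I"
  proof (rule inj_onI, rule ccontr)
    fix i j assume ij: "i \<in> I" "j \<in> I" "G (gen i) = G (gen j)" "i \<noteq> j"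
    have "(\<Sum>l\<in>I. scal (if l = i then 1 else if l = j then - 1 else 0) * G (gen l))
      = (\<Sum>l\<in>{i, j}. scal (if l = i then 1 else if l = j then - 1 else 0) * G (gen l))"
      by (rule sum.mono_neutral_right) (use ij fin in auto)
    also have "\<dots> = 0" using ij by (simp add: scal_uminus)
    finally have "(if i = i then 1 else if i = j then - 1 else 0 :: complex) = 0"
      by (rule key) (rule ij)
    then show False by simp
  qed
  have "independent ((\<lambda>i. G (gen i)) ` I)"
  proof (rule independent_if_scalars_zero)
    show "finite ((\<lambda>i. G (gen i)) ` I)" using fin by simp
    fix f x assume 0: "(\<Sum>x\<in>(\<lambda>i. G (gen i)) ` I. scal (f x) * x) = 0" and "x \<in> (\<lambda>i. G (gen i)) ` I"
    then obtain i where i: "i \<in> I" "x = G (gen i)" by blast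
    show "f x = 0"
      using key[of "\<lambda>i. f (G (gen i))" i] 0 i unfolding sum.reindex[OF inj_G] by simp
  qed
  moreover have "(\<lambda>i. G (gen i)) ` I \<subseteq> span (gen ` J)"
  proof
    fix x assume "x \<in> (\<lambda>i. G (gen i)) ` I"
    then have "x \<in> supp_in ((\<lambda>i. [i]) ` J)" using supp by blast
    then show "x \<in> span (gen ` J)"
      by (induction rule: supp_in_induct) (auto intro: span_zero span_add span_scale span_base)
  qed
  ultimately have "card ((\<lambda>i. G (gen i)) ` I) \<le> card (gen ` J)"
    using independent_span_bound fin by blast
  then show ?thesis
    using card_image[OF inj_G] card_image_le[OF fin(2), of gen] by simp
qed

context quantum_gl
begin

section \<open>Modules over the quantum group seen through the free algebra\<close>

abbreviation "U \<equiv> Uq n q s"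
abbreviation "\<pi> \<equiv> uq_proj n q s"

lemma ring_U: "ring U"
  unfolding Uq_def by (rule ideal.quotient_is_ring[OF uq_ideal_ideal])

lemma \<pi>_hom: "\<pi> \<in> ring_hom Ufree U"
  unfolding Uq_def uq_proj_def[abs_def] by (rule ideal.rcos_ring_hom[OF uq_ideal_ideal])

lemma \<pi>_simps:
  "a \<in> carrier Ufree \<Longrightarrow> \<pi> a \<in> carrier U"
  "a \<in> carrier Ufree \<Longrightarrow> b \<in> carrier Ufree \<Longrightarrow> \<pi> (a * b) = \<pi> a \<otimes>\<^bsub>U\<^esub> \<pi> b"
  "a \<in> carrier Ufree \<Longrightarrow> b \<in> carrier Ufree \<Longrightarrow> \<pi> (a + b) = \<pi> a \<oplus>\<^bsub>U\<^esub> \<pi> b"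
  "\<pi> 1 = \<one>\<^bsub>U\<^esub>"
  using ring_hom_closed[OF \<pi>_hom] ring_hom_mult[OF \<pi>_hom] ring_hom_add[OF \<pi>_hom] ring_hom_one[OF \<pi>_hom]
  by simp_all

lemma carrier_U: "carrier U = \<pi> ` carrier Ufree"
  by (auto simp: Uq_def FactRing_def A_RCOSETS_defs uq_proj_def a_r_coset_def)

lemma \<pi>_ideal: "u \<in> uq_ideal n q s \<Longrightarrow> \<pi> u = \<zero>\<^bsub>U\<^esub>"
proof -
  assume u: "u \<in> uq_ideal n q s"
  interpret ideal "uq_ideal n q s" Ufree by (rule uq_ideal_ideal)
  show ?thesis using a_rcos_const[OF u] by (simp add: uq_proj_def Uq_def FactRing_def)
qed

lemma Ufree_intros:
  "0 \<in> carrier Ufree" "1 \<in> carrier Ufree" "scal c \<in> carrier Ufree"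
  "a \<in> carrier Ufree \<Longrightarrow> b \<in> carrier Ufree \<Longrightarrow> a * b \<in> carrier Ufree"
  "a \<in> carrier Ufree \<Longrightarrow> b \<in> carrier Ufree \<Longrightarrow> a + b \<in> carrier Ufree"
  "a \<in> carrier Ufree \<Longrightarrow> b \<in> carrier Ufree \<Longrightarrow> a - b \<in> carrier Ufree"
  "g \<in> uq_gens n \<Longrightarrow> gen g \<in> carrier Ufree"
  by (auto simp: free_algebra_carrier intro: supp_in_lists_intros)

lemma FF_Ufree: "p \<in> FF \<Longrightarrow> p \<in> carrier Ufree"
  unfolding free_algebra_carrier by (rule subsetD[OF supp_in_mono]) (auto simp: uq_gens_def)

lemma FF_intros:
  "0 \<in> FF" "1 \<in> FF" "scal c \<in> FF" "a \<in> FF \<Longrightarrow> b \<in> FF \<Longrightarrow> a * b \<in> FF"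
  "a \<in> FF \<Longrightarrow> b \<in> FF \<Longrightarrow> a + b \<in> FF" "a \<in> FF \<Longrightarrow> b \<in> FF \<Longrightarrow> a - b \<in> FF"
  "k \<in> {1..<n} \<Longrightarrow> gen (GenF k) \<in> FF"
  by (auto intro: supp_in_lists_intros)

definition actM :: "(uq_gen free_alg set, 'm) module \<Rightarrow> uq_gen free_alg \<Rightarrow> 'm \<Rightarrow> 'm" where
  "actM M u x = \<pi> u \<odot>\<^bsub>M\<^esub> x"

definition hw :: "(uq_gen free_alg set, 'm) module \<Rightarrow> (nat \<Rightarrow> int) \<Rightarrow> 'm \<Rightarrow> bool" where
  "hw M lam v \<longleftrightarrow> v \<in> carrier M \<and> (\<forall>k\<in>{1..<n}. actM M (gen (GenE k)) v = \<zero>\<^bsub>M\<^esub>) \<and>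
    (\<forall>a\<in>doubled_lattice n. actM M (gen (GenQ a)) v = actM M (scal (s powi pairing n a lam)) v)"

lemma irreducible_highest_weight_hw:
  "irreducible_highest_weight n q s lam M \<longleftrightarrow>
    irreducible_module U M \<and> (\<exists>v. v \<noteq> \<zero>\<^bsub>M\<^esub> \<and> hw M (\<lambda>i. int (lam i)) v)"
  by (auto simp: irreducible_highest_weight_def hw_def actM_def)

lemma actM:
  assumes M: "left_module U M"
  shows "u \<in> carrier Ufree \<Longrightarrow> x \<in> carrier M \<Longrightarrow> actM M u x \<in> carrier M"
    "u \<in> carrier Ufree \<Longrightarrow> w \<in> carrier Ufree \<Longrightarrow> x \<in> carrier M \<Longrightarrow> actM M (u * w) x = actM M u (actM M w x)"
    "u \<in> carrier Ufree \<Longrightarrow> w \<in> carrier Ufree \<Longrightarrow> x \<in> carrier M \<Longrightarrow> actM M (u + w) x = actM M u x \<oplus>\<^bsub>M\<^esub> actM M w x"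
    "u \<in> carrier Ufree \<Longrightarrow> x \<in> carrier M \<Longrightarrow> y \<in> carrier M \<Longrightarrow> actM M u (x \<oplus>\<^bsub>M\<^esub> y) = actM M u x \<oplus>\<^bsub>M\<^esub> actM M u y"
    "x \<in> carrier M \<Longrightarrow> actM M 1 x = x"
    "u \<in> uq_ideal n q s \<Longrightarrow> x \<in> carrier M \<Longrightarrow> actM M u x = \<zero>\<^bsub>M\<^esub>"
    "u \<in> carrier Ufree \<Longrightarrow> actM M u \<zero>\<^bsub>M\<^esub> = \<zero>\<^bsub>M\<^esub>"
    "x \<in> carrier M \<Longrightarrow> actM M 0 x = \<zero>\<^bsub>M\<^esub>"
    "x \<in> carrier M \<Longrightarrow> actM M (scal c) x = \<zero>\<^bsub>M\<^esub> \<longleftrightarrow> c = 0 \<or> x = \<zero>\<^bsub>M\<^esub>"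
proof -
  interpret left_module U M by fact
  show 1: "u \<in> carrier Ufree \<Longrightarrow> x \<in> carrier M \<Longrightarrow> actM M u x \<in> carrier M"
    by (simp add: actM_def \<pi>_simps smult_closed)
  show 2: "u \<in> carrier Ufree \<Longrightarrow> w \<in> carrier Ufree \<Longrightarrow> x \<in> carrier M \<Longrightarrow> actM M (u * w) x = actM M u (actM M w x)" for u w x
    by (simp add: actM_def \<pi>_simps smult_assoc1)
  show "u \<in> carrier Ufree \<Longrightarrow> w \<in> carrier Ufree \<Longrightarrow> x \<in> carrier M \<Longrightarrow> actM M (u + w) x = actM M u x \<oplus>\<^bsub>M\<^esub> actM M w x"
    by (simp add: actM_def \<pi>_simps smult_l_distr)
  show "u \<in> carrier Ufree \<Longrightarrow> x \<in> carrier M \<Longrightarrow> y \<in> carrier M \<Longrightarrow> actM M u (x \<oplus>\<^bsub>M\<^esub> y) = actM M u x \<oplus>\<^bsub>M\<^esub> actM M u y"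
    by (simp add: actM_def \<pi>_simps smult_r_distr)
  show 3: "x \<in> carrier M \<Longrightarrow> actM M 1 x = x" for x
    by (simp add: actM_def \<pi>_simps smult_one)
  show 4: "u \<in> uq_ideal n q s \<Longrightarrow> x \<in> carrier M \<Longrightarrow> actM M u x = \<zero>\<^bsub>M\<^esub>" for u x
    by (simp add: actM_def \<pi>_ideal smult_l_null)
  show 5: "u \<in> carrier Ufree \<Longrightarrow> actM M u \<zero>\<^bsub>M\<^esub> = \<zero>\<^bsub>M\<^esub>" for u
    by (simp add: actM_def \<pi>_simps smult_r_null)
  have "0 \<in> uq_ideal n q s"
    using additive_subgroup.zero_closed[OF ideal.axioms(1)[OF uq_ideal_ideal]] by simp
  then show 6: "x \<in> carrier M \<Longrightarrow> actM M 0 x = \<zero>\<^bsub>M\<^esub>" for x by (rule 4)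
  show "x \<in> carrier M \<Longrightarrow> actM M (scal c) x = \<zero>\<^bsub>M\<^esub> \<longleftrightarrow> c = 0 \<or> x = \<zero>\<^bsub>M\<^esub>"
  proof
    assume x: "x \<in> carrier M" and 0: "actM M (scal c) x = \<zero>\<^bsub>M\<^esub>"
    have "x = \<zero>\<^bsub>M\<^esub>" if "c \<noteq> 0"
      using 2[of "scal (1 / c)" "scal c" x] x 0 5[of "scal (1 / c)"] 3[OF x] that
      by (simp add: Ufree_intros scal_mult)
    then show "c = 0 \<or> x = \<zero>\<^bsub>M\<^esub>" by blast
  qed (use 5 6 Ufree_intros(3) in auto)
qed

text \<open>The form of triangular decomposition that is needed: modulo a left ideal containing the
  relations, the e_k and the q^a - c a, every element is a polynomial in the f_k, because the other
  generators can be pushed to the right end. L is kept abstract so that it can later be a common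
  annihilator of vectors in two modules.\<close>

lemma FF_modulo:
  fixes c :: "(nat \<Rightarrow> int) \<Rightarrow> complex"
  assumes L0: "0 \<in> L" and Ladd: "\<And>x y. x \<in> L \<Longrightarrow> y \<in> L \<Longrightarrow> x + y \<in> L"
    and Lmult: "\<And>a x. a \<in> carrier Ufree \<Longrightarrow> x \<in> L \<Longrightarrow> a * x \<in> L"
    and Lideal: "uq_ideal n q s \<subseteq> L" and LE: "\<And>k. k \<in> {1..<n} \<Longrightarrow> gen (GenE k) \<in> L"
    and LQ: "\<And>a. a \<in> doubled_lattice n \<Longrightarrow> gen (GenQ a) - scal (c a) \<in> L"
    and u: "u \<in> carrier Ufree"
  shows "\<exists>p\<in>FF. u - p \<in> L"
proof -
  have Lsc: "scal d * x \<in> L" if "x \<in> L" for d x by (rule Lmult[OF Ufree_intros(3) that])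
  have Lmin: "x - y \<in> L" if "x \<in> L" "y \<in> L" for x y
    using Ladd[OF that(1) Lsc[OF that(2), of "-1"]] by (simp add: scal_uminus)
  define ok where "ok u \<longleftrightarrow> (\<exists>p\<in>FF. u - p \<in> L)" for u
  have okL: "ok x" if "x \<in> L" for x
    unfolding ok_def using that by (intro bexI[of _ 0]) auto
  have okF: "ok x" if "x \<in> FF" for x
    unfolding ok_def using that L0 by (intro bexI[of _ x]) auto
  have okadd: "ok (x + y)" if xy: "ok x" "ok y" for x y
  proof -
    obtain p r where "p \<in> FF" "x - p \<in> L" "r \<in> FF" "y - r \<in> L" using xy by (auto simp: ok_def)
    then show ?thesis
      unfolding ok_def using Ladd[of "x - p" "y - r"]
      by (intro bexI[of _ "p + r"] FF_intros) (simp_all add: algebra_simps)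
  qed
  have oksc: "ok (scal d * x)" if "ok x" for d x
  proof -
    obtain p where "p \<in> FF" "x - p \<in> L" using \<open>ok x\<close> by (auto simp: ok_def)
    then show ?thesis
      unfolding ok_def using Lsc[of "x - p" d]
      by (intro bexI[of _ "scal d * p"] FF_intros) (simp_all add: right_diff_distrib)
  qed
  have okFmult: "ok (gen (GenF k) * x)" if "k \<in> {1..<n}" "ok x" for k x
  proof -
    obtain p where "p \<in> FF" "x - p \<in> L" using \<open>ok x\<close> by (auto simp: ok_def)
    then show ?thesis
      unfolding ok_def using that(1) Lmult[of "gen (GenF k)" "x - p"]
      by (intro bexI[of _ "gen (GenF k) * p"] FF_intros) (simp_all add: right_diff_distrib Ufree_intros)
  qed
  interpret I: ideal "uq_ideal n q s" Ufree by (rule uq_ideal_ideal)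
  have ideal_mult: "x * y \<in> uq_ideal n q s" "y * x \<in> uq_ideal n q s"
    if "x \<in> uq_ideal n q s" "y \<in> carrier Ufree" for x y
    using I.I_r_closed[OF that] I.I_l_closed[OF that] by simp_all
  have ideal_add: "x + y \<in> uq_ideal n q s" if "x \<in> uq_ideal n q s" "y \<in> uq_ideal n q s" for x y
    using additive_subgroup.a_closed[OF ideal.axioms(1)[OF uq_ideal_ideal] that] by simp
  have ideal_diff: "x - y \<in> uq_ideal n q s" if "x \<in> uq_ideal n q s" "y \<in> uq_ideal n q s" for x y
    using ideal_add[OF that(1) ideal_mult(2)[OF that(2) Ufree_intros(3)[of "-1"]]] by (simp add: scal_uminus)
  have rel: "x \<in> uq_ideal n q s" if "x \<in> uq_relations n q s" for x
    using that uq_relations_ideal by blast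
  \<comment> \<open>The relation is given as a conjugation; multiplying by q^a on the right and
    using q^-a q^a = 1 yields the commutation form.\<close>
  have QF: "gen (GenQ a) * gen (GenF k) - scal (s powi - pairing n a (root k)) * gen (GenF k) * gen (GenQ a) \<in> uq_ideal n q s"
    if a: "a \<in> doubled_lattice n" and k: "k \<in> {1..<n}" for a k
  proof -
    let ?Q = "gen (GenQ a)" and ?Q' = "gen (GenQ (\<lambda>i. - a i))" and ?F = "gen (GenF k)"
    let ?t = "scal (s powi - pairing n a (root k))"
    have na: "(\<lambda>i. - a i) \<in> doubled_lattice n" using a doubled_lattice_intros by blast
    have 1: "?Q * ?F * ?Q' - ?t * ?F \<in> uq_ideal n q s"
      using a k by (intro rel) (auto simp: uq_relations_def)
    have "?Q' * ?Q - gen (GenQ (\<lambda>i. - a i + a i)) \<in> uq_relations n q s"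
      unfolding uq_relations_def using a na by blast
    then have 2: "?Q' * ?Q - gen (GenQ (\<lambda>i. 0)) \<in> uq_ideal n q s"
      using rel by simp
    have 3: "gen (GenQ (\<lambda>_. 0)) - 1 \<in> uq_ideal n q s"
      by (intro rel) (auto simp: uq_relations_def)
    have c: "?Q \<in> carrier Ufree" "?F \<in> carrier Ufree" using a k by (auto intro!: Ufree_intros)
    have "(?Q * ?F * ?Q' - ?t * ?F) * ?Q
        - ?Q * ?F * ((?Q' * ?Q - gen (GenQ (\<lambda>i. 0))) + (gen (GenQ (\<lambda>_. 0)) - 1)) \<in> uq_ideal n q s"
      by (rule ideal_diff[OF ideal_mult(1)[OF 1 c(1)] ideal_mult(2)[OF ideal_add[OF 2 3] Ufree_intros(4)[OF c]]])
    also have "(?Q * ?F * ?Q' - ?t * ?F) * ?Q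
        - ?Q * ?F * ((?Q' * ?Q - gen (GenQ (\<lambda>i. 0))) + (gen (GenQ (\<lambda>_. 0)) - 1))
      = ?Q * ?F - ?t * ?F * ?Q"
      by (simp add: algebra_simps)
    finally show ?thesis .
  qed
  have words: "word gs \<in> carrier Ufree" if "gs \<in> lists (GenF ` {1..<n})" for gs
    using that by (intro FF_Ufree) auto
  have wC: "word (g # gs) = gen g * word gs" for g :: uq_gen and gs by (simp add: word_mult)
  have ring1: "(x * y - t * y * x) * w + t * (y * (x * w - z)) = x * (y * w) - t * (y * z)"
    and ring2: "(x * y - y * x - t * (z - z')) * w + (y * (x * w) + t * (z * w + - 1 * (z' * w))) = x * (y * w)"
    for x y z z' t w :: "uq_gen free_alg"
    by (simp_all add: algebra_simps)
  have Qw: "\<exists>d. gen (GenQ a) * word gs - scal d * word gs \<in> L"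
    if "a \<in> doubled_lattice n" "gs \<in> lists (GenF ` {1..<n})" for a gs
    using that(2)
  proof (induction gs)
    case Nil
    then show ?case using LQ[OF that(1)] by (auto simp: word_Nil)
  next
    case (Cons g gs)
    then obtain k d where k: "g = GenF k" "k \<in> {1..<n}"
      and d: "gen (GenQ a) * word gs - scal d * word gs \<in> L" by auto
    let ?t = "s powi - pairing n a (root k)"
    have "(gen (GenQ a) * gen (GenF k) - scal ?t * gen (GenF k) * gen (GenQ a)) * word gs \<in> L"
      using ideal_mult(1)[OF QF[OF that(1) k(2)] words] Cons Lideal by blast
    moreover have "scal ?t * (gen (GenF k) * (gen (GenQ a) * word gs - scal d * word gs)) \<in> L"
      using d k by (intro Lsc Lmult Ufree_intros) auto
    ultimately have "(gen (GenQ a) * gen (GenF k) - scal ?t * gen (GenF k) * gen (GenQ a)) * word gs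
        + scal ?t * (gen (GenF k) * (gen (GenQ a) * word gs - scal d * word gs)) \<in> L"
      by (rule Ladd)
    also have "(gen (GenQ a) * gen (GenF k) - scal ?t * gen (GenF k) * gen (GenQ a)) * word gs
        + scal ?t * (gen (GenF k) * (gen (GenQ a) * word gs - scal d * word gs))
      = gen (GenQ a) * word (g # gs) - scal ?t * (gen (GenF k) * (scal d * word gs))"
      unfolding k(1) wC[of _ gs] by (rule ring1)
    also have "scal ?t * (gen (GenF k) * (scal d * word gs)) = scal (?t * d) * word (g # gs)"
      unfolding k(1) wC[of _ gs] by (simp only: scal_mult_right[of "gen (GenF k)"] scal_mult_left)
    finally show ?case by blast
  qed
  have Qok: "ok (gen (GenQ a) * word gs)"
    if "a \<in> doubled_lattice n" "gs \<in> lists (GenF ` {1..<n})" for a gs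
    using Qw[OF that] that by (force simp: ok_def intro: supp_in_scal)
  have Eok: "ok (gen (GenE i) * word gs)" if i: "i \<in> {1..<n}" and gs: "gs \<in> lists (GenF ` {1..<n})" for i gs
    using gs
  proof (induction gs)
    case Nil
    then show ?case using okL[OF LE[OF i]] by (simp add: word_Nil)
  next
    case (Cons g gs)
    then obtain k where k: "g = GenF k" "k \<in> {1..<n}" by auto
    let ?d = "if i = k then 1 / (q - 1 / q) else 0"
    let ?Q = "gen (GenQ (\<lambda>t. 2 * root i t))" and ?Q' = "gen (GenQ (\<lambda>t. - 2 * root i t))"
    let ?r = "gen (GenE i) * gen (GenF k) - gen (GenF k) * gen (GenE i) - scal ?d * (?Q - ?Q')"
    have "?r \<in> uq_relations n q s" unfolding uq_relations_def using i k(2) by blast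
    then have r: "?r * word gs \<in> L"
      using ideal_mult(1)[OF rel words] Cons Lideal by blast
    have lat: "(\<lambda>t. 2 * root i t) \<in> doubled_lattice n" "(\<lambda>t. - 2 * root i t) \<in> doubled_lattice n"
      using doubled_lattice_intros(5,6)[OF i] by simp_all
    \<comment> \<open>Modulo the relation, E_i F_k w becomes F_k E_i w plus multiples of q^a w, and
      all of these reduce already.\<close>
    have "ok (?r * word gs + (gen (GenF k) * (gen (GenE i) * word gs)
        + scal ?d * (?Q * word gs + scal (-1) * (?Q' * word gs))))"
      using Cons k lat by (intro okadd okL[OF r] okFmult oksc Qok) auto
    also have "?r * word gs + (gen (GenF k) * (gen (GenE i) * word gs)
        + scal ?d * (?Q * word gs + scal (-1) * (?Q' * word gs))) = gen (GenE i) * (gen (GenF k) * word gs)"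
      unfolding scal_uminus scal_1 by (rule ring2)
    finally show ?case unfolding k(1) wC[of _ gs] .
  qed
  have okgen: "ok (gen g * x)" if g: "g \<in> uq_gens n" and x: "ok x" for g x
  proof -
    obtain p where p: "p \<in> FF" "x - p \<in> L" using x by (auto simp: ok_def)
    have "ok (gen g * p)"
      using p(1)
    proof (induction rule: supp_in_induct)
      case (word d gs)
      have "ok (gen g * word gs)"
        using g word Eok[of _ gs] Qok[of _ gs] okFmult[OF _ okF, of _ "word gs"] by (cases g) auto
      then show ?case using oksc by (simp add: scal_mult_right)
    qed (auto simp: distrib_left intro: okadd okL L0)
    moreover have "ok (gen g * (x - p))"
      by (rule okL[OF Lmult[OF Ufree_intros(7)[OF g] p(2)]])
    ultimately have "ok (gen g * p + gen g * (x - p))" by (rule okadd)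
    then show ?thesis by (simp add: algebra_simps)
  qed
  have okword: "ok (word gs)" if "gs \<in> lists (uq_gens n)" for gs
    using that
  proof (induction gs)
    case Nil
    then show ?case using okF[OF FF_intros(2)] by (simp add: word_Nil)
  next
    case (Cons g gs)
    then show ?case using okgen unfolding wC[of _ gs] by simp
  qed
  have "ok u"
    using u unfolding free_algebra_carrier
    by (induction rule: supp_in_induct) (auto intro: okadd oksc okword okL L0)
  then show ?thesis by (simp add: ok_def)
qed

text \<open>
  The half sum of positive roots grades the negative part by length, so the component of degree 0
  can be cut out by an element of the algebra.
\<close>

lemma FF_annihilates:
  assumes M: "left_module U M" and v: "hw M lam v" "v \<noteq> \<zero>\<^bsub>M\<^esub>" and p: "p \<in> FF" "actM M p v = \<zero>\<^bsub>M\<^esub>"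
  shows "lk p [] = 0"
proof -
  note A = actM[OF M]
  have vM: "v \<in> carrier M" using v by (simp add: hw_def)
  \<comment> \<open>The half sum of positive roots shifted by a constant, so that its entries are
    integers; it pairs to 1 with each simple root. Read as doubled coordinates it makes Q scale an
    F-word of length l applied to v by s^(c0 - l).\<close>
  define \<rho> where "\<rho> i = (if i \<in> {1..n} then int n - int i else 0)" for i
  define c0 where "c0 = pairing n \<rho> lam"
  have \<rho>: "\<rho> \<in> doubled_lattice n" by (simp add: doubled_lattice_def \<rho>_def)
  have \<rho>root: "pairing n \<rho> (root k) = 1" if "k \<in> {1..<n}" for k
    using that by (simp add: pairing_root pairing_eps \<rho>_def)
  let ?Q = "gen (GenQ \<rho>)" and ?Q' = "gen (GenQ (\<lambda>i. - \<rho> i))"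
  have QU: "?Q \<in> carrier Ufree" "?Q' \<in> carrier Ufree"
    using \<rho> doubled_lattice_intros(3)[OF \<rho>] by (auto intro: Ufree_intros)
  have rel: "actM M r x = \<zero>\<^bsub>M\<^esub>" if "r \<in> uq_relations n q s" "x \<in> carrier M" for r x
    using A(6) that uq_relations_ideal by blast
  have sub: "actM M u x = actM M w x" if "actM M (u - w) x = \<zero>\<^bsub>M\<^esub>" "u \<in> carrier Ufree" "w \<in> carrier Ufree" "x \<in> carrier M"
    for u w x
  proof -
    interpret left_module U M by fact
    have "actM M ((u - w) + w) x = actM M (u - w) x \<oplus>\<^bsub>M\<^esub> actM M w x"
      using that by (intro A(3) Ufree_intros)
    then show ?thesis using that A(1) by simp
  qed
  have sc: "actM M (scal a) (actM M u x) = actM M u (actM M (scal a) x)" if "u \<in> carrier Ufree" "x \<in> carrier M" for a u x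
    using that by (simp add: scal_commute[of u] Ufree_intros flip: A(2))
  have scM: "actM M (scal a) (actM M (scal b) x) = actM M (scal (a * b)) x" if "x \<in> carrier M" for a b x
    using A(2)[OF Ufree_intros(3,3) that] by (simp add: scal_mult)
  have QQ': "actM M ?Q' (actM M ?Q x) = x" if x: "x \<in> carrier M" for x
  proof -
    have "?Q' * ?Q - gen (GenQ (\<lambda>i. - \<rho> i + \<rho> i)) \<in> uq_relations n q s"
      unfolding uq_relations_def using \<rho> doubled_lattice_intros(3)[OF \<rho>] by blast
    then have 1: "actM M (?Q' * ?Q - gen (GenQ (\<lambda>i. 0))) x = \<zero>\<^bsub>M\<^esub>" using rel x by simp
    have 2: "actM M (gen (GenQ (\<lambda>i. 0)) - 1) x = \<zero>\<^bsub>M\<^esub>"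
      by (rule rel[OF _ x]) (auto simp: uq_relations_def)
    have "gen (GenQ (\<lambda>i. 0)) \<in> carrier Ufree" by (auto intro!: Ufree_intros doubled_lattice_intros)
    then show ?thesis
      using sub[OF 1] sub[OF 2] x QU by (simp add: A Ufree_intros)
  qed
  have QF: "actM M ?Q (actM M (gen (GenF k)) x) = actM M (scal (1 / s)) (actM M (gen (GenF k)) (actM M ?Q x))"
    if k: "k \<in> {1..<n}" and x: "x \<in> carrier M" for k x
  proof -
    let ?F = "gen (GenF k)"
    have FU: "?F \<in> carrier Ufree" using k by (auto intro: Ufree_intros)
    have "?Q * ?F * ?Q' - scal (s powi (- pairing n \<rho> (root k))) * ?F \<in> uq_relations n q s"
      using k \<rho> unfolding uq_relations_def by blast
    then have "actM M (?Q * ?F * ?Q' - scal (1 / s) * ?F) (actM M ?Q x) = \<zero>\<^bsub>M\<^esub>"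
      using rel A(1)[OF QU(1) x] by (simp add: \<rho>root[OF k] power_int_minus divide_inverse)
    from sub[OF this] show ?thesis
      using x QU FU QQ' by (simp add: A Ufree_intros)
  qed
  have Qw: "actM M ?Q (actM M (word gs) v) = actM M (scal (s powi (c0 - int (length gs)))) (actM M (word gs) v)"
    if "gs \<in> lists (GenF ` {1..<n})" for gs
    using that
  proof (induction gs)
    case Nil
    then show ?case using v(1) \<rho> by (simp add: word_Nil A vM hw_def c0_def)
  next
    case (Cons g gs)
    then obtain k where k: "g = GenF k" "k \<in> {1..<n}" by auto
    have w: "word gs \<in> carrier Ufree" "gen (GenF k) \<in> carrier Ufree"
      using Cons k by (auto intro!: FF_Ufree Ufree_intros)
    have eq: "word (g # gs) = gen (GenF k) * word gs" by (simp add: word_mult k)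
    let ?t = "s powi (c0 - int (length gs))" and ?w = "actM M (word gs) v"
    have wM: "?w \<in> carrier M" using w vM by (intro A)
    have IH: "actM M ?Q ?w = actM M (scal ?t) ?w" using Cons by simp
    have "s powi (c0 - int (length (g # gs))) = (1 / s) * ?t"
      by (simp add: power_int_diff power_int_add)
    moreover have "actM M ?Q (actM M (word (g # gs)) v)
        = actM M (scal (1 / s)) (actM M (gen (GenF k)) (actM M (scal ?t) ?w))"
      unfolding eq A(2)[OF w(2,1) vM] QF[OF k(2) wM] IH ..
    moreover have "\<dots> = actM M (scal (1 / s * ?t)) (actM M (word (g # gs)) v)"
      unfolding eq A(2)[OF w(2,1) vM] sc[OF w(2) wM, symmetric]
      by (rule scM) (intro A(1) w wM)
    ultimately show ?case by simp
  qed
  \<comment> \<open>The product of Q - s^(c0 - d) over d = 1, ..., D. It annihilates F-words of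
    length 1 to D applied to v and multiplies v by the scalar \<open>\<kappa> 0 D\<close>.\<close>
  define R where "R D = rec_nat 1 (\<lambda>d r. (?Q - scal (s powi (c0 - int (Suc d)))) * r) D" for D
  have R: "R 0 = 1" "R (Suc D) = (?Q - scal (s powi (c0 - int (Suc D)))) * R D" for D
    by (simp_all add: R_def)
  have RU: "R D \<in> carrier Ufree" for D
    by (induction D) (auto simp: R intro!: Ufree_intros QU)
  define \<kappa> where "\<kappa> l D = (\<Prod>d\<in>{1..D}. s powi (c0 - int l) - s powi (c0 - int d))" for l D
  have Rw: "actM M (R D) (actM M (word gs) v) = actM M (scal (\<kappa> (length gs) D)) (actM M (word gs) v)"
    if "gs \<in> lists (GenF ` {1..<n})" for gs D
  proof (induction D)
    case 0
    have "word gs \<in> carrier Ufree" using that by (auto intro: FF_Ufree)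
    then show ?case by (simp add: R \<kappa>_def A vM)
  next
    case (Suc D)
    let ?x = "actM M (word gs) v" and ?t = "s powi (c0 - int (length gs))" and ?d = "s powi (c0 - int (Suc D))"
    have w: "?x \<in> carrier M" using that by (auto intro!: A FF_Ufree vM)
    have "actM M (R (Suc D)) ?x = actM M (?Q - scal ?d) (actM M (scal (\<kappa> (length gs) D)) ?x)"
      using Suc w QU RU by (simp add: R A Ufree_intros)
    also have "\<dots> = actM M (scal (\<kappa> (length gs) D)) (actM M (?Q - scal ?d) ?x)"
      using sc[of "?Q - scal ?d" ?x] w QU by (simp add: Ufree_intros)
    also have "actM M (?Q - scal ?d) ?x = actM M (scal (?t - ?d)) ?x"
    proof -
      have "actM M ((?Q - scal ?d) - scal (?t - ?d)) ?x = actM M (?Q + scal (- ?t)) ?x"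
        by (simp add: scal_diff scal_uminus)
      also have "\<dots> = actM M (scal ?t) ?x \<oplus>\<^bsub>M\<^esub> actM M (scal (- ?t)) ?x"
        using A(3)[OF QU(1) Ufree_intros(3) w] Qw[OF that] by simp
      also have "\<dots> = actM M (scal ?t + scal (- ?t)) ?x"
        using w by (simp add: A(3) Ufree_intros)
      also have "\<dots> = \<zero>\<^bsub>M\<^esub>" using w by (simp add: scal_uminus A)
      finally show ?thesis
        using sub w QU by (simp add: Ufree_intros)
    qed
    finally show ?case
      using w by (simp add: \<kappa>_def scM)
  qed
  define D where "D = Max (length ` letters ` Poly_Mapping.keys p)"
  have "p \<in> supp_in {gs \<in> lists (GenF ` {1..<n}). length gs \<le> D}"
    using p(1) by (auto simp: supp_in_def D_def)
  then have main: "actM M (R D) (actM M p v) = actM M (scal (\<kappa> 0 D * lk p [])) v \<and> p \<in> FF"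
  proof (induction rule: supp_in_induct)
    case zero
    then show ?case by (simp add: A vM RU)
  next
    case (add x y)
    then have "actM M (R D) (actM M (x + y) v) = actM M (scal (\<kappa> 0 D * lk x [])) v \<oplus>\<^bsub>M\<^esub> actM M (scal (\<kappa> 0 D * lk y [])) v"
      using vM RU by (simp add: A FF_Ufree)
    then show ?case
      using add vM FF_intros(5)[of x y] by (auto simp: lookup_add distrib_left scal_add A Ufree_intros)
  next
    case (word c gs)
    have w: "word gs \<in> carrier Ufree" using word by (auto intro: FF_Ufree)
    have "actM M (R D) (actM M (scal c * word gs) v) = actM M (scal c) (actM M (R D) (actM M (word gs) v))"
      unfolding A(2)[OF Ufree_intros(3) w vM] by (rule sc[OF RU A(1)[OF w vM], symmetric])
    also have "\<dots> = actM M (scal (c * \<kappa> (length gs) D)) (actM M (word gs) v)"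
      using w vM Rw[of gs D] word by (simp add: scM A)
    also have "\<dots> = actM M (scal (\<kappa> 0 D * lk (scal c * word gs) [])) v"
    proof (cases "gs = []")
      case True
      then show ?thesis by (simp add: word_Nil A vM lk_scal mult.commute)
    next
      case False
      then have "\<kappa> (length gs) D = 0"
        unfolding \<kappa>_def using word by (intro prod_zero) (auto intro!: bexI[of _ "length gs"] simp: Suc_le_eq)
      then show ?thesis using False w vM by (simp add: A lookup_word)
    qed
    finally show ?case using word by (auto intro: supp_in_scal)
  qed
  have "actM M (scal (\<kappa> 0 D * lk p [])) v = \<zero>\<^bsub>M\<^esub>"
    using main p(2) RU by (simp add: A)
  then have "\<kappa> 0 D * lk p [] = 0" using v(2) vM by (simp add: A)
  \<comment> \<open>The factors are s^c0 - s^(c0 - d) with d > 0, nonzero because q is not a root of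
    unity.\<close>
  moreover have "\<kappa> 0 D \<noteq> 0" by (auto simp: \<kappa>_def s_powi_inj)
  ultimately show ?thesis by simp
qed

end

section \<open>Uniqueness of irreducible highest weight modules\<close>

context quantum_gl
begin

text \<open>If x kills v but not w, irreducibility gives u with u x w = w. Reduce u x to a
  polynomial p in the f_k modulo the joint annihilator of v and w. Then p v = 0 forces the constant
  term of p to be 0, while (p - 1) w = 0 forces it to be 1.\<close>

lemma highest_annihilator:
  assumes M: "left_module U M" and v: "hw M lam v" "v \<noteq> \<zero>\<^bsub>M\<^esub>"
    and N: "left_module U N" "irreducible_module U N" and w: "hw N lam w" "w \<noteq> \<zero>\<^bsub>N\<^esub>"
    and x: "x \<in> carrier Ufree" "actM M x v = \<zero>\<^bsub>M\<^esub>"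
  shows "actM N x w = \<zero>\<^bsub>N\<^esub>"
proof (rule ccontr)
  assume ne: "actM N x w \<noteq> \<zero>\<^bsub>N\<^esub>"
  note A = actM[OF M] and B = actM[OF N(1)]
  interpret M: left_module U M by fact
  interpret N: left_module U N by fact
  have vM: "v \<in> carrier M" and wN: "w \<in> carrier N" using v w by (simp_all add: hw_def)
  have "actM N x w \<in> carrier N" using x wN by (intro B)
  then obtain a where "a \<in> carrier U" "a \<odot>\<^bsub>N\<^esub> actM N x w = w"
    using irreducible_generates[OF N(2) _ ne wN] by metis
  then obtain u where u: "u \<in> carrier Ufree" "actM N u (actM N x w) = w"
    unfolding carrier_U actM_def by blast
  \<comment> \<open>The joint annihilator; v and w have the same weight, so it contains the same q^b
    - s^<b, lam> for both, as the reduction requires.\<close>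
  define L where "L = {y \<in> carrier Ufree. actM M y v = \<zero>\<^bsub>M\<^esub> \<and> actM N y w = \<zero>\<^bsub>N\<^esub>}"
  have "\<exists>p\<in>FF. u * x - p \<in> L"
  proof (rule FF_modulo)
    show "0 \<in> L" using vM wN by (simp add: L_def A B Ufree_intros)
    show "y + z \<in> L" if "y \<in> L" "z \<in> L" for y z
      using that vM wN by (simp add: L_def A B Ufree_intros)
    show "b * y \<in> L" if "b \<in> carrier Ufree" "y \<in> L" for b y
      using that vM wN by (simp add: L_def A B Ufree_intros)
    show "uq_ideal n q s \<subseteq> L"
      using ideal.Icarr[OF uq_ideal_ideal] vM wN by (auto simp: L_def A B)
    show "gen (GenE k) \<in> L" if "k \<in> {1..<n}" for k
      using that v(1) w(1) by (auto simp: L_def hw_def intro!: Ufree_intros)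
    show "gen (GenQ b) - scal (s powi pairing n b lam) \<in> L" if b: "b \<in> doubled_lattice n" for b
    proof -
      let ?t = "s powi pairing n b lam"
      have c: "gen (GenQ b) \<in> carrier Ufree" using b by (auto intro: Ufree_intros)
      have eq: "gen (GenQ b) - scal ?t = gen (GenQ b) + scal (- ?t)" by (simp add: scal_uminus)
      have "actM M (gen (GenQ b) - scal ?t) v = actM M (scal ?t) v \<oplus>\<^bsub>M\<^esub> actM M (scal (- ?t)) v"
        unfolding eq using A(3)[OF c Ufree_intros(3) vM] v(1) b by (simp add: hw_def)
      also have "\<dots> = actM M (scal ?t + scal (- ?t)) v"
        using A(3)[OF Ufree_intros(3,3) vM] by simp
      also have "\<dots> = \<zero>\<^bsub>M\<^esub>" using vM by (simp add: scal_uminus A)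
      finally have 1: "actM M (gen (GenQ b) - scal ?t) v = \<zero>\<^bsub>M\<^esub>" .
      have "actM N (gen (GenQ b) - scal ?t) w = actM N (scal ?t) w \<oplus>\<^bsub>N\<^esub> actM N (scal (- ?t)) w"
        unfolding eq using B(3)[OF c Ufree_intros(3) wN] w(1) b by (simp add: hw_def)
      also have "\<dots> = actM N (scal ?t + scal (- ?t)) w"
        using B(3)[OF Ufree_intros(3,3) wN] by simp
      also have "\<dots> = \<zero>\<^bsub>N\<^esub>" using wN by (simp add: scal_uminus B)
      finally show ?thesis using 1 c by (simp add: L_def Ufree_intros)
    qed
    show "u * x \<in> carrier Ufree" using u x by (intro Ufree_intros)
  qed
  then obtain p where p: "p \<in> FF" "u * x - p \<in> L" by blast
  then have pL: "actM M (u * x - p) v = \<zero>\<^bsub>M\<^esub>" "actM N (u * x - p) w = \<zero>\<^bsub>N\<^esub>" "u * x - p \<in> carrier Ufree"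
    by (auto simp: L_def)
  note pU = FF_Ufree[OF p(1)]
  have "actM M (u * x) v = actM M ((u * x - p) + p) v" by simp
  also have "\<dots> = actM M p v" using A(3)[OF pL(3) pU vM] pL(1) A(1)[OF pU vM] by simp
  finally have "actM M p v = \<zero>\<^bsub>M\<^esub>" using u x vM A(7) by (simp add: A(2))
  then have "lk p [] = 0" by (rule FF_annihilates[OF M v p(1)])
  have "actM N (u * x) w = actM N ((u * x - p) + p) w" by simp
  also have "\<dots> = actM N p w" using B(3)[OF pL(3) pU wN] pL(2) B(1)[OF pU wN] by simp
  finally have pw: "actM N p w = w" using u x wN by (simp add: B(2))
  have "actM N (p + scal (- 1)) w = w \<oplus>\<^bsub>N\<^esub> actM N (scal (- 1)) w"
    using B(3)[OF pU Ufree_intros(3) wN] pw by simp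
  also have "\<dots> = actM N (1 + scal (- 1)) w"
    using B(3)[OF Ufree_intros(2,3) wN] B(5)[OF wN] by simp
  also have "\<dots> = \<zero>\<^bsub>N\<^esub>" using wN by (simp add: scal_uminus B)
  finally have "lk (p + scal (- 1)) [] = 0"
    by (rule FF_annihilates[OF N(1) w FF_intros(5)[OF p(1) FF_intros(3)]])
  then have "lk p [] = 1"
    by (simp add: lookup_add lk_scal)
  then show False using \<open>lk p [] = 0\<close> by simp
qed

lemma actM_generates:
  assumes "irreducible_module U M" "y \<in> carrier M" "y \<noteq> \<zero>\<^bsub>M\<^esub>" "z \<in> carrier M"
  shows "\<exists>u\<in>carrier Ufree. actM M u y = z"
proof -
  obtain a where "a \<in> carrier U" "a \<odot>\<^bsub>M\<^esub> y = z" by (rule irreducible_generates[OF assms])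
  then show ?thesis unfolding carrier_U actM_def by blast
qed

lemma actM_diff_zero:
  assumes M: "left_module U M" and "u \<in> carrier Ufree" "w \<in> carrier Ufree" "x \<in> carrier M"
  shows "actM M (u - w) x = \<zero>\<^bsub>M\<^esub> \<longleftrightarrow> actM M u x = actM M w x"
proof -
  interpret left_module U M by fact
  note A = actM[OF M]
  have d: "u - w \<in> carrier Ufree" using assms by (intro Ufree_intros)
  have "actM M ((u - w) + w) x = actM M (u - w) x \<oplus>\<^bsub>M\<^esub> actM M w x"
    using d assms by (intro A(3))
  then have eq: "actM M u x = actM M (u - w) x \<oplus>\<^bsub>M\<^esub> actM M w x" by simp
  have cl: "actM M (u - w) x \<in> carrier M" "actM M w x \<in> carrier M"
    using d assms by (auto intro: A(1))
  show ?thesis unfolding eq using cl by (metis M.add.r_cancel_one M.l_zero)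
qed

text \<open>The two vectors have the same annihilator in the free algebra, so u v -> u w is well
  defined and bijective.\<close>

lemma highest_weight_unique:
  assumes M: "irreducible_module U M" and v: "hw M lam v" "v \<noteq> \<zero>\<^bsub>M\<^esub>"
    and N: "irreducible_module U N" and w: "hw N lam w" "w \<noteq> \<zero>\<^bsub>N\<^esub>"
  shows "module_isomorphic U M N"
proof -
  have LM: "left_module U M" and NL: "left_module U N" using M N by (auto simp: irreducible_module_def)
  note A = actM[OF LM] and B = actM[OF NL]
  have vM: "v \<in> carrier M" and wN: "w \<in> carrier N" using v w by (simp_all add: hw_def)
  have ann: "actM M x v = \<zero>\<^bsub>M\<^esub> \<longleftrightarrow> actM N x w = \<zero>\<^bsub>N\<^esub>" if "x \<in> carrier Ufree" for x
    using highest_annihilator[OF LM v NL N w that] highest_annihilator[OF NL w LM M v that] by blast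
  have eq_iff: "actM M x v = actM M y v \<longleftrightarrow> actM N x w = actM N y w"
    if "x \<in> carrier Ufree" "y \<in> carrier Ufree" for x y
    using ann[of "x - y"] that by (simp add: actM_diff_zero[OF LM _ _ vM] actM_diff_zero[OF NL _ _ wN] Ufree_intros)
  have genM: "\<exists>u\<in>carrier Ufree. actM M u v = z" if "z \<in> carrier M" for z
    by (rule actM_generates[OF M vM v(2) that])
  have genN: "\<exists>u\<in>carrier Ufree. actM N u w = z" if "z \<in> carrier N" for z
    by (rule actM_generates[OF N wN w(2) that])
  define h where "h z = actM N (SOME u. u \<in> carrier Ufree \<and> actM M u v = z) w" for z
  have h: "h (actM M u v) = actM N u w" if u: "u \<in> carrier Ufree" for u
  proof -
    let ?P = "\<lambda>u'. u' \<in> carrier Ufree \<and> actM M u' v = actM M u v"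
    have "?P (Eps ?P)" by (rule someI[of ?P u]) (simp add: u)
    then show ?thesis unfolding h_def using eq_iff u by blast
  qed
  have "iso_via U M N h"
    unfolding iso_via_def
  proof (intro conjI ballI)
    show "bij_betw h (carrier M) (carrier N)"
      unfolding bij_betw_def
    proof (intro conjI inj_onI equalityI subsetI)
      fix x y assume "x \<in> carrier M" "y \<in> carrier M" "h x = h y"
      then show "x = y" using genM[of x] genM[of y] h eq_iff by metis
    next
      fix y assume "y \<in> h ` carrier M"
      then obtain z where z: "z \<in> carrier M" "y = h z" by blast
      then obtain u where "u \<in> carrier Ufree" "actM M u v = z" using genM by blast
      then show "y \<in> carrier N" using h[of u] B(1)[OF _ wN] z by auto
    next
      fix y assume "y \<in> carrier N"
      then obtain u where u: "u \<in> carrier Ufree" "actM N u w = y" using genN by blast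
      show "y \<in> h ` carrier M"
        by (rule image_eqI[of _ _ "actM M u v"]) (use u h[of u] A(1)[OF _ vM] in auto)
    qed
    fix x assume x: "x \<in> carrier M"
    then obtain u where u: "u \<in> carrier Ufree" "x = actM M u v" using genM by blast
    show "h (x \<oplus>\<^bsub>M\<^esub> y) = h x \<oplus>\<^bsub>N\<^esub> h y" if y: "y \<in> carrier M" for y
    proof -
      obtain u' where u': "u' \<in> carrier Ufree" "y = actM M u' v" using genM y by blast
      have "h (actM M (u + u') v) = h x \<oplus>\<^bsub>N\<^esub> h y"
        using u u' wN by (simp add: h Ufree_intros B)
      then show ?thesis using u u' vM by (simp add: A)
    qed
    show "h (a \<odot>\<^bsub>M\<^esub> x) = a \<odot>\<^bsub>N\<^esub> h x" if a: "a \<in> carrier U" for a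
    proof -
      obtain u' where u': "u' \<in> carrier Ufree" "a = \<pi> u'" using a unfolding carrier_U by blast
      have "h (actM M (u' * u) v) = actM N u' (h x)"
        using u u' wN by (simp add: h Ufree_intros B)
      moreover have "actM M (u' * u) v = a \<odot>\<^bsub>M\<^esub> x"
        using A(2)[OF u'(1) u(1) vM] unfolding u(2) u'(2) by (simp only: actM_def)
      ultimately show ?thesis unfolding u'(2) by (simp only: actM_def)
    qed
  qed
  then show ?thesis by (auto simp: module_isomorphic_iso_via)
qed

lemma hw_add_scal:
  assumes M: "left_module U M" and x: "hw M lam x" and y: "hw M lam y"
  shows "hw M lam (x \<oplus>\<^bsub>M\<^esub> y)" "hw M lam (actM M (scal c) x)"
proof -
  interpret left_module U M by fact
  note A = actM[OF M]
  have xy: "x \<in> carrier M" "y \<in> carrier M" using x y by (auto simp: hw_def)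
  have g: "gen (GenE k) \<in> carrier Ufree" if "k \<in> {1..<n}" for k using that by (auto intro: Ufree_intros)
  have q: "gen (GenQ a) \<in> carrier Ufree" if "a \<in> doubled_lattice n" for a using that by (auto intro: Ufree_intros)
  show "hw M lam (x \<oplus>\<^bsub>M\<^esub> y)"
    using x y xy g q by (auto simp: hw_def A(4) Ufree_intros)
  have sc: "actM M u (actM M (scal c) x) = actM M (scal c) (actM M u x)" if "u \<in> carrier Ufree" for u
    using that xy by (simp add: scal_commute[of u] Ufree_intros flip: A(2))
  show "hw M lam (actM M (scal c) x)"
    using x xy g q by (auto simp: hw_def sc A Ufree_intros)
qed

text \<open>Write x = p v with p a polynomial in the f_k and subtract the constant term c: y = (p -
  c) v is again of highest weight. If y were nonzero, v = r y for some r in the f_k, and r (p - c) -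
  1 would kill v although its constant term is -1.\<close>

lemma hw_proportional:
  assumes M: "irreducible_module U M" and v: "hw M lam v" "v \<noteq> \<zero>\<^bsub>M\<^esub>" and x: "hw M lam x"
  shows "\<exists>c. x = actM M (scal c) v"
proof -
  have LM: "left_module U M" using M by (auto simp: irreducible_module_def)
  interpret left_module U M by fact
  note A = actM[OF LM]
  have vM: "v \<in> carrier M" and xM: "x \<in> carrier M" using v x by (simp_all add: hw_def)
  have FFgen: "\<exists>p\<in>FF. actM M p y = z" if y: "hw M lam y" "y \<noteq> \<zero>\<^bsub>M\<^esub>" and z: "z \<in> carrier M" for y z
  proof -
    have yM: "y \<in> carrier M" using y by (simp add: hw_def)
    obtain u where u: "u \<in> carrier Ufree" "actM M u y = z" using actM_generates[OF M yM y(2) z] by blast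
    define L where "L = {x \<in> carrier Ufree. actM M x y = \<zero>\<^bsub>M\<^esub>}"
    have "\<exists>p\<in>FF. u - p \<in> L"
    proof (rule FF_modulo)
      show "0 \<in> L" using yM by (simp add: L_def A Ufree_intros)
      show "w + z \<in> L" if "w \<in> L" "z \<in> L" for w z
        using that yM by (simp add: L_def A Ufree_intros)
      show "b * z \<in> L" if "b \<in> carrier Ufree" "z \<in> L" for b z
        using that yM by (simp add: L_def A Ufree_intros)
      show "uq_ideal n q s \<subseteq> L"
        using ideal.Icarr[OF uq_ideal_ideal] yM by (auto simp: L_def A)
      show "gen (GenE k) \<in> L" if "k \<in> {1..<n}" for k
        using that y(1) by (auto simp: L_def hw_def intro!: Ufree_intros)
      show "gen (GenQ b) - scal (s powi pairing n b lam) \<in> L" if b: "b \<in> doubled_lattice n" for b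
        using b y(1) yM by (simp add: L_def actM_diff_zero[OF LM _ _ yM] Ufree_intros hw_def)
    qed (rule u(1))
    then obtain p where p: "p \<in> FF" "actM M (u - p) y = \<zero>\<^bsub>M\<^esub>" by (auto simp: L_def)
    then have "actM M p y = z"
      using u actM_diff_zero[OF LM u(1) FF_Ufree[OF p(1)] yM] by simp
    then show ?thesis using p(1) by blast
  qed
  obtain p where p: "p \<in> FF" "actM M p v = x" using FFgen[OF v xM] by blast
  define c where "c = lk p []"
  let ?p = "p + scal (- c)"
  have pF: "?p \<in> FF" "?p \<in> carrier Ufree" using FF_intros(5)[OF p(1) FF_intros(3)] FF_Ufree by blast+
  have lk0: "lk ?p [] = 0"
    by (simp add: c_def lookup_add lk_scal)
  define y where "y = actM M ?p v"
  have y_eq: "y = x \<oplus>\<^bsub>M\<^esub> actM M (scal (- c)) v"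
    unfolding y_def p(2)[symmetric] using p(1) vM by (intro A(3) FF_Ufree Ufree_intros)
  have y: "hw M lam y"
    unfolding y_eq by (intro hw_add_scal[OF LM] x v(1) hw_add_scal(2)[OF LM v(1) v(1)])
  have "y = \<zero>\<^bsub>M\<^esub>"
  proof (rule ccontr)
    assume "y \<noteq> \<zero>\<^bsub>M\<^esub>"
    then obtain r where r: "r \<in> FF" "actM M r y = v" using FFgen[OF y _ vM] by blast
    have rp: "r * ?p \<in> FF" "r * ?p \<in> carrier Ufree" using FF_intros(4)[OF r(1) pF(1)] FF_Ufree by blast+
    have "actM M (r * ?p) v = actM M 1 v"
      using r pF vM by (simp add: A FF_Ufree y_def)
    then have "actM M (r * ?p - 1) v = \<zero>\<^bsub>M\<^esub>"
      using actM_diff_zero[OF LM rp(2) Ufree_intros(2) vM] by simp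
    then have "lk (r * ?p - 1) [] = 0"
      by (rule FF_annihilates[OF LM v FF_intros(6)[OF rp(1) FF_intros(2)]])
    moreover have "?p \<in> supp_in {ws. ws \<noteq> []}"
      using lk0 by (intro supp_inI) auto
    then have "r * ?p \<in> supp_in {ws. ws \<noteq> []}"
    proof (induction r rule: free_alg_induct)
      case (word d ws)
      have "word ws * ?p \<in> supp_in {ws. ws \<noteq> []}"
        by (rule lin_supp_in[of "\<lambda>p. word ws * p", OF _ word]) (auto intro!: lin_intros simp: word_mult)
      then show ?case by (simp add: mult.assoc supp_in_scal)
    qed (auto simp: distrib_right intro: supp_in_add)
    then have "lk (r * ?p) [] = 0" using supp_inD by fastforce
    ultimately show False by (simp add: lookup_minus lk_1)
  qed
  then have "actM M (p - scal c) v = \<zero>\<^bsub>M\<^esub>"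
    by (simp add: y_def scal_uminus)
  then have "x = actM M (scal c) v"
    using actM_diff_zero[OF LM FF_Ufree[OF p(1)] Ufree_intros(3) vM] p(2) by simp
  then show ?thesis by blast
qed

lemma hw_transport:
  assumes M: "left_module U M" and P: "left_module U P" and f: "iso_via U M P f"
    and e: "hw M lam e" "e \<noteq> \<zero>\<^bsub>M\<^esub>"
  shows "hw P lam (f e)" "f e \<noteq> \<zero>\<^bsub>P\<^esub>"
proof -
  interpret M: left_module U M by (rule M)
  have z: "f \<zero>\<^bsub>M\<^esub> = \<zero>\<^bsub>P\<^esub>" by (rule iso_via_zero[OF f M P])
  have eM: "e \<in> carrier M" using e by (simp add: hw_def)
  have fa: "actM P u (f e) = f (actM M u e)" if "u \<in> carrier Ufree" for u
    using that eM iso_viaD(4)[OF f] by (simp add: actM_def \<pi>_simps)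
  show "hw P lam (f e)"
    using e(1) iso_viaD(2)[OF f eM] by (auto simp: hw_def fa z Ufree_intros)
  show "f e \<noteq> \<zero>\<^bsub>P\<^esub>" using iso_viaD(5)[OF f eM, of "\<zero>\<^bsub>M\<^esub>"] z e(2) by auto
qed

section \<open>Multiplicities\<close>

text \<open>Summands isomorphic to H are counted by the dimension of the space of highest weight
  vectors of weight lam in M. The first decomposition embeds the coordinate space on its copies of H
  into that space, and the second provides coordinates that determine such a vector.\<close>

lemma multiplicity_le:
  fixes N N' :: "nat \<Rightarrow> (uq_gen free_alg set, 'c) module"
  assumes M: "left_module U M" and H: "irreducible_module U H" and e: "hw H lam e" "e \<noteq> \<zero>\<^bsub>H\<^esub>"
    and N: "\<And>i. i < r \<Longrightarrow> irreducible_module U (N i)" and g: "iso_via U M (direct_sum {..<r} N) g"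
    and N': "\<And>i. i < r' \<Longrightarrow> irreducible_module U (N' i)" and g': "iso_via U M (direct_sum {..<r'} N') g'"
  shows "card {i. i < r \<and> module_isomorphic U H (N i)} \<le> card {i. i < r' \<and> module_isomorphic U H (N' i)}"
    (is "card ?I \<le> card ?J")
proof -
  interpret left_module U M by fact
  note A = actM[OF M]
  have EL: "left_module U H" using H by (simp add: irreducible_module_def)
  have NL: "left_module U (N i)" if "i < r" for i using N[OF that] by (simp add: irreducible_module_def)
  have NL': "left_module U (N' i)" if "i < r'" for i using N'[OF that] by (simp add: irreducible_module_def)
  have hwE: "\<exists>b. hw P lam b \<and> b \<noteq> \<zero>\<^bsub>P\<^esub>" if P: "left_module U P" and iso: "module_isomorphic U H P" for P :: "(uq_gen free_alg set, 'c) module"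
    using iso hw_transport[OF EL P _ e] unfolding module_isomorphic_iso_via by blast
  have gcomp: "g x \<in> (\<Pi>\<^sub>E i\<in>{..<r}. carrier (N i))" if "x \<in> carrier M" for x
    using iso_viaD(2)[OF g that] by simp
  have "\<forall>i. \<exists>b. i \<in> ?I \<longrightarrow> hw (N i) lam b \<and> b \<noteq> \<zero>\<^bsub>N i\<^esub>" using hwE NL by blast
  then obtain b where b: "\<And>i. i \<in> ?I \<Longrightarrow> hw (N i) lam (b i) \<and> b i \<noteq> \<zero>\<^bsub>N i\<^esub>" by metis
  have "\<forall>i. \<exists>b. i \<in> ?J \<longrightarrow> hw (N' i) lam b \<and> b \<noteq> \<zero>\<^bsub>N' i\<^esub>" using hwE NL' by blast
  then obtain b' where b': "\<And>i. i \<in> ?J \<Longrightarrow> hw (N' i) lam (b' i) \<and> b' i \<noteq> \<zero>\<^bsub>N' i\<^esub>" by metis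
  \<comment> \<open>The vector with coefficient \<open>lk p [i]\<close> at the highest weight vector
    b i of each copy of H and zero in the other summands.\<close>
  let ?sum = "\<lambda>p. \<lambda>i\<in>{..<r}. if i \<in> ?I then actM (N i) (scal (lk p [i])) (b i) else \<zero>\<^bsub>N i\<^esub>"
  have zN: "\<zero>\<^bsub>N i\<^esub> \<in> carrier (N i)" if "i < r" for i
  proof -
    interpret N: left_module U "N i" by (rule NL[OF that])
    show ?thesis by simp
  qed
  have bN: "b i \<in> carrier (N i)" if "i \<in> ?I" for i using b[OF that] by (simp add: hw_def)
  have scN: "actM (N i) (scal c) (b i) \<in> carrier (N i)" if "i \<in> ?I" for i c
    using that actM(1)[OF NL Ufree_intros(3) bN] by auto
  have sum_carrier: "?sum p \<in> carrier (direct_sum {..<r} N)" for p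
    using scN zN by (auto simp: PiE_def Pi_def)
  define \<alpha> where "\<alpha> p = inv_into (carrier M) g (?sum p)" for p
  have \<alpha>: "\<alpha> p \<in> carrier M" "g (\<alpha> p) = ?sum p" for p
    unfolding \<alpha>_def using iso_viaD(1)[OF g] sum_carrier[of p]
    by (auto simp: bij_betw_def inv_into_into f_inv_into_f simp del: direct_sum_simps)
  have g_eq: "x = y" if "x \<in> carrier M" "y \<in> carrier M" "\<And>i. i < r \<Longrightarrow> g x i = g y i" for x y
  proof -
    have "g x = g y"
      by (rule PiE_ext[OF gcomp[OF that(1)] gcomp[OF that(2)]]) (use that(3) in simp)
    then show ?thesis using iso_viaD(5)[OF g that(1,2)] by simp
  qed
  have g_act: "g (actM M u x) i = actM (N i) u (g x i)" if "u \<in> carrier Ufree" "x \<in> carrier M" "i < r" for u x i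
    using iso_viaD(4)[OF g \<pi>_simps(1)[OF that(1)] that(2)] that(3) by (simp add: actM_def)
  have g'_act: "g' (actM M u x) i = actM (N' i) u (g' x i)" if "u \<in> carrier Ufree" "x \<in> carrier M" "i < r'" for u x i
    using iso_viaD(4)[OF g' \<pi>_simps(1)[OF that(1)] that(2)] that(3) by (simp add: actM_def)
  have g_add: "g (x \<oplus>\<^bsub>M\<^esub> y) i = g x i \<oplus>\<^bsub>N i\<^esub> g y i" if "x \<in> carrier M" "y \<in> carrier M" "i < r" for x y i
    using iso_viaD(3)[OF g that(1,2)] that(3) by simp
  have g'_add: "g' (x \<oplus>\<^bsub>M\<^esub> y) i = g' x i \<oplus>\<^bsub>N' i\<^esub> g' y i" if "x \<in> carrier M" "y \<in> carrier M" "i < r'" for x y i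
    using iso_viaD(3)[OF g' that(1,2)] that(3) by simp
  have g'C: "g' x i \<in> carrier (N' i)" if "x \<in> carrier M" "i < r'" for x i
    using iso_viaD(2)[OF g' that(1)] that(2) by auto
  have gC: "g x i \<in> carrier (N i)" if "x \<in> carrier M" "i < r" for x i
    using iso_viaD(2)[OF g that(1)] that(2) by auto
  have g_zero: "g \<zero>\<^bsub>M\<^esub> i = \<zero>\<^bsub>N i\<^esub>" if "i < r" for i
    using g_act[of 0 "\<zero>\<^bsub>M\<^esub>" i] that A(8)[OF M.zero_closed] actM(8)[OF NL[OF that] gC[OF M.zero_closed that]]
    by (simp add: Ufree_intros)
  have g'_zero: "g' \<zero>\<^bsub>M\<^esub> i = \<zero>\<^bsub>N' i\<^esub>" if "i < r'" for i
    using g'_act[of 0 "\<zero>\<^bsub>M\<^esub>" i] that A(8)[OF M.zero_closed] actM(8)[OF NL'[OF that] g'C[OF M.zero_closed that]]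
    by (simp add: Ufree_intros)
  have zero_hw: "hw (N i) lam \<zero>\<^bsub>N i\<^esub>" if "i < r" for i
    using zN[OF that] actM(7)[OF NL[OF that]] by (auto simp: hw_def Ufree_intros)
  have \<alpha>_hw: "hw M lam (\<alpha> p)" for p
  proof -
    have comp: "hw (N i) lam (g (\<alpha> p) i)" if "i < r" for i
      using that b hw_add_scal(2)[OF NL[OF that], of lam "b i" "b i" "lk p [i]"] zero_hw[OF that] by (auto simp: \<alpha>(2))
    show ?thesis
      unfolding hw_def
    proof (intro conjI ballI \<alpha>(1))
      fix k assume k: "k \<in> {1..<n}"
      then have gk: "gen (GenE k) \<in> carrier Ufree" by (auto intro: Ufree_intros)
      show "actM M (gen (GenE k)) (\<alpha> p) = \<zero>\<^bsub>M\<^esub>"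
        by (rule g_eq) (use comp k in \<open>auto simp: g_act[OF gk \<alpha>(1)] g_zero hw_def A(1)[OF gk \<alpha>(1)]\<close>)
    next
      fix a assume a: "a \<in> doubled_lattice n"
      then have ga: "gen (GenQ a) \<in> carrier Ufree" by (auto intro: Ufree_intros)
      show "actM M (gen (GenQ a)) (\<alpha> p) = actM M (scal (s powi pairing n a lam)) (\<alpha> p)"
        by (rule g_eq) (use comp a in \<open>auto simp: g_act[OF ga \<alpha>(1)] g_act[OF Ufree_intros(3) \<alpha>(1)] hw_def
            A(1)[OF ga \<alpha>(1)] A(1)[OF Ufree_intros(3) \<alpha>(1)]\<close>)
    qed
  qed
  have \<alpha>_add: "\<alpha> (p + p') = \<alpha> p \<oplus>\<^bsub>M\<^esub> \<alpha> p'" for p p'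
  proof (rule g_eq)
    fix i assume i: "i < r"
    interpret N: left_module U "N i" by (rule NL[OF i])
    show "g (\<alpha> (p + p')) i = g (\<alpha> p \<oplus>\<^bsub>M\<^esub> \<alpha> p') i"
      using i actM(3)[OF NL[OF i] Ufree_intros(3,3) bN]
      by (auto simp: g_add[OF \<alpha>(1) \<alpha>(1)] \<alpha>(2) lookup_add scal_add)
  qed (use \<alpha>(1) in auto)
  have scalN: "actM P (scal (c * d)) x = actM P (scal c) (actM P (scal d) x)" if "left_module U P" "x \<in> carrier P"
    for P :: "(uq_gen free_alg set, 'c) module" and c d x
    using actM(2)[OF that(1) Ufree_intros(3,3) that(2)] by (simp add: scal_mult)
  have \<alpha>_scal: "\<alpha> (scal c * p) = actM M (scal c) (\<alpha> p)" for c p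
  proof (rule g_eq)
    fix i assume i: "i < r"
    show "g (\<alpha> (scal c * p)) i = g (actM M (scal c) (\<alpha> p)) i"
      using i scalN[OF NL[OF i] bN] actM(7)[OF NL[OF i]]
      by (auto simp: g_act[OF Ufree_intros(3) \<alpha>(1)] \<alpha>(2) Ufree_intros)
  qed (use \<alpha>(1) A(1)[OF Ufree_intros(3) \<alpha>(1)] in auto)
  have comp': "hw (N' j) lam (g' x j)" if "j < r'" "hw M lam x" for j x
  proof -
    have xM: "x \<in> carrier M" using that by (simp add: hw_def)
    have "gen (GenE k) \<in> carrier Ufree" if "k \<in> {1..<n}" for k using that by (auto intro: Ufree_intros)
    moreover have "gen (GenQ a) \<in> carrier Ufree" if "a \<in> doubled_lattice n" for a using that by (auto intro: Ufree_intros)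
    ultimately show ?thesis
      using that(2) g'C[OF xM that(1)]
      by (auto simp: hw_def g'_zero[OF that(1)] Ufree_intros simp flip: g'_act[OF _ xM that(1)])
  qed
  have coeff: "\<exists>!c. g' x j = actM (N' j) (scal c) (b' j)" if j: "j \<in> ?J" and x: "hw M lam x" for j x
  proof -
    have jr: "j < r'" using j by simp
    have b'N: "b' j \<in> carrier (N' j)" using b'[OF j] by (simp add: hw_def)
    have "\<exists>c. g' x j = actM (N' j) (scal c) (b' j)"
      using hw_proportional[OF N'[OF jr] _ _ comp'[OF jr x]] b'[OF j] by blast
    moreover have "c = d" if "actM (N' j) (scal c) (b' j) = actM (N' j) (scal d) (b' j)" for c d
    proof -
      have "actM (N' j) (scal c - scal d) (b' j) = \<zero>\<^bsub>N' j\<^esub>"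
        using actM_diff_zero[OF NL'[OF jr] Ufree_intros(3,3) b'N] that by simp
      then have "c - d = 0"
        using actM(9)[OF NL'[OF jr] b'N, of "c - d"] b'[OF j] by (simp add: scal_diff)
      then show ?thesis by simp
    qed
    ultimately show ?thesis by metis
  qed
  define \<gamma> where "\<gamma> x j = (THE c. g' x j = actM (N' j) (scal c) (b' j))" for x j
  have \<gamma>: "g' x j = actM (N' j) (scal (\<gamma> x j)) (b' j)" if "j \<in> ?J" "hw M lam x" for j x
    unfolding \<gamma>_def by (rule theI'[OF coeff[OF that]])
  have \<gamma>I: "\<gamma> x j = c" if "j \<in> ?J" "hw M lam x" "g' x j = actM (N' j) (scal c) (b' j)" for j x c
    using coeff[OF that(1,2)] \<gamma>[OF that(1,2)] that(3) by blast
  \<comment> \<open>A nonzero component would be a highest weight vector of weight lam, and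
    uniqueness would make its summand isomorphic to H.\<close>
  have outside: "g' x j = \<zero>\<^bsub>N' j\<^esub>" if "j < r'" "j \<notin> ?J" "hw M lam x" for j x
  proof (rule ccontr)
    assume "g' x j \<noteq> \<zero>\<^bsub>N' j\<^esub>"
    then have "module_isomorphic U H (N' j)"
      using highest_weight_unique[OF H e N'[OF that(1)] comp'[OF that(1,3)]] by blast
    then show False using that(1,2) by simp
  qed
  define G where "G p = (\<Sum>j\<in>?J. scal (\<gamma> (\<alpha> p) j) * gen j)" for p
  show ?thesis
  proof (rule card_le_of_linear_inj[of ?I ?J G])
    show "lin G"
    proof (rule linI)
      fix p p' and c
      have "\<gamma> (\<alpha> (p + p')) j = \<gamma> (\<alpha> p) j + \<gamma> (\<alpha> p') j" if j: "j \<in> ?J" for j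
      proof (rule \<gamma>I[OF j \<alpha>_hw])
        have jr: "j < r'" and b'N: "b' j \<in> carrier (N' j)" using j b'[OF j] by (auto simp: hw_def)
        show "g' (\<alpha> (p + p')) j = actM (N' j) (scal (\<gamma> (\<alpha> p) j + \<gamma> (\<alpha> p') j)) (b' j)"
          using g'_add[OF \<alpha>(1) \<alpha>(1) jr] \<gamma>[OF j \<alpha>_hw] actM(3)[OF NL'[OF jr] Ufree_intros(3,3) b'N]
          by (simp add: \<alpha>_add scal_add)
      qed
      then show "G (p + p') = G p + G p'"
        by (simp add: G_def scal_add distrib_right sum.distrib)
      have "\<gamma> (\<alpha> (scal c * p)) j = c * \<gamma> (\<alpha> p) j" if j: "j \<in> ?J" for j
      proof (rule \<gamma>I[OF j \<alpha>_hw])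
        have jr: "j < r'" and b'N: "b' j \<in> carrier (N' j)" using j b'[OF j] by (auto simp: hw_def)
        show "g' (\<alpha> (scal c * p)) j = actM (N' j) (scal (c * \<gamma> (\<alpha> p) j)) (b' j)"
          using g'_act[OF Ufree_intros(3) \<alpha>(1) jr] \<gamma>[OF j \<alpha>_hw] scalN[OF NL'[OF jr] b'N]
          by (simp add: \<alpha>_scal)
      qed
      then show "G (scal c * p) = scal c * G p"
        by (simp add: G_def sum_distrib_left scal_mult_left)
    qed
    show "G p \<in> supp_in ((\<lambda>i. [i]) ` ?J)" for p
      unfolding G_def by (intro supp_in_sum supp_in_scal) simp
    fix p assume p: "p \<in> supp_in ((\<lambda>i. [i]) ` ?I)" "G p = 0"
    have \<gamma>0: "\<gamma> (\<alpha> p) j = 0" if j: "j \<in> ?J" for j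
    proof -
      have "lk (G p) [j] = (\<Sum>i\<in>?J. if i = j then \<gamma> (\<alpha> p) j else 0)"
        unfolding G_def lookup_sum by (intro sum.cong) (auto simp: lookup_word)
      also have "\<dots> = \<gamma> (\<alpha> p) j" using j by simp
      finally show ?thesis using p(2) by simp
    qed
    have "g' (\<alpha> p) j = \<zero>\<^bsub>N' j\<^esub>" if "j < r'" for j
    proof (cases "j \<in> ?J")
      case True
      then have "b' j \<in> carrier (N' j)" using b' by (simp add: hw_def)
      then show ?thesis using \<gamma>[OF True \<alpha>_hw] \<gamma>0[OF True] actM(8)[OF NL'[OF that]] by simp
    qed (use outside that \<alpha>_hw in blast)
    then have "g' (\<alpha> p) = g' \<zero>\<^bsub>M\<^esub>"
      using iso_viaD(2)[OF g' \<alpha>(1)] iso_viaD(2)[OF g' M.zero_closed] g'_zero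
      by (intro PiE_ext[of _ "{..<r'}" "\<lambda>i. carrier (N' i)"]) auto
    then have "\<alpha> p = \<zero>\<^bsub>M\<^esub>" using iso_viaD(5)[OF g' \<alpha>(1) M.zero_closed] by simp
    then have zero: "?sum p i = \<zero>\<^bsub>N i\<^esub>" if "i < r" for i
      using \<alpha>(2)[of p] g_zero[OF that] by simp
    show "p = 0"
    proof (rule free_alg_eqI)
      fix ws
      show "lk p ws = lk 0 ws"
      proof (cases "ws \<in> (\<lambda>i. [i]) ` ?I")
        case True
        then obtain i where i: "ws = [i]" "i \<in> ?I" by blast
        then have "actM (N i) (scal (lk p [i])) (b i) = \<zero>\<^bsub>N i\<^esub>" using zero[of i] by simp
        then show ?thesis using actM(9)[OF NL bN[OF i(2)]] b[OF i(2)] i by simp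
      next
        case False
        then show ?thesis using supp_inD[OF p(1), of ws] by auto
      qed
    qed
  qed simp_all
qed

text \<open>Any two decompositions contain equally many copies of H by the inequality in both
  directions, so the definite description has the value given by any one of them.\<close>

lemma multiplicity_in_eq:
  fixes M :: "(uq_gen free_alg set, 'm) module" and N :: "nat \<Rightarrow> (uq_gen free_alg set, 'm) module"
  assumes M: "left_module U M" and H: "irreducible_module U H" and e: "hw H lam e" "e \<noteq> \<zero>\<^bsub>H\<^esub>"
    and N: "\<And>i. i < r \<Longrightarrow> irreducible_module U (N i)" and iso: "module_isomorphic U M (direct_sum {..<r} N)"
  shows "multiplicity_in U H M = card {i. i < r \<and> module_isomorphic U H (N i)}"
  unfolding multiplicity_in_def
proof (rule the_equality)
  show "\<exists>r' (N' :: nat \<Rightarrow> (uq_gen free_alg set, 'm) module). (\<forall>i<r'. irreducible_module U (N' i)) \<and> module_isomorphic U M (direct_sum {..<r'} N') \<and>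
      card {i. i < r \<and> module_isomorphic U H (N i)} = card {i. i < r' \<and> module_isomorphic U H (N' i)}"
    by (intro exI[of _ r] exI[of _ N]) (use N iso in auto)
  fix m assume "\<exists>r' (N' :: nat \<Rightarrow> (uq_gen free_alg set, 'm) module). (\<forall>i<r'. irreducible_module U (N' i)) \<and> module_isomorphic U M (direct_sum {..<r'} N') \<and>
      m = card {i. i < r' \<and> module_isomorphic U H (N' i)}"
  then obtain r' and N' :: "nat \<Rightarrow> (uq_gen free_alg set, 'm) module" where N': "\<And>i. i < r' \<Longrightarrow> irreducible_module U (N' i)"
    "module_isomorphic U M (direct_sum {..<r'} N')" "m = card {i. i < r' \<and> module_isomorphic U H (N' i)}"
    by blast
  obtain g where g: "iso_via U M (direct_sum {..<r} N) g"
    using iso by (auto simp: module_isomorphic_iso_via)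
  obtain g' where g': "iso_via U M (direct_sum {..<r'} N') g'"
    using N'(2) by (auto simp: module_isomorphic_iso_via)
  show "m = card {i. i < r \<and> module_isomorphic U H (N i)}"
    unfolding N'(3)
    by (rule le_antisym[OF multiplicity_le[OF M H e N'(1) g' N g] multiplicity_le[OF M H e N g N'(1) g']])
qed

lemma E_module_irreducible:
  fixes M :: "(uq_gen free_alg set, 'm) module"
  assumes M: "irreducible_module U M" and v: "hw M (\<lambda>i. int (lam i)) v" "v \<noteq> \<zero>\<^bsub>M\<^esub>"
  shows "irreducible_highest_weight n q s lam (E_module n q s lam)"
proof -
  have LM: "left_module U M" using M by (simp add: irreducible_module_def)
  have vM: "v \<in> carrier M" using v by (simp add: hw_def)
  obtain N :: "(uq_gen free_alg set, uq_gen free_alg set set) module" and h where N: "iso_via U M N h" "left_module U N"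
    using transport_to_sets[OF LM, of v] irreducible_generates[OF M vM v(2)] by metis
  note hw_transport[OF LM N(2,1) v]
  then have "irreducible_highest_weight n q s lam N"
    using irreducible_transport[OF M N] by (auto simp: irreducible_highest_weight_hw)
  then show ?thesis
    unfolding E_module_def by (rule someI[of "irreducible_highest_weight n q s lam"])
qed

end

section \<open>Paths and standard tableaux\<close>

context quantum_gl
begin

text \<open>Shapes with m boxes and at most n rows, so that induction on m is possible while n stays
  fixed.\<close>

definition young :: "nat \<Rightarrow> (nat \<Rightarrow> nat) set" where
  "young m = {lam. (\<forall>i. i \<notin> {1..n} \<longrightarrow> lam i = 0) \<and> (\<forall>i\<ge>1. lam (i + 1) \<le> lam i) \<and> (\<Sum>i=1..n. lam i) = m}"

definition removable :: "(nat \<Rightarrow> nat) \<Rightarrow> nat set" where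
  "removable mu = {j \<in> {1..n}. mu (j + 1) < mu j}"

definition remove :: "(nat \<Rightarrow> nat) \<Rightarrow> nat \<Rightarrow> nat \<Rightarrow> nat" where
  "remove mu j = mu(j := mu j - 1)"

lemma young_remove:
  assumes "mu \<in> young (Suc m)" "j \<in> removable mu"
  shows "remove mu j \<in> young m"
proof -
  have j: "j \<in> {1..n}" "mu (j + 1) < mu j" using assms(2) by (auto simp: removable_def)
  have "(\<Sum>i=1..n. mu i) = mu j + (\<Sum>i\<in>{1..n} - {j}. mu i)"
    using j(1) by (simp add: sum.remove)
  moreover have "(\<Sum>i=1..n. remove mu j i) = (mu j - 1) + (\<Sum>i\<in>{1..n} - {j}. mu i)"
    using j(1) by (subst sum.remove[of _ j]) (auto simp: remove_def intro!: sum.cong)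
  ultimately have "(\<Sum>i=1..n. remove mu j i) = m"
    using assms(1) j(2) by (simp add: young_def)
  moreover have "remove mu j (i + 1) \<le> remove mu j i" if "i \<ge> 1" for i
  proof -
    have "mu (i + 1) \<le> mu i" using assms(1) that by (simp add: young_def)
    then show ?thesis using j(2) by (auto simp: remove_def)
  qed
  moreover have "remove mu j i = 0" if "i \<notin> {1..n}" for i
    using assms(1) that j(1) unfolding young_def remove_def by auto
  ultimately show ?thesis by (simp add: young_def)
qed

lemma removable_nonempty:
  assumes "mu \<in> young (Suc m)"
  shows "removable mu \<noteq> {}"
proof -
  have "\<exists>i\<in>{1..n}. mu i > 0"
  proof (rule ccontr)
    assume "\<not> ?thesis"
    then have "(\<Sum>i=1..n. mu i) = 0" by simp
    then show False using assms by (simp add: young_def)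
  qed
  then have ne: "{i \<in> {1..n}. mu i > 0} \<noteq> {}" by blast
  define j where "j = Max {i \<in> {1..n}. mu i > 0}"
  have fin: "finite {i \<in> {1..n}. mu i > 0}" by simp
  have j: "j \<in> {1..n}" "mu j > 0" using Max_in[OF fin ne] unfolding j_def by blast+
  have "mu (j + 1) = 0"
  proof (rule ccontr)
    assume a: "mu (j + 1) \<noteq> 0"
    have "\<forall>i. i \<notin> {1..n} \<longrightarrow> mu i = 0" using assms by (simp add: young_def)
    with a have "j + 1 \<in> {i \<in> {1..n}. mu i > 0}" by auto
    from Max_ge[OF fin this] have "j + 1 \<le> j" by (simp only: j_def)
    then show False by simp
  qed
  then show ?thesis using j by (auto simp: removable_def)
qed

definition paths_to :: "nat \<Rightarrow> (nat \<Rightarrow> nat) \<Rightarrow> nat list set" where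
  "paths_to m lam = {js \<in> paths m. count_list js = lam}"

lemma finite_paths_to: "finite (paths_to m lam)"
  using finite_paths by (simp add: paths_to_def)

lemma count_list_young: "js \<in> paths m \<Longrightarrow> count_list js \<in> young m"
  using paths_props[of js m] sum_count_set[of js "{1..n}"] by (auto simp: young_def count_list_0_iff)

text \<open>The last step of a path fills a corner of mu; this is the branching rule that standard
  tableaux satisfy too.\<close>

lemma paths_to_Suc:
  assumes mu: "mu \<in> young (Suc m)"
  shows "paths_to (Suc m) mu = (\<Union>j\<in>removable mu. (\<lambda>js. js @ [j]) ` paths_to m (remove mu j))"
proof (intro equalityI subsetI)
  fix l assume "l \<in> paths_to (Suc m) mu"
  then obtain js j where l: "l = js @ [j]" "js \<in> paths m" "j \<in> {1..n}" "addable (count_list js) j"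
    and c: "count_list l = mu" by (auto simp: paths_to_def)
  have mu_eq: "mu i = count_list js i + (if i = j then 1 else 0)" for i
    using fun_cong[OF c, of i] l(1) by auto
  have "count_list js (j + 1) \<le> count_list js j" using paths_props(3)[OF l(2)] l(3) by simp
  then have "j \<in> removable mu" using l(3) by (simp add: removable_def mu_eq)
  moreover have "count_list js = remove mu j" by (auto simp: remove_def mu_eq fun_eq_iff)
  ultimately show "l \<in> (\<Union>j\<in>removable mu. (\<lambda>js. js @ [j]) ` paths_to m (remove mu j))"
    using l(1,2) by (auto simp: paths_to_def)
next
  fix l assume "l \<in> (\<Union>j\<in>removable mu. (\<lambda>js. js @ [j]) ` paths_to m (remove mu j))"
  then obtain js j where l: "l = js @ [j]" "j \<in> removable mu" "js \<in> paths m" "count_list js = remove mu j"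
    by (auto simp: paths_to_def)
  have j: "j \<in> {1..n}" "mu (j + 1) < mu j" using l(2) by (auto simp: removable_def)
  have "addable (count_list js) j"
  proof (cases "j = 1")
    case False
    then have "j = Suc (j - 1)" "j - 1 \<ge> 1" using j(1) by auto
    then have "mu j \<le> mu (j - 1)" using mu by (metis (mono_tags, lifting) Suc_eq_plus1 mem_Collect_eq young_def)
    then show ?thesis using j False by (auto simp: addable_def l(4) remove_def)
  qed (simp add: addable_def)
  moreover have "count_list l = mu" using j by (auto simp: l(1,4) remove_def fun_eq_iff)
  ultimately show "l \<in> paths_to (Suc m) mu" using l(1,3) j by (auto simp: paths_to_def)
qed

lemma card_paths_to_Suc:
  assumes "mu \<in> young (Suc m)"
  shows "card (paths_to (Suc m) mu) = (\<Sum>j\<in>removable mu. card (paths_to m (remove mu j)))"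
proof -
  have "card (paths_to (Suc m) mu) = (\<Sum>j\<in>removable mu. card ((\<lambda>js. js @ [j]) ` paths_to m (remove mu j)))"
    unfolding paths_to_Suc[OF assms]
    by (rule card_UN_disjoint) (auto simp: removable_def finite_paths_to)
  then show ?thesis by (simp add: card_image inj_on_def)
qed

lemma diagram_remove:
  assumes "j \<in> removable mu"
  shows "diagram mu = insert (j, mu j) (diagram (remove mu j))" "(j, mu j) \<notin> diagram (remove mu j)"
  using assms by (auto simp: diagram_def removable_def remove_def split: if_splits)

text \<open>The box with the largest entry has no box to its right and none below it.\<close>

lemma standard_tableaux_max:
  assumes mu: "mu \<in> young (Suc m)" and S: "S \<in> standard_tableaux (Suc m) mu"
  shows "\<exists>j\<in>removable mu. S (j, mu j) = Suc m"
proof -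
  have bij: "bij_betw S (diagram mu) {1..Suc m}"
    and row: "\<And>i j. (i, j) \<in> diagram mu \<Longrightarrow> (i, j + 1) \<in> diagram mu \<Longrightarrow> S (i, j) < S (i, j + 1)"
    and col: "\<And>i j. (i, j) \<in> diagram mu \<Longrightarrow> (i + 1, j) \<in> diagram mu \<Longrightarrow> S (i, j) < S (i + 1, j)"
    using S by (auto simp: standard_tableaux_def)
  have le: "S b \<le> Suc m" if "b \<in> diagram mu" for b using bij that by (auto simp: bij_betw_def)
  have "Suc m \<in> S ` diagram mu" using bij by (auto simp: bij_betw_def)
  then obtain i c where ic: "(i, c) \<in> diagram mu" "S (i, c) = Suc m" by auto
  have "(i, c + 1) \<notin> diagram mu" using row[OF ic(1)] le[of "(i, c + 1)"] ic(2) by fastforce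
  then have c: "c = mu i" using ic(1) by (auto simp: diagram_def)
  have "(i + 1, c) \<notin> diagram mu" using col[OF ic(1)] le[of "(i + 1, c)"] ic(2) by fastforce
  then have "mu (i + 1) < mu i" using ic(1) c by (auto simp: diagram_def)
  moreover have "i \<in> {1..n}"
    using mu ic(1) unfolding young_def diagram_def by force
  ultimately show ?thesis using ic(2) c by (auto simp: removable_def)
qed

lemma standard_tableaux_restrict:
  assumes j: "j \<in> removable mu" and S: "S \<in> standard_tableaux (Suc m) mu" "S (j, mu j) = Suc m"
  shows "restrict S (diagram (remove mu j)) \<in> standard_tableaux m (remove mu j)"
proof -
  let ?D = "diagram (remove mu j)"
  note D = diagram_remove[OF j]
  have bij: "bij_betw S (diagram mu) {1..Suc m}" using S by (auto simp: standard_tableaux_def)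
  have inj: "inj_on S (insert (j, mu j) ?D)" and im: "S ` insert (j, mu j) ?D = {1..Suc m}"
    using bij unfolding D(1) bij_betw_def by auto
  have "S ` ?D = {1..Suc m} - {Suc m}"
  proof -
    have "Suc m \<notin> S ` ?D" using inj D(2) unfolding inj_on_insert S(2) by simp
    moreover have "insert (Suc m) (S ` ?D) = {1..Suc m}" using im S(2) by simp
    ultimately show ?thesis by blast
  qed
  also have "{1..Suc m} - {Suc m} = {1..m}" by auto
  finally have "bij_betw S ?D {1..m}"
    using inj by (simp add: bij_betw_def inj_on_insert)
  then have "bij_betw (restrict S ?D) ?D {1..m}"
    by (simp add: bij_betw_restrict_eq)
  moreover have sub: "b \<in> diagram mu" if "b \<in> ?D" for b using D(1) that by blast
  ultimately show ?thesis using S(1) sub by (simp add: standard_tableaux_def)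
qed

lemma standard_tableaux_extend:
  assumes mu: "mu \<in> young (Suc m)" and j: "j \<in> removable mu" and S: "S \<in> standard_tableaux m (remove mu j)"
  shows "S((j, mu j) := Suc m) \<in> standard_tableaux (Suc m) mu"
proof -
  let ?D = "diagram (remove mu j)" and ?b = "(j, mu j)"
  note D = diagram_remove[OF j]
  have bij: "bij_betw S ?D {1..m}"
    and row: "\<And>i j'. (i, j') \<in> ?D \<Longrightarrow> (i, j' + 1) \<in> ?D \<Longrightarrow> S (i, j') < S (i, j' + 1)"
    and col: "\<And>i j'. (i, j') \<in> ?D \<Longrightarrow> (i + 1, j') \<in> ?D \<Longrightarrow> S (i, j') < S (i + 1, j')"
    and ext: "S \<in> extensional ?D"
    using S by (auto simp: standard_tableaux_def)
  let ?S = "S(?b := Suc m)"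
  have le: "S b < Suc m" if "b \<in> ?D" for b using bij_betwE[OF bij] that by fastforce
  have T': "?S b = S b" if "b \<in> ?D" for b using D(2) that by auto
  have "bij_betw ?S ?D {1..m}" using bij T' by (subst bij_betw_cong[of ?D ?S S]) auto
  then have "bij_betw ?S (insert ?b ?D) (insert (Suc m) {1..m})"
    using D(2) notIn_Un_bij_betw[of ?b ?D ?S "{1..m}"] by simp
  then have 1: "bij_betw ?S (diagram mu) {1..Suc m}"
    unfolding D(1) by (simp add: atLeastAtMostSuc_conv)
  have b1: "(j, mu j + 1) \<notin> diagram mu" "(j + 1, mu j) \<notin> diagram mu"
    using j by (auto simp: diagram_def removable_def)
  have 2: "?S (i, c) < ?S (i, c + 1)" if "(i, c) \<in> diagram mu" "(i, c + 1) \<in> diagram mu" for i c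
  proof -
    have "(i, c) \<noteq> ?b" using b1 that by auto
    then have ic: "(i, c) \<in> ?D" using that D(1) by blast
    then show ?thesis
      using T'[OF ic] le[OF ic] row[OF ic] that(2) D by (cases "(i, c + 1) = ?b") auto
  qed
  have 3: "?S (i, c) < ?S (i + 1, c)" if "(i, c) \<in> diagram mu" "(i + 1, c) \<in> diagram mu" for i c
  proof -
    have "(i, c) \<noteq> ?b" using b1 that by auto
    then have ic: "(i, c) \<in> ?D" using that D(1) by blast
    then show ?thesis
      using T'[OF ic] le[OF ic] col[OF ic] that(2) D by (cases "(i + 1, c) = ?b") auto
  qed
  have "?S \<in> extensional (diagram mu)"
    using ext unfolding D(1) extensional_def by auto
  then show ?thesis using 1 2 3 unfolding standard_tableaux_def by blast
qed

lemma finite_diagram: "mu \<in> young m \<Longrightarrow> finite (diagram mu)"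
proof (rule finite_subset)
  assume mu: "mu \<in> young m"
  show "diagram mu \<subseteq> (SIGMA i:{1..n}. {1..mu i})"
    using mu unfolding young_def diagram_def by force
qed auto

lemma finite_standard_tableaux: "mu \<in> young m \<Longrightarrow> finite (standard_tableaux k mu)"
proof (rule finite_subset)
  assume mu: "mu \<in> young m"
  show "standard_tableaux k mu \<subseteq> (\<Pi>\<^sub>E b\<in>diagram mu. {1..k})"
    by (auto simp: standard_tableaux_def bij_betw_def PiE_def)
  show "finite (\<Pi>\<^sub>E b\<in>diagram mu. {1..k})"
    by (rule finite_PiE) (use finite_diagram[OF mu] in auto)
qed

text \<open>The tableaux are sorted by the corner with the largest entry; deleting and reinserting
  this entry are mutually inverse.\<close>

lemma card_standard_tableaux_Suc:
  assumes mu: "mu \<in> young (Suc m)"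
  shows "card (standard_tableaux (Suc m) mu) = (\<Sum>j\<in>removable mu. card (standard_tableaux m (remove mu j)))"
proof -
  define A where "A j = {S \<in> standard_tableaux (Suc m) mu. S (j, mu j) = Suc m}" for j
  have un: "standard_tableaux (Suc m) mu = (\<Union>j\<in>removable mu. A j)"
    using standard_tableaux_max[OF mu] by (auto simp: A_def)
  have fin: "finite (A j)" for j
    using finite_standard_tableaux[OF mu, of "Suc m"] by (simp add: A_def)
  have disj: "A j \<inter> A j' = {}" if "j \<in> removable mu" "j' \<in> removable mu" "j \<noteq> j'" for j j'
  proof (rule ccontr)
    assume "A j \<inter> A j' \<noteq> {}"
    then obtain S where "S \<in> A j" "S \<in> A j'" by blast
    then have S: "S \<in> standard_tableaux (Suc m) mu" "S (j, mu j) = S (j', mu j')"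
      by (simp_all add: A_def)
    have "(j, mu j) \<in> diagram mu" "(j', mu j') \<in> diagram mu"
      using diagram_remove(1) that by blast+
    then have "(j, mu j) = (j', mu j')"
      using S unfolding standard_tableaux_def bij_betw_def inj_on_def by blast
    then show False using that by simp
  qed
  have "card (A j) = card (standard_tableaux m (remove mu j))" if j: "j \<in> removable mu" for j
  proof (rule bij_betw_same_card[of "\<lambda>S. restrict S (diagram (remove mu j))"],
      rule bij_betw_byWitness[of _ "\<lambda>S. S((j, mu j) := Suc m)"])
    note D = diagram_remove[OF j]
    show "\<forall>S\<in>A j. (restrict S (diagram (remove mu j)))((j, mu j) := Suc m) = S"
    proof
      fix S assume S: "S \<in> A j"
      then have ext: "S \<in> extensional (insert (j, mu j) (diagram (remove mu j)))" "S (j, mu j) = Suc m"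
        unfolding A_def standard_tableaux_def D(1)[symmetric] by auto
      then show "(restrict S (diagram (remove mu j)))((j, mu j) := Suc m) = S"
        by (auto simp: fun_eq_iff extensional_def restrict_def)
    qed
    show "\<forall>S\<in>standard_tableaux m (remove mu j). restrict (S((j, mu j) := Suc m)) (diagram (remove mu j)) = S"
    proof
      fix S assume "S \<in> standard_tableaux m (remove mu j)"
      then have "S \<in> extensional (diagram (remove mu j))" by (simp add: standard_tableaux_def)
      then show "restrict (S((j, mu j) := Suc m)) (diagram (remove mu j)) = S"
        using D(2) by (auto simp: fun_eq_iff extensional_def restrict_def)
    qed
    show "(\<lambda>S. restrict S (diagram (remove mu j))) ` A j \<subseteq> standard_tableaux m (remove mu j)"
      using standard_tableaux_restrict[OF j] by (auto simp: A_def)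
    show "(\<lambda>S. S((j, mu j) := Suc m)) ` standard_tableaux m (remove mu j) \<subseteq> A j"
      using standard_tableaux_extend[OF mu j] by (auto simp: A_def)
  qed
  moreover have "card (\<Union>j\<in>removable mu. A j) = (\<Sum>j\<in>removable mu. card (A j))"
    by (rule card_UN_disjoint) (use fin disj in \<open>auto simp: removable_def\<close>)
  ultimately show ?thesis unfolding un by simp
qed

lemma card_paths_to: "lam \<in> young m \<Longrightarrow> card (paths_to m lam) = card (standard_tableaux m lam)"
proof (induction m arbitrary: lam)
  case 0
  have "lam i = 0" for i
  proof (cases "i \<in> {1..n}")
    case True
    then show ?thesis using 0 by (simp add: young_def)
  next
    case False
    then show ?thesis using 0 unfolding young_def by simp
  qed
  then have lam: "lam = (\<lambda>_. 0)" by (simp add: fun_eq_iff)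
  have "diagram lam = {}" by (auto simp: diagram_def lam)
  then have "standard_tableaux 0 lam = {\<lambda>_. undefined}"
    by (auto simp: standard_tableaux_def bij_betw_def)
  moreover have "paths_to 0 lam = {[]}" by (auto simp: paths_to_def lam)
  ultimately show ?case by simp
next
  case (Suc m)
  then show ?case
    by (simp add: card_paths_to_Suc card_standard_tableaux_Suc young_remove)
qed

text \<open>Supplies, for each partition, a cyclic module that witnesses the choice in
  \<open>E_module\<close>.\<close>

lemma paths_to_nonempty: "lam \<in> young m \<Longrightarrow> paths_to m lam \<noteq> {}"
proof (induction m arbitrary: lam)
  case 0
  have "lam i = 0" for i using 0 by (cases "i \<in> {1..n}") (simp_all add: young_def)
  then have "lam = (\<lambda>_. 0)" by (simp add: fun_eq_iff)
  then show ?case by (auto simp: paths_to_def)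
next
  case (Suc m)
  obtain j where j: "j \<in> removable lam" using removable_nonempty[OF Suc.prems] by blast
  then obtain t where "t \<in> paths_to m (remove lam j)"
    using Suc.IH[OF young_remove[OF Suc.prems j]] by blast
  with j have "t @ [j] \<in> paths_to (Suc m) lam" unfolding paths_to_Suc[OF Suc.prems] by blast
  then show ?case by blast
qed

lemma partitions_young: "partitions n = young n"
proof -
  have "(\<forall>i\<in>{1..<n}. lam (i + 1) \<le> lam i) \<longleftrightarrow> (\<forall>i\<ge>1::nat. lam (i + 1) \<le> lam i)"
    if "\<forall>i. i \<notin> {1..n} \<longrightarrow> lam i = 0" for lam :: "nat \<Rightarrow> nat"
  proof (intro iffI allI impI ballI)
    fix i :: nat assume a: "\<forall>i\<in>{1..<n}. lam (i + 1) \<le> lam i" and i: "1 \<le> i"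
    show "lam (i + 1) \<le> lam i"
    proof (cases "i < n")
      case True
      then show ?thesis using a i by auto
    next
      case False
      then have "lam (i + 1) = 0" using that by auto
      then show ?thesis by simp
    qed
  qed auto
  then show ?thesis unfolding partitions_def young_def by blast
qed

end

section \<open>The module generated by the quantum alpha-determinant\<close>

context quantum_gl
begin

section \<open>The action on cosets\<close>

lemma act_aq_carrier:
  assumes "u \<in> carrier Ufree" "p \<in> carrier (aq_free n)"
  shows "act u p \<in> carrier (aq_free n)"
  using assms(1) unfolding free_algebra_carrier
proof (induction rule: supp_in_induct)
  case (word c gs)
  have "act (word gs) p \<in> carrier (aq_free n)"
    using word by (induction gs) (auto simp: act_word assms intro: opr_aq_carrier)
  then show ?case by (simp add: act_left_lin aq_carrier supp_in_scal)
qed (auto simp: act_left_lin aq_carrier intro: supp_in_add)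

lemma act_aq_ideal:
  assumes "u \<in> carrier Ufree" "p \<in> aq_ideal n q"
  shows "act u p \<in> aq_ideal n q"
  using assms(1) unfolding free_algebra_carrier
proof (induction rule: supp_in_induct)
  case (word c gs)
  have "act (word gs) p \<in> aq_ideal n q"
    using word by (induction gs) (auto simp: act_word assms intro: opr_aq_ideal)
  then show ?case by (simp add: act_left_lin aq_ideal_scal)
qed (auto simp: act_left_lin intro: aq_ideal_add aq_ideal_0)

lemma ring_Aq: "ring (Aq n q)"
  unfolding Aq_def by (rule ideal.quotient_is_ring[OF aq_ideal_ideal])

lemma aq_proj_hom: "aq_proj n q \<in> ring_hom (aq_free n) (Aq n q)"
  unfolding Aq_def aq_proj_def[abs_def] by (rule ideal.rcos_ring_hom[OF aq_ideal_ideal])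

lemma aq_proj_simps:
  "a \<in> carrier (aq_free n) \<Longrightarrow> aq_proj n q a \<in> carrier (Aq n q)"
  "a \<in> carrier (aq_free n) \<Longrightarrow> b \<in> carrier (aq_free n) \<Longrightarrow> aq_proj n q (a * b) = aq_proj n q a \<otimes>\<^bsub>Aq n q\<^esub> aq_proj n q b"
  "a \<in> carrier (aq_free n) \<Longrightarrow> b \<in> carrier (aq_free n) \<Longrightarrow> aq_proj n q (a + b) = aq_proj n q a \<oplus>\<^bsub>Aq n q\<^esub> aq_proj n q b"
  using ring_hom_closed[OF aq_proj_hom] ring_hom_mult[OF aq_proj_hom] ring_hom_add[OF aq_proj_hom]
  by (simp_all add: aq_free_def)

lemma aq_proj_ideal: "p \<in> aq_ideal n q \<Longrightarrow> aq_proj n q p = \<zero>\<^bsub>Aq n q\<^esub>"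
proof -
  assume p: "p \<in> aq_ideal n q"
  interpret ideal "aq_ideal n q" "aq_free n" by (rule aq_ideal_ideal)
  show ?thesis using a_rcos_const[OF p] by (simp add: aq_proj_def Aq_def FactRing_def)
qed

lemma aq_proj_add_ideal:
  assumes "i \<in> aq_ideal n q" "p \<in> carrier (aq_free n)"
  shows "aq_proj n q (i + p) = aq_proj n q p"
proof -
  interpret ring "Aq n q" by (rule ring_Aq)
  show ?thesis
    using assms aq_proj_simps(3)[OF aq_ideal_carrier[OF assms(1)] assms(2)] aq_proj_ideal[OF assms(1)]
      aq_proj_simps(1)[OF assms(2)] by simp
qed

lemma coset_elements:
  "u \<in> carrier Ufree \<Longrightarrow> x \<in> \<pi> u \<longleftrightarrow> (\<exists>i\<in>uq_ideal n q s. x = i + u)"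
  "p \<in> carrier (aq_free n) \<Longrightarrow> y \<in> aq_proj n q p \<longleftrightarrow> (\<exists>i\<in>aq_ideal n q. y = i + p)"
  by (auto simp: uq_proj_def aq_proj_def a_r_coset_def r_coset_def aq_free_def)

lemma act_coset: "u \<in> carrier Ufree \<Longrightarrow> x \<in> \<pi> u \<Longrightarrow> act x p = act u p"
  by (auto simp: coset_elements act_left_lin act_uq_ideal)

lemma in_coset: "u \<in> carrier Ufree \<Longrightarrow> u \<in> \<pi> u" "p \<in> carrier (aq_free n) \<Longrightarrow> p \<in> aq_proj n q p"
proof -
  have "0 \<in> uq_ideal n q s"
    using additive_subgroup.zero_closed[OF ideal.axioms(1)[OF uq_ideal_ideal]] by simp
  then show "u \<in> carrier Ufree \<Longrightarrow> u \<in> \<pi> u" "p \<in> carrier (aq_free n) \<Longrightarrow> p \<in> aq_proj n q p"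
    using aq_ideal_0 by (auto simp: coset_elements intro: bexI[of _ 0])
qed

text \<open>The union in \<open>rho\<close> runs over representatives of both cosets. All give the
  same coset, because one ideal acts by zero and the other is stable under the action.\<close>

lemma rho_proj:
  assumes u: "u \<in> carrier Ufree" and p: "p \<in> carrier (aq_free n)"
  shows "rho n q s (\<pi> u) (aq_proj n q p) = aq_proj n q (act u p)"
proof -
  have "aq_proj n q (act x y) = aq_proj n q (act u p)" if xy: "x \<in> \<pi> u" "y \<in> aq_proj n q p" for x y
  proof -
    obtain i where i: "i \<in> aq_ideal n q" "y = i + p" using coset_elements(2)[OF p] xy by blast
    have "act x y = act u i + act u p"
      using act_coset[OF u xy(1)] i(2) by (simp add: act_lin)
    then show ?thesis
      using aq_proj_add_ideal[OF act_aq_ideal[OF u i(1)] act_aq_carrier[OF u p]] by simp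
  qed
  then show ?thesis
    unfolding rho_def using in_coset(1)[OF u] in_coset(2)[OF p] by blast
qed

subsection \<open>Relabelling the rows\<close>

definition relabel :: "(nat \<Rightarrow> nat) \<Rightarrow> (nat \<times> nat) free_alg \<Rightarrow> (nat \<times> nat) free_alg" where
  "relabel w = lin_ext (\<lambda>ws. word (map (apfst w) ws))"

lemma relabel_word: "relabel w (word ws) = word (map (apfst w) ws)"
  by (simp add: relabel_def)

lemma lin_relabel: "lin (relabel w)"
  by (simp add: relabel_def)

lemmas relabel_lin = lin_simps[OF lin_relabel]

lemma wt_pair_relabel: "wt_pair n a (map (apfst w) ws) = wt_pair n a ws"
  by (induction ws) auto

lemma replace_letter_relabel:
  "replace_letter n s k a b (map (apfst w) ws) = relabel w (replace_letter n s k a b ws)"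
  unfolding replace_letter_def relabel_lin length_map
proof (rule sum.cong[OF refl])
  fix l assume "l \<in> {..<length ws}"
  then have l: "l < length ws" by simp
  have "q_factor n s k (map (apfst w) ws) l = q_factor n s k ws l"
    using l by (simp add: q_factor_eq take_map drop_map wt_pair_relabel)
  moreover have "(map (apfst w) ws)[l := (fst (map (apfst w) ws ! l), b)] = map (apfst w) (ws[l := (fst (ws ! l), b)])"
    using l by (simp add: map_update)
  ultimately show "(if snd (map (apfst w) ws ! l) = a then scal (q_factor n s k (map (apfst w) ws) l)
      * word ((map (apfst w) ws)[l := (fst (map (apfst w) ws ! l), b)]) else 0)
    = relabel w (if snd (ws ! l) = a then scal (q_factor n s k ws l) * word (ws[l := (fst (ws ! l), b)]) else 0)"
    using l by (simp add: relabel_lin relabel_word)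
qed

text \<open>The operators read and change column indices only.\<close>

lemma opr_relabel: "opr g (relabel w p) = relabel w (opr g p)"
proof (rule lin_eq[of "\<lambda>p. opr g (relabel w p)" "\<lambda>p. relabel w (opr g p)"])
  show "lin (\<lambda>p. opr g (relabel w p))" by (rule lin_compose[OF lin_opr lin_relabel])
  show "lin (\<lambda>p. relabel w (opr g p))" by (rule lin_compose[OF lin_relabel lin_opr])
  fix ws
  show "opr g (relabel w (word ws)) = relabel w (opr g (word ws))"
  proof (cases g)
    case (GenQ a)
    then show ?thesis by (simp add: relabel_word K_word relabel_lin wt_pair_relabel)
  qed (simp_all only: relabel_word opr_def lin_ext_word rho_gen_replace_letter replace_letter_relabel)
qed

text \<open>The sum in \<open>D_elt\<close> as a linear map on the free algebra, where equivariance
  is checked before relations are factored out.\<close>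

definition Psi :: "complex \<Rightarrow> (nat \<times> nat) free_alg \<Rightarrow> (nat \<times> nat) free_alg" where
  "Psi \<alpha> p = (\<Sum>w | w permutes {1..n}.
     scal (\<alpha> ^ (n - num_cycles n w) * q ^ inversions n w) * relabel w p)"

lemma lin_Psi: "lin (Psi \<alpha>)"
  unfolding Psi_def[abs_def] by (intro lin_intros lin_relabel)

lemmas Psi_lin = lin_simps[OF lin_Psi]

lemma opr_Psi: "opr g (Psi \<alpha> p) = Psi \<alpha> (opr g p)"
  by (simp add: Psi_def opr_lin opr_relabel)

lemma act_Psi: "act u (Psi \<alpha> p) = Psi \<alpha> (act u p)"
proof (induction u rule: free_alg_induct)
  case (word c gs)
  have "act (word gs) (Psi \<alpha> p) = Psi \<alpha> (act (word gs) p)"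
    by (induction gs) (auto simp: act_word opr_Psi)
  then show ?case by (simp add: act_left_lin Psi_lin)
qed (auto simp: act_left_lin Psi_lin)

lemma Psi_degree:
  assumes "p \<in> T n"
  shows "Psi \<alpha> p \<in> supp_in {ws \<in> lists letters_n. length ws = n}"
  unfolding Psi_def
proof (intro supp_in_sum supp_in_scal lin_supp_in[OF lin_relabel assms])
  fix w ws assume w: "w \<in> {w. w permutes {1..n}}" and "ws \<in> tw n"
  then have ws: "map fst ws = [1..<Suc n]" "snd ` set ws \<subseteq> {1..n}" by (auto simp: tw_def)
  have "length (map fst ws) = n" unfolding ws(1) by (simp del: upt_Suc)
  then have len: "length ws = n" by simp
  have "set (map fst ws) = {1..n}" unfolding ws(1) by (auto simp del: upt_Suc)
  then have rows: "fst ` set ws = {1..n}" by (simp only: set_map)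
  have "map (apfst w) ws \<in> lists letters_n"
  proof (intro in_listsI ballI)
    fix x assume "x \<in> set (map (apfst w) ws)"
    then obtain y where y: "y \<in> set ws" "x = apfst w y" by auto
    have "snd y \<in> {1..n}" using ws(2) imageI[OF y(1), of snd] by blast
    moreover have "w (fst y) \<in> {1..n}"
      using permutes_in_image[of w "{1..n}" "fst y"] w imageI[OF y(1), of fst] rows by blast
    ultimately show "x \<in> letters_n" by (simp only: y(2) mem_Times_iff fst_apfst snd_apfst comp_apply simp_thms)
  qed
  then show "relabel w (word ws) \<in> supp_in {ws \<in> lists letters_n. length ws = n}"
    using len by (simp add: relabel_word)
qed

lemma Psi_carrier: "p \<in> T n \<Longrightarrow> Psi \<alpha> p \<in> carrier (aq_free n)"
  unfolding aq_carrier by (rule subsetD[OF supp_in_mono Psi_degree]) auto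

definition Phi :: "complex \<Rightarrow> (nat \<times> nat) free_alg \<Rightarrow> (nat \<times> nat) free_alg set" where
  "Phi \<alpha> p = aq_proj n q (Psi \<alpha> p)"

lemma D_elt_Phi: "D_elt n q \<alpha> f = Phi \<alpha> (word (wd f))"
  by (simp add: D_elt_def Phi_def Psi_def relabel_word wd_def comp_def apfst_def)

lemma Phi_carrier: "p \<in> T n \<Longrightarrow> Phi \<alpha> p \<in> carrier (Aq n q)"
  by (simp add: Phi_def aq_proj_simps Psi_carrier)

lemma Phi_add: "p \<in> T n \<Longrightarrow> r \<in> T n \<Longrightarrow> Phi \<alpha> (p + r) = Phi \<alpha> p \<oplus>\<^bsub>Aq n q\<^esub> Phi \<alpha> r"
  by (simp add: Phi_def Psi_lin aq_proj_simps Psi_carrier)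

lemma Phi_0: "Phi \<alpha> 0 = \<zero>\<^bsub>Aq n q\<^esub>"
  by (simp add: Phi_def Psi_lin aq_proj_ideal aq_ideal_0)

lemma rho_Phi: "u \<in> carrier Ufree \<Longrightarrow> p \<in> T n \<Longrightarrow> rho n q s (\<pi> u) (Phi \<alpha> p) = Phi \<alpha> (act u p)"
  by (simp add: Phi_def rho_proj Psi_carrier act_Psi)

lemma T_n_expand:
  assumes "p \<in> T n"
  shows "p = (\<Sum>f\<in>{1..n} \<rightarrow>\<^sub>E {1..n}. scal (lk p (wd f)) * word (wd f))"
proof (rule free_alg_eqI)
  fix ws
  let ?A = "{1..n} \<rightarrow>\<^sub>E {1..n}"
  have fin: "finite ?A" by (rule finite_PiE) auto
  have inj: "f = g" if "f \<in> ?A" "g \<in> ?A" "wd f = wd g" for f g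
    by (rule PiE_ext[OF that(1,2)]) (use that(3) in \<open>auto simp: wd_def simp del: upt_Suc\<close>)
  have eq: "lk (\<Sum>f\<in>?A. scal (lk p (wd f)) * word (wd f)) ws = (\<Sum>f\<in>?A. if ws = wd f then lk p ws else 0)"
    unfolding lookup_sum by (intro sum.cong) (auto simp: lookup_word)
  show "lk p ws = lk (\<Sum>f\<in>?A. scal (lk p (wd f)) * word (wd f)) ws"
  proof (cases "ws \<in> tw n")
    case True
    then obtain g where g: "g \<in> ?A" "ws = wd g" by (auto simp: tw_n_wd)
    have "(\<Sum>f\<in>?A. if ws = wd f then lk p ws else 0) = (\<Sum>f\<in>?A. if f = g then lk p ws else 0)"
      by (intro sum.cong) (use inj g in auto)
    then show ?thesis using g(1) fin unfolding eq by simp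
  next
    case False
    then have "lk p ws = 0" using supp_inD[OF assms] by blast
    moreover from this have "(\<Sum>f\<in>?A. if ws = wd f then lk p ws else 0) = 0"
      by (intro sum.neutral) auto
    ultimately show ?thesis unfolding eq by simp
  qed
qed

lemma aq_proj_sum:
  assumes "finite A" "\<And>f. f \<in> A \<Longrightarrow> x f \<in> carrier (aq_free n)"
  shows "aq_proj n q (\<Sum>f\<in>A. x f) = finsum (Aq n q) (\<lambda>f. aq_proj n q (x f)) A"
  using assms
proof (induction A rule: finite_induct)
  interpret ring "Aq n q" by (rule ring_Aq)
  case empty
  then show ?case by (simp add: aq_proj_ideal aq_ideal_0)
next
  interpret ring "Aq n q" by (rule ring_Aq)
  case (insert a A)
  have "(\<Sum>f\<in>A. x f) \<in> carrier (aq_free n)"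
    using insert.prems unfolding aq_carrier by (intro supp_in_sum) auto
  then show ?case
    using insert by (simp add: aq_proj_simps Pi_def)
qed

text \<open>The coordinates of a vector in the kernel are the coefficients of a linear relation
  between the \<open>D_elt\<close>, so they vanish when \<alpha> is not singular.\<close>

lemma Phi_inj:
  assumes \<alpha>: "\<alpha> \<in> - Sing n q" and p: "p \<in> T n" "Phi \<alpha> p = \<zero>\<^bsub>Aq n q\<^esub>"
  shows "p = 0"
proof -
  interpret ring "Aq n q" by (rule ring_Aq)
  let ?A = "{1..n} \<rightarrow>\<^sub>E {1..n}"
  have fin: "finite ?A" by (rule finite_PiE) auto
  have wT: "word (wd f) \<in> T n" if "f \<in> ?A" for f using that by (auto simp: tw_n_wd)
  have car: "scal (lk p (wd f)) * Psi \<alpha> (word (wd f)) \<in> carrier (aq_free n)" if "f \<in> ?A" for f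
    using Psi_carrier[OF wT[OF that]] by (simp add: aq_carrier supp_in_scal)
  have sc: "scal c \<in> carrier (aq_free n)" for c by (simp add: aq_carrier supp_in_scal_1)
  have "Phi \<alpha> p = aq_proj n q (\<Sum>f\<in>?A. scal (lk p (wd f)) * Psi \<alpha> (word (wd f)))"
    unfolding Phi_def by (rule arg_cong[OF trans[OF arg_cong[OF T_n_expand[OF p(1)]]]]) (simp only: Psi_lin)
  also have "\<dots> = (\<Oplus>\<^bsub>Aq n q\<^esub>f\<in>?A. aq_proj n q (scal (lk p (wd f)) * Psi \<alpha> (word (wd f))))"
    by (rule aq_proj_sum[OF fin car])
  also have "\<dots> = (\<Oplus>\<^bsub>Aq n q\<^esub>f\<in>?A. aq_proj n q (scal (lk p (wd f))) \<otimes>\<^bsub>Aq n q\<^esub> D_elt n q \<alpha> f)"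
  proof (rule finsum_cong')
    have eq: "aq_proj n q (scal (lk p (wd f)) * Psi \<alpha> (word (wd f)))
        = aq_proj n q (scal (lk p (wd f))) \<otimes>\<^bsub>Aq n q\<^esub> D_elt n q \<alpha> f" if "f \<in> ?A" for f
      unfolding D_elt_Phi Phi_def by (rule aq_proj_simps(2)[OF sc Psi_carrier[OF wT[OF that]]])
    then show "aq_proj n q (scal (lk p (wd f)) * Psi \<alpha> (word (wd f)))
        = aq_proj n q (scal (lk p (wd f))) \<otimes>\<^bsub>Aq n q\<^esub> D_elt n q \<alpha> f" if "f \<in> ?A" for f
      using that by this
    show "(\<lambda>f. aq_proj n q (scal (lk p (wd f))) \<otimes>\<^bsub>Aq n q\<^esub> D_elt n q \<alpha> f) \<in> ?A \<rightarrow> carrier (Aq n q)"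
    proof (rule funcsetI)
      fix f assume f: "f \<in> ?A"
      show "aq_proj n q (scal (lk p (wd f))) \<otimes>\<^bsub>Aq n q\<^esub> D_elt n q \<alpha> f \<in> carrier (Aq n q)"
        using aq_proj_simps(1)[OF car[OF f]] unfolding eq[OF f] .
    qed
  qed (rule refl)
  finally have dep: "(\<Oplus>\<^bsub>Aq n q\<^esub>f\<in>?A. aq_proj n q (scal (lk p (wd f))) \<otimes>\<^bsub>Aq n q\<^esub> D_elt n q \<alpha> f) = \<zero>\<^bsub>Aq n q\<^esub>"
    using p(2) by simp
  have "\<not> (\<exists>f\<in>?A. lk p (wd f) \<noteq> 0)"
  proof
    assume "\<exists>f\<in>?A. lk p (wd f) \<noteq> 0"
    with dep have "\<alpha> \<in> Sing n q"
      unfolding Sing_def mem_Collect_eq by (intro exI[of _ "\<lambda>f. lk p (wd f)"] conjI)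
    with \<alpha> show False by simp
  qed
  then have "(\<Sum>f\<in>?A. scal (lk p (wd f)) * word (wd f)) = 0" by (intro sum.neutral) auto
  then show ?thesis using T_n_expand[OF p(1)] by (rule trans[rotated])
qed

subsection \<open>Modules of tensors\<close>

text \<open>A class in \<open>Uq\<close> acts through a chosen representative; any choice gives the
  same result, because the ideal of relations acts by zero.\<close>

definition Tm :: "(nat \<times> nat) free_alg set \<Rightarrow> (uq_gen free_alg set, (nat \<times> nat) free_alg) module" where
  "Tm N = \<lparr>carrier = N, monoid.mult = undefined, one = undefined, zero = 0, add = (+),
    smult = (\<lambda>X. act (SOME u. u \<in> carrier Ufree \<and> \<pi> u = X))\<rparr>"

lemma Tm_simps [simp]: "carrier (Tm N) = N" "\<zero>\<^bsub>Tm N\<^esub> = 0" "x \<oplus>\<^bsub>Tm N\<^esub> y = x + y"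
  by (simp_all add: Tm_def)

lemma Tm_smult:
  assumes "u \<in> carrier Ufree"
  shows "\<pi> u \<odot>\<^bsub>Tm N\<^esub> x = act u x"
proof -
  define w where "w = (SOME w. w \<in> carrier Ufree \<and> \<pi> w = \<pi> u)"
  have "w \<in> carrier Ufree \<and> \<pi> w = \<pi> u"
    unfolding w_def by (rule someI[of _ u]) (simp only: assms simp_thms)
  then have "w \<in> \<pi> u" using in_coset(1)[of w] by simp
  then have "act w x = act u x" by (rule act_coset[OF assms])
  then show ?thesis by (simp only: Tm_def module.select_convs flip: w_def)
qed

lemma actM_Tm: "u \<in> carrier Ufree \<Longrightarrow> actM (Tm N) u x = act u x"
  by (simp add: actM_def Tm_smult)

lemma left_module_Tm:
  assumes N: "stable n N"
  shows "left_module U (Tm N)"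
proof -
  have "abelian_group (Tm N)"
  proof (rule abelian_groupI)
    fix x assume "x \<in> carrier (Tm N)"
    then show "\<exists>y\<in>carrier (Tm N). y \<oplus>\<^bsub>Tm N\<^esub> x = \<zero>\<^bsub>Tm N\<^esub>"
      using stableD(4)[OF N, of x "-1"] by (intro bexI[of _ "scal (-1) * x"]) (auto simp: scal_uminus)
  qed (use stableD[OF N] in \<open>auto simp: add.assoc add.commute\<close>)
  moreover have "left_module_axioms U (Tm N)"
  proof
    show "\<one>\<^bsub>U\<^esub> \<odot>\<^bsub>Tm N\<^esub> x = x" if "x \<in> carrier (Tm N)" for x
      using Tm_smult[OF Ufree_intros(2)] by (simp add: act_1 \<pi>_simps(4))
    fix a b x y assume a: "a \<in> carrier U"
    obtain u where u: "u \<in> carrier Ufree" "a = \<pi> u" using a unfolding carrier_U by blast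
    show "a \<odot>\<^bsub>Tm N\<^esub> x \<in> carrier (Tm N)" if "x \<in> carrier (Tm N)"
      using that stable_act[OF N u(1)] by (simp add: u(2) Tm_smult[OF u(1)])
    show "a \<odot>\<^bsub>Tm N\<^esub> (x \<oplus>\<^bsub>Tm N\<^esub> y) = a \<odot>\<^bsub>Tm N\<^esub> x \<oplus>\<^bsub>Tm N\<^esub> a \<odot>\<^bsub>Tm N\<^esub> y"
      by (simp add: u(2) Tm_smult[OF u(1)] act_lin)
    assume b: "b \<in> carrier U"
    obtain w where w: "w \<in> carrier Ufree" "b = \<pi> w" using b unfolding carrier_U by blast
    show "(a \<oplus>\<^bsub>U\<^esub> b) \<odot>\<^bsub>Tm N\<^esub> x = a \<odot>\<^bsub>Tm N\<^esub> x \<oplus>\<^bsub>Tm N\<^esub> b \<odot>\<^bsub>Tm N\<^esub> x"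
      using Tm_smult[OF Ufree_intros(5)[OF u(1) w(1)]]
      by (simp add: u w \<pi>_simps(3) Tm_smult act_left_lin)
    show "(a \<otimes>\<^bsub>U\<^esub> b) \<odot>\<^bsub>Tm N\<^esub> x = a \<odot>\<^bsub>Tm N\<^esub> (b \<odot>\<^bsub>Tm N\<^esub> x)"
      using Tm_smult[OF Ufree_intros(4)[OF u(1) w(1)]]
      by (simp add: u w \<pi>_simps(2) Tm_smult act_mult)
  qed
  ultimately show ?thesis using ring_U by (simp add: left_module_def)
qed

text \<open>The copy of \<open>Tm N\<close> inside the determinant module.
  \<open>multiplicity_in\<close> ranges over summands of the same type as the module itself, so the
  summands have to consist of cosets.\<close>

abbreviation "VN \<alpha> N \<equiv> (V_module n q s \<alpha>)\<lparr>carrier := Phi \<alpha> ` N\<rparr>"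

lemma V_module_simps:
  "add (V_module n q s \<alpha>) = add (Aq n q)" "zero (V_module n q s \<alpha>) = zero (Aq n q)"
  "smult (V_module n q s \<alpha>) = rho n q s"
  by (simp_all add: V_module_def Aq_degree_n_def)

text \<open>The determinant is the image of the word of the identity, which generates the whole
  tensor power.\<close>

lemma V_module_VN: "VN \<alpha> (T n) = V_module n q s \<alpha>"
proof -
  have w: "word (wd id) \<in> T n" using cyc_generator cycI by metis
  have "q_alpha_det n q \<alpha> = Phi \<alpha> (word (wd id))"
    by (simp add: q_alpha_det_def D_elt_Phi id_def)
  then have "carrier (V_module n q s \<alpha>) = (\<lambda>u. rho n q s u (Phi \<alpha> (word (wd id)))) ` carrier U"
    by (auto simp: V_module_def)
  also have "\<dots> = (\<lambda>u. Phi \<alpha> (act u (word (wd id)))) ` carrier Ufree"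
    unfolding carrier_U image_image using rho_Phi[OF _ w] by auto
  also have "\<dots> = Phi \<alpha> ` T n"
    unfolding cyc_generator[symmetric] cyc_def image_image ..
  finally show ?thesis by simp
qed

lemma iso_Tm_VN:
  assumes \<alpha>: "\<alpha> \<in> - Sing n q" and N: "stable n N"
  shows "iso_via U (Tm N) (VN \<alpha> N) (Phi \<alpha>)"
proof -
  interpret ring "Aq n q" by (rule ring_Aq)
  have NT: "x \<in> T n" if "x \<in> N" for x using stableD(1)[OF N that] .
  show ?thesis
    unfolding iso_via_def
  proof (intro conjI ballI)
    have "inj_on (Phi \<alpha>) N"
    proof (rule inj_onI)
      fix x y assume xy: "x \<in> N" "y \<in> N" "Phi \<alpha> x = Phi \<alpha> y"
      have d: "x - y \<in> T n" using NT[OF stable_diff[OF N xy(1,2)]] .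
      have "Phi \<alpha> (x - y) \<oplus>\<^bsub>Aq n q\<^esub> Phi \<alpha> y = Phi \<alpha> y"
        using Phi_add[OF d NT[OF xy(2)], of \<alpha>] xy(3) by simp
      then have "Phi \<alpha> (x - y) = \<zero>\<^bsub>Aq n q\<^esub>"
        using Phi_carrier[OF d] Phi_carrier[OF NT[OF xy(2)]] by (metis add.r_cancel_one)
      then show "x = y" using Phi_inj[OF \<alpha> d] by simp
    qed
    then show "bij_betw (Phi \<alpha>) (carrier (Tm N)) (carrier (VN \<alpha> N))"
      by (simp add: bij_betw_def)
    fix x assume x: "x \<in> carrier (Tm N)"
    show "Phi \<alpha> (x \<oplus>\<^bsub>Tm N\<^esub> y) = Phi \<alpha> x \<oplus>\<^bsub>VN \<alpha> N\<^esub> Phi \<alpha> y" if "y \<in> carrier (Tm N)" for y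
      using x that by (simp add: V_module_simps Phi_add NT)
    show "Phi \<alpha> (a \<odot>\<^bsub>Tm N\<^esub> x) = a \<odot>\<^bsub>VN \<alpha> N\<^esub> Phi \<alpha> x" if a: "a \<in> carrier U" for a
    proof -
      obtain u where u: "u \<in> carrier Ufree" "a = \<pi> u" using a unfolding carrier_U by blast
      then show ?thesis using x by (simp add: V_module_simps Tm_smult rho_Phi NT)
    qed
  qed
qed

lemma left_module_VN:
  assumes "\<alpha> \<in> - Sing n q" "stable n N"
  shows "left_module U (VN \<alpha> N)"
  by (rule left_module_transport[OF left_module_Tm[OF assms(2)] iso_Tm_VN[OF assms]])
    (simp add: V_module_simps Phi_0)

lemma V_module_iso_Tm:
  assumes \<alpha>: "\<alpha> \<in> - Sing n q"
  shows "module_isomorphic U (V_module n q s \<alpha>) (Tm (T n))"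
proof -
  have "module_isomorphic U (Tm (T n)) (V_module n q s \<alpha>)"
    using iso_Tm_VN[OF \<alpha> stable_T] unfolding V_module_VN module_isomorphic_iso_via by (rule exI[where x = "Phi \<alpha>"])
  then show ?thesis by (rule module_isomorphic_sym[OF left_module_Tm[OF stable_T]])
qed

section \<open>Decomposition of the determinant module and its multiplicities\<close>

context
  fixes v
  assumes fam: "sing_family n v"
begin

lemma stable_fam: "t \<in> paths n \<Longrightarrow> stable n (cyc (v t))"
  by (intro stable_cyc fam_props(1)[OF fam])

lemma irreducible_Tm:
  assumes t: "t \<in> paths n"
  shows "irreducible_module U (Tm (cyc (v t)))"
proof (rule irreducibleI[OF left_module_Tm[OF stable_fam[OF t]]])
  show "carrier (Tm (cyc (v t))) \<noteq> {\<zero>\<^bsub>Tm (cyc (v t))\<^esub>}"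
    using cycI fam_props(5)[OF fam t] by auto
  fix y z assume yz: "y \<in> carrier (Tm (cyc (v t)))" "y \<noteq> \<zero>\<^bsub>Tm (cyc (v t))\<^esub>" "z \<in> carrier (Tm (cyc (v t)))"
  then have y: "y \<in> cyc (v t)" "y \<noteq> 0" and z: "z \<in> cyc (v t)" by simp_all
  have "cyc y = cyc (v t)"
  proof (rule fam_irreducible[OF fam t])
    show "stable n (cyc y)" by (rule stable_cyc[OF stableD(1)[OF stable_fam[OF t] y(1)]])
    show "cyc y \<subseteq> cyc (v t)" by (rule cyc_least[OF stable_fam[OF t] y(1)])
    show "cyc y \<noteq> {0}" using cycI[of y] y(2) by auto
  qed
  then obtain u where "u \<in> carrier Ufree" "z = act u y" using z unfolding cyc_def by blast
  then show "\<exists>a\<in>carrier U. a \<odot>\<^bsub>Tm (cyc (v t))\<^esub> y = z"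
    using \<pi>_simps(1) by (intro bexI[of _ "\<pi> u"]) (auto simp: Tm_smult)
qed

lemma hw_Tm_iff:
  assumes "x \<in> N"
  shows "hw (Tm N) lam x \<longleftrightarrow> (\<forall>k\<in>{1..<n}. E k x = 0) \<and>
    (\<forall>a\<in>doubled_lattice n. K a x = scal (s powi pairing n a lam) * x)"
proof -
  have "actM (Tm N) (gen (GenE k)) x = E k x" if "k \<in> {1..<n}" for k
    using actM_Tm[OF Ufree_intros(7)] that by (simp add: act_gen)
  moreover have "actM (Tm N) (gen (GenQ a)) x = K a x" if "a \<in> doubled_lattice n" for a
    using actM_Tm[OF Ufree_intros(7)] that by (simp add: act_gen)
  ultimately show ?thesis
    using assms by (simp add: hw_def actM_Tm[OF Ufree_intros(3)] act_scal)
qed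

lemma hw_fam:
  assumes "t \<in> paths n"
  shows "hw (Tm (cyc (v t))) (content t) (v t)"
  unfolding hw_Tm_iff[OF cycI] using fam_props(2,3)[OF fam assms] by (auto simp: isw_def)

text \<open>\<open>hw\<close> tests lattice elements and \<open>isw\<close> all integer functions;
  truncating a function to {1..n} changes neither its operator nor its pairings.\<close>

lemma isw_lattice:
  assumes "\<And>a. a \<in> doubled_lattice n \<Longrightarrow> K a x = scal (s powi pairing n a lam) * x"
  shows "isw lam x"
  unfolding isw_def
proof
  fix a :: "nat \<Rightarrow> int"
  let ?a = "\<lambda>i. if i \<in> {1..n} then a i else 0"
  have wt: "wt_pair n a ws = wt_pair n ?a ws" for ws
    by (induction ws) (auto simp: pairing_eps)
  have "K a x = K ?a x"
    by (rule lin_eq[OF lin_opr lin_opr]) (simp add: K_word wt)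
  also have "\<dots> = scal (s powi pairing n ?a lam) * x"
    by (rule assms) (simp add: doubled_lattice_def)
  also have "pairing n ?a lam = pairing n a lam"
    unfolding pairing_def by (rule sum.cong) simp_all
  finally show "K a x = scal (s powi pairing n a lam) * x" .
qed

text \<open>A highest weight vector of another weight is orthogonal to v t by weights and to the
  rest of the family by orthogonality of the cyclic modules, so it vanishes.\<close>

lemma hw_weight:
  assumes t: "t \<in> paths n" and x: "hw (Tm (cyc (v t))) lam x" "x \<noteq> 0" and i: "i \<in> {1..n}"
  shows "lam i = content t i"
proof (rule ccontr)
  assume ne: "lam i \<noteq> content t i"
  have xc: "x \<in> cyc (v t)" using x(1) by (simp add: hw_def)
  then have sx: "sing n x" and wx: "isw lam x"
    using x(1) stableD(1)[OF stable_fam[OF t]] unfolding hw_Tm_iff[OF xc]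
    by (auto simp: sing_def intro: isw_lattice)
  have "x = 0"
  proof (rule sing_orth_eq_0[OF fam sx])
    fix t' assume t': "t' \<in> paths n"
    show "form x (v t') = 0"
    proof (cases "t' = t")
      case True
      then show ?thesis using isw_orth[OF wx fam_props(2)[OF fam t] i ne] by simp
    next
      case False
      then show ?thesis using fam_orth[OF fam t t' _ xc cycI] by simp
    qed
  qed
  then show False using x(2) by simp
qed

text \<open>Summation of components is surjective by \<open>fam_sum\<close> and injective by
  \<open>fam_direct\<close>; its inverse is the required map.\<close>

lemma Tm_direct_sum: "module_isomorphic U (Tm (T n)) (direct_sum (paths n) (\<lambda>t. Tm (cyc (v t))))"
proof -
  let ?D = "direct_sum (paths n) (\<lambda>t. Tm (cyc (v t)))"
  let ?S = "\<lambda>w. \<Sum>t\<in>paths n. w t"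
  note st = stable_fam
  have stT: "\<And>t x. t \<in> paths n \<Longrightarrow> x \<in> cyc (v t) \<Longrightarrow> x \<in> T n" using stableD(1)[OF st] by blast
  have smD: "\<pi> u \<odot>\<^bsub>?D\<^esub> w = (\<lambda>t\<in>paths n. act u (w t))" if "u \<in> carrier Ufree" for u w
    by (simp add: Tm_smult[OF that])
  have iso: "iso_via U ?D (Tm (T n)) ?S"
    unfolding iso_via_def
  proof (intro conjI ballI)
    show "bij_betw ?S (carrier ?D) (carrier (Tm (T n)))"
      unfolding bij_betw_def
    proof (intro conjI equalityI subsetI)
      show "inj_on ?S (carrier ?D)"
      proof (rule inj_onI)
        fix w w' assume w: "w \<in> carrier ?D" "w' \<in> carrier ?D" "?S w = ?S w'"
        then have wP: "w \<in> (\<Pi>\<^sub>E t\<in>paths n. cyc (v t))" "w' \<in> (\<Pi>\<^sub>E t\<in>paths n. cyc (v t))" by simp_all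
        show "w = w'"
        proof (rule PiE_ext[OF wP])
          fix t assume t: "t \<in> paths n"
          have "w t - w' t = 0"
          proof (rule fam_direct[OF fam _ _ t, of "\<lambda>t. w t - w' t"])
            show "\<forall>t\<in>paths n. w t - w' t \<in> cyc (v t)"
              using wP by (auto intro!: stable_diff[OF st])
            show "(\<Sum>t\<in>paths n. w t - w' t) = 0" using w(3) by (simp add: sum_subtractf)
          qed
          then show "w t = w' t" by simp
        qed
      qed
      fix x assume "x \<in> ?S ` carrier ?D"
      then obtain w where w: "w \<in> (\<Pi>\<^sub>E t\<in>paths n. cyc (v t))" "x = ?S w" by auto
      have "w t \<in> T n" if "t \<in> paths n" for t using stT[OF that] w(1) that by auto
      then show "x \<in> carrier (Tm (T n))" unfolding w(2) by (auto intro!: supp_in_sum)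
    next
      fix x assume "x \<in> carrier (Tm (T n))"
      then obtain w where w: "\<forall>t\<in>paths n. w t \<in> cyc (v t)" "x = ?S w" using fam_sum[OF fam, of x] by auto
      then show "x \<in> ?S ` carrier ?D"
        by (intro image_eqI[of _ _ "restrict w (paths n)"]) auto
    qed
    fix w assume "w \<in> carrier ?D"
    show "?S (w \<oplus>\<^bsub>?D\<^esub> w') = ?S w \<oplus>\<^bsub>Tm (T n)\<^esub> ?S w'" for w' by (simp add: sum.distrib)
    show "?S (a \<odot>\<^bsub>?D\<^esub> w) = a \<odot>\<^bsub>Tm (T n)\<^esub> ?S w" if a: "a \<in> carrier U" for a
    proof -
      obtain u where u: "u \<in> carrier Ufree" "a = \<pi> u" using a unfolding carrier_U by blast
      show ?thesis unfolding u(2) smD[OF u(1)] Tm_smult[OF u(1)] by (simp add: act_lin)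
    qed
  qed
  have "iso_via U (Tm (T n)) ?D (inv_into (carrier ?D) ?S)"
  proof (rule iso_via_inv_closed[OF iso])
    show "w \<oplus>\<^bsub>?D\<^esub> w' \<in> carrier ?D" if "w \<in> carrier ?D" "w' \<in> carrier ?D" for w w'
      using that stableD(3)[OF st] by (auto simp: PiE_def Pi_def)
    show "a \<odot>\<^bsub>?D\<^esub> w \<in> carrier ?D" if a: "a \<in> carrier U" and w: "w \<in> carrier ?D" for a w
    proof -
      obtain u where u: "u \<in> carrier Ufree" "a = \<pi> u" using a unfolding carrier_U by blast
      show ?thesis unfolding u(2) smD[OF u(1)] using w stable_act[OF st u(1)] by (auto simp: PiE_def Pi_def)
    qed
  qed
  then show ?thesis by (auto simp: module_isomorphic_iso_via)
qed

lemma E_module_props: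
  assumes lam: "lam \<in> partitions n"
  shows "irreducible_highest_weight n q s lam (E_module n q s lam)"
    and "t \<in> paths_to n lam \<Longrightarrow> module_isomorphic U (Tm (cyc (v t))) (E_module n q s lam)"
proof -
  have *: "irreducible_highest_weight n q s lam (E_module n q s lam)
      \<and> module_isomorphic U (Tm (cyc (v t))) (E_module n q s lam)" if t: "t \<in> paths_to n lam" for t
  proof -
    have tp: "t \<in> paths n" and c: "content t = (\<lambda>i. int (lam i))"
      using t by (auto simp: paths_to_def content_def)
    note hw = hw_fam[OF tp, unfolded c]
    have vz: "v t \<noteq> \<zero>\<^bsub>Tm (cyc (v t))\<^esub>" using fam_props(5)[OF fam tp] by simp
    have 1: "irreducible_highest_weight n q s lam (E_module n q s lam)"
      by (rule E_module_irreducible[OF irreducible_Tm[OF tp] hw vz])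
    then obtain e where e: "irreducible_module U (E_module n q s lam)"
      "e \<noteq> \<zero>\<^bsub>E_module n q s lam\<^esub>" "hw (E_module n q s lam) (\<lambda>i. int (lam i)) e"
      by (auto simp: irreducible_highest_weight_hw)
    then have "module_isomorphic U (Tm (cyc (v t))) (E_module n q s lam)"
      by (intro highest_weight_unique[OF irreducible_Tm[OF tp] hw vz e(1) e(3,2)])
    with 1 show ?thesis by simp
  qed
  then show "t \<in> paths_to n lam \<Longrightarrow> module_isomorphic U (Tm (cyc (v t))) (E_module n q s lam)" using * by simp
  show "irreducible_highest_weight n q s lam (E_module n q s lam)"
  proof -
    have "paths_to n lam \<noteq> {}" by (rule paths_to_nonempty[OF lam[unfolded partitions_young]])
    then obtain t' where "t' \<in> paths_to n lam" by blast
    then show ?thesis using *[of t'] by simp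
  qed
qed

text \<open>The paths are renumbered by pairs of a shape and an index below the number of standard
  tableaux of that shape.\<close>

lemma decomposition:
  assumes \<alpha>: "\<alpha> \<in> - Sing n q"
  shows "module_isomorphic U (V_module n q s \<alpha>)
           (direct_sum (SIGMA lam:partitions n. {..<num_standard_tableaux n lam})
              (\<lambda>(lam, i). E_module n q s lam))"
proof -
  note V = V_module_iso_Tm[OF \<alpha>]
  let ?f = "num_standard_tableaux n"
  have "\<exists>e. bij_betw e {..<?f lam} (paths_to n lam)" if "lam \<in> partitions n" for lam
    using ex_bij_betw_nat_finite[OF finite_paths_to[of n lam]] card_paths_to[of lam n] that
    by (simp add: partitions_young num_standard_tableaux_def atLeast0LessThan)
  then obtain e where e: "\<And>lam. lam \<in> partitions n \<Longrightarrow> bij_betw (e lam) {..<?f lam} (paths_to n lam)"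
    by metis
  let ?I = "SIGMA lam:partitions n. {..<?f lam}"
  have eI: "e lam i \<in> paths_to n lam" if "lam \<in> partitions n" "i < ?f lam" for lam i
    using e[OF that(1)] that(2) by (auto simp: bij_betw_def)
  have bij: "bij_betw (\<lambda>(lam, i). e lam i) ?I (paths n)"
    unfolding bij_betw_def
  proof (intro conjI equalityI subsetI)
    show "inj_on (\<lambda>(lam, i). e lam i) ?I"
    proof (rule inj_onI)
      fix x y assume xy: "x \<in> ?I" "y \<in> ?I" "(\<lambda>(lam, i). e lam i) x = (\<lambda>(lam, i). e lam i) y"
      obtain lam i mu j where x: "x = (lam, i)" and y: "y = (mu, j)" by (cases x, cases y) auto
      have "e lam i \<in> paths_to n lam" "e lam i \<in> paths_to n mu"
        using eI[of lam i] eI[of mu j] xy x y by auto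
      then have "lam = mu" by (simp add: paths_to_def)
      moreover have "i = j"
        using e[of lam] xy x y \<open>lam = mu\<close> by (auto simp: bij_betw_def dest: inj_onD)
      ultimately show "x = y" by (simp add: x y)
    qed
    show "t \<in> paths n" if "t \<in> (\<lambda>(lam, i). e lam i) ` ?I" for t
      using that eI by (auto simp: paths_to_def)
    fix t assume t: "t \<in> paths n"
    let ?lam = "count_list t"
    have lam: "?lam \<in> partitions n" using count_list_young[OF t] by (simp add: partitions_young)
    have "t \<in> e ?lam ` {..<?f ?lam}" using e[OF lam] t by (auto simp: bij_betw_def paths_to_def)
    then obtain i where "i < ?f ?lam" "t = e ?lam i" by auto
    then show "t \<in> (\<lambda>(lam, i). e lam i) ` ?I"
      using lam by (intro image_eqI[of _ _ "(?lam, i)"]) auto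
  qed
  have "module_isomorphic U (direct_sum (paths n) (\<lambda>t. Tm (cyc (v t))))
    (direct_sum ?I (\<lambda>(lam, i). E_module n q s lam))"
  proof (rule direct_sum_cong_iso[OF bij])
    fix x assume x: "x \<in> ?I"
    obtain lam i where li: "x = (lam, i)" "lam \<in> partitions n" "i < ?f lam" using x by (cases x) auto
    show "module_isomorphic U (Tm (cyc (v (case x of (lam, i) \<Rightarrow> e lam i)))) (case x of (lam, i) \<Rightarrow> E_module n q s lam)"
      unfolding li(1) prod.case by (rule E_module_props(2)[OF li(2) eI[OF li(2,3)]])
  qed
  then show ?thesis
    by (rule module_isomorphic_trans[OF module_isomorphic_trans[OF V Tm_direct_sum]])
qed

text \<open>Comparison of highest weights shows that the i-th summand is isomorphic to the module of
  weight lam exactly when the i-th path ends in lam.\<close>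

lemma multiplicity:
  assumes \<alpha>: "\<alpha> \<in> - Sing n q" and lam: "lam \<in> partitions n"
  shows "multiplicity_in U (E_module n q s lam) (V_module n q s \<alpha>) = num_standard_tableaux n lam"
proof -
  let ?E = "E_module n q s lam"
  have VL: "left_module U (V_module n q s \<alpha>)"
    using left_module_VN[OF \<alpha> stable_T] by (simp only: V_module_VN)
  note V = V_module_iso_Tm[OF \<alpha>]
  define r where "r = card (paths n)"
  obtain b where b: "bij_betw b {..<r} (paths n)"
    using ex_bij_betw_nat_finite[OF finite_paths[of n]] by (auto simp: r_def atLeast0LessThan)
  have bI: "b i \<in> paths n" if "i < r" for i using b that by (auto simp: bij_betw_def)
  let ?N = "\<lambda>i. VN \<alpha> (cyc (v (b i)))"
  have isoN: "module_isomorphic U (Tm (cyc (v (b i)))) (?N i)" if "i < r" for i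
    using iso_Tm_VN[OF \<alpha> stable_fam[OF bI[OF that]]] by (auto simp: module_isomorphic_iso_via)
  have irrN: "irreducible_module U (?N i)" if "i < r" for i
    by (rule irreducible_transport[OF irreducible_Tm[OF bI[OF that]] iso_Tm_VN[OF \<alpha> stable_fam[OF bI[OF that]]]
          left_module_VN[OF \<alpha> stable_fam[OF bI[OF that]]]])
  have "module_isomorphic U (direct_sum (paths n) (\<lambda>t. Tm (cyc (v t)))) (direct_sum {..<r} ?N)"
    by (rule direct_sum_cong_iso[OF b]) (use isoN in auto)
  then have dec: "module_isomorphic U (V_module n q s \<alpha>) (direct_sum {..<r} ?N)"
    by (rule module_isomorphic_trans[OF module_isomorphic_trans[OF V Tm_direct_sum]])
  obtain e where E: "irreducible_module U ?E" and e: "hw ?E (\<lambda>i. int (lam i)) e" "e \<noteq> \<zero>\<^bsub>?E\<^esub>"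
    using E_module_props(1)[OF lam] by (auto simp: irreducible_highest_weight_hw)
  have EL: "left_module U ?E" using E by (simp add: irreducible_module_def)
  have iff: "module_isomorphic U ?E (?N i) \<longleftrightarrow> b i \<in> paths_to n lam" if i: "i < r" for i
  proof
    assume "b i \<in> paths_to n lam"
    then have "module_isomorphic U (Tm (cyc (v (b i)))) ?E" by (rule E_module_props(2)[OF lam])
    then have "module_isomorphic U ?E (Tm (cyc (v (b i))))"
      by (rule module_isomorphic_sym[OF left_module_Tm[OF stable_fam[OF bI[OF i]]]])
    then show "module_isomorphic U ?E (?N i)" by (rule module_isomorphic_trans[OF _ isoN[OF i]])
  next
    assume "module_isomorphic U ?E (?N i)"
    then have "module_isomorphic U ?E (Tm (cyc (v (b i))))"
      by (rule module_isomorphic_trans)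
        (rule module_isomorphic_sym[OF left_module_Tm[OF stable_fam[OF bI[OF i]]] isoN[OF i]])
    then obtain f where f: "iso_via U ?E (Tm (cyc (v (b i)))) f" by (auto simp: module_isomorphic_iso_via)
    note h = hw_transport[OF EL left_module_Tm[OF stable_fam[OF bI[OF i]]] f e]
    have eq: "int (lam j) = content (b i) j" if "j \<in> {1..n}" for j
      using hw_weight[OF bI[OF i] h(1) _ that] h(2) by simp
    have "lam j = count_list (b i) j" for j
    proof (cases "j \<in> {1..n}")
      case True
      then show ?thesis using eq by (simp add: content_def)
    next
      case False
      then show ?thesis
        using lam count_list_young[OF bI[OF i]] unfolding partitions_young young_def by auto
    qed
    then show "b i \<in> paths_to n lam" using bI[OF i] by (auto simp: paths_to_def)
  qed
  have "multiplicity_in U ?E (V_module n q s \<alpha>) = card {i. i < r \<and> module_isomorphic U ?E (?N i)}"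
    by (rule multiplicity_in_eq[OF VL E e irrN dec])
  also have "{i. i < r \<and> module_isomorphic U ?E (?N i)} = {i \<in> {..<r}. b i \<in> paths_to n lam}"
    using iff by auto
  also have "card \<dots> = card (b ` {i \<in> {..<r}. b i \<in> paths_to n lam})"
    using b by (intro card_image[symmetric]) (auto simp: bij_betw_def inj_on_def)
  also have "b ` {i \<in> {..<r}. b i \<in> paths_to n lam} = paths_to n lam"
    using b by (auto simp: bij_betw_def paths_to_def)
  also have "card (paths_to n lam) = num_standard_tableaux n lam"
    using card_paths_to[of lam n] lam by (simp add: partitions_young num_standard_tableaux_def)
  finally show ?thesis .
qed

end

end

theorem proposition3p4:
  fixes n :: nat and q s \<alpha> :: complex
  assumes "n \<ge> 1"
    and "q \<noteq> 0"
    and "\<forall>k::nat. k > 0 \<longrightarrow> q ^ k \<noteq> 1"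
    and "s ^ 2 = q"
    and "\<alpha> \<in> - Sing n q"
  shows "module_isomorphic (Uq n q s) (V_module n q s \<alpha>)
           (direct_sum (SIGMA lam:partitions n. {..<num_standard_tableaux n lam})
              (\<lambda>(lam, i). E_module n q s lam))
       \<and> (\<forall>lam\<in>partitions n.
            multiplicity_in (Uq n q s) (E_module n q s lam) (V_module n q s \<alpha>)
              = num_standard_tableaux n lam)"
proof -
  interpret quantum_gl n q s
    using assms by unfold_locales auto
  obtain v where v: "sing_family n v" using sing_family_exists by blast
  show ?thesis using decomposition[OF v assms(5)] multiplicity[OF v assms(5)] by blast
qed

end
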